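(* Let $\gamma\ge 0$ and suppose the noise satisfies $\sum_i c_i^2\|e_i\|_{H^h}^2<\infty$ for some $h>3$. Fix $t_0\in\mathbb{R}$. For $\chi\in L^\infty(D)$, let $\xi(t;\chi)$, $t\ge t_0$, denote the unique solution of the stochastic damped Euler vorticity equation $$d\xi+u\cdot\nabla\xi\,dt+\gamma\xi\,dt=dW^{curl},\qquad \xi=\nabla^\perp\cdot u,\ \nabla\cdot u=0,$$ with $\xi(t_0)=\chi$. If a sequence $(\chi^n)_n\subset L^\infty(D)$ converges weakly$\star$ in $L^\infty(D)$ to $\chi\in L^\infty(D)$, then $\mathbf{P}$-a.s., for every $t>t_0$, the sequence $\xi(t;\chi^n)$ converges weakly$\star$ in $L^\infty(D)$ to $\xi(t;\chi)$.
   Context: $D=\mathbb{R}^2/\mathbb{Z}^2$ is the torus. $H$ is the space of periodic, square-integrable, divergence-free vector fields on $D$ with zero mean (with the $L^2$ inner product); $H^h$ denotes the corresponding Sobolev space of order $h$ intersected with $H$. $(\Omega,\mathcal{F},\mathbf{P})$ is a complete probability space; $(\beta_i)_{i\in\mathbb{N}}$ are independent two-sided real standard Wiener processes indexed by $t\in\mathbb{R}$; $(e_i)_i$ is a complete orthonormal system of $H$; $c_i\in\mathbb{R}$; the noise is $W(t,x)=\sum_i c_i\beta_i(t)e_i(x)$ and $W^{curl}=\nabla^\perp\cdot W=\partial_1W_2-\partial_2W_1$. The velocity is recovered from the vorticity by the Biot–Savart law $u=K*\xi$. It is known (and assumed here) that under these assumptions, for every initial vorticity $\chi\in L^\infty(D)$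 (with corresponding velocity in $H^1$), there is a pathwise unique weak solution $\xi$ with $\xi\in L^\infty([t_0,T]\times D)$ for all $T$ a.s., weakly$\star$ continuous in time with values in $L^\infty(D)$; the equation is understood in the weak sense: for test functions $g\in C^1(D)$, $\langle\xi(t),g\rangle+\gamma\int_{t_0}^t\langle\xi(s),g\rangle ds-\int_{t_0}^t\langle u(s)\cdot\nabla g,\xi(s)\rangle ds=\langle\chi,g\rangle+\langle W^{curl}(t)-W^{curl}(t_0),g\rangle$. Weak$\star$ convergence in $L^\infty$ means convergence of $\int_D \xi_n g\,dx$ for all $g\in L^1(D)$. *)

theory Defs
  imports "HOL-Probability.Probability"
begin

section \<open>The torus D = R^2/Z^2, represented by 1-periodic functions on R^2\<close>

definition per :: "(real^2 \<Rightarrow> 'b) \<Rightarrow> bool" where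
  "per f \<longleftrightarrow> (\<forall>x. f (x + axis 1 1) = f x \<and> f (x + axis 2 1) = f x)"

definition cell :: "(real^2) set" where
  "cell = cbox 0 1"

definition Linf :: "(real^2 \<Rightarrow> real) \<Rightarrow> bool" where
  "Linf f \<longleftrightarrow> per f \<and> f \<in> borel_measurable lborel \<and> (\<exists>C. AE x in lborel. \<bar>f x\<bar> \<le> C)"

definition dpair :: "(real^2 \<Rightarrow> real) \<Rightarrow> (real^2 \<Rightarrow> real) \<Rightarrow> real" where
  "dpair f g = (LINT x:cell|lborel. f x * g x)"

definition wstar_conv :: "(nat \<Rightarrow> real^2 \<Rightarrow> real) \<Rightarrow> (real^2 \<Rightarrow> real) \<Rightarrow> bool" where
  "wstar_conv fs f \<longleftrightarrow>
     (\<forall>g. set_integrable lborel cell g \<longrightarrow> (\<lambda>n. dpair (fs n) g) \<longlonglongrightarrow> dpair f g)"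

definition C1per :: "(real^2 \<Rightarrow> real) \<Rightarrow> (real^2 \<Rightarrow> real^2) \<Rightarrow> bool" where
  "C1per g G \<longleftrightarrow> per g \<and> (\<forall>x. (g has_derivative (\<lambda>h. G x \<bullet> h)) (at x)) \<and> continuous_on UNIV G"

definition L2field :: "(real^2 \<Rightarrow> real^2) \<Rightarrow> bool" where
  "L2field v \<longleftrightarrow> per v \<and> v \<in> borel_measurable lborel \<and>
     set_integrable lborel cell (\<lambda>x. (norm (v x))\<^sup>2)"

definition vinner :: "(real^2 \<Rightarrow> real^2) \<Rightarrow> (real^2 \<Rightarrow> real^2) \<Rightarrow> real" where
  "vinner v w = (LINT x:cell|lborel. v x \<bullet> w x)"

definition inH :: "(real^2 \<Rightarrow> real^2) \<Rightarrow> bool" where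
  "inH v \<longleftrightarrow> L2field v \<and> (LINT x:cell|lborel. v x) = 0 \<and>
     (\<forall>g G. C1per g G \<longrightarrow> (LINT x:cell|lborel. v x \<bullet> G x) = 0)"

definition complete_ONS_H :: "(nat \<Rightarrow> real^2 \<Rightarrow> real^2) \<Rightarrow> bool" where
  "complete_ONS_H e \<longleftrightarrow> (\<forall>i. inH (e i)) \<and>
     (\<forall>i j. vinner (e i) (e j) = (if i = j then 1 else 0)) \<and>
     (\<forall>f. inH f \<longrightarrow> (\<forall>i. vinner f (e i) = 0) \<longrightarrow> (AE x in lborel. x \<in> cell \<longrightarrow> f x = 0))"

definition fourier :: "(real^2 \<Rightarrow> real) \<Rightarrow> int \<times> int \<Rightarrow> complex" where
  "fourier f k = (LINT x:cell|lborel.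
      complex_of_real (f x) * cis (- 2 * pi * (of_int (fst k) * x$1 + of_int (snd k) * x$2)))"

definition sob_sq :: "real \<Rightarrow> (real^2 \<Rightarrow> real^2) \<Rightarrow> ennreal" where
  "sob_sq h v = (\<integral>\<^sup>+ k. ennreal ((1 + (2*pi)\<^sup>2 * (of_int (fst k))\<^sup>2 + (2*pi)\<^sup>2 * (of_int (snd k))\<^sup>2) powr h *
        ((cmod (fourier (\<lambda>x. v x $ 1) k))\<^sup>2 + (cmod (fourier (\<lambda>x. v x $ 2) k))\<^sup>2)) \<partial>count_space UNIV)"

definition two_sided_wiener :: "'a measure \<Rightarrow> (real \<Rightarrow> 'a \<Rightarrow> real) \<Rightarrow> bool" where
  "two_sided_wiener M B \<longleftrightarrow>
     (\<forall>t. B t \<in> borel_measurable M) \<and>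
     (AE \<omega> in M. B 0 \<omega> = 0) \<and>
     (AE \<omega> in M. continuous_on UNIV (\<lambda>t. B t \<omega>)) \<and>
     (\<forall>s t. s < t \<longrightarrow> distributed M lborel (\<lambda>\<omega>. B t \<omega> - B s \<omega>) (normal_density 0 (sqrt (t - s)))) \<and>
     (\<forall>(ts :: nat \<Rightarrow> real) n. strict_mono ts \<longrightarrow>
        prob_space.indep_vars M (\<lambda>_. borel) (\<lambda>k \<omega>. B (ts (Suc k)) \<omega> - B (ts k) \<omega>) {..<n})"

definition indep_wiener_family :: "'a measure \<Rightarrow> (nat \<Rightarrow> real \<Rightarrow> 'a \<Rightarrow> real) \<Rightarrow> bool" where
  "indep_wiener_family M \<beta> \<longleftrightarrow> (\<forall>i. two_sided_wiener M (\<beta> i)) \<and>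
     prob_space.indep_sets M
       (\<lambda>i. sigma_sets (space M) {\<beta> i t -` A \<inter> space M | t A. A \<in> sets borel}) UNIV"

text \<open>Pairing of W^curl(omega,t) = curl (sum_i c_i beta_i(t) e_i) with a C^1 test function g
  with gradient G: <curl e, g> = int (e_1 d_2 g - e_2 d_1 g).\<close>
definition wcurl_pair :: "(nat \<Rightarrow> real) \<Rightarrow> (nat \<Rightarrow> real \<Rightarrow> 'a \<Rightarrow> real) \<Rightarrow> (nat \<Rightarrow> real^2 \<Rightarrow> real^2)
    \<Rightarrow> 'a \<Rightarrow> real \<Rightarrow> (real^2 \<Rightarrow> real^2) \<Rightarrow> real" where
  "wcurl_pair c \<beta> e \<omega> t G =
     (\<Sum>i. c i * \<beta> i t \<omega> * (LINT x:cell|lborel. e i x $ 1 * G x $ 2 - e i x $ 2 * G x $ 1))"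

text \<open>u = K * w (Biot--Savart on the torus): the unique zero-mean L^2 field with
  div u = 0 and curl u = w - mean w (weakly).\<close>
definition biot_savart :: "(real^2 \<Rightarrow> real) \<Rightarrow> (real^2 \<Rightarrow> real^2) \<Rightarrow> bool" where
  "biot_savart w u \<longleftrightarrow> L2field u \<and> (LINT x:cell|lborel. u x) = 0 \<and>
     (\<forall>g G. C1per g G \<longrightarrow>
        (LINT x:cell|lborel. u x \<bullet> G x) = 0 \<and>
        (LINT x:cell|lborel. u x $ 1 * G x $ 2 - u x $ 2 * G x $ 1)
          = (LINT x:cell|lborel. (w x - (LINT y:cell|lborel. w y)) * g x))"

definition weak_solution ::
  "real \<Rightarrow> (nat \<Rightarrow> real) \<Rightarrow> (nat \<Rightarrow> real \<Rightarrow> 'a \<Rightarrow> real) \<Rightarrow> (nat \<Rightarrow> real^2 \<Rightarrow> real^2) \<Rightarrow> real \<Rightarrow> 'a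
   \<Rightarrow> (real^2 \<Rightarrow> real) \<Rightarrow> (real \<Rightarrow> real^2 \<Rightarrow> real) \<Rightarrow> (real \<Rightarrow> real^2 \<Rightarrow> real^2) \<Rightarrow> bool" where
  "weak_solution \<gamma> c \<beta> e t0 \<omega> X0 \<xi> u \<longleftrightarrow>
     (\<forall>t\<ge>t0. Linf (\<xi> t) \<and> biot_savart (\<xi> t) (u t)) \<and>
     (\<lambda>p. \<xi> (fst p) (snd p)) \<in> borel_measurable (restrict_space (lborel \<Otimes>\<^sub>M lborel) ({t0..} \<times> UNIV)) \<and>
     (\<forall>T. \<exists>C. \<forall>t\<in>{t0..T}. AE x in lborel. \<bar>\<xi> t x\<bar> \<le> C) \<and>
     (\<forall>g. set_integrable lborel cell g \<longrightarrow> continuous_on {t0..} (\<lambda>t. dpair (\<xi> t) g)) \<and>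
     (\<forall>g G t. C1per g G \<longrightarrow> t0 \<le> t \<longrightarrow>
        dpair (\<xi> t) g + \<gamma> * (LINT s:{t0..t}|lborel. dpair (\<xi> s) g)
          - (LINT s:{t0..t}|lborel. dpair (\<lambda>x. u s x \<bullet> G x) (\<xi> s))
        = dpair X0 g + (wcurl_pair c \<beta> e \<omega> t G - wcurl_pair c \<beta> e \<omega> t0 G))"

end

theory Submission
 imports Defs
begin

text \<open>
The difference of two solutions with vorticity difference \<open>\<eta>\<close> and velocity difference \<open>v\<close> does not
see the noise. Testing its equation with the stream function of \<open>\<eta>\<close> bounds the derivative of
\<open>\<parallel>v\<parallel>^2\<close> by twice the integral of \<open>\<eta> u \<bullet> v\<^sup>\<bottom>\<close>, and as \<open>\<eta> v\<^sup>\<bottom>\<close> is a divergence, the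
Lipschitz constant of \<open>u\<close> controls it. The velocity of a bounded vorticity is only log-Lipschitz: replacing \<open>u\<close> by its
mollification at scale \<open>\<surd>\<sigma>\<close> costs \<open>O(\<surd>\<sigma>)\<close> and yields the Lipschitz constant \<open>O(1 + ln (1/\<sigma>))\<close>. On
a time step so short that Gronwall's factor is at most \<open>O(\<sigma>\<^sup>-\<^sup>1\<^sup>/\<^sup>4)\<close> the error vanishes as
\<open>\<sigma> \<rightarrow> 0\<close>, so convergence of the velocities in \<open>L^2\<close> propagates from step to step. For
bounded vorticities this convergence, together with that of the means, is equivalent to weak-star convergence.

The argument needs an \<open>L\<^sup>\<infinity>\<close> bound uniform in \<open>n\<close>. The initial data are bounded by the
uniform boundedness principle. Since \<open>h > 3\<close>, chaining bounds the Fourier coefficients of the noise so well that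
almost surely it is a function \<open>w t\<close> bounded and Lipschitz locally uniformly in \<open>t\<close>; then \<open>\<xi> - w\<close> solves a transport
equation with bounded forcing, and the maximum principle follows by mollification, the commutator
tending to zero in \<open>L\<^sup>1\<close>.
\<close>

section \<open>Integration on the torus\<close>

text \<open>The exceptional null set may depend neither on the test function nor on the solutions,
  although the series \<open>wcurl_pair\<close> is shown to converge only almost surely, for a fixed
  gradient and a fixed time. Probability is therefore applied to countably many quantities: the
  modes \<open>gc k\<close> and \<open>gs k\<close> at the times \<open>t0 + j/2^m\<close>. The rest
  is extracted from the equation: solved for \<open>N t G\<close>, the weak formulation shows that
  the noise increment is linear in \<open>G\<close>, bounded by an \<open>H^1\<close> norm and
  continuous in \<open>t\<close>, so that its dyadic values on the modes determine it.

  Removing the noise function \<open>w\<close> leaves the forcing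
  \<open>- \<gamma> w - u . grad w\<close>, whose size grows linearly with the unknown sup norm of
  the vorticity. One comparison would presuppose the bound that is sought; repeating it with an
  exponential weight that halves the constant each time eliminates the bound of the individual
  solution.

  The mollifying profile is polynomial inside its support, so that its scale derivative is an
  explicit divergence. Integrating over the scale then replaces every estimate of the singular
  Biot--Savart kernel.\<close>

definition torus :: "(real^2) measure" where
 "torus = density lborel (indicator cell)"

abbreviation torus_integral :: "(real^2 => 'b::{banach, second_countable_topology}) => 'b" (binder \<open>TI \<close> 10) where
 "torus_integral f \<equiv> integral\<^sup>L torus f"

abbreviation component :: "('a => 'b^'n) => 'n => 'a => 'b" (infixl \<open>$$\<close> 90) where
 "u $$ j \<equiv> (\<lambda>x. u x $ j)"

abbreviation tint :: "(real^2 => 'b::{banach, second_countable_topology}) => bool" where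
 "tint \<equiv> integrable torus"

abbreviation "bmeas \<equiv> borel_measurable borel"

lemmas tcong = Bochner_Integration.integral_cong

lemma sets_torus [simp, measurable_cong]: "sets torus = sets borel"
 by (simp add: torus_def)

lemma space_torus [simp]: "space torus = UNIV"
 by (simp add: torus_def)

lemma cell_borel [measurable]: "cell \<in> sets borel"
 by (simp add: cell_def)

lemma emeasure_cell: "emeasure lborel cell = 1"
proof -
 have le: "(0::real^2) \<bullet> b <= 1 \<bullet> b" "(1::real^2) \<bullet> b = 1" if "b \<in> Basis" for b
  using that by (auto simp: Basis_vec_def inner_axis)
 have "emeasure lborel (cbox 0 (1::real^2)) = (\<Prod>b\<in>Basis. ((1::real^2) - 0) \<bullet> b)"
  by (rule emeasure_lborel_cbox) (use le in auto)
 also have "(\<Prod>b\<in>Basis. ((1::real^2) - 0) \<bullet> b) = 1"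
  by (rule prod.neutral) (auto simp: le)
 finally show ?thesis by (simp add: cell_def)
qed

lemma emeasure_torus: "A \<in> sets borel ==> emeasure torus A = emeasure lborel (cell \<inter> A)"
 by (simp add: torus_def emeasure_density nn_integral_indicator' flip: indicator_inter_arith)

lemma prob_space_torus: "prob_space torus"
 by (rule prob_spaceI) (simp add: emeasure_torus emeasure_cell)

interpretation torus: prob_space torus by (rule prob_space_torus)
interpretation torus_pair: pair_prob_space torus torus ..

lemma AE_torus_iff: "(AE x in torus. P x) \<longleftrightarrow> (AE x in lborel. x \<in> cell \<longrightarrow> P x)"
 unfolding torus_def by (subst AE_density) (auto simp: indicator_def)

lemma AE_torusI: "(AE x in lborel. P x) ==> (AE x in torus. P x)"
 unfolding AE_torus_iff by auto

lemma LINT_cell_eq: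
 fixes f :: "real^2 => 'b::{banach, second_countable_topology}"
 assumes [measurable]: "f \<in> bmeas"
 shows "(LINT x:cell|lborel. f x) = (TI x. f x)"
proof -
 have eq: "torus = density lborel (\<lambda>x. ennreal (indicat_real cell x))"
  by (simp add: torus_def ennreal_indicator)
 show ?thesis
  unfolding eq set_lebesgue_integral_def by (subst integral_density) auto
qed

lemma set_integrable_cell_iff:
 fixes f :: "real^2 => 'b::{banach, second_countable_topology}"
 assumes [measurable]: "f \<in> bmeas"
 shows "set_integrable lborel cell f \<longleftrightarrow> tint f"
proof -
 have eq: "torus = density lborel (\<lambda>x. ennreal (indicat_real cell x))"
  by (simp add: torus_def ennreal_indicator)
 show ?thesis
  unfolding eq set_integrable_def by (subst integrable_density) auto
qed

lemma borel_measurable_vec_nth_comp [measurable (raw)]: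
 fixes f :: "'a => real^'n"
 assumes "f \<in> borel_measurable M" shows "(f $$ i) \<in> borel_measurable M"
 using measurable_compose[OF assms, of "\<lambda>x. x $ i" borel]
 by (simp add: borel_measurable_continuous_onI continuous_on_component)

lemma UNIV_2_eq: "(UNIV :: 2 set) = {1, 2}"
 using exhaust_2 by auto

lemma forall_2_iff: "(\<forall>i::2. P i) \<longleftrightarrow> P 1 \<and> P 2"
 by (metis exhaust_2)

section \<open>Lattice translations and the invariances of the torus integral\<close>

definition ivec :: "int \<times> int => real^2" where
 "ivec k = of_int (fst k) *\<^sub>R axis 1 1 + of_int (snd k) *\<^sub>R axis 2 1"

lemma ivec_nth [simp]: "ivec k $ 1 = of_int (fst k)" "ivec k $ 2 = of_int (snd k)"
 by (simp_all add: ivec_def axis_def)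

lemma ivec_uminus: "ivec (- k) = - ivec k"
 by (simp add: ivec_def)

lemma ivec_add: "ivec (k + l) = ivec k + ivec l"
 by (simp add: ivec_def algebra_simps)

lemma period_int:
 fixes f :: "'a::real_vector => 'b"
 assumes "\<And>x. f (x + a) = f x"
 shows "f (x + of_int k *\<^sub>R a) = f x"
proof -
 have nat: "f (x + of_nat n *\<^sub>R a) = f x" for n x
 proof (induction n arbitrary: x)
  case (Suc n)
  have "f (x + of_nat (Suc n) *\<^sub>R a) = f ((x + of_nat n *\<^sub>R a) + a)"
   by (simp add: algebra_simps)
  with Suc show ?case by (simp add: assms)
 qed simp
 show ?thesis
 proof (cases "k >= 0")
  case True
  with nat[of x "nat k"] show ?thesis by simp
 next
  case False
  thus ?thesis
   using nat[of "x + of_int k *\<^sub>R a" "nat (- k)"] by simp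
 qed
qed

lemma per_ivec: assumes "per f" shows "f (x + ivec k) = f x"
proof -
 have "f (x + ivec k) = f ((x + of_int (fst k) *\<^sub>R axis 1 1) + of_int (snd k) *\<^sub>R axis 2 1)"
  by (simp add: ivec_def add.assoc)
 also have "\<dots> = f x"
  using assms by (simp add: per_def period_int[where a="axis 1 1"] period_int[where a="axis 2 1"])
 finally show ?thesis .
qed

text \<open>Half open, so that every lattice orbit meets it exactly once; \<open>cell\<close> counts
  its boundary repeatedly, but that boundary is a null set.\<close>

definition Q0 :: "(real^2) set" where
 "Q0 = {x. 0 <= x$1 \<and> x$1 < 1 \<and> 0 <= x$2 \<and> x$2 < 1}"

lemma Q0_borel [measurable]: "Q0 \<in> sets borel"
 unfolding Q0_def by measurable

lemma AE_cell_Q0: "AE x in lborel. x \<in> cell \<longleftrightarrow> x \<in> Q0"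
proof -
 have "emeasure lborel (cell - box 0 1) = emeasure lborel cell - emeasure lborel (box 0 (1::real^2))"
 proof (rule emeasure_Diff)
  show "box 0 (1::real^2) \<subseteq> cell" unfolding cell_def by (rule box_subset_cbox)
  show "emeasure lborel (box 0 (1::real^2)) \<noteq> \<infinity>" using emeasure_lborel_box_finite[of 0 "1::real^2"] by (simp add: less_top)
 qed (auto simp: cell_def)
 also have "emeasure lborel (box 0 (1::real^2)) = 1"
 proof -
  have le: "(0::real^2) \<bullet> b <= 1 \<bullet> b" "(1::real^2) \<bullet> b = 1" if "b \<in> Basis" for b
   using that by (auto simp: Basis_vec_def inner_axis)
  have "emeasure lborel (box 0 (1::real^2)) = (\<Prod>b\<in>Basis. ((1::real^2) - 0) \<bullet> b)"
   by (rule emeasure_lborel_box) (use le in auto)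
  also have "(\<Prod>b\<in>Basis. ((1::real^2) - 0) \<bullet> b) = 1"
   by (rule prod.neutral) (auto simp: le)
  finally show ?thesis by simp
 qed
 finally have "cell - box 0 1 \<in> null_sets lborel"
  unfolding null_sets_def by (simp add: emeasure_cell)
 hence "AE x in lborel. x \<notin> cell - box 0 1" by (rule AE_not_in)
 thus ?thesis
  by eventually_elim (auto simp: cell_def Q0_def mem_box_cart forall_2_iff)
qed

lemma nn_integral_torus_Q0:
 assumes [measurable]: "f \<in> bmeas"
 shows "(\<integral>\<^sup>+x. f x \<partial>torus) = (\<integral>\<^sup>+x. indicator Q0 x*f x \<partial>lborel)"
proof -
 have "(\<integral>\<^sup>+x. f x \<partial>torus) = (\<integral>\<^sup>+x. indicator cell x*f x \<partial>lborel)"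
  unfolding torus_def by (subst nn_integral_density) auto
 also have "\<dots> = (\<integral>\<^sup>+x. indicator Q0 x*f x \<partial>lborel)"
  by (rule nn_integral_cong_AE) (use AE_cell_Q0 in eventually_elim, auto simp: indicator_def)
 finally show ?thesis .
qed

definition ifloor :: "real^2 => int \<times> int" where
 "ifloor x = (\<lfloor>x$1\<rfloor>, \<lfloor>x$2\<rfloor>)"

lemma Q0_shift_iff: "x + ivec k \<in> Q0 \<longleftrightarrow> k = - ifloor x"
proof -
 have "0 <= a + of_int m \<and> a + of_int m < 1 \<longleftrightarrow> m = - \<lfloor>a\<rfloor>" for a :: real and m :: int
  by linarith
 thus ?thesis
  by (cases k) (auto simp: Q0_def ifloor_def)
qed

lemma Q0_tiling: "(\<integral>\<^sup>+k. indicator Q0 (x + ivec k) \<partial>count_space UNIV) = (1::ennreal)"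
proof -
 have "(\<integral>\<^sup>+k. indicator Q0 (x + ivec k) \<partial>count_space UNIV)
   = (\<integral>\<^sup>+k. indicator {- ifloor x} k \<partial>count_space UNIV)"
  by (intro nn_integral_cong) (auto simp: indicator_def Q0_shift_iff)
 also have "\<dots> = 1" by (simp del: nn_integral_indicator_singleton)
 finally show ?thesis .
qed

lemma nn_integral_lborel_translate:
 fixes c :: "'a::euclidean_space"
 assumes [measurable]: "f \<in> bmeas"
 shows "(\<integral>\<^sup>+x. f (c + x) \<partial>lborel) = (\<integral>\<^sup>+x. f x \<partial>lborel)"
 by (subst (2) lborel_distr_plus[of c, symmetric]) (simp add: nn_integral_distr)

text \<open>Inserting the tiling identity of \<open>Q0\<close> under the integral over
  \<open>E\<close>, translating the \<open>k\<close>-th piece by \<open>- ivec k\<close> and summing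
  the indicators of \<open>E\<close> exchanges the two fundamental domains. Translated and reflected
  copies of \<open>Q0\<close> then give the invariances of the torus integral.\<close>

lemma nn_integral_fundamental_domain:
 fixes f :: "real^2 => ennreal"
 assumes [measurable]: "f \<in> bmeas" "E \<in> sets borel" and f: "per f"
  and E: "\<And>x. (\<integral>\<^sup>+k. indicator E (x + ivec k) \<partial>count_space UNIV) = (1::ennreal)"
 shows "(\<integral>\<^sup>+x. indicator E x*f x \<partial>lborel) = (\<integral>\<^sup>+x. f x \<partial>torus)"
proof -
 have cnt: "(\<integral>\<^sup>+x. \<integral>\<^sup>+k. g x k \<partial>count_space UNIV \<partial>lborel) = (\<integral>\<^sup>+k. \<integral>\<^sup>+x. g x k \<partial>lborel \<partial>count_space UNIV)"
  if "\<And>k. (\<lambda>x. g x k) \<in> bmeas" for g :: "real^2 => int \<times> int => ennreal"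
  by (rule nn_integral_count_space_nn_integral) (use that in auto)
 have "(\<integral>\<^sup>+x. indicator E x*f x \<partial>lborel)
   = (\<integral>\<^sup>+x. \<integral>\<^sup>+k. indicator E x*f x*indicator Q0 (x + ivec k) \<partial>count_space UNIV \<partial>lborel)"
  by (subst nn_integral_cmult) (auto simp: Q0_tiling)
 also have "\<dots> = (\<integral>\<^sup>+k. \<integral>\<^sup>+x. indicator E x*f x*indicator Q0 (x + ivec k) \<partial>lborel \<partial>count_space UNIV)"
  by (rule cnt) simp
 also have "\<dots> = (\<integral>\<^sup>+k. \<integral>\<^sup>+x. indicator E (ivec (-k) + x)*f (ivec (-k) + x)*indicator Q0 (ivec (-k) + x + ivec k)
   \<partial>lborel \<partial>count_space UNIV)"
  by (rule nn_integral_cong,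
    rule nn_integral_lborel_translate[where f="\<lambda>x. indicator E x*f x*indicator Q0 (x + ivec k)" for k, symmetric]) simp
 also have "\<dots> = (\<integral>\<^sup>+k. \<integral>\<^sup>+x. indicator Q0 x*f x*indicator E (x + ivec (-k)) \<partial>lborel \<partial>count_space UNIV)"
 proof (intro nn_integral_cong)
  fix k x
  have "f (ivec (-k) + x) = f x" using per_ivec[OF f, of x "-k"] by (simp add: add.commute)
  moreover have "ivec (-k) + x + ivec k = x" by (simp add: ivec_uminus)
  moreover have "ivec (-k) + x = x + ivec (-k)" by (simp add: add.commute)
  ultimately show "indicator E (ivec (-k) + x)*f (ivec (-k) + x)*indicator Q0 (ivec (-k) + x + ivec k)
    = indicator Q0 x*f x*indicator E (x + ivec (-k))"
   by (metis mult.commute mult.assoc)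
 qed
 also have "\<dots> = (\<integral>\<^sup>+x. \<integral>\<^sup>+k. indicator Q0 x*f x*indicator E (x + ivec (-k)) \<partial>count_space UNIV \<partial>lborel)"
  by (rule cnt[symmetric]) simp
 also have "\<dots> = (\<integral>\<^sup>+x. indicator Q0 x*f x*(\<integral>\<^sup>+k. indicator E (x + ivec (-k)) \<partial>count_space UNIV) \<partial>lborel)"
  by (subst nn_integral_cmult) auto
 also have "(\<lambda>x. \<integral>\<^sup>+k. indicator E (x + ivec (-k)) \<partial>count_space UNIV) = (\<lambda>x. 1)"
 proof
  fix x
  have "(\<integral>\<^sup>+k. indicator E (x + ivec (-k)) \<partial>count_space UNIV) = (\<integral>\<^sup>+k. indicator E (x + ivec k) \<partial>count_space UNIV)"
   by (rule nn_integral_bij_count_space) (auto intro!: bij_betwI[where g=uminus])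
  thus "(\<integral>\<^sup>+k. indicator E (x + ivec (-k)) \<partial>count_space UNIV) = (1::ennreal)" by (simp add: E)
 qed
 finally show ?thesis
  by (simp add: nn_integral_torus_Q0)
qed

lemma nn_integral_torus_shift:
 fixes f :: "real^2 => ennreal"
 assumes [measurable]: "f \<in> bmeas" and f: "per f"
 shows "(\<integral>\<^sup>+x. f (y + x) \<partial>torus) = (\<integral>\<^sup>+x. f x \<partial>torus)"
proof -
 define E where "E = (\<lambda>x. x - y) -` Q0"
 have [measurable]: "E \<in> sets borel"
  unfolding E_def by (rule measurable_sets_borel[OF _ Q0_borel]) measurable
 have "(\<integral>\<^sup>+x. f (y + x) \<partial>torus) = (\<integral>\<^sup>+x. indicator Q0 x*f (y + x) \<partial>lborel)"
  by (simp add: nn_integral_torus_Q0)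
 also have "\<dots> = (\<integral>\<^sup>+x. indicator E (y + x)*f (y + x) \<partial>lborel)"
  by (intro nn_integral_cong) (auto simp: E_def indicator_def)
 also have "\<dots> = (\<integral>\<^sup>+x. indicator E x*f x \<partial>lborel)"
  by (rule nn_integral_lborel_translate[where f="\<lambda>x. indicator E x*f x"]) simp
 also have "\<dots> = (\<integral>\<^sup>+x. f x \<partial>torus)"
 proof (rule nn_integral_fundamental_domain)
  fix x show "(\<integral>\<^sup>+k. indicator E (x + ivec k) \<partial>count_space UNIV) = (1::ennreal)"
   using Q0_tiling[of "x - y"] by (simp add: E_def indicator_def algebra_simps)
 qed (use f in auto)
 finally show ?thesis .
qed

lemma nn_integral_torus_reflect:
 fixes f :: "real^2 => ennreal"
 assumes [measurable]: "f \<in> bmeas" and f: "per f"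
 shows "(\<integral>\<^sup>+x. f (- x) \<partial>torus) = (\<integral>\<^sup>+x. f x \<partial>torus)"
proof -
 define E where "E = uminus -` Q0"
 have [measurable]: "E \<in> sets borel"
  unfolding E_def by (rule measurable_sets_borel[OF _ Q0_borel]) measurable
 have "(\<integral>\<^sup>+x. f (- x) \<partial>torus) = (\<integral>\<^sup>+x. indicator E (- x)*f (- x) \<partial>lborel)"
  by (simp add: nn_integral_torus_Q0 E_def indicator_def)
 also have "\<dots> = (\<integral>\<^sup>+x. indicator E x*f x \<partial>distr lborel borel uminus)"
  by (simp add: nn_integral_distr)
 also have "distr lborel borel uminus = (lborel :: (real^2) measure)"
  using lborel_affine[of "-1" "0::real^2"] by (simp add: density_1)
 also have "(\<integral>\<^sup>+x. indicator E x*f x \<partial>lborel) = (\<integral>\<^sup>+x. f x \<partial>torus)"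
 proof (rule nn_integral_fundamental_domain)
  fix x
  have "(\<integral>\<^sup>+k. indicator E (x + ivec k) \<partial>count_space UNIV)
    = (\<integral>\<^sup>+k. indicator Q0 (- x + ivec (-k)) \<partial>count_space UNIV)"
   by (simp add: E_def indicator_def ivec_uminus)
  also have "\<dots> = (\<integral>\<^sup>+k. indicator Q0 (- x + ivec k) \<partial>count_space UNIV)"
   by (rule nn_integral_bij_count_space) (auto intro!: bij_betwI[where g=uminus])
  finally show "(\<integral>\<^sup>+k. indicator E (x + ivec k) \<partial>count_space UNIV) = (1::ennreal)" 
   by (simp only: Q0_tiling)
 qed (use f in auto)
 finally show ?thesis .
qed

text \<open>Reduction modulo the lattice into \<open>Q0\<close>. It turns translation and reflection
  into maps that preserve \<open>torus\<close>, so that integrability and vector-valued integrals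
  transfer by push-forward.\<close>

definition Qfrac :: "real^2 => real^2" where
 "Qfrac x = x - ivec (ifloor x)"

lemma Qfrac_measurable [measurable]: "Qfrac \<in> bmeas"
proof -
 have eq: "Qfrac = (\<lambda>x. x - (of_int \<lfloor>x$1\<rfloor> *\<^sub>R axis 1 1 + of_int \<lfloor>x$2\<rfloor> *\<^sub>R axis 2 1))"
  by (auto simp: Qfrac_def ivec_def ifloor_def)
 show ?thesis unfolding eq by measurable
qed

lemma per_Qfrac: "per f ==> f (Qfrac x) = f x"
 using per_ivec[of f x "- ifloor x"] by (simp add: Qfrac_def ivec_uminus)

lemma ifloor_shift: "ifloor (x + ivec k) = ifloor x + k"
 by (cases k) (simp add: ifloor_def)

lemma per_Qfrac_comp: "per (\<lambda>x. f (Qfrac x))"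
proof -
 have "Qfrac (x + ivec k) = Qfrac x" for x k
  by (simp add: Qfrac_def ifloor_shift ivec_add)
 from this[of _ "(1,0)"] this[of _ "(0,1)"] show ?thesis
  by (simp add: per_def) (simp add: ivec_def)
qed

lemma per_shift: "per f ==> per (\<lambda>x. f (y + x))" "per f ==> per (\<lambda>x. f (x - y))" "per f ==> per (\<lambda>x. f (y - x))"
proof -
 assume f: "per f"
 have p: "per (\<lambda>x. f (y + x))" for y using f unfolding per_def by (metis add.assoc)
 thus "per (\<lambda>x. f (y + x))" .
 show "per (\<lambda>x. f (x - y))" using p[of "-y"] by simp
 have "f (z - axis 1 1) = f z" "f (z - axis 2 1) = f z" for z
  using f per_ivec[OF f, of z "(-1,0)"] per_ivec[OF f, of z "(0,-1)"] by (auto simp: ivec_def)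
 thus "per (\<lambda>x. f (y - x))" unfolding per_def by (metis diff_diff_eq)
qed

lemma distr_torus_shift: "distr torus borel (\<lambda>x. Qfrac (y + x)) = torus"
proof (rule measure_eqI)
 fix A assume "A \<in> sets (distr torus borel (\<lambda>x. Qfrac (y + x)))"
 hence [measurable]: "A \<in> sets borel" by simp
 have "emeasure (distr torus borel (\<lambda>x. Qfrac (y + x))) A = (\<integral>\<^sup>+x. indicator A (Qfrac (y + x)) \<partial>torus)"
  by (simp add: nn_integral_distr flip: nn_integral_indicator)
 also have "\<dots> = (\<integral>\<^sup>+x. indicator A (Qfrac x) \<partial>torus)"
  by (rule nn_integral_torus_shift[where f="\<lambda>x. indicator A (Qfrac x)"]) (auto intro: per_Qfrac_comp)
 also have "\<dots> = (\<integral>\<^sup>+x. indicator Q0 x*indicator A (Qfrac x) \<partial>lborel)"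
  by (simp add: nn_integral_torus_Q0)
 also have "\<dots> = (\<integral>\<^sup>+x. indicator Q0 x*indicator A x \<partial>lborel)"
 proof (intro nn_integral_cong)
  fix x
  have "Qfrac x = x" if "x \<in> Q0"
   using Q0_shift_iff[of x 0] that by (auto simp: Qfrac_def ivec_def)
  thus "indicator Q0 x*indicator A (Qfrac x) = (indicator Q0 x*indicator A x :: ennreal)"
   by (auto simp: indicator_def)
 qed
 also have "\<dots> = emeasure torus A"
  by (simp add: nn_integral_torus_Q0 flip: nn_integral_indicator)
 finally show "emeasure (distr torus borel (\<lambda>x. Qfrac (y + x))) A = emeasure torus A" .
qed simp

lemma distr_torus_reflect: "distr torus borel (\<lambda>x. Qfrac (- x)) = torus"
proof (rule measure_eqI)
 fix A assume "A \<in> sets (distr torus borel (\<lambda>x. Qfrac (- x)))"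
 hence [measurable]: "A \<in> sets borel" by simp
 have "emeasure (distr torus borel (\<lambda>x. Qfrac (- x))) A = (\<integral>\<^sup>+x. indicator A (Qfrac (- x)) \<partial>torus)"
  by (simp add: nn_integral_distr flip: nn_integral_indicator)
 also have "\<dots> = (\<integral>\<^sup>+x. indicator A (Qfrac x) \<partial>torus)"
  by (rule nn_integral_torus_reflect[where f="\<lambda>x. indicator A (Qfrac x)"]) (auto intro: per_Qfrac_comp)
 also have "\<dots> = (\<integral>\<^sup>+x. indicator A x \<partial>distr torus borel (\<lambda>x. Qfrac (0 + x)))"
  by (subst nn_integral_distr) auto
 also have "\<dots> = emeasure torus A" unfolding distr_torus_shift by simp
 finally show "emeasure (distr torus borel (\<lambda>x. Qfrac (- x))) A = emeasure torus A" .
qed simp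

context
 fixes f :: "real^2 => 'b::{banach, second_countable_topology}"
 assumes f[measurable]: "f \<in> bmeas" and per: "per f"
begin

lemma integral_torus_shift: "(TI x. f (y + x)) = (TI x. f x)"
 by (subst (2) distr_torus_shift[of y, symmetric]) (simp add: integral_distr per_Qfrac[OF per])

lemma integrable_torus_shift: "tint (\<lambda>x. f (y + x)) \<longleftrightarrow> tint f"
 by (subst (2) distr_torus_shift[of y, symmetric]) (simp add: integrable_distr_eq per_Qfrac[OF per])

lemma integral_torus_minus: "(TI x. f (y - x)) = (TI x. f x)"
proof -
 have p: "per (\<lambda>x. f (y + x))" by (rule per_shift(1)[OF per])
 have "(TI x. f (y + x)) = (TI x. f (y - x))"
  using per_Qfrac[OF p]
  by (subst distr_torus_reflect[symmetric]) (simp add: integral_distr)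
 thus ?thesis by (simp add: integral_torus_shift)
qed

lemma integrable_torus_minus: "tint (\<lambda>x. f (y - x)) \<longleftrightarrow> tint f"
proof -
 have p: "per (\<lambda>x. f (y + x))" by (rule per_shift(1)[OF per])
 have "tint (\<lambda>x. f (y + x)) \<longleftrightarrow> tint (\<lambda>x. f (y - x))"
  using per_Qfrac[OF p]
  by (subst distr_torus_reflect[symmetric]) (simp add: integrable_distr_eq)
 thus ?thesis by (simp add: integrable_torus_shift)
qed

end

subsection \<open>Square-integrable functions\<close>

definition L2f :: "(real^2 => real) => bool" where
 "L2f f \<longleftrightarrow> per f \<and> f \<in> bmeas \<and> tint (\<lambda>x. (f x)^2)"

definition nsq :: "(real^2 => real) => real" where
 "nsq f = (TI x. (f x)^2)"

abbreviation nsq2 :: "(real^2 => real^2) => real" where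
 "nsq2 v \<equiv> nsq (v $$ 1) + nsq (v $$ 2)"

abbreviation fr2 :: "(real^2 => real^2) => int \<times> int => real" where
 "fr2 v k \<equiv> (norm (fourier (v $$ 1) k))^2 + (norm (fourier (v $$ 2) k))^2"

lemma L2fD: assumes "L2f f" shows L2f_per: "per f" and L2f_meas [measurable_dest]: "f \<in> bmeas"
 and L2f_sq: "tint (\<lambda>x. (f x)^2)"
 using assms by (auto simp: L2f_def)

lemma nsq_nonneg [simp]: "0 <= nsq f" by (simp add: nsq_def)

lemma integrable_mult_sq:
 fixes f g :: "'a => real"
 assumes [measurable]: "f \<in> borel_measurable M" "g \<in> borel_measurable M"
  and "integrable M (\<lambda>x. (f x)^2)" "integrable M (\<lambda>x. (g x)^2)"
 shows "integrable M (\<lambda>x. f x*g x)"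
proof (rule Bochner_Integration.integrable_bound)
 show "integrable M (\<lambda>x. (f x)^2 + (g x)^2)" using assms by simp
 have "\<bar>a*b\<bar> <= a^2 + b^2" for a b :: real
  using sum_squares_bound[of "\<bar>a\<bar>" "\<bar>b\<bar>"] mult_nonneg_nonneg[OF abs_ge_zero[of a] abs_ge_zero[of b]]
  unfolding abs_mult power2_abs by (simp only: mult.assoc)
 thus "AE x in M. norm (f x*g x) <= norm ((f x)^2 + (g x)^2)" by auto
qed simp

lemma Cauchy_Schwarz_integral:
 fixes f g :: "'a => real"
 assumes [measurable]: "f \<in> borel_measurable M" "g \<in> borel_measurable M"
  and f: "integrable M (\<lambda>x. (f x)^2)" and g: "integrable M (\<lambda>x. (g x)^2)"
 shows "\<bar>\<integral>x. f x*g x \<partial>M\<bar> <= sqrt (\<integral>x. (f x)^2 \<partial>M) * sqrt (\<integral>x. (g x)^2 \<partial>M)"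
proof -
 define A where "A = (\<integral>x. (f x)^2 \<partial>M)"
 define B where "B = (\<integral>x. f x*g x \<partial>M)"
 define C where "C = (\<integral>x. (g x)^2 \<partial>M)"
 note fg = integrable_mult_sq[OF assms]
 have nonneg: "0 <= C*t^2 + 2*B*t + A" for t
 proof -
  have "0 <= (\<integral>x. (f x + t*g x)^2 \<partial>M)" by simp
  also have "\<dots> = (\<integral>x. (f x)^2 + (2*t*(f x*g x) + t^2*(g x)^2) \<partial>M)"
   by (rule tcong) (auto simp: power2_eq_square algebra_simps)
  also have "\<dots> = A + (2*t*B + t^2 * C)"
   using f g fg by (simp add: A_def B_def C_def)
  finally show ?thesis by (simp add: algebra_simps)
 qed
 have "B^2 <= A * C"
 proof (cases "C = 0")
  case True
  have "B = 0"
  proof (rule ccontr)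
   assume "B \<noteq> 0"
   \<comment> \<open>This argument gives the affine function \<open>2*B*t + A\<close> the value
     -1.\<close>
   with nonneg[of "- (A + 1)/(2*B)"] True show False by (simp add: field_simps)
  qed
  thus ?thesis using True by simp
 next
  case False
  hence "C > 0" by (simp add: C_def less_le)
  have "C*(- B/C)^2 + 2*B*(- B/C) + A = A - B^2/C"
   using False by (simp add: field_simps power2_eq_square)
  hence "B^2/C <= A" using nonneg[of "- B/C"] by linarith
  thus ?thesis using \<open>C > 0\<close> by (simp add: pos_divide_le_eq)
 qed
 hence "\<bar>B\<bar> <= sqrt (A * C)" by (metis real_sqrt_abs real_sqrt_le_mono)
 thus ?thesis by (simp add: A_def B_def C_def real_sqrt_mult)
qed

lemma Basis_real2: "Basis = {axis 1 1, axis 2 (1::real) :: real^2}"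
 by (auto simp: Basis_vec_def UNIV_2_eq)

lemma inner_real2: "(x::real^2) \<bullet> y = x$1*y$1 + x$2*y$2"
 by (simp add: inner_vec_def UNIV_2_eq)

lemma nn_integral_finite_le:
 fixes f :: "'a => real"
 assumes [measurable]: "f \<in> borel_measurable M" and f: "\<And>x. 0 <= f x" and le: "(\<integral>\<^sup>+x. f x \<partial>M) <= ennreal B" and B: "0 <= B"
 shows "integrable M f" "(\<integral>x. f x \<partial>M) <= B"
proof -
 show i: "integrable M f"
  by (rule integrableI_nonneg) (use f le in \<open>auto intro: le_less_trans simp: top.not_eq_extremum\<close>)
 have "ennreal (\<integral>x. f x \<partial>M) <= ennreal B"
  using le f by (subst nn_integral_eq_integral[symmetric]) (auto intro: i)
 thus "(\<integral>x. f x \<partial>M) <= B" using B by (simp add: ennreal_le_iff)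
qed

text \<open>Differentiation under the integral with a weight that is merely integrable: the
  Lipschitz bound on \<open>q\<close> dominates the remainder quotient by
  \<open>2*B*\<bar>u z\<bar>\<close>. The set \<open>S\<close> will be a scale interval, the whole
  plane and a time interval.\<close>

lemma has_derivative_integral_dominated:
 fixes q :: "'b => 'a::real_normed_vector => real" and u :: "'b => real"
 assumes u: "integrable M u"
  and m: "\<And>x. x \<in> S ==> (\<lambda>z. q z x) \<in> borel_measurable M"
  and m': "\<And>h. (\<lambda>z. q' z h) \<in> borel_measurable M"
  and x: "x \<in> S"
  and d: "\<And>z. (q z has_derivative q' z) (at x within S)"
  and q0: "\<And>z. \<bar>q z x\<bar> <= K"
  and lip: "\<And>z y. y \<in> S ==> \<bar>q z y - q z x\<bar> <= B*norm (y - x)"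
  and lip': "\<And>z h. \<bar>q' z h\<bar> <= B*norm h"
 shows "((\<lambda>x. \<integral>z. u z*q z x \<partial>M) has_derivative (\<lambda>h. \<integral>z. u z*q' z h \<partial>M)) (at x within S)"
proof -
 have [measurable]: "u \<in> borel_measurable M" using u by auto
 note m'[measurable]
 have ui: "integrable M (\<lambda>z. C*\<bar>u z\<bar>)" for C using u by auto
 have iq: "integrable M (\<lambda>z. u z*q z y)" if "y \<in> S" for y
 proof (rule Bochner_Integration.integrable_bound[OF ui])
  note m[OF that, measurable]
  show "(\<lambda>z. u z*q z y) \<in> borel_measurable M" by simp
  have "\<bar>q z y\<bar> <= \<bar>K + B*norm (y - x)\<bar>" for z using q0[of z] lip[OF that, of z] by linarith
  thus "AE z in M. norm (u z*q z y) <= norm (\<bar>K + B*norm (y - x)\<bar>*\<bar>u z\<bar>)"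
   by (intro AE_I2) (simp add: abs_mult mult.commute mult_left_mono)
 qed
 have iq': "integrable M (\<lambda>z. u z*q' z h)" for h
 proof (rule Bochner_Integration.integrable_bound[OF ui])
  show "AE z in M. norm (u z*q' z h) <= norm ((B*norm h)*\<bar>u z\<bar>)"
   using lip'[of _ h] by (intro AE_I2)
    (simp add: abs_mult mult.commute, metis abs_ge_self abs_ge_zero abs_mult abs_norm_cancel mult.commute mult_left_mono order_trans)
 qed simp
 have lin: "linear (q' z)" for z using d[of z] by (rule has_derivative_linear)
 have bl: "bounded_linear (\<lambda>h. \<integral>z. u z*q' z h \<partial>M)"
 proof (rule bounded_linear_intro[where K="(\<integral>z. \<bar>u z\<bar> \<partial>M)*B"])
  fix h k show "(\<integral>z. u z*q' z (h + k) \<partial>M) = (\<integral>z. u z*q' z h \<partial>M) + (\<integral>z. u z*q' z k \<partial>M)"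
   by (simp add: linear_add[OF lin] distrib_left iq')
 next
  fix r h show "(\<integral>z. u z*q' z (r *\<^sub>R h) \<partial>M) = r *\<^sub>R (\<integral>z. u z*q' z h \<partial>M)"
   by (simp add: linear_scale[OF lin] mult.left_commute)
 next
  fix h
  have "norm (\<integral>z. u z*q' z h \<partial>M) <= (\<integral>z. \<bar>u z\<bar>*(B*norm h) \<partial>M)"
   by (rule order_trans[OF integral_norm_bound], rule integral_mono)
    (use u integrable_abs[OF iq'[of h]] lip'[of _ h] in \<open>auto simp: abs_mult intro!: mult_left_mono\<close>)
  also have "\<dots> = norm h*((\<integral>z. \<bar>u z\<bar> \<partial>M)*B)" by (simp add: mult_ac)
  finally show "norm (\<integral>z. u z*q' z h \<partial>M) <= norm h*((\<integral>z. \<bar>u z\<bar> \<partial>M)*B)" .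
 qed
 have "((\<lambda>y. ((\<integral>z. u z*q z y \<partial>M) - (\<integral>z. u z*q z x \<partial>M) - (\<integral>z. u z*q' z (y - x) \<partial>M)) /\<^sub>R norm (y - x)) \<longlongrightarrow> 0) (at x within S)"
  unfolding tendsto_at_iff_sequentially comp_def
 proof (intro allI impI)
  fix X :: "nat => 'a" assume X: "\<forall>i. X i \<in> S - {x}" "X \<longlonglongrightarrow> x"
  define R where "R i z = (q z (X i) - q z x - q' z (X i - x)) /\<^sub>R norm (X i - x)" for i z
  have "(\<lambda>i. \<integral>z. u z * R i z \<partial>M) \<longlonglongrightarrow> (\<integral>z. 0 \<partial>M)"
  proof (rule integral_dominated_convergence[where w="\<lambda>z. 2*B*\<bar>u z\<bar>"])
   show "(\<lambda>z. u z * R i z) \<in> borel_measurable M" for i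
   proof -
    have "X i \<in> S" using X(1) by auto
    note m[OF this, measurable] m[OF x, measurable]
    show ?thesis unfolding R_def by measurable
   qed
   show "AE z in M. (\<lambda>i. u z * R i z) \<longlonglongrightarrow> 0"
   proof (rule AE_I2)
    fix z
    have "((\<lambda>y. (q z y - q z x - q' z (y - x)) /\<^sub>R norm (y - x)) \<longlongrightarrow> 0) (at x within S)"
     using d[of z] by (simp add: has_derivative_at_within)
    hence "(\<lambda>i. R i z) \<longlonglongrightarrow> 0"
     using X unfolding tendsto_at_iff_sequentially comp_def R_def by auto
    thus "(\<lambda>i. u z * R i z) \<longlonglongrightarrow> 0" by (rule tendsto_mult_right_zero)
   qed
   show "AE z in M. norm (u z * R i z) <= 2*B*\<bar>u z\<bar>" for i
   proof (rule AE_I2)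
    fix z
    have p: "norm (X i - x) > 0" using X(1) by auto
    have "\<bar>q z (X i) - q z x - q' z (X i - x)\<bar> <= 2*B*norm (X i - x)"
     using lip[of "X i" z] lip'[of z "X i - x"] X(1) by fastforce
    hence "\<bar>R i z\<bar> <= 2*B" using p by (simp add: R_def abs_mult field_simps)
    thus "norm (u z * R i z) <= 2*B*\<bar>u z\<bar>"
     by (simp add: abs_mult mult.commute mult_left_mono)
   qed
   show "integrable M (\<lambda>z. 2*B*\<bar>u z\<bar>)" by (rule ui)
  qed simp
  moreover have "(\<integral>z. u z * R i z \<partial>M) = ((\<integral>z. u z*q z (X i) \<partial>M) - (\<integral>z. u z*q z x \<partial>M) - (\<integral>z. u z*q' z (X i - x) \<partial>M)) /\<^sub>R norm (X i - x)" for i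
  proof -
   have "(\<integral>z. u z * R i z \<partial>M) = (\<integral>z. (u z*q z (X i) - u z*q z x - u z*q' z (X i - x)) /\<^sub>R norm (X i - x) \<partial>M)"
    unfolding R_def by (rule tcong) (auto simp: algebra_simps)
   also have "\<dots> = ((\<integral>z. u z*q z (X i) \<partial>M) - (\<integral>z. u z*q z x \<partial>M) - (\<integral>z. u z*q' z (X i - x) \<partial>M)) /\<^sub>R norm (X i - x)"
    using X(1) x iq by (simp add: iq')
   finally show ?thesis .
  qed
  ultimately show "(\<lambda>i. ((\<integral>z. u z*q z (X i) \<partial>M) - (\<integral>z. u z*q z x \<partial>M) - (\<integral>z. u z*q' z (X i - x) \<partial>M)) /\<^sub>R norm (X i - x)) \<longlonglongrightarrow> 0"
   by simp
 qed
 thus ?thesis using bl by (simp add: has_derivative_at_within)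
qed

lemma L2f_mult: "L2f f ==> L2f g ==> tint (\<lambda>x. f x*g x)"
 by (rule integrable_mult_sq) (auto simp: L2f_def)

lemma L2f_CS: "L2f f ==> L2f g ==> \<bar>TI x. f x*g x\<bar> <= sqrt (nsq f) * sqrt (nsq g)"
 unfolding nsq_def by (rule Cauchy_Schwarz_integral) (auto simp: L2f_def)

lemma per_const [simp]: "per (\<lambda>x. c)" by (simp add: per_def)

lemma L2f_const: "L2f (\<lambda>x. c)"
 by (auto simp: L2f_def per_def)

lemma L2f_integrable: "L2f f ==> tint f"
 using L2f_mult[of f "\<lambda>x. 1"] L2f_const by simp

lemma L2f_add: assumes "L2f f" "L2f g" shows "L2f (\<lambda>x. f x + g x)"
proof -
 note [measurable] = assms[THEN L2f_meas]
 have "tint (\<lambda>x. (f x)^2 + (g x)^2 + 2*(f x*g x))"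
  using assms by (intro Bochner_Integration.integrable_add integrable_mult_right L2f_mult) (auto simp: L2f_def)
 thus ?thesis using assms by (simp add: L2f_def per_def power2_sum mult.assoc)
qed

lemma L2f_cmult: "L2f f ==> L2f (\<lambda>x. c*f x)"
 by (auto simp: L2f_def per_def power_mult_distrib)

lemma L2f_uminus: "L2f f ==> L2f (\<lambda>x. - f x)"
 using L2f_cmult[of f "-1"] by simp

lemma L2f_diff: "L2f f ==> L2f g ==> L2f (\<lambda>x. f x - g x)"
 using L2f_add[of f "\<lambda>x. - g x"] L2f_uminus by simp

lemma L2f_sum: "(\<And>k. k \<in> F ==> L2f (f k)) ==> L2f (\<lambda>x. \<Sum>k\<in>F. f k x)"
 by (induction F rule: infinite_finite_induct) (auto intro: L2f_const L2f_add)

lemma L2f_bounded_mult: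
 assumes "L2f f" and [measurable]: "g \<in> bmeas" and "per g" and "AE x in torus. \<bar>g x\<bar> <= C"
 shows "L2f (\<lambda>x. g x*f x)" "nsq (\<lambda>x. g x*f x) <= C^2*nsq f"
proof -
 note [measurable] = L2f_meas[OF assms(1)]
 have b: "AE x in torus. (g x*f x)^2 <= C^2*(f x)^2"
  using assms(4)
 proof eventually_elim
  fix x assume "\<bar>g x\<bar> <= C"
  hence "(g x)^2 <= C^2" by (rule power2_le_iff_abs_le[THEN iffD2, rotated]) (use \<open>\<bar>g x\<bar> <= C\<close> in linarith)
  thus "(g x*f x)^2 <= C^2*(f x)^2" by (simp add: power_mult_distrib mult_right_mono)
 qed
 have i: "tint (\<lambda>x. C^2*(f x)^2)" using L2f_sq[OF assms(1)] by simp
 have i2: "tint (\<lambda>x. (g x*f x)^2)"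
  by (rule Bochner_Integration.integrable_bound[OF i]) (use b in auto)
 thus "L2f (\<lambda>x. g x*f x)" using assms by (auto simp: L2f_def per_def)
 show "nsq (\<lambda>x. g x*f x) <= C^2*nsq f"
  using integral_mono_AE[OF i2 i b] by (simp add: nsq_def)
qed

lemma L2f_bounded:
 assumes "f \<in> bmeas" "per f" "AE x in torus. \<bar>f x\<bar> <= C"
 shows "L2f f" "nsq f <= C^2"
 using L2f_bounded_mult[OF L2f_const[of 1] assms] by (auto simp: nsq_def torus.prob_space[simplified])

lemma nsq_sqrt_triangle:
 assumes "L2f f" "L2f g"
 shows "sqrt (nsq (\<lambda>x. f x + g x)) <= sqrt (nsq f) + sqrt (nsq g)"
proof (rule real_le_lsqrt)
 have "nsq (\<lambda>x. f x + g x) = (TI x. (f x)^2 + ((g x)^2 + 2*(f x*g x)))"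
  unfolding nsq_def by (rule tcong) (auto simp: power2_sum)
 also have "\<dots> = nsq f + (nsq g + 2*(TI x. f x*g x))"
  using assms by (simp add: L2f_sq L2f_mult nsq_def)
 also have "\<dots> <= (sqrt (nsq f) + sqrt (nsq g))^2"
  using L2f_CS[OF assms] by (simp add: power2_sum)
 finally show "nsq (\<lambda>x. f x + g x) <= (sqrt (nsq f) + sqrt (nsq g))^2" .
qed simp

lemma nsq_add_le: "L2f f ==> L2f g ==> nsq (\<lambda>x. f x + g x) <= 2*nsq f + 2*nsq g"
proof -
 assume a: "L2f f" "L2f g"
 have "nsq (\<lambda>x. f x + g x) <= (TI x. 2*(f x)^2 + 2*(g x)^2)"
  unfolding nsq_def
 proof (rule integral_mono)
  fix x show "(f x + g x)^2 <= 2*(f x)^2 + 2*(g x)^2"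
   using sum_squares_bound[of "f x" "g x"] by (simp add: power2_sum)
 qed (use a L2f_sq[OF L2f_add[OF a]] in \<open>auto simp: L2f_sq\<close>)
 also have "\<dots> = 2*nsq f + 2*nsq g" using a by (simp add: L2f_sq nsq_def)
 finally show ?thesis .
qed

lemma L2f_shift:
 assumes f: "L2f f"
 shows "L2f (\<lambda>x. f (y + x))" "nsq (\<lambda>x. f (y + x)) = nsq f"
  and "L2f (\<lambda>x. f (y - x))" "nsq (\<lambda>x. f (y - x)) = nsq f"
  and "L2f (\<lambda>x. f (x - y))" "nsq (\<lambda>x. f (x - y)) = nsq f"
proof -
 note [measurable] = L2f_meas[OF f]
 have sq: "per (\<lambda>x. (f x)^2)" using L2f_per[OF f] by (simp add: per_def)
 have 1: "L2f (\<lambda>x. f (y + x)) \<and> nsq (\<lambda>x. f (y + x)) = nsq f" for y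
  using integrable_torus_shift[OF _ sq, of y] integral_torus_shift[OF _ sq, of y] f per_shift(1)[OF L2f_per[OF f]]
  by (auto simp: L2f_def nsq_def)
 thus "L2f (\<lambda>x. f (y + x))" "nsq (\<lambda>x. f (y + x)) = nsq f" by auto
 show "L2f (\<lambda>x. f (x - y))" "nsq (\<lambda>x. f (x - y)) = nsq f" using 1[of "-y"] by auto
 show "L2f (\<lambda>x. f (y - x))" "nsq (\<lambda>x. f (y - x)) = nsq f"
  using integrable_torus_minus[OF _ sq, of y] integral_torus_minus[OF _ sq, of y] f per_shift(3)[OF L2f_per[OF f]]
  by (auto simp: L2f_def nsq_def)
qed

subsection \<open>Periodic continuously differentiable functions\<close>

lemma continuous_bounded_Q0:
 fixes f :: "real^2 => 'b::real_normed_vector"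
 assumes "per f" "continuous_on UNIV f"
 obtains B where "\<And>x. norm (f x) <= B" "B > 0"
proof -
 have "compact (f ` cell)"
  by (rule compact_continuous_image[OF continuous_on_subset[OF assms(2) subset_UNIV]])
   (simp add: cell_def compact_cbox)
 hence "bounded (f ` cell)" by (rule compact_imp_bounded)
 then obtain B where B: "\<And>x. x \<in> cell ==> norm (f x) <= B" "B > 0"
  unfolding bounded_pos by auto
 have "norm (f x) <= B" for x
 proof -
  have "Qfrac x \<in> Q0" using Q0_shift_iff[of x "- ifloor x"] by (simp add: Qfrac_def ivec_uminus)
  hence "Qfrac x \<in> cell" by (auto simp: Q0_def cell_def mem_box_cart forall_2_iff)
  from B(1)[OF this] show ?thesis by (simp add: per_Qfrac[OF assms(1)])
 qed
 with B(2) show ?thesis using that by blast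
qed

lemma C1perD:
 assumes "C1per g G"
 shows C1per_per: "per g" and C1per_deriv: "(g has_derivative (\<lambda>h. G x \<bullet> h)) (at x)"
  and C1per_contG: "continuous_on UNIV G" and C1per_cont: "continuous_on UNIV g"
  and C1per_meas: "g \<in> bmeas" and C1per_measG: "G \<in> bmeas"
proof -
 show "per g" "(g has_derivative (\<lambda>h. G x \<bullet> h)) (at x)" "continuous_on UNIV G" for x
  using assms by (auto simp: C1per_def)
 show c: "continuous_on UNIV g"
  using assms by (intro continuous_at_imp_continuous_on ballI has_derivative_continuous) (auto simp: C1per_def)
 thus "g \<in> bmeas" by (rule borel_measurable_continuous_onI)
 show "G \<in> bmeas"
  using assms by (intro borel_measurable_continuous_onI) (auto simp: C1per_def)
qed

lemma C1per_perG: assumes "C1per g G" shows "per G"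
proof -
 have "G (x + a) = G x" if a: "\<And>y. g (y + a) = g y" for x a
 proof -
  have "((\<lambda>y. g (y + a)) has_derivative (\<lambda>h. G (x + a) \<bullet> h)) (at x)"
   by (rule has_derivative_compose[of "\<lambda>y. y + a" "\<lambda>h. h" x UNIV g "\<lambda>h. G (x + a) \<bullet> h"])
    (auto intro!: derivative_eq_intros C1per_deriv[OF assms])
  hence "(g has_derivative (\<lambda>h. G (x + a) \<bullet> h)) (at x)" by (simp add: a)
  from has_derivative_unique[OF this C1per_deriv[OF assms]] show ?thesis
   by (metis inner_commute vector_eq_ldot)
 qed
 thus ?thesis using C1per_per[OF assms] by (auto simp: per_def)
qed

lemma C1per_bounded:
 assumes "C1per g G"
 obtains B where "\<And>x. \<bar>g x\<bar> <= B" "\<And>x. norm (G x) <= B" "B > 0"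
proof -
 obtain B1 where 1: "\<And>x. norm (g x) <= B1"
  using continuous_bounded_Q0[OF C1per_per[OF assms] C1per_cont[OF assms]] by metis
 obtain B2 where 2: "\<And>x. norm (G x) <= B2" "B2 > 0"
  using continuous_bounded_Q0[OF C1per_perG[OF assms] C1per_contG[OF assms]] by metis
 show ?thesis
  by (rule that[of "max B1 B2"]) (use 1 2 in \<open>auto simp: le_max_iff_disj less_max_iff_disj\<close>)
qed

lemma C1per_L2f:
 assumes "C1per g G"
 shows "L2f g" "L2f (G $$ i)"
proof -
 obtain B where B: "\<And>x. \<bar>g x\<bar> <= B" "\<And>x. norm (G x) <= B" using C1per_bounded[OF assms] by metis
 note [measurable] = C1per_meas[OF assms] C1per_measG[OF assms]
 show "L2f g" by (rule L2f_bounded[where C=B]) (use C1per_per[OF assms] B in auto)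
 show "L2f (G $$ i)"
  by (rule L2f_bounded[where C=B])
   (use C1per_perG[OF assms] in \<open>auto simp: per_def intro!: AE_I2 order_trans[OF component_le_norm_cart B(2)]
    borel_measurable_vec_nth_comp[OF C1per_measG[OF assms]]\<close>)
qed

lemma C1per_lipschitz:
 assumes "C1per g G" "\<And>x. norm (G x) <= B"
 shows "\<bar>g x - g y\<bar> <= B*norm (x - y)"
proof -
 have "norm (g x - g y) <= B*norm (x - y)"
 proof (rule differentiable_bound[where S=UNIV])
  show "(g has_derivative (\<lambda>h. G x \<bullet> h)) (at x within UNIV)" for x using C1per_deriv[OF assms(1)] .
  show "onorm (\<lambda>h. G x \<bullet> h) <= B" for x
   by (rule onorm_le) (metis assms(2) Cauchy_Schwarz_ineq2 mult_right_mono norm_ge_zero order_trans real_norm_def)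
 qed auto
 thus ?thesis by simp
qed

lemma C1per_shift:
 assumes "C1per g G"
 shows "C1per (\<lambda>z. g (x - z)) (\<lambda>z. - G (x - z))"
 unfolding C1per_def
proof (intro conjI allI)
 show "per (\<lambda>z. g (x - z))" using per_shift(3) C1per_per[OF assms] by blast
 show "((\<lambda>z. g (x - z)) has_derivative (\<lambda>h. - G (x - z) \<bullet> h)) (at z)" for z
  by (rule has_derivative_eq_rhs[OF has_derivative_compose[of "\<lambda>z. x - z" "\<lambda>h. - h" z UNIV g "\<lambda>h. G (x - z) \<bullet> h"]])
   (auto intro!: derivative_eq_intros C1per_deriv[OF assms])
 show "continuous_on UNIV (\<lambda>z. - G (x - z))"
  by (intro continuous_intros continuous_on_compose2[OF C1per_contG[OF assms]]) auto
qed

lemma C1per_mult: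
 assumes f: "C1per f F" and g: "C1per g G"
 shows "C1per (\<lambda>z. f z*g z) (\<lambda>z. f z *\<^sub>R G z + g z *\<^sub>R F z)"
 unfolding C1per_def
proof (intro conjI allI)
 show "per (\<lambda>z. f z*g z)" using C1per_per[OF f] C1per_per[OF g] by (simp add: per_def)
 show "((\<lambda>z. f z*g z) has_derivative (\<lambda>h. (f z *\<^sub>R G z + g z *\<^sub>R F z) \<bullet> h)) (at z)" for z
  by (rule has_derivative_eq_rhs[OF has_derivative_mult[OF C1per_deriv[OF f] C1per_deriv[OF g]]])
   (auto simp: inner_simps algebra_simps)
 show "continuous_on UNIV (\<lambda>z. f z *\<^sub>R G z + g z *\<^sub>R F z)"
  using C1per_cont[OF f] C1per_cont[OF g] C1per_contG[OF f] C1per_contG[OF g] by (intro continuous_intros)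
qed

lemma C1per_add:
 assumes f: "C1per f F" and g: "C1per g G"
 shows "C1per (\<lambda>z. f z + g z) (\<lambda>z. F z + G z)"
 unfolding C1per_def
proof (intro conjI allI)
 show "per (\<lambda>z. f z + g z)" using C1per_per[OF f] C1per_per[OF g] by (simp add: per_def)
 show "((\<lambda>z. f z + g z) has_derivative (\<lambda>h. (F z + G z) \<bullet> h)) (at z)" for z
  by (rule has_derivative_eq_rhs[OF has_derivative_add[OF C1per_deriv[OF f] C1per_deriv[OF g]]])
   (auto simp: inner_simps)
 show "continuous_on UNIV (\<lambda>z. F z + G z)"
  using C1per_contG[OF f] C1per_contG[OF g] by (intro continuous_intros)
qed

lemma C1per_const: "C1per (\<lambda>z. c) (\<lambda>z. 0)"
 by (auto simp: C1per_def per_def)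

lemma C1per_cmult: "C1per f F ==> C1per (\<lambda>z. c*f z) (\<lambda>z. c *\<^sub>R F z)"
 using C1per_mult[OF C1per_const[of c], of f F] by simp

lemma C1per_sum: "(\<And>k. k \<in> I ==> C1per (f k) (F k)) ==> C1per (\<lambda>z. \<Sum>k\<in>I. f k z) (\<lambda>z. \<Sum>k\<in>I. F k z)"
 by (induction I rule: infinite_finite_induct) (auto intro: C1per_const C1per_add)

lemma C1per_compose:
 assumes g: "C1per g G" and d: "\<And>x. (b has_real_derivative b' x) (at x)" and c: "continuous_on UNIV b'"
 shows "C1per (\<lambda>z. b (g z)) (\<lambda>z. b' (g z) *\<^sub>R G z)"
 unfolding C1per_def
proof (intro conjI allI)
 show "per (\<lambda>z. b (g z))" using C1per_per[OF g] by (simp add: per_def)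
 show "((\<lambda>z. b (g z)) has_derivative (\<lambda>h. (b' (g z) *\<^sub>R G z) \<bullet> h)) (at z)" for z
  using has_derivative_compose[OF C1per_deriv[OF g] d[of "g z", unfolded has_field_derivative_def]] by simp
 show "continuous_on UNIV (\<lambda>z. b' (g z) *\<^sub>R G z)"
  using C1per_cont[OF g] C1per_contG[OF g] by (intro continuous_intros continuous_on_compose2[OF c]) auto
qed

text \<open>Integration by parts in the form of a difference quotient: only the Lipschitz constant of
 \<open>U\<close> enters.\<close>
lemma integral_lipschitz_gradient:
 assumes F: "C1per f F" and U: "per U" and lip: "\<And>x y. \<bar>U x - U y\<bar> <= L*norm (x - y)"
 shows "\<bar>TI x. U x*F x $ j\<bar> <= L*(TI x. \<bar>f x\<bar>)"
proof -
 have "0 <= L*norm (0 - axis 1 (1::real) :: real^2)" by (rule order_trans[OF abs_ge_zero lip])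
 hence L: "0 <= L" by simp
 have contU: "continuous_on UNIV U"
  using lip L by (intro lipschitz_on_continuous_on[of L] lipschitz_onI) (auto simp: dist_norm)
 obtain BU where BU: "\<And>x. norm (U x) <= BU" "BU > 0" using continuous_bounded_Q0[OF U contU] by metis
 obtain B where B: "\<And>x. \<bar>f x\<bar> <= B" "\<And>x. norm (F x) <= B" "B > 0" using C1per_bounded[OF F] by metis
 have [measurable]: "U \<in> bmeas" using contU by (rule borel_measurable_continuous_onI)
 note [measurable] = C1per_meas[OF F] C1per_measG[OF F]
 define h where "h n = inverse (real (Suc n))" for n
 define a :: "real^2" where "a = axis j 1"
 have na: "norm a = 1" by (simp add: a_def)
 have hp: "h n > 0" for n by (simp add: h_def)
 have h0: "h \<longlonglongrightarrow> 0" unfolding h_def by (rule LIMSEQ_inverse_real_of_nat)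
 have int_b: "tint k" if [measurable]: "k \<in> bmeas" and "\<And>x. \<bar>k x\<bar> <= C" for k :: "real^2 => real" and C
  by (rule torus.integrable_const_bound[where B=C]) (use that in auto)
 define D where "D n x = (f (h n *\<^sub>R a + x) - f x)/h n" for n x
 have [measurable]: "D n \<in> bmeas" for n unfolding D_def by measurable
 have Db: "\<bar>D n x\<bar> <= B" for n x
  using C1per_lipschitz[OF F B(2), of "h n *\<^sub>R a + x" x] hp[of n] na by (simp add: D_def field_simps)
 have lim: "(\<lambda>n. TI x. U x*D n x) \<longlonglongrightarrow> (TI x. U x*F x $ j)"
 proof (rule integral_dominated_convergence[where w="\<lambda>x. BU*B"])
  show "AE x in torus. (\<lambda>n. U x*D n x) \<longlonglongrightarrow> U x*F x $ j"
  proof (intro AE_I2 tendsto_intros)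
   fix x
   have "((\<lambda>t. f (t *\<^sub>R a + x)) has_derivative (\<lambda>t. F x \<bullet> (t *\<^sub>R a))) (at 0)"
    by (rule has_derivative_compose[of "\<lambda>t. t *\<^sub>R a + x" "\<lambda>t. t *\<^sub>R a" 0 UNIV f "\<lambda>h. F x \<bullet> h"])
     (auto intro!: derivative_eq_intros C1per_deriv[OF F])
   hence "((\<lambda>t. f (t *\<^sub>R a + x)) has_real_derivative F x $ j) (at 0)"
    unfolding has_field_derivative_def by (rule has_derivative_eq_rhs) (auto simp: a_def inner_axis)
   hence "(\<lambda>t. (f (t *\<^sub>R a + x) - f x)/t) \<midarrow>0\<rightarrow> F x $ j" by (simp add: DERIV_def)
   moreover have "filterlim h (at 0) sequentially"
    using h0 hp by (auto simp: filterlim_at intro!: always_eventually less_imp_neq[symmetric])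
   ultimately show "(\<lambda>n. D n x) \<longlonglongrightarrow> F x $ j"
    unfolding D_def by (rule filterlim_compose)
  qed
  show "AE x in torus. norm (U x*D n x) <= BU*B" for n
   using BU Db by (auto simp: abs_mult intro!: mult_mono)
 qed simp_all
 have "\<bar>TI x. U x*D n x\<bar> <= L*(TI x. \<bar>f x\<bar>)" for n
 proof -
  have i1: "tint (\<lambda>x. U x*f (h n *\<^sub>R a + x))" "tint (\<lambda>x. U x*f x)"
   "tint (\<lambda>x. U (x - h n *\<^sub>R a)*f x)"
   by (rule int_b[where C="BU*B"], use BU B in \<open>auto simp: abs_mult intro!: mult_mono\<close>)+
  have "(TI x. U x*f (h n *\<^sub>R a + x)) = (TI x. (\<lambda>y. U (y - h n *\<^sub>R a)*f y) (h n *\<^sub>R a + x))"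
   by simp
  also have "\<dots> = (TI x. U (x - h n *\<^sub>R a)*f x)"
  proof (rule integral_torus_shift)
   have "per (\<lambda>x. U (x - h n *\<^sub>R a))" by (rule per_shift(2)[OF U])
   thus "per (\<lambda>y. U (y - h n *\<^sub>R a)*f y)" using C1per_per[OF F] by (simp add: per_def)
  qed simp
  finally have eq: "(TI x. U x*f (h n *\<^sub>R a + x)) = (TI x. U (x - h n *\<^sub>R a)*f x)" .
  have "(TI x. U x*D n x) = (TI x. (U x*f (h n *\<^sub>R a + x) - U x*f x)/h n)"
   by (rule tcong) (auto simp: D_def field_simps)
  also have "\<dots> = ((TI x. U (x - h n *\<^sub>R a)*f x) - (TI x. U x*f x))/h n"
   using i1 by (simp add: eq)
  also have "\<dots> = (TI x. (U (x - h n *\<^sub>R a)*f x - U x*f x)/h n)"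
   using i1 by simp
  also have "\<bar>\<dots>\<bar> <= (TI x. L*\<bar>f x\<bar>)"
  proof (rule order_trans[OF integral_abs_bound], rule integral_mono)
   fix x
   have "\<bar>U (x - h n *\<^sub>R a) - U x\<bar> <= L*h n"
    using lip[of "x - h n *\<^sub>R a" x] hp[of n] na by simp
   hence "\<bar>U (x - h n *\<^sub>R a) - U x\<bar>*\<bar>f x\<bar> <= L*h n*\<bar>f x\<bar>" by (rule mult_right_mono) simp
   thus "\<bar>(U (x - h n *\<^sub>R a)*f x - U x*f x)/h n\<bar> <= L*\<bar>f x\<bar>"
    using hp[of n] by (simp add: abs_mult[symmetric] left_diff_distrib field_simps)
  qed (use i1 int_b[of "\<lambda>x. \<bar>f x\<bar>" B] B in auto)
  finally show ?thesis by simp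
 qed
 thus ?thesis
  using LIMSEQ_le_const2[OF tendsto_rabs[OF lim]] by blast
qed

lemma integral_gradient_zero:
 assumes "C1per f F" shows "(TI x. F x $ j) = 0"
 using integral_lipschitz_gradient[OF assms, of "\<lambda>x. 1" 0 j] by simp

section \<open>Fourier series on the torus\<close>

definition ph :: "int \<times> int => real^2 => real" where
 "ph k x = 2*pi*(of_int (fst k)*x$1 + of_int (snd k)*x$2)"

text \<open>Gradients of \<open>cos (ph k x)\<close> and \<open>sin (ph k x)\<close>. They are the
  only test gradients for which the noise is estimated probabilistically.\<close>

abbreviation "gc k \<equiv> \<lambda>x. (- sin (ph k x)) *\<^sub>R ((2*pi) *\<^sub>R ivec k)"
abbreviation "gs k \<equiv> \<lambda>x. cos (ph k x) *\<^sub>R ((2*pi) *\<^sub>R ivec k)"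

lemma ph_add: "ph k (x + y) = ph k x + ph k y" "ph (k + l) x = ph k x + ph l x"
 by (simp_all add: ph_def algebra_simps)

lemma ph_minus: "ph k (- x) = - ph k x" "ph (- k) x = - ph k x"
 by (simp_all add: ph_def algebra_simps)

lemma ph_zero [simp]: "ph 0 x = 0" by (simp add: ph_def)

lemma ph_inner: "ph k x = (2*pi) *\<^sub>R ivec k \<bullet> x"
 by (simp add: ph_def inner_real2 algebra_simps)

lemma ph_measurable [measurable]: "ph k \<in> bmeas"
 unfolding ph_def[abs_def] by measurable

lemma cis_measurable [measurable]: "cis \<in> bmeas"
 by (intro borel_measurable_continuous_onI continuous_intros)

lemma cis_2pi_int: "cis (2*pi * of_int m) = 1"
 by (simp add: complex_eq_iff)

lemma cis_ph_ivec: "cis (ph k (x + ivec l)) = cis (ph k x)"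
proof -
 have "ph k (ivec l) = 2*pi * of_int (fst k*fst l + snd k * snd l)"
  by (simp add: ph_def)
 thus ?thesis by (simp add: ph_add cis_2pi_int flip: cis_mult)
qed

lemma per_cis_ph: "per (\<lambda>x. cis (ph k x))"
 using cis_ph_ivec[of k _ "(1,0)"] cis_ph_ivec[of k _ "(0,1)"] by (simp add: per_def ivec_def)

lemma per_cos_ph: "per (\<lambda>x. cos (ph k x))" and per_sin_ph: "per (\<lambda>x. sin (ph k x))"
 using per_cis_ph[of k] by (auto simp: per_def complex_eq_iff)

lemma integrable_torus_bounded:
 fixes f :: "real^2 => 'b::{banach, second_countable_topology}"
 assumes [measurable]: "f \<in> bmeas" and "\<And>x. norm (f x) <= C"
 shows "tint f"
 by (rule torus.integrable_const_bound[where B=C]) (use assms in auto)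

text \<open>Translation by \<open>y\<close> multiplies the integral by \<open>cis (ph k y)\<close>.
  Half a period in a coordinate of non-zero frequency makes this factor -1.\<close>

lemma integral_cis_ph: "(TI x. cis (ph k x)) = (if k = 0 then 1 else 0)"
proof (cases "k = 0")
 case True thus ?thesis using torus.prob_space by simp
next
 case False
 obtain y where y: "cis (ph k y) \<noteq> 1"
 proof (cases "fst k = 0")
  case True
  with False have "snd k \<noteq> 0" by (simp add: prod_eq_iff)
  hence "ph k (axis 2 (1/(2 * of_int (snd k)))) = pi" by (simp add: ph_def axis_def True)
  thus ?thesis using that by (metis cis_pi one_neq_neg_one)
 next
  case False
  hence "ph k (axis 1 (1/(2 * of_int (fst k)))) = pi" by (simp add: ph_def axis_def)
  thus ?thesis using that by (metis cis_pi one_neq_neg_one)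
 qed
 have "(TI x. cis (ph k x)) = (TI x. cis (ph k (y + x)))"
  by (rule integral_torus_shift[symmetric]) (auto intro: per_cis_ph)
 also have "\<dots> = cis (ph k y)*(TI x. cis (ph k x))"
  by (simp add: ph_add flip: cis_mult)
 finally show ?thesis using y False by simp
qed

lemma fourier_eq:
 assumes [measurable]: "f \<in> bmeas"
 shows "fourier f k = (TI x. complex_of_real (f x)*cis (- ph k x))"
 unfolding fourier_def by (subst LINT_cell_eq) (auto simp: ph_def algebra_simps)

definition trig :: "(int \<times> int) set => (int \<times> int => complex) => real^2 => complex" where
 "trig F c x = (\<Sum>k\<in>F. c k*cis (ph k x))"

lemma trig_measurable [measurable]: "trig F c \<in> bmeas"
 unfolding trig_def[abs_def] by measurable

lemma trig_bounded: "norm (trig F c x) <= (\<Sum>k\<in>F. norm (c k))"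
 unfolding trig_def by (rule order_trans[OF norm_sum]) (simp add: norm_mult)

lemma integral_trig_sq:
 assumes F: "finite F"
 shows "(TI x. (norm (trig F c x))^2) = (\<Sum>k\<in>F. (norm (c k))^2)"
proof -
 have "complex_of_real (TI x. (norm (trig F c x))^2) = (TI x. complex_of_real ((norm (trig F c x))^2))"
  by (rule integral_complex_of_real[symmetric])
 also have "\<dots> = (TI x. (\<Sum>k\<in>F. \<Sum>l\<in>F. c k*cnj (c l)*cis (ph (k - l) x)))"
 proof (rule tcong[OF refl])
  fix x
  have "complex_of_real ((norm (trig F c x))^2) = trig F c x*cnj (trig F c x)"
   by (rule complex_norm_square)
  also have "\<dots> = (\<Sum>k\<in>F. \<Sum>l\<in>F. c k*cnj (c l)*cis (ph (k - l) x))"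
   unfolding trig_def cnj_sum sum_product
   by (intro sum.cong refl) (simp add: cis_cnj ph_add(2)[of _ "-_", simplified] ph_minus cis_mult mult_ac)
  finally show "complex_of_real ((norm (trig F c x))^2) = (\<Sum>k\<in>F. \<Sum>l\<in>F. c k*cnj (c l)*cis (ph (k - l) x))" .
 qed
 also have "\<dots> = (\<Sum>k\<in>F. \<Sum>l\<in>F. c k*cnj (c l)*(TI x. cis (ph (k - l) x)))"
 proof -
  have i: "tint (\<lambda>x. c k*cnj (c l)*cis (ph (k - l) x))" for k l
   by (rule integrable_torus_bounded[where C="norm (c k*cnj (c l))"]) (auto simp: norm_mult)
  thus ?thesis by (subst Bochner_Integration.integral_sum, simp, subst Bochner_Integration.integral_sum) auto
 qed
 also have "\<dots> = (\<Sum>k\<in>F. c k*cnj (c k))"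
  by (intro sum.cong refl) (simp add: integral_cis_ph F if_distrib sum.delta cong: if_cong)
 also have "\<dots> = complex_of_real (\<Sum>k\<in>F. (norm (c k))^2)"
  by (simp only: complex_norm_square of_real_sum)
 finally show ?thesis by (simp only: of_real_eq_iff)
qed

lemma integral_L2f_cis:
 assumes "L2f f"
 shows "tint (\<lambda>x. complex_of_real (f x)*cis (ph k x))"
proof -
 note [measurable] = L2f_meas[OF assms]
 show ?thesis
  by (rule Bochner_Integration.integrable_bound[OF L2f_integrable[OF assms]]) (auto simp: norm_mult)
qed

text \<open>Completing the square mode by mode. Bessel's inequality is the case
  \<open>c = fourier f\<close>; for other \<open>c\<close> the identity turns any good approximation
  into a lower bound for the captured mass, which is Parseval.\<close>

lemma trig_distance:
 assumes f: "L2f f" and F: "finite F"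
 shows "tint (\<lambda>x. (norm (complex_of_real (f x) - trig F c x))^2)"
  and "(TI x. (norm (complex_of_real (f x) - trig F c x))^2)
   = nsq f + (\<Sum>k\<in>F. (norm (c k - fourier f k))^2 - (norm (fourier f k))^2)"
proof -
 note [measurable] = L2f_meas[OF f]
 have cnj_m[measurable]: "cnj \<in> bmeas"
  by (intro borel_measurable_continuous_onI continuous_intros)
 have ft: "tint (\<lambda>x. complex_of_real (f x)*cnj (trig F c x))"
  by (rule Bochner_Integration.integrable_bound[OF integrable_mult_right[of "\<Sum>k\<in>F. norm (c k)", OF integrable_abs[OF L2f_integrable[OF f]]]])
   (auto simp: norm_mult mult.commute trig_bounded abs_mult intro!: AE_I2 mult_left_mono order_trans[OF trig_bounded abs_ge_self])
 have it: "tint (\<lambda>x. (norm (trig F c x))^2)"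
  by (rule integrable_torus_bounded[where C="(\<Sum>k\<in>F. norm (c k))^2"]) (auto intro!: power_mono trig_bounded)
 have eq: "(norm (complex_of_real (f x) - trig F c x))^2
   = (f x)^2 + ((norm (trig F c x))^2 - 2 * Re (complex_of_real (f x)*cnj (trig F c x)))" for x
  unfolding cmod_power2 by (simp add: power2_eq_square algebra_simps)
 have ftr: "tint (\<lambda>x. Re (complex_of_real (f x)*cnj (trig F c x)))"
  using ft by (rule integrable_Re)
 show "tint (\<lambda>x. (norm (complex_of_real (f x) - trig F c x))^2)"
  unfolding eq using L2f_sq[OF f] it ftr by (intro Bochner_Integration.integrable_add Bochner_Integration.integrable_diff integrable_mult_right)
 have "(TI x. complex_of_real (f x)*cnj (trig F c x)) = (TI x. (\<Sum>k\<in>F. cnj (c k)*(complex_of_real (f x)*cis (ph (-k) x))))"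
  by (rule tcong) (auto simp: trig_def sum_distrib_left cis_cnj ph_minus mult_ac)
 also have "\<dots> = (\<Sum>k\<in>F. cnj (c k)*(TI x. complex_of_real (f x)*cis (ph (-k) x)))"
  by (subst Bochner_Integration.integral_sum) (auto intro!: integral_L2f_cis[OF f])
 also have "\<dots> = (\<Sum>k\<in>F. cnj (c k)*fourier f k)" by (simp add: fourier_eq ph_minus)
 finally have ip: "(TI x. Re (complex_of_real (f x)*cnj (trig F c x))) = (\<Sum>k\<in>F. Re (cnj (c k)*fourier f k))"
  unfolding integral_Re[OF ft] by (simp only: Re_sum)
 have "(TI x. (norm (complex_of_real (f x) - trig F c x))^2)
   = nsq f + ((\<Sum>k\<in>F. (norm (c k))^2) - 2*(\<Sum>k\<in>F. Re (cnj (c k)*fourier f k)))"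
  unfolding eq nsq_def using L2f_sq[OF f] it ftr by (simp add: ip[simplified] integral_trig_sq[OF F])
 also have "(\<Sum>k\<in>F. (norm (c k))^2) - 2*(\<Sum>k\<in>F. Re (cnj (c k)*fourier f k))
   = (\<Sum>k\<in>F. (norm (c k - fourier f k))^2 - (norm (fourier f k))^2)"
  unfolding sum_distrib_left sum_subtractf[symmetric]
  unfolding cmod_power2 by (intro sum.cong refl) (simp add: power2_eq_square algebra_simps)
 finally show "(TI x. (norm (complex_of_real (f x) - trig F c x))^2)
   = nsq f + (\<Sum>k\<in>F. (norm (c k - fourier f k))^2 - (norm (fourier f k))^2)" .
qed

lemma bessel:
 assumes f: "L2f f" and F: "finite F"
 shows "(\<Sum>k\<in>F. (norm (fourier f k))^2) <= nsq f"
proof -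
 have "0 <= (TI x. (norm (complex_of_real (f x) - trig F (fourier f) x))^2)" by simp
 thus ?thesis using trig_distance(2)[OF f F, of "fourier f"] by (simp add: sum_negf)
qed

subsection \<open>Trigonometric polynomials are dense\<close>

definition trigs :: "(real^2 => complex) set" where
 "trigs = {trig F c | F c. finite F}"

lemma trigs_add: assumes "S \<in> trigs" "T \<in> trigs" shows "(\<lambda>x. S x + T x) \<in> trigs"
proof -
 obtain F c G d where S: "S = trig F c" "finite F" and T: "T = trig G d" "finite G"
  using assms by (auto simp: trigs_def)
 define b where "b k = (if k \<in> F then c k else 0) + (if k \<in> G then d k else 0)" for k
 have "(\<Sum>k\<in>F. c k*cis (ph k x)) = (\<Sum>k\<in>F \<union> G. (if k \<in> F then c k else 0)*cis (ph k x))"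
  "(\<Sum>k\<in>G. d k*cis (ph k x)) = (\<Sum>k\<in>F \<union> G. (if k \<in> G then d k else 0)*cis (ph k x))" for x
  using S T by (auto intro!: sum.mono_neutral_cong_left)
 hence "S x + T x = trig (F \<union> G) b x" for x
  by (simp add: S T trig_def b_def distrib_right sum.distrib)
 thus ?thesis unfolding trigs_def using S T by (auto intro!: exI[of _ "F \<union> G"] exI[of _ b])
qed

lemma trigs_zero: "(\<lambda>x. 0) \<in> trigs"
 by (auto simp: trigs_def trig_def[abs_def] intro!: exI[of _ "{}"])

lemma trigs_single: "(\<lambda>x. c*cis (ph k x)) \<in> trigs"
 by (auto simp: trigs_def trig_def[abs_def] intro!: exI[of _ "{k}"] exI[of _ "\<lambda>_. c"])

lemma trigs_const: "(\<lambda>x. c) \<in> trigs"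
 using trigs_single[of c 0] by simp

lemma trigs_mult_single: assumes "S \<in> trigs" shows "(\<lambda>x. c*cis (ph l x)*S x) \<in> trigs"
proof -
 obtain F b where S: "S = trig F b" "finite F" using assms by (auto simp: trigs_def)
 have "c*cis (ph l x)*S x = trig ((+) l ` F) (\<lambda>k. c*b (k - l)) x" for x
  by (simp add: S trig_def sum_distrib_left sum.reindex ph_add flip: cis_mult) (simp add: mult_ac)
 thus ?thesis unfolding trigs_def using S by (auto intro!: exI[of _ "(+) l ` F"] exI[of _ "\<lambda>k. c*b (k - l)"])
qed

lemma trigs_sum: "(\<And>k. k \<in> F ==> S k \<in> trigs) ==> (\<lambda>x. \<Sum>k\<in>F. S k x) \<in> trigs"
 by (induction F rule: infinite_finite_induct) (auto intro: trigs_zero trigs_add)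

lemma trigs_mult: assumes "S \<in> trigs" "T \<in> trigs" shows "(\<lambda>x. S x*T x) \<in> trigs"
proof -
 obtain F b where S: "S = trig F b" "finite F" using assms by (auto simp: trigs_def)
 have "(\<lambda>x. \<Sum>k\<in>F. b k*cis (ph k x)*T x) \<in> trigs"
  by (intro trigs_sum trigs_mult_single assms)
 thus ?thesis by (simp add: S trig_def[abs_def] sum_distrib_right)
qed

lemma trigs_measurable: "T \<in> trigs ==> T \<in> bmeas"
 by (auto simp: trigs_def)

lemma trigs_bounded: assumes "T \<in> trigs" obtains B where "\<And>x. norm (T x) <= B"
 using assms trig_bounded unfolding trigs_def by blast

text \<open>Embeds the torus in the product of two circles. Stone--Weierstrass applies on that
  compact set, and polynomials in \<open>Phi x\<close> are trigonometric polynomials.\<close>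

definition Phi :: "real^2 => complex \<times> complex" where
 "Phi x = (cis (2*pi*x$1), cis (2*pi*x$2))"

lemma trigs_polynomial:
 assumes "real_polynomial_function p"
 shows "(\<lambda>x. complex_of_real (p (Phi x))) \<in> trigs"
 using assms
proof (induction rule: real_polynomial_function.induct)
 case (linear h)
 interpret bounded_linear h by fact
 have ph1: "ph (1,0) x = 2*pi*x$1" "ph (0,1) x = 2*pi*x$2"
  "ph (-1,0) x = - (2*pi*x$1)" "ph (0,-1) x = - (2*pi*x$2)" for x by (simp_all add: ph_def)
 have "h (Phi x) = cos (2*pi*x$1)*h (1,0) + sin (2*pi*x$1)*h (\<i>,0) + cos (2*pi*x$2)*h (0,1) + sin (2*pi*x$2)*h (0,\<i>)" for x
 proof -
  have "Phi x = cos (2*pi*x$1) *\<^sub>R (1,0) + sin (2*pi*x$1) *\<^sub>R (\<i>,0) + cos (2*pi*x$2) *\<^sub>R (0,1) + sin (2*pi*x$2) *\<^sub>R (0,\<i>)"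
   by (auto simp: Phi_def complex_eq_iff)
  hence "h (Phi x) = h (cos (2*pi*x$1) *\<^sub>R (1,0) + sin (2*pi*x$1) *\<^sub>R (\<i>,0) + cos (2*pi*x$2) *\<^sub>R (0,1) + sin (2*pi*x$2) *\<^sub>R (0,\<i>))" by (simp only:)
  thus ?thesis unfolding add scaleR by simp
 qed
 hence "complex_of_real (h (Phi x)) =
   ((of_real (h (1,0)) - \<i> * of_real (h (\<i>,0)))/2)*cis (ph (1,0) x) + ((of_real (h (1,0)) + \<i> * of_real (h (\<i>,0)))/2)*cis (ph (-1,0) x)
  + (((of_real (h (0,1)) - \<i> * of_real (h (0,\<i>)))/2)*cis (ph (0,1) x) + ((of_real (h (0,1)) + \<i> * of_real (h (0,\<i>)))/2)*cis (ph (0,-1) x))" for x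
  by (simp add: ph1 complex_eq_iff) (simp add: field_simps)
 thus ?case by (simp only:) (intro trigs_add trigs_single)
next
 case (const c) thus ?case by (simp add: trigs_const)
next
 case (add f g) thus ?case by (simp add: trigs_add)
next
 case (mult f g) thus ?case by (simp add: trigs_mult)
qed

text \<open>Periodicity is left out on purpose: the density argument passes through indicators of
  arbitrary Borel sets, compared on one cell only.\<close>

definition tdense :: "(real^2 => real) => bool" where
 "tdense f \<longleftrightarrow> f \<in> bmeas \<and> tint (\<lambda>x. (f x)^2) \<and>
  (\<forall>e>0. \<exists>T\<in>trigs. (TI x. (norm (complex_of_real (f x) - T x))^2) < e)"

lemma norm_sq_triangle: "(norm (a + b))^2 <= 2*(norm a)^2 + 2*(norm (b::'a::real_normed_vector))^2"
proof -
 have "(norm (a + b))^2 <= (norm a + norm b)^2" by (intro power_mono norm_triangle_ineq) auto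
 also have "\<dots> <= 2*(norm a)^2 + 2*(norm b)^2"
  using sum_squares_bound[of "norm a" "norm b"] by (simp add: power2_sum)
 finally show ?thesis .
qed

lemma integrable_norm_sq_diff:
 fixes f :: "real^2 => real"
 assumes [measurable]: "f \<in> bmeas" and f: "tint (\<lambda>x. (f x)^2)" and T: "T \<in> trigs"
 shows "tint (\<lambda>x. (norm (complex_of_real (f x) - T x))^2)"
proof -
 note [measurable] = trigs_measurable[OF T]
 obtain B where B: "\<And>x. norm (T x) <= B" using trigs_bounded[OF T] by blast
 have "tint (\<lambda>x. 2*(f x)^2 + 2*B^2)" using f by auto
 thus ?thesis
 proof (rule Bochner_Integration.integrable_bound)
  have "(norm (complex_of_real (f x) - T x))^2 <= 2*(f x)^2 + 2*B^2" for x
   using norm_sq_triangle[of "complex_of_real (f x)" "- T x"] power_mono[OF B[of x], of 2] by simp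
  thus "AE x in torus. norm ((norm (complex_of_real (f x) - T x))^2) <= norm (2*(f x)^2 + 2*B^2)" by simp
 qed simp
qed

lemma tdense_close:
 assumes [measurable]: "f \<in> bmeas" and f: "tint (\<lambda>x. (f x)^2)"
  and cl: "\<And>e. e > 0 ==> \<exists>g. tdense g \<and> (TI x. (f x - g x)^2) < e"
 shows "tdense f"
 unfolding tdense_def
proof (intro conjI allI impI)
 fix e :: real assume e: "e > 0"
 then obtain g where g: "tdense g" "(TI x. (f x - g x)^2) < e/4" using cl[of "e/4"] by auto
 hence [measurable]: "g \<in> bmeas" and gi: "tint (\<lambda>x. (g x)^2)" by (auto simp: tdense_def)
 obtain T where T: "T \<in> trigs" "(TI x. (norm (complex_of_real (g x) - T x))^2) < e/4"
  using g e unfolding tdense_def by (meson divide_pos_pos zero_less_numeral)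
 note [measurable] = trigs_measurable[OF T(1)]
 have fg: "tint (\<lambda>x. (f x - g x)^2)"
 proof (rule Bochner_Integration.integrable_bound[of _ "\<lambda>x. 2*(f x)^2 + 2*(g x)^2"])
  show "AE x in torus. norm ((f x - g x)^2) <= norm (2*(f x)^2 + 2*(g x)^2)"
   using norm_sq_triangle[of "f _" "- g _"] by simp
 qed (use f gi in auto)
 have "(TI x. (norm (complex_of_real (f x) - T x))^2) <= (TI x. 2*(f x - g x)^2 + 2*(norm (complex_of_real (g x) - T x))^2)"
 proof (rule integral_mono)
  fix x show "(norm (complex_of_real (f x) - T x))^2 <= 2*(f x - g x)^2 + 2*(norm (complex_of_real (g x) - T x))^2"
   using norm_sq_triangle[of "complex_of_real (f x - g x)" "complex_of_real (g x) - T x"] 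
   by (simp add: norm_of_real del: of_real_diff) simp
 qed (use fg integrable_norm_sq_diff[OF _ f T(1)] integrable_norm_sq_diff[OF _ gi T(1)] in auto)
 also have "\<dots> = 2*(TI x. (f x - g x)^2) + 2*(TI x. (norm (complex_of_real (g x) - T x))^2)"
  using fg integrable_norm_sq_diff[OF _ gi T(1)] by simp
 also have "\<dots> < e" using T(2) g(2) by simp
 finally show "\<exists>T\<in>trigs. (TI x. (norm (complex_of_real (f x) - T x))^2) < e" using T(1) by auto
qed (use f in auto)

lemma tdense_add: assumes "tdense f" "tdense g" shows "tdense (\<lambda>x. a*f x + b*g x)"
proof -
 have [measurable]: "f \<in> bmeas" "g \<in> bmeas"
  and fi: "tint (\<lambda>x. (f x)^2)" and gi: "tint (\<lambda>x. (g x)^2)" using assms by (auto simp: tdense_def)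
 have sq: "(a*p + b*q)^2 <= 2*(a^2*p^2) + 2*(b^2*q^2)" for p q :: real
  using norm_sq_triangle[of "a*p" "b*q"] by (simp add: power_mult_distrib)
 have i: "tint (\<lambda>x. (a*f x + b*g x)^2)"
  by (rule Bochner_Integration.integrable_bound[of _ "\<lambda>x. 2*(a^2*(f x)^2) + 2*(b^2*(g x)^2)"])
   (use fi gi sq in auto)
 show ?thesis unfolding tdense_def
 proof (intro conjI allI impI)
  fix e :: real assume e: "e > 0"
  define d where "d = e/(4*(a^2 + b^2 + 1))"
  have ab: "a^2 + b^2 + 1 > 0" by (smt (verit) zero_le_power2)
  have d: "d > 0" using e ab by (simp add: d_def)
  obtain S where S: "S \<in> trigs" "(TI x. (norm (complex_of_real (f x) - S x))^2) < d"
   using assms(1) d unfolding tdense_def by blast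
  obtain T where T: "T \<in> trigs" "(TI x. (norm (complex_of_real (g x) - T x))^2) < d"
   using assms(2) d unfolding tdense_def by blast
  define R where "R x = of_real a*S x + of_real b*T x" for x
  have R: "R \<in> trigs" unfolding R_def[abs_def] by (intro trigs_add trigs_mult S T trigs_const)
  note int3 = integrable_norm_sq_diff[OF _ fi S(1)] integrable_norm_sq_diff[OF _ gi T(1)] integrable_norm_sq_diff[OF _ i R]
  have "(TI x. (norm (complex_of_real (a*f x + b*g x) - R x))^2)
    <= (TI x. 2*a^2*(norm (complex_of_real (f x) - S x))^2 + 2*b^2*(norm (complex_of_real (g x) - T x))^2)"
  proof (rule integral_mono)
   fix x
   have "complex_of_real (a*f x + b*g x) - R x = of_real a*(of_real (f x) - S x) + of_real b*(of_real (g x) - T x)"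
    by (simp add: R_def algebra_simps)
   thus "(norm (complex_of_real (a*f x + b*g x) - R x))^2 <= 2*a^2*(norm (complex_of_real (f x) - S x))^2 + 2*b^2*(norm (complex_of_real (g x) - T x))^2"
    using norm_sq_triangle[of "of_real a*(of_real (f x) - S x)" "of_real b*(of_real (g x) - T x)"]
    by (simp add: norm_mult power_mult_distrib mult.assoc)
  qed (use int3 in auto)
  also have "\<dots> = 2*a^2*(TI x. (norm (complex_of_real (f x) - S x))^2) + 2*b^2*(TI x. (norm (complex_of_real (g x) - T x))^2)"
   using int3 by simp
  also have "\<dots> <= 2*a^2*d + 2*b^2*d"
   using S(2) T(2) by (intro add_mono mult_left_mono) auto
  also have "\<dots> = 2*d*(a^2 + b^2)" by (simp add: algebra_simps)
  also have "\<dots> < 4*d*(a^2 + b^2 + 1)"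
  proof -
   have "0 <= d*(a^2 + b^2)" using d by simp
   thus ?thesis using d unfolding distrib_left by linarith
  qed
  also have "\<dots> = e" using ab unfolding d_def by (simp add: field_simps del: distrib_left_numeral)
  finally show "\<exists>T\<in>trigs. (TI x. (norm (complex_of_real (a*f x + b*g x) - T x))^2) < e" using R by auto
 qed (use i in auto)
qed

lemma tdense_sum: "(\<And>k. k \<in> I ==> tdense (f k)) ==> tdense (\<lambda>x. \<Sum>k\<in>I. a k*f k x)"
proof (induction I rule: infinite_finite_induct)
 case (insert i I)
 thus ?case using tdense_add[of "f i" "\<lambda>x. \<Sum>k\<in>I. a k*f k x" "a i" 1] by simp
qed (auto simp: tdense_def intro!: bexI[OF _ trigs_zero])

lemma Phi_continuous: "continuous_on UNIV Phi"
 unfolding Phi_def[abs_def] by (intro continuous_intros)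

lemma tdense_Phi:
 assumes p: "continuous_on UNIV p"
 shows "tdense (\<lambda>x. p (Phi x))"
proof -
 have c: "continuous_on UNIV (\<lambda>x. p (Phi x))"
  by (rule continuous_on_compose2[OF p Phi_continuous]) auto
 hence [measurable]: "(\<lambda>x. p (Phi x)) \<in> bmeas" by (rule borel_measurable_continuous_onI)
 define S :: "(complex \<times> complex) set" where "S = sphere 0 1 \<times> sphere 0 1"
 have S: "compact S" unfolding S_def by (intro compact_Times compact_sphere)
 have PS: "Phi x \<in> S" for x by (simp add: S_def Phi_def)
 have "per (\<lambda>x. p (Phi x))" by (simp add: per_def Phi_def axis_def distrib_left flip: cis_mult)
 then obtain B where B: "\<And>x. norm (p (Phi x)) <= B" using continuous_bounded_Q0 c by blast
 have i: "tint (\<lambda>x. (p (Phi x))^2)"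
  by (rule integrable_torus_bounded[where C="B^2"]) (use B in \<open>auto simp: abs_le_square_iff[symmetric] intro: order_trans abs_ge_self\<close>)
 show ?thesis unfolding tdense_def
 proof (intro conjI allI impI)
  fix e :: real assume e: "e > 0"
  define d where "d = sqrt (e/2)"
  have d: "d > 0" "d^2 < e" using e by (auto simp: d_def)
  obtain g where g: "real_polynomial_function g" "\<And>x. x \<in> S ==> \<bar>p x - g x\<bar> < d"
   using Stone_Weierstrass_real_polynomial_function[OF S continuous_on_subset[OF p] d(1)] by auto
  note T = trigs_polynomial[OF g(1)]
  have "(TI x. (norm (complex_of_real (p (Phi x)) - complex_of_real (g (Phi x))))^2) <= (TI x. d^2)"
  proof (rule integral_mono)
   show "tint (\<lambda>x. (norm (complex_of_real (p (Phi x)) - complex_of_real (g (Phi x))))^2)"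
    by (rule integrable_norm_sq_diff[OF _ i T]) simp
   fix x
   have "norm (complex_of_real (p (Phi x)) - complex_of_real (g (Phi x))) <= d"
    using g(2)[OF PS[of x]] by (simp add: norm_of_real flip: of_real_diff)
   thus "(norm (complex_of_real (p (Phi x)) - complex_of_real (g (Phi x))))^2 <= d^2" by (rule power_mono) simp
  qed simp
  also have "\<dots> = d^2" using torus.prob_space by simp
  also have "\<dots> < e" by (rule d)
  finally show "\<exists>T\<in>trigs. (TI x. (norm (complex_of_real (p (Phi x)) - T x))^2) < e" using T by (rule bexI)
 qed (use i in auto)
qed

lemma tdense_zero: "tdense (\<lambda>x. 0)"
 by (auto simp: tdense_def intro!: bexI[OF _ trigs_zero])

lemma cis_inj_unit:
 assumes "cis (2*pi*a) = cis (2*pi*b)" "0 <= a" "a < 1" "0 <= b" "b < 1"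
 shows "a = b"
proof -
 have "cos (2*pi*a) = cos (2*pi*b)" "sin (2*pi*a) = sin (2*pi*b)"
  using assms(1) by (auto simp: complex_eq_iff)
 then obtain n :: int where "2*pi*a = 2*pi*b + 2*pi * of_int n"
  using sin_cos_eq_iff[of "2*pi*a" "2*pi*b"] by auto
 hence "2*pi*a = 2*pi*(b + of_int n)" by (simp only: distrib_left)
 hence "a = b + of_int n" by simp
 moreover from this have "n = 0" using assms by linarith
 ultimately show ?thesis by simp
qed

lemma Phi_inj: "inj_on Phi Q0"
 by (rule inj_onI) (auto simp: Phi_def Q0_def vec_eq_iff forall_2_iff intro: cis_inj_unit)

lemma AE_torus_Q0: "AE x in torus. x \<in> Q0"
 using AE_cell_Q0 by (auto simp: AE_torus_iff)

lemma tdense_compact: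
 assumes K: "compact K" "K \<subseteq> Q0"
 shows "tdense (indicator K)"
proof (cases "K = {}")
 case True thus ?thesis using tdense_zero by (simp add: indicator_def[abs_def])
next
 case False
 have [measurable]: "K \<in> sets borel" using K(1) by (simp add: borel_compact)
 define C where "C = Phi ` K"
 have C: "compact C" "C \<noteq> {}"
  unfolding C_def using K False by (auto intro!: compact_continuous_image continuous_on_subset[OF Phi_continuous])
 define p where "p n w = max 0 (1 - real n*infdist w C)" for n w
 have pc: "continuous_on UNIV (p n)" for n
  unfolding p_def[abs_def] by (intro continuous_intros continuous_on_infdist continuous_on_id)
 have [measurable]: "(\<lambda>x. p n (Phi x)) \<in> bmeas" for n
  by (intro borel_measurable_continuous_onI continuous_on_compose2[OF pc Phi_continuous]) auto
 have pb: "0 <= p n w" "p n w <= 1" for n w by (auto simp: p_def infdist_nonneg)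
 have "(\<lambda>n. TI x. (indicator K x - p n (Phi x))^2) \<longlonglongrightarrow> (TI x. 0)"
 proof (rule integral_dominated_convergence[where w="\<lambda>_. 1"])
  show "AE x in torus. (\<lambda>n. (indicator K x - p n (Phi x))^2) \<longlonglongrightarrow> 0"
   using AE_torus_Q0
  proof eventually_elim
   fix x assume x: "x \<in> Q0"
   show "(\<lambda>n. (indicator K x - p n (Phi x))^2) \<longlonglongrightarrow> 0"
   proof (cases "x \<in> K")
    case True
    hence "p n (Phi x) = 1" for n by (simp add: p_def C_def)
    thus ?thesis using True by simp
   next
    case False
    hence "Phi x \<notin> C" using x K(2) Phi_inj by (auto simp: C_def inj_on_def subset_iff)
    hence d: "infdist (Phi x) C > 0"
     using C by (metis compact_imp_closed in_closed_iff_infdist_zero infdist_nonneg less_le)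
    obtain N where N: "1/infdist (Phi x) C < real N" using reals_Archimedean2 by blast
    have "p n (Phi x) = 0" if "n >= N" for n
    proof -
     have "1/infdist (Phi x) C <= real n" using N that by linarith
     hence "1 <= real n*infdist (Phi x) C" using d by (simp add: field_simps)
     thus ?thesis by (simp add: p_def)
    qed
    hence "eventually (\<lambda>n. (indicator K x - p n (Phi x))^2 = 0) sequentially"
     using False by (auto simp: eventually_sequentially)
    thus ?thesis by (rule tendsto_eventually)
   qed
  qed
  show "AE x in torus. norm ((indicator K x - p n (Phi x))^2) <= 1" for n
  proof (rule AE_I2)
   fix x
   have "\<bar>indicator K x - p n (Phi x)\<bar> <= 1" using pb[of n "Phi x"] by (auto simp: indicator_def)
   thus "norm ((indicator K x - p n (Phi x))^2) <= 1" by (simp add: abs_square_le_1)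
  qed
 qed auto
 hence lim: "(\<lambda>n. TI x. (indicator K x - p n (Phi x))^2) \<longlonglongrightarrow> 0" by simp
 show ?thesis
 proof (rule tdense_close)
  show "tint (\<lambda>x. (indicat_real K x)^2)"
   by (rule integrable_torus_bounded[where C=1]) (auto simp: indicator_def)
  fix e :: real assume "e > 0"
  then obtain n where "(TI x. (indicator K x - p n (Phi x))^2) < e"
   using order_tendstoD(2)[OF lim, of e] by (auto simp: eventually_sequentially)
  thus "\<exists>g. tdense g \<and> (TI x. (indicator K x - g x)^2) < e" using tdense_Phi[OF pc[of n]] by blast
 qed simp
qed

text \<open>Inner regularity of the finite Borel measure \<open>torus\<close>; intersecting with
  \<open>Q0\<close> first changes the set by a null set and makes \<open>tdense_compact\<close>
  applicable.\<close>

lemma tdense_borel: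
 assumes [measurable]: "A \<in> sets borel"
 shows "tdense (indicator A)"
proof (rule tdense_close)
 show "tint (\<lambda>x. (indicat_real A x)^2)"
  by (rule integrable_torus_bounded[where C=1]) (auto simp: indicator_def)
 fix e :: real assume e: "e > 0"
 have "\<exists>K. K \<subseteq> A \<inter> Q0 \<and> compact K \<and> measure torus (A \<inter> Q0) - e < measure torus K"
 proof (rule ccontr)
  assume "\<not> ?thesis"
  hence le: "measure torus K <= measure torus (A \<inter> Q0) - e" if "K \<subseteq> A \<inter> Q0" "compact K" for K using that by force
  have 0: "0 <= measure torus (A \<inter> Q0) - e" using le[of "{}"] by simp
  have "emeasure torus (A \<inter> Q0) = (SUP K\<in>{K. K \<subseteq> A \<inter> Q0 \<and> compact K}. emeasure torus K)"
   by (rule inner_regular) (auto simp: torus.emeasure_eq_measure)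
  also have "\<dots> <= ennreal (measure torus (A \<inter> Q0) - e)"
   by (rule SUP_least) (use le in \<open>auto simp: torus.emeasure_eq_measure intro!: ennreal_leI\<close>)
  finally show False using e 0 by (simp add: torus.emeasure_eq_measure ennreal_le_iff)
 qed
 then obtain K where K: "K \<subseteq> A \<inter> Q0" "compact K" "measure torus (A \<inter> Q0) - e < measure torus K" by blast
 have [measurable]: "K \<in> sets borel" using K(2) by (simp add: borel_compact)
 have "(TI x. (indicat_real A x - indicat_real K x)^2) = (TI x. indicat_real (A \<inter> Q0 - K) x)"
 proof (rule integral_cong_AE)
  show "AE x in torus. (indicat_real A x - indicat_real K x)^2 = indicat_real (A \<inter> Q0 - K) x"
   using AE_torus_Q0 by eventually_elim (use K(1) in \<open>auto simp: indicator_def\<close>)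
 qed auto
 also have "\<dots> = measure torus (A \<inter> Q0 - K)" by simp
 also have "\<dots> = measure torus (A \<inter> Q0) - measure torus K" using K(1) by (intro torus.finite_measure_Diff) auto
 finally show "\<exists>g. tdense g \<and> (TI x. (indicator A x - g x)^2) < e"
  using K tdense_compact[of K] by (intro exI[of _ "indicator K"]) auto
qed simp

lemma tdense_L2:
 assumes [measurable]: "f \<in> bmeas" and f: "tint (\<lambda>x. (f x)^2)"
 shows "tdense f"
proof -
 obtain S where S: "\<And>i. simple_function torus (S i)" "\<And>x. (\<lambda>i. S i x) \<longlonglongrightarrow> f x" "\<And>i x. dist (S i x) 0 <= 2*dist (f x) 0"
  using borel_measurable_implies_sequence_metric[of f torus 0] by auto
 have [measurable]: "S i \<in> bmeas" for i
  using borel_measurable_simple_function[OF S(1)] measurable_cong_sets[OF sets_torus refl] by blast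
 have Sd: "tdense (S i)" for i
 proof -
  have fin: "finite (S i ` UNIV)" using S(1)[of i] by (simp add: simple_function_def)
  have eq: "S i x = (\<Sum>y\<in>S i ` UNIV. y*indicator (S i -` {y}) x)" for x
  proof -
   have "(\<Sum>y\<in>S i ` UNIV. y*indicator (S i -` {y}) x) = (\<Sum>y\<in>S i ` UNIV. if y = S i x then y else 0)"
    by (rule sum.cong) (auto simp: indicator_def)
   also have "\<dots> = S i x" using fin by (subst sum.delta) auto
   finally show ?thesis by simp
  qed
  have "tdense (\<lambda>x. \<Sum>y\<in>S i ` UNIV. y*indicator (S i -` {y}) x)"
  proof (rule tdense_sum, rule tdense_borel)
   fix y show "S i -` {y} \<in> sets borel"
    by (rule measurable_sets_borel[of "S i" borel "{y}"]) auto
  qed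
  thus ?thesis unfolding eq[symmetric] .
 qed
 \<comment> \<open>The simple functions satisfy
   \<open>\<bar>S i x\<bar> <= 2*\<bar>f x\<bar>\<close>, so the error is at most
   \<open>3*\<bar>f x\<bar>\<close>, whose square is the dominating function.\<close>
 have "(\<lambda>i. TI x. (f x - S i x)^2) \<longlonglongrightarrow> (TI x. 0)"
 proof (rule integral_dominated_convergence[where w="\<lambda>x. 9*(f x)^2"])
  show "AE x in torus. (\<lambda>i. (f x - S i x)^2) \<longlonglongrightarrow> 0"
  proof (rule AE_I2)
   fix x
   have "(\<lambda>i. (f x - S i x)^2) \<longlonglongrightarrow> (f x - f x)^2" by (intro tendsto_intros S)
   thus "(\<lambda>i. (f x - S i x)^2) \<longlonglongrightarrow> 0" by simp
  qed
  show "AE x in torus. norm ((f x - S i x)^2) <= 9*(f x)^2" for i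
  proof (rule AE_I2)
   fix x
   have "\<bar>f x - S i x\<bar> <= 3*\<bar>f x\<bar>" using S(3)[of i x] by simp
   hence "\<bar>f x - S i x\<bar>^2 <= (3*\<bar>f x\<bar>)^2" by (rule power_mono) simp
   thus "norm ((f x - S i x)^2) <= 9*(f x)^2" by (simp add: power_mult_distrib)
  qed
 qed (use f in auto)
 hence lim: "(\<lambda>i. TI x. (f x - S i x)^2) \<longlonglongrightarrow> 0" by simp
 show ?thesis
 proof (rule tdense_close[OF _ f])
  fix e :: real assume "e > 0"
  then obtain n where "(TI x. (f x - S n x)^2) < e"
   using order_tendstoD(2)[OF lim, of e] by (auto simp: eventually_sequentially)
  thus "\<exists>g. tdense g \<and> (TI x. (f x - g x)^2) < e" using Sd[of n] by blast
 qed simp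
qed

subsection \<open>Parseval's identity\<close>

definition Bx :: "nat => (int \<times> int) set" where
 "Bx n = {- int n..int n} \<times> {- int n..int n}"

lemma finite_Bx [simp]: "finite (Bx n)" by (simp add: Bx_def)

lemma Bx_mono: "m <= n ==> Bx m \<subseteq> Bx n" by (auto simp: Bx_def)

lemma finite_subset_Bx: assumes "finite F" obtains n where "F \<subseteq> Bx n"
proof -
 have "\<exists>n. F \<subseteq> Bx n" using assms
 proof induction
  case (insert k F)
  then obtain n where n: "F \<subseteq> Bx n" by auto
  define m where "m = max n (max (nat \<bar>fst k\<bar>) (nat \<bar>snd k\<bar>))"
  have "nat \<bar>fst k\<bar> <= m" "nat \<bar>snd k\<bar> <= m" unfolding m_def by linarith+
  hence "k \<in> Bx m" by (cases k) (auto simp: Bx_def)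
  moreover have "F \<subseteq> Bx m" using n Bx_mono[of n m] by (auto simp: m_def)
  ultimately show ?case by auto
 qed auto
 thus ?thesis using that by blast
qed

text \<open>If some trigonometric polynomial approximates \<open>f\<close> with squared error below
  \<open>e\<close>, then by \<open>trig_distance\<close> its frequencies already carry all but
  \<open>e\<close> of the norm; enlarging the frequency set can only improve this.\<close>

lemma parseval:
 assumes f: "L2f f"
 shows "(\<lambda>n. \<Sum>k\<in>Bx n. (norm (fourier f k))^2) \<longlonglongrightarrow> nsq f"
proof (rule LIMSEQ_I)
 fix e :: real assume e: "e > 0"
 have "tdense f" using f by (intro tdense_L2) (auto simp: L2f_def)
 then obtain T where "T \<in> trigs" and T: "(TI x. (norm (complex_of_real (f x) - T x))^2) < e"
  using e by (auto simp: tdense_def)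
 then obtain F c where F: "finite F" "T = trig F c" by (auto simp: trigs_def)
 have "nsq f + (\<Sum>k\<in>F. (norm (c k - fourier f k))^2 - (norm (fourier f k))^2) < e"
  using T trig_distance(2)[OF f F(1), of c] by (simp add: F)
 moreover have "(\<Sum>k\<in>F. (norm (c k - fourier f k))^2 - (norm (fourier f k))^2) >= - (\<Sum>k\<in>F. (norm (fourier f k))^2)"
  by (simp add: sum_subtractf sum_nonneg)
 ultimately have lt: "nsq f - e < (\<Sum>k\<in>F. (norm (fourier f k))^2)" by linarith
 obtain N where N: "F \<subseteq> Bx N" using finite_subset_Bx[OF F(1)] .
 show "\<exists>N. \<forall>n\<ge>N. norm ((\<Sum>k\<in>Bx n. (norm (fourier f k))^2) - nsq f) < e"
 proof (intro exI allI impI)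
  fix n assume "n >= N"
  hence "F \<subseteq> Bx n" using N Bx_mono by blast
  hence "(\<Sum>k\<in>F. (norm (fourier f k))^2) <= (\<Sum>k\<in>Bx n. (norm (fourier f k))^2)"
   by (intro sum_mono2) auto
  thus "norm ((\<Sum>k\<in>Bx n. (norm (fourier f k))^2) - nsq f) < e"
   using lt bessel[OF f finite_Bx[of n]] by auto
 qed
qed

text \<open>The real part of the partial Fourier sum. Taking it for real \<open>f\<close> cannot
  increase the distance to \<open>f\<close>, which avoids showing that the complex sum is
  real.\<close>

definition Pfour :: "nat => (real^2 => real) => real^2 => real" where
 "Pfour n f x = (\<Sum>k\<in>Bx n. Re (fourier f k)*cos (ph k x) - Im (fourier f k) * sin (ph k x))"

lemma Pfour_eq_trig: "Pfour n f x = Re (trig (Bx n) (fourier f) x)"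
 by (simp add: Pfour_def trig_def)

lemma C1per_cos_ph: "C1per (\<lambda>x. cos (ph k x)) (gc k)"
 and C1per_sin_ph: "C1per (\<lambda>x. sin (ph k x)) (gs k)"
proof -
 have d: "(ph k has_derivative (\<lambda>h. ((2*pi) *\<^sub>R ivec k) \<bullet> h)) (at x)" for x
  unfolding ph_inner[abs_def] by (auto intro!: derivative_eq_intros)
 have c: "continuous_on UNIV (ph k)" unfolding ph_inner[abs_def] by (intro continuous_intros)
 show "C1per (\<lambda>x. cos (ph k x)) (gc k)"
  unfolding C1per_def
 proof (intro conjI allI per_cos_ph)
  show "((\<lambda>x. cos (ph k x)) has_derivative (\<lambda>h. ((- sin (ph k x)) *\<^sub>R ((2*pi) *\<^sub>R ivec k)) \<bullet> h)) (at x)" for x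
   by (rule has_derivative_eq_rhs[OF has_derivative_cos[OF d]]) auto
 qed (intro continuous_intros c)
 show "C1per (\<lambda>x. sin (ph k x)) (gs k)"
  unfolding C1per_def
 proof (intro conjI allI per_sin_ph)
  show "((\<lambda>x. sin (ph k x)) has_derivative (\<lambda>h. (cos (ph k x) *\<^sub>R ((2*pi) *\<^sub>R ivec k)) \<bullet> h)) (at x)" for x
   by (rule has_derivative_eq_rhs[OF has_derivative_sin[OF d]]) auto
 qed (intro continuous_intros c)
qed

lemma L2f_cos_ph: "L2f (\<lambda>x. cos (ph k x))" and L2f_sin_ph: "L2f (\<lambda>x. sin (ph k x))"
 by (rule C1per_L2f(1)[OF C1per_cos_ph] C1per_L2f(1)[OF C1per_sin_ph])+

lemma L2f_Pfour: "L2f (Pfour n f)"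
 unfolding Pfour_def[abs_def] by (intro L2f_sum L2f_diff L2f_cmult L2f_cos_ph L2f_sin_ph)

lemma Pfour_approx:
 assumes f: "L2f f"
 shows "nsq (\<lambda>x. f x - Pfour n f x) <= nsq f - (\<Sum>k\<in>Bx n. (norm (fourier f k))^2)"
proof -
 have "nsq (\<lambda>x. f x - Pfour n f x) <= (TI x. (norm (complex_of_real (f x) - trig (Bx n) (fourier f) x))^2)"
  unfolding nsq_def
 proof (rule integral_mono)
  show "tint (\<lambda>x. (f x - Pfour n f x)^2)" by (rule L2f_sq[OF L2f_diff[OF f L2f_Pfour]])
  show "tint (\<lambda>x. (norm (complex_of_real (f x) - trig (Bx n) (fourier f) x))^2)"
   by (rule trig_distance(1)[OF f finite_Bx])
  fix x
  have "\<bar>f x - Pfour n f x\<bar> <= norm (complex_of_real (f x) - trig (Bx n) (fourier f) x)"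
   using abs_Re_le_cmod[of "complex_of_real (f x) - trig (Bx n) (fourier f) x"] by (simp add: Pfour_eq_trig)
  hence "\<bar>f x - Pfour n f x\<bar>^2 <= (norm (complex_of_real (f x) - trig (Bx n) (fourier f) x))^2" by (rule power_mono) simp
  thus "(f x - Pfour n f x)^2 <= (norm (complex_of_real (f x) - trig (Bx n) (fourier f) x))^2" by simp
 qed
 also have "\<dots> = nsq f - (\<Sum>k\<in>Bx n. (norm (fourier f k))^2)"
  using trig_distance(2)[OF f finite_Bx[of n], of "fourier f"] by (simp add: sum_negf)
 finally show ?thesis .
qed

lemma Pfour_tendsto:
 assumes f: "L2f f" shows "(\<lambda>n. nsq (\<lambda>x. f x - Pfour n f x)) \<longlonglongrightarrow> 0"
proof (rule tendsto_sandwich[OF _ _ tendsto_const])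
 show "(\<lambda>n. nsq f - (\<Sum>k\<in>Bx n. (norm (fourier f k))^2)) \<longlonglongrightarrow> 0"
  using tendsto_diff[OF tendsto_const[of "nsq f"] parseval[OF f]] by simp
qed (auto intro!: always_eventually Pfour_approx f)

subsection \<open>Fourier coefficients\<close>

lemma fourier_parts:
 assumes f: "L2f f"
 shows "Re (fourier f k) = (TI x. f x*cos (ph k x))"
  and "Im (fourier f k) = - (TI x. f x * sin (ph k x))"
proof -
 note [measurable] = L2f_meas[OF f]
 have i: "tint (\<lambda>x. complex_of_real (f x)*cis (- ph k x))"
  using integral_L2f_cis[OF f, of "-k"] by (simp add: ph_minus)
 show "Re (fourier f k) = (TI x. f x*cos (ph k x))"
  unfolding fourier_eq[OF L2f_meas[OF f]] integral_Re[OF i, symmetric] by simp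
 show "Im (fourier f k) = - (TI x. f x * sin (ph k x))"
  unfolding fourier_eq[OF L2f_meas[OF f]] integral_Im[OF i, symmetric] by simp
qed

lemma fourier_shift:
 assumes f: "L2f f"
 shows "fourier (\<lambda>x. f (y + x)) k = cis (ph k y)*fourier f k"
proof -
 note [measurable] = L2f_meas[OF f]
 have "fourier (\<lambda>x. f (y + x)) k = (TI x. (\<lambda>z. cis (ph k y)*(complex_of_real (f z)*cis (- ph k z))) (y + x))"
  by (subst fourier_eq) (auto simp: ph_add cis_mult mult.left_commute simp del: Bochner_Integration.integral_mult_right_zero
    intro!: tcong)
 also have "\<dots> = (TI x. cis (ph k y)*(complex_of_real (f x)*cis (- ph k x)))"
 proof (rule integral_torus_shift)
  show "per (\<lambda>z. cis (ph k y)*(complex_of_real (f z)*cis (- ph k z)))"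
   using L2f_per[OF f] per_cis_ph[of "-k"] by (simp add: per_def ph_minus)
 qed simp
 also have "\<dots> = cis (ph k y)*fourier f k" by (simp add: fourier_eq)
 finally show ?thesis .
qed

lemma fourier_diff:
 assumes "L2f f" "L2f g"
 shows "fourier (\<lambda>x. f x - g x) k = fourier f k - fourier g k"
 using assms by (simp add: complex_eq_iff fourier_parts L2f_diff L2f_mult L2f_cos_ph L2f_sin_ph left_diff_distrib)

text \<open>The gradients of \<open>g*cos\<close> and \<open>g*sin\<close> integrate to zero; this
  is the integration by parts for the real and the imaginary part.\<close>

lemma fourier_gradient:
 assumes g: "C1per g G"
 shows "fourier (G $$ j) k = \<i> * of_real (2*pi*(ivec k $ j))*fourier g k"
proof -
 note L = C1per_L2f[OF g]
 have "0 = (TI x. (g x *\<^sub>R ((- sin (ph k x)) *\<^sub>R ((2*pi) *\<^sub>R ivec k)) + cos (ph k x) *\<^sub>R G x) $ j)"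
  by (rule integral_gradient_zero[OF C1per_mult[OF g C1per_cos_ph], symmetric])
 also have "\<dots> = (TI x. G x $ j*cos (ph k x) - (2*pi*ivec k $ j)*(g x * sin (ph k x)))"
  by (rule tcong) (auto simp: algebra_simps)
 also have "\<dots> = Re (fourier (G $$ j) k) + (2*pi*ivec k $ j)*Im (fourier g k)"
  using L by (simp add: fourier_parts L2f_mult L2f_cos_ph L2f_sin_ph)
 finally have 1: "Re (fourier (G $$ j) k) = - (2*pi*ivec k $ j)*Im (fourier g k)" by simp
 have "0 = (TI x. (g x *\<^sub>R (cos (ph k x) *\<^sub>R ((2*pi) *\<^sub>R ivec k)) + sin (ph k x) *\<^sub>R G x) $ j)"
  by (rule integral_gradient_zero[OF C1per_mult[OF g C1per_sin_ph], symmetric])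
 also have "\<dots> = (TI x. G x $ j * sin (ph k x) + (2*pi*ivec k $ j)*(g x*cos (ph k x)))"
  by (rule tcong) (auto simp: algebra_simps)
 also have "\<dots> = - Im (fourier (G $$ j) k) + (2*pi*ivec k $ j) * Re (fourier g k)"
  using L by (simp add: fourier_parts L2f_mult L2f_cos_ph L2f_sin_ph)
 finally have 2: "Im (fourier (G $$ j) k) = (2*pi*ivec k $ j) * Re (fourier g k)" by simp
 show ?thesis by (simp add: complex_eq_iff 1 2)
qed

text \<open>Splitting off finitely many modes and bounding the remaining ones by \<open>|cis a - 1| <= 2\<close>.\<close>
lemma nsq_translation:
 assumes f: "L2f f"
 shows "nsq (\<lambda>x. f (y + x) - f x) <= (\<Sum>k\<in>Bx n. (norm (cis (ph k y) - 1))^2*(norm (fourier f k))^2)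
   + 4*(nsq f - (\<Sum>k\<in>Bx n. (norm (fourier f k))^2))"
proof (rule LIMSEQ_le_const2[OF parseval])
 show L: "L2f (\<lambda>x. f (y + x) - f x)" by (intro L2f_diff L2f_shift f)
 have c: "fourier (\<lambda>x. f (y + x) - f x) k = (cis (ph k y) - 1)*fourier f k" for k
  using fourier_diff[OF L2f_shift(1)[OF f, of y] f, of k] fourier_shift[OF f, of y k] by (simp add: left_diff_distrib)
 have le4: "(norm (cis a - 1))^2 <= 4" for a
  using power_mono[OF norm_triangle_ineq4[of "cis a" 1], of 2] by simp
 show "\<exists>N. \<forall>m\<ge>N. (\<Sum>k\<in>Bx m. (norm (fourier (\<lambda>x. f (y + x) - f x) k))^2)
   <= (\<Sum>k\<in>Bx n. (norm (cis (ph k y) - 1))^2*(norm (fourier f k))^2) + 4*(nsq f - (\<Sum>k\<in>Bx n. (norm (fourier f k))^2))"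
 proof (intro exI allI impI)
  fix m assume "m >= n"
  hence sub: "Bx n \<subseteq> Bx m" by (rule Bx_mono)
  have "(\<Sum>k\<in>Bx m. (norm (fourier (\<lambda>x. f (y + x) - f x) k))^2)
    = (\<Sum>k\<in>Bx m - Bx n. (norm (cis (ph k y) - 1))^2*(norm (fourier f k))^2) + (\<Sum>k\<in>Bx n. (norm (cis (ph k y) - 1))^2*(norm (fourier f k))^2)"
   unfolding c norm_mult power_mult_distrib by (rule sum.subset_diff[OF sub finite_Bx])
  also have "(\<Sum>k\<in>Bx m - Bx n. (norm (cis (ph k y) - 1))^2*(norm (fourier f k))^2)
    <= (\<Sum>k\<in>Bx m - Bx n. 4*(norm (fourier f k))^2)"
   by (intro sum_mono mult_right_mono le4) auto
  also have "\<dots> = 4*((\<Sum>k\<in>Bx m. (norm (fourier f k))^2) - (\<Sum>k\<in>Bx n. (norm (fourier f k))^2))"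
   by (simp add: sum_distrib_left[symmetric] sum_diff[OF finite_Bx sub])
  also have "\<dots> <= 4*(nsq f - (\<Sum>k\<in>Bx n. (norm (fourier f k))^2))"
   using bessel[OF f finite_Bx[of m]] by simp
  finally show "(\<Sum>k\<in>Bx m. (norm (fourier (\<lambda>x. f (y + x) - f x) k))^2)
   <= (\<Sum>k\<in>Bx n. (norm (cis (ph k y) - 1))^2*(norm (fourier f k))^2) + 4*(nsq f - (\<Sum>k\<in>Bx n. (norm (fourier f k))^2))"
   by simp
 qed
qed

lemma cis_minus_1_le: "norm (cis a - 1) <= \<bar>a\<bar>"
proof -
 have "(norm (cis a - 1))^2 = 2 - 2*cos a"
  unfolding cmod_power2 using sin_cos_squared_add[of a] by (simp add: power2_eq_square algebra_simps)
 also have "\<dots> = (2 * sin (a/2))^2"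
  using cos_double_sin[of "a/2"] by (simp add: power_mult_distrib)
 also have "\<dots> <= \<bar>a\<bar>^2"
  using abs_sin_x_le_abs_x[of "a/2"] by (subst power2_abs[symmetric], intro power_mono) (auto simp: abs_mult)
 finally show ?thesis by (rule power2_le_imp_le) simp
qed

lemma translation_continuous:
 assumes f: "L2f f" and e: "e > 0"
 obtains d where "d > 0" "\<And>y. norm y < d ==> nsq (\<lambda>x. f (y + x) - f x) < e"
proof -
 \<comment> \<open>The tail enters with the factor 4, so \<open>e/8\<close> here and
   \<open>e/2\<close> for the finite part add up to \<open>e\<close>.\<close>
 obtain n where n: "nsq f - (\<Sum>k\<in>Bx n. (norm (fourier f k))^2) < e/8"
 proof -
  have "eventually (\<lambda>n. nsq f - e/8 < (\<Sum>k\<in>Bx n. (norm (fourier f k))^2)) sequentially"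
   using e by (intro order_tendstoD(1)[OF parseval[OF f]]) auto
  then obtain n where "nsq f - e/8 < (\<Sum>k\<in>Bx n. (norm (fourier f k))^2)" by (auto simp: eventually_sequentially)
  hence "nsq f - (\<Sum>k\<in>Bx n. (norm (fourier f k))^2) < e/8" by linarith
  thus ?thesis by (rule that)
 qed
 have "((\<lambda>y. \<Sum>k\<in>Bx n. (norm (cis (ph k y) - 1))^2*(norm (fourier f k))^2) \<longlongrightarrow>
   (\<Sum>k\<in>Bx n. (norm (cis (ph k 0) - 1))^2*(norm (fourier f k))^2)) (nhds 0)"
  unfolding ph_inner by (intro tendsto_intros) (simp add: filterlim_ident)
 hence "((\<lambda>y. \<Sum>k\<in>Bx n. (norm (cis (ph k y) - 1))^2*(norm (fourier f k))^2) \<longlongrightarrow> 0) (nhds 0)"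
  by (simp add: ph_def)
 hence "eventually (\<lambda>y. (\<Sum>k\<in>Bx n. (norm (cis (ph k y) - 1))^2*(norm (fourier f k))^2) < e/2) (nhds 0)"
  by (rule order_tendstoD) (use e in simp)
 then obtain d where d: "d > 0" "\<And>y. norm y < d ==> (\<Sum>k\<in>Bx n. (norm (cis (ph k y) - 1))^2*(norm (fourier f k))^2) < e/2"
  unfolding eventually_nhds_metric by (auto simp: dist_norm)
 show ?thesis
 proof (rule that[OF d(1)])
  fix y :: "real^2" assume "norm y < d"
  have "p < e" if "a < e/2" "p <= a + 4*b" "b < e/8" for p a b using that by linarith
  from this[OF d(2)[OF \<open>norm y < d\<close>] nsq_translation[OF f, of y n] n]
  show "nsq (\<lambda>x. f (y + x) - f x) < e" .
 qed
qed

section \<open>Periodised kernels\<close>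

text \<open>The nearest lattice point; \<open>pr\<close> reduces a point to the cell centred at the
  origin, where a kernel supported near 0 is evaluated.\<close>

definition rnd :: "real^2 => int \<times> int" where
 "rnd z = (\<lfloor>z$1 + 1/2\<rfloor>, \<lfloor>z$2 + 1/2\<rfloor>)"

definition pr :: "real^2 => real^2" where
 "pr z = z - ivec (rnd z)"

lemma rnd_shift: "rnd (z + ivec k) = rnd z + k"
proof -
 have "\<lfloor>a + of_int m + 1/2\<rfloor> = \<lfloor>a + 1/2\<rfloor> + m" for a :: real and m by linarith
 thus ?thesis by (cases k) (simp add: rnd_def)
qed

lemma pr_shift: "pr (z + ivec k) = pr z"
 by (simp add: pr_def rnd_shift ivec_add)

lemma per_pr: "per (\<lambda>z. f (pr z))"
 using pr_shift[of _ "(1,0)"] pr_shift[of _ "(0,1)"] by (simp add: per_def) (simp add: ivec_def)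

lemma pr_measurable [measurable]: "pr \<in> bmeas"
proof -
 have eq: "pr = (\<lambda>x. x - (of_int \<lfloor>x$1 + 1/2\<rfloor> *\<^sub>R axis 1 1 + of_int \<lfloor>x$2 + 1/2\<rfloor> *\<^sub>R axis 2 1))"
  by (auto simp: pr_def ivec_def rnd_def)
 show ?thesis unfolding eq by measurable
qed

lemma rnd_unique: assumes "norm (z - ivec k) < 1/2" shows "rnd z = k"
proof -
 have "\<bar>(z - ivec k) $ i\<bar> < 1/2" for i using component_le_norm_cart[of "z - ivec k" i] assms by linarith
 from this[of 1] this[of 2]
 have "\<bar>z$1 - of_int (fst k)\<bar> < 1/2" "\<bar>z$2 - of_int (snd k)\<bar> < 1/2" by simp_all
 hence "\<lfloor>z$1 + 1/2\<rfloor> = fst k" "\<lfloor>z$2 + 1/2\<rfloor> = snd k" by linarith+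
 thus ?thesis by (simp add: rnd_def)
qed

text \<open>\<open>pr\<close> jumps where a coordinate is a half-integer, but a function vanishing
  outside the ball of radius 1/4 does not notice. On a neighbourhood of radius 1/8, either
  \<open>norm (pr z) < 3/8\<close> and the nearest lattice point stays the same because 3/8 + 1/8 =
  1/2, or both arguments lie outside that ball because 3/8 - 1/8 = 1/4.\<close>

lemma pr_local:
 "eventually (\<lambda>z'. \<forall>f :: real^2 => 'b::zero. (\<forall>y. norm y >= 1/4 \<longrightarrow> f y = 0) \<longrightarrow> f (pr z') = f (z' - ivec (rnd z))) (nhds z)"
 unfolding eventually_nhds_metric
proof (intro exI[of _ "1/8"] conjI allI impI)
 fix z' and f :: "real^2 => 'b" assume d: "dist z' z < 1/8" and f: "\<forall>y. norm y >= 1/4 \<longrightarrow> f y = 0"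
 have n: "norm (z' - z) < 1/8" "norm (z - z') < 1/8" using d by (auto simp: dist_norm norm_minus_commute)
 show "f (pr z') = f (z' - ivec (rnd z))"
 proof (cases "norm (pr z) < 3/8")
  case True
  have "norm (z' - ivec (rnd z)) <= norm (z' - z) + norm (pr z)"
   using norm_triangle_ineq[of "z' - z" "z - ivec (rnd z)"] by (simp add: pr_def)
  hence "rnd z' = rnd z" using n True by (intro rnd_unique) linarith
  thus ?thesis by (simp add: pr_def)
 next
  case False
  have "norm (pr z) <= norm (z - z') + norm (z' - ivec (rnd z))"
   using norm_triangle_ineq[of "z - z'" "z' - ivec (rnd z)"] by (simp add: pr_def)
  hence 1: "norm (z' - ivec (rnd z)) >= 1/4" using n False by linarith
  have 2: "norm (pr z') >= 1/4"
  proof (rule ccontr)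
   assume c: "\<not> ?thesis"
   have "norm (z - ivec (rnd z')) <= norm (z - z') + norm (pr z')"
    using norm_triangle_ineq[of "z - z'" "z' - ivec (rnd z')"] by (simp add: pr_def)
   hence "norm (z - ivec (rnd z')) < 3/8" using c n by linarith
   moreover from this have "rnd z = rnd z'" by (intro rnd_unique) linarith
   ultimately show False using False by (simp add: pr_def)
  qed
  show ?thesis using f 1 2 by simp
 qed
qed simp

lemma C1per_periodise:
 assumes d: "\<And>y. (f has_derivative (\<lambda>h. F y \<bullet> h)) (at y)" and c: "continuous_on UNIV F"
  and f0: "\<And>y. norm y >= 1/4 ==> f y = 0" and F0: "\<And>y. norm y >= 1/4 ==> F y = 0"
 shows "C1per (\<lambda>z. f (pr z)) (\<lambda>z. F (pr z))"
 unfolding C1per_def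
proof (intro conjI allI per_pr)
 fix z
 have d': "((\<lambda>z'. f (z' - ivec (rnd z))) has_derivative (\<lambda>h. F (pr z) \<bullet> h)) (at z)"
  unfolding pr_def
  by (rule has_derivative_compose[of "\<lambda>z'. z' - ivec (rnd z)" "\<lambda>h. h" z UNIV f "\<lambda>h. F (z - ivec (rnd z)) \<bullet> h"])
   (auto intro!: derivative_eq_intros d)
 have "eventually (\<lambda>z'. f (z' - ivec (rnd z)) = f (pr z')) (nhds z)"
  using pr_local[of z, where 'b=real] by eventually_elim (use f0 in metis)
 hence ev: "eventually (\<lambda>z'. f (z' - ivec (rnd z)) = f (pr z')) (at z)"
  unfolding eventually_at_filter by (rule eventually_mono) simp
 show "((\<lambda>z. f (pr z)) has_derivative (\<lambda>h. F (pr z) \<bullet> h)) (at z)"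
  by (rule has_derivative_transform_eventually[OF d' ev]) (simp_all add: pr_def)
next
 show "continuous_on UNIV (\<lambda>z. F (pr z))"
 proof (rule continuous_at_imp_continuous_on, rule ballI)
  fix z
  have 1: "isCont (\<lambda>z'. F (z' - ivec (rnd z))) z"
   using c by (intro isCont_o2[where g=F and f="\<lambda>z'. z' - ivec (rnd z)"]) (auto simp: continuous_on_eq_continuous_at)
  have 2: "eventually (\<lambda>z'. F (z' - ivec (rnd z)) = F (pr z')) (nhds z)"
   using pr_local[of z, where 'b="real^2"] by eventually_elim (use F0 in metis)
  show "isCont (\<lambda>z. F (pr z)) z" by (rule isCont_cong[THEN iffD1, OF 2 1])
 qed
qed

section \<open>The mollifying kernel and its flux in the scale parameter\<close>

definition bs :: "real => real^2 => real" where
 "bs s z = max 0 (s - (norm (pr z))^2)"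

text \<open>The parameter \<open>s\<close> is the square of the support radius. The square of the
  positive part is the lowest power that is \<open>C^1\<close>, and \<open>s <= 1/16\<close> keeps
  the support in the ball of radius 1/4 on which periodisation is harmless.\<close>

definition rk :: "real => real^2 => real" where
 "rk s z = (bs s z)^2"

definition rkG :: "real => real^2 => real^2" where
 "rkG s z = (- 4*bs s z) *\<^sub>R pr z"

text \<open>The radial profile times the \<open>i\<close>-th coordinate: the flux field whose
  divergence is, up to a factor depending on \<open>s\<close>, the scale derivative of the
  kernel.\<close>

definition dk :: "2 => real => real^2 => real" where
 "dk i s z = (bs s z)^2*pr z $ i"

definition dkG :: "2 => real => real^2 => real^2" where
 "dkG i s z = (bs s z)^2 *\<^sub>R axis i 1 - (4*bs s z*pr z $ i) *\<^sub>R pr z"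

lemma has_real_derivative_max0_sq: "((\<lambda>t::real. (max 0 t)^2) has_real_derivative 2*max 0 t) (at t)"
proof -
 consider "t > 0" | "t < 0" | "t = 0" by linarith
 thus ?thesis
 proof cases
  case 1
  have "((\<lambda>t::real. t^2) has_real_derivative 2*max 0 t) (at t)" using 1 by (auto intro!: derivative_eq_intros)
  moreover have "eventually (\<lambda>t. t^2 = (max 0 t)^2) (nhds t)"
   using eventually_nhds_in_open[of "{0<..}" t] 1 by (auto elim: eventually_mono)
  ultimately show ?thesis by (simp cong: DERIV_cong_ev)
 next
  case 2
  have "((\<lambda>t::real. 0) has_real_derivative 2*max 0 t) (at t)" using 2 by auto
  moreover have "eventually (\<lambda>t::real. (max 0 t)^2 = 0) (nhds t)"
   using eventually_nhds_in_open[of "{..<0}" t] 2 by (auto elim: eventually_mono)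
  ultimately show ?thesis by (subst DERIV_cong_ev[OF refl _ refl])
 next
  case 3
  have "((\<lambda>h. (max 0 (0 + h))^2/h) \<longlongrightarrow> 0) (at (0::real))"
  proof (rule Lim_null_comparison[of _ "\<lambda>h. \<bar>h\<bar>"])
   show "\<forall>\<^sub>F h in at 0. norm ((max 0 (0 + h))^2/h) <= \<bar>h::real\<bar>"
    by (intro always_eventually allI) (auto simp: max_def power2_eq_square)
  qed (intro tendsto_eq_intros, auto)
  thus ?thesis by (simp add: DERIV_def 3)
 qed
qed

lemma has_derivative_base_sq:
 "((\<lambda>y::real^2. (max 0 (s - (norm y)^2))^2) has_derivative (\<lambda>h. ((- 4*max 0 (s - (norm y)^2)) *\<^sub>R y) \<bullet> h)) (at y)"
proof -
 have "((\<lambda>y::real^2. s - (norm y)^2) has_derivative (\<lambda>h. - 2*(y \<bullet> h))) (at y)"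
  unfolding power2_norm_eq_inner by (auto intro!: derivative_eq_intros simp: inner_commute)
 from has_derivative_compose[OF this has_real_derivative_max0_sq[unfolded has_field_derivative_def]]
 show ?thesis by (rule has_derivative_eq_rhs) (auto simp: algebra_simps)
qed

lemma max0_base_zero: "s <= 1/16 ==> norm (y::real^2) >= 1/4 ==> max 0 (s - (norm y)^2) = 0"
 using power_mono[of "1/4" "norm y" 2] by (simp add: power2_eq_square)

lemma C1per_rk: assumes "s <= 1/16" shows "C1per (rk s) (rkG s)"
proof -
 have "C1per (\<lambda>z. (\<lambda>y. (max 0 (s - (norm y)^2))^2) (pr z)) (\<lambda>z. (\<lambda>y. (- 4*max 0 (s - (norm y)^2)) *\<^sub>R y) (pr z))"
  by (rule C1per_periodise[OF has_derivative_base_sq])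
   (use max0_base_zero[OF assms] in \<open>auto intro!: continuous_intros\<close>)
 thus ?thesis by (simp add: rk_def[abs_def] rkG_def[abs_def] bs_def)
qed

lemma C1per_dk: assumes "s <= 1/16" shows "C1per (dk i s) (dkG i s)"
proof -
 let ?b = "\<lambda>y::real^2. max 0 (s - (norm y)^2)"
 have "((\<lambda>y::real^2. y $ i) has_derivative (\<lambda>h. h $ i)) (at y)" for y
  by (rule bounded_linear_imp_has_derivative) (rule bounded_linear_vec_nth)
 from has_derivative_mult[OF has_derivative_base_sq this]
 have "((\<lambda>y. (?b y)^2*y $ i) has_derivative (\<lambda>h. ((?b y)^2 *\<^sub>R axis i 1 - (4*?b y*y $ i) *\<^sub>R y) \<bullet> h)) (at y)" for y
  by (rule has_derivative_eq_rhs) (auto simp: inner_diff_left inner_axis' algebra_simps)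
 hence "C1per (\<lambda>z. (\<lambda>y. (?b y)^2*y $ i) (pr z)) (\<lambda>z. (\<lambda>y. (?b y)^2 *\<^sub>R axis i 1 - (4*?b y*y $ i) *\<^sub>R y) (pr z))"
  by (rule C1per_periodise)
   (use max0_base_zero[OF assms] in \<open>auto intro!: continuous_intros\<close>)
 thus ?thesis by (simp add: dk_def[abs_def] dkG_def[abs_def] bs_def)
qed

lemma bs_measurable [measurable]: "bs s \<in> bmeas"
 unfolding bs_def[abs_def] by measurable

lemma bs_bounds: "0 <= bs s z" "0 <= s ==> bs s z <= s"
 by (auto simp: bs_def)

lemma bs_zero: "0 <= s ==> norm (pr z) >= sqrt s ==> bs s z = 0"
 using power_mono[of "sqrt s" "norm (pr z)" 2] by (simp add: bs_def)

lemma kernel_zero: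
 assumes "0 <= s" "norm (pr z) >= sqrt s"
 shows "rk s z = 0" "rkG s z = 0" "dk i s z = 0" "dkG i s z = 0"
 using bs_zero[OF assms] by (auto simp: rk_def rkG_def dk_def dkG_def)

lemma kernel_bounds:
 assumes s: "0 < s"
 shows "0 <= rk s z" "rk s z <= s^2" "norm (rkG s z) <= 4*(s * sqrt s)"
  "\<bar>dk i s z\<bar> <= s^2 * sqrt s" "norm (dkG i s z) <= 5 * s^2"
proof -
 note b = bs_bounds(1)[of s z] bs_bounds(2)[of s z]
 show "0 <= rk s z" by (simp add: rk_def)
 show "rk s z <= s^2" using b s by (auto simp: rk_def intro!: power_mono)
 show "norm (rkG s z) <= 4*(s * sqrt s)"
 proof (cases "norm (pr z) >= sqrt s")
  case True thus ?thesis using kernel_zero[of s z] s by simp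
 next
  case False thus ?thesis using b s by (auto simp: rkG_def intro!: mult_mono)
 qed
 show "\<bar>dk i s z\<bar> <= s^2 * sqrt s"
 proof (cases "norm (pr z) >= sqrt s")
  case True thus ?thesis using kernel_zero[of s z] s by simp
 next
  case False
  hence "\<bar>pr z $ i\<bar> <= sqrt s" using component_le_norm_cart[of "pr z" i] by linarith
  thus ?thesis using b s by (auto simp: dk_def abs_mult intro!: mult_mono power_mono)
 qed
 show "norm (dkG i s z) <= 5 * s^2"
 proof (cases "norm (pr z) >= sqrt s")
  case True thus ?thesis using kernel_zero[of s z] s by simp
 next
  case False
  hence c: "\<bar>pr z $ i\<bar> <= sqrt s" "norm (pr z) <= sqrt s" using component_le_norm_cart[of "pr z" i] by linarith+
  have "norm (dkG i s z) <= norm ((bs s z)^2 *\<^sub>R (axis i 1 :: real^2)) + norm ((4*bs s z*pr z $ i) *\<^sub>R pr z)"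
   unfolding dkG_def by (rule norm_triangle_ineq4)
  also have "\<dots> = (bs s z)^2 + 4*bs s z*(\<bar>pr z $ i\<bar>*norm (pr z))"
   using b by (simp add: abs_mult)
  also have "\<dots> <= s^2 + 4 * s*(sqrt s * sqrt s)"
   using b s c by (intro add_mono mult_mono power_mono) auto
  also have "\<dots> = 5 * s^2" using s by (simp add: power2_eq_square)
  finally show ?thesis .
 qed
qed

definition supp :: "real => (real^2) set" where
 "supp s = {z. norm (pr z) < sqrt s}"

lemma supp_measurable [measurable]: "supp s \<in> sets borel"
 unfolding supp_def by measurable

lemma measure_supp:
 assumes s: "0 < s" "s <= 1/16"
 shows "measure torus (supp s) <= 4 * s"
proof -
 \<comment> \<open>The shift moves the support from the corners of the cell to its centre, where
   \<open>rnd\<close> vanishes; there it lies in a square of side \<open>2 * sqrt s\<close>.\<close>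
 define a :: "real^2" where "a = (\<chi> i. 1/2)"
 define b :: "real^2" where "b = (\<chi> i. sqrt s)"
 have "(\<integral>\<^sup>+z. indicator (supp s) z \<partial>torus) = (\<integral>\<^sup>+z. indicator (supp s) (- a + z) \<partial>torus)"
  by (rule nn_integral_torus_shift[symmetric])
   (auto simp: supp_def indicator_def per_pr[of "\<lambda>y. of_bool (norm y < sqrt s)"])
 also have "\<dots> = (\<integral>\<^sup>+z. indicator Q0 z*indicator (supp s) (- a + z) \<partial>lborel)"
  by (simp add: nn_integral_torus_Q0)
 also have "\<dots> <= (\<integral>\<^sup>+z. indicator (cbox (- b) b) (- a + z) \<partial>lborel)"
 proof (rule nn_integral_mono)
  fix z
  have "- a + z \<in> cbox (- b) b" if z: "z \<in> Q0" "- a + z \<in> supp s"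
  proof -
   have "rnd (- a + z) = 0"
    using z(1) by (auto simp: rnd_def a_def Q0_def floor_eq_iff zero_prod_def)
   hence "norm (- a + z) < sqrt s" using z(2) by (simp add: supp_def pr_def ivec_def)
   hence "\<bar>(- a + z) $ i\<bar> <= sqrt s" for i using component_le_norm_cart[of "- a + z" i] by linarith
   thus ?thesis by (auto simp: mem_box_cart b_def abs_le_iff) (smt (verit))+
  qed
  thus "indicator Q0 z*indicator (supp s) (- a + z) <= (indicator (cbox (- b) b) (- a + z) :: ennreal)"
   by (auto simp: indicator_def)
 qed
 also have "\<dots> = (\<integral>\<^sup>+z. indicator (cbox (- b) b) z \<partial>lborel)"
  by (rule nn_integral_lborel_translate) simp
 also have "\<dots> = emeasure lborel (cbox (- b) b)" by simp
 also have "\<dots> = (\<Prod>i\<in>Basis. (b - (- b)) \<bullet> i)"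
  by (rule emeasure_lborel_cbox) (use s in \<open>auto simp: Basis_real2 b_def inner_axis\<close>)
 also have "(\<Prod>i\<in>Basis. (b - (- b)) \<bullet> i) = 4 * s"
  using s by (simp add: Basis_real2 b_def inner_axis axis_eq_axis)
 finally show ?thesis using s
  by (simp add: torus.emeasure_eq_measure ennreal_le_iff)
qed

lemma kernel_le_supp:
 assumes s: "0 < s"
 shows "rk s z <= s^2*indicator (supp s) z" "norm (rkG s z) <= 4*(s * sqrt s)*indicator (supp s) z"
  "\<bar>dk i s z\<bar> <= s^2 * sqrt s*indicator (supp s) z"
 using kernel_bounds[OF s, where z=z] kernel_zero[where s=s and z=z] s by (auto simp: indicator_def supp_def)

text \<open>\<open>rk s z/s^3\<close> is \<open>1/s\<close> times a fixed profile of
  \<open>z/sqrt s\<close>, which is the mass-preserving scaling in dimension 2. The derivative of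
  such a family is the divergence of \<open>- z/(2*s)\<close> times the kernel, and
  \<open>z * rk s z\<close> is the field \<open>dk\<close>.\<close>

lemma rk_s_deriv:
 assumes "s > 0"
 shows "((\<lambda>s. rk s z/s^3) has_real_derivative (- (dkG 1 s z $ 1 + dkG 2 s z $ 2)/(2 * s^4))) (at s within S)"
proof -
 have "((\<lambda>s. (max 0 (s - (norm (pr z))^2))^2) has_real_derivative 2*max 0 (s - (norm (pr z))^2)*1) (at s)"
  by (rule DERIV_chain'[where f="\<lambda>s. s - (norm (pr z))^2" and g="\<lambda>t. (max 0 t)^2"])
   (auto intro!: derivative_eq_intros has_real_derivative_max0_sq)
 hence d: "((\<lambda>s. rk s z) has_real_derivative 2*bs s z) (at s within S)"
  by (simp add: rk_def bs_def has_field_derivative_at_within)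
 have "((\<lambda>s. rk s z/s^3) has_real_derivative (2*bs s z * s^3 - rk s z*(3 * s^2))/(s^3 * s^3)) (at s within S)"
  using assms by (auto intro!: derivative_eq_intros d simp: power2_eq_square power3_eq_cube)
 moreover have "dkG 1 s z $ 1 + dkG 2 s z $ 2 = 6*(bs s z)^2 - 4*bs s z * s"
 proof -
  have "dkG 1 s z $ 1 + dkG 2 s z $ 2 = 2*(bs s z)^2 - 4*bs s z*(norm (pr z))^2"
   unfolding power2_norm_eq_inner inner_real2 by (simp add: dkG_def axis_def algebra_simps power2_eq_square)
  moreover have "bs s z = 0 \<or> (norm (pr z))^2 = s - bs s z" by (auto simp: bs_def max_def)
  ultimately show ?thesis
  proof (elim disjE)
   assume *: "(norm (pr z))^2 = s - bs s z" and e: "dkG 1 s z $ 1 + dkG 2 s z $ 2 = 2*(bs s z)^2 - 4*bs s z*(norm (pr z))^2"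
   show ?thesis unfolding e*by (simp add: power2_eq_square algebra_simps)
  qed simp
 qed
 moreover have "(2*bs s z * s^3 - rk s z*(3 * s^2))/(s^3 * s^3) = - (6*(bs s z)^2 - 4*bs s z * s)/(2 * s^4)"
  using assms by (simp add: rk_def field_simps power2_eq_square power3_eq_cube power4_eq_xxxx)
 ultimately show ?thesis by simp
qed

lemma dkG_measurable [measurable]: "dkG i s \<in> bmeas"
 unfolding dkG_def[abs_def] by measurable

lemma rkG_measurable [measurable]: "rkG s \<in> bmeas"
 unfolding rkG_def[abs_def] by measurable

lemma rk_measurable [measurable]: "rk s \<in> bmeas"
 unfolding rk_def[abs_def] by measurable

lemma dk_measurable [measurable]: "dk i s \<in> bmeas"
 unfolding dk_def[abs_def] by measurable

lemma integral_rk_deriv: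
 assumes u: "tint u" and a: "0 < a" and s: "s \<in> {a..1/16}"
 shows "((\<lambda>s. TI z. u z*(rk s (x - z)/s^3)) has_real_derivative
   (TI z. u z*(- (dkG 1 s (x - z) $ 1 + dkG 2 s (x - z) $ 2)/(2 * s^4)))) (at s within {a..1/16})"
proof -
 let ?d = "\<lambda>s z. - (dkG 1 s (x - z) $ 1 + dkG 2 s (x - z) $ 2)/(2 * s^4)"
 define B where "B = 5/a^2"
 have dB: "\<bar>?d s z\<bar> <= B" if s: "s \<in> {a..1/16}" for s z
 proof -
  have s0: "s > 0" using s a by auto
  have "\<bar>dkG i s (x - z) $ j\<bar> <= 5 * s^2" for i j
   using order_trans[OF component_le_norm_cart kernel_bounds(5)[OF s0]] by blast
  from this[of 1 1] this[of 2 2] have "\<bar>dkG 1 s (x - z) $ 1 + dkG 2 s (x - z) $ 2\<bar> <= 10 * s^2" by linarith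
  hence "\<bar>- (dkG 1 s (x - z) $ 1 + dkG 2 s (x - z) $ 2)\<bar>/(2 * s^4) <= 10 * s^2/(2 * s^4)"
   using s0 unfolding abs_minus_cancel by (intro divide_right_mono) auto
  hence "\<bar>?d s z\<bar> <= 10 * s^2/(2 * s^4)" using s0 unfolding abs_divide by simp
  also have "\<dots> = 5/s^2" using s0 by (simp add: field_simps power2_eq_square power4_eq_xxxx)
  also have "\<dots> <= B" unfolding B_def using s a by (intro divide_left_mono power_mono mult_pos_pos) auto
  finally show ?thesis .
 qed
 have "((\<lambda>s. TI z. u z*(rk s (x - z)/s^3)) has_derivative (\<lambda>h. TI z. u z*(?d s z*h))) (at s within {a..1/16})"
 proof (rule has_derivative_integral_dominated[OF u, where K="1/a" and B=B])
  show "((\<lambda>s. rk s (x - z)/s^3) has_derivative (*) (?d s z)) (at s within {a..1/16})" for z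
   using rk_s_deriv[of s "x - z"] s a by (auto simp: has_field_derivative_def)
  show "\<bar>rk s (x - z)/s^3\<bar> <= 1/a" for z
  proof -
   have "rk s (x - z)/s^3 <= s^2/s^3" using s a by (intro divide_right_mono kernel_bounds) auto
   also have "\<dots> = 1/s" using s a by (simp add: field_simps power2_eq_square power3_eq_cube)
   also have "\<dots> <= 1/a" using s a by (intro divide_left_mono) auto
   finally show ?thesis using s a kernel_bounds(1)[of s "x - z"] by simp
  qed
  show "\<bar>?d s z*h\<bar> <= B*norm h" for z h
   unfolding abs_mult real_norm_def by (rule mult_right_mono[OF dB[OF s]]) simp
  show "\<bar>rk y (x - z)/y^3 - rk s (x - z)/s^3\<bar> <= B*norm (y - s)" if "y \<in> {a..1/16}" for z y
  proof -
   have "norm (rk y (x - z)/y^3 - rk s (x - z)/s^3) <= B*norm (y - s)"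
   proof (rule differentiable_bound[where S="{a..1/16}" and f'="\<lambda>s h. ?d s z*h"])
    show "((\<lambda>s. rk s (x - z)/s^3) has_derivative (*) (?d t z)) (at t within {a..1/16})" if "t \<in> {a..1/16}" for t
     using rk_s_deriv[of t "x - z"] that a by (auto simp: has_field_derivative_def)
    show "onorm ((*) (?d t z)) <= B" if "t \<in> {a..1/16}" for t
     by (rule onorm_le, unfold real_norm_def abs_mult, rule mult_right_mono[OF dB[OF that]]) simp
   qed (use that s in auto)
   thus ?thesis by simp
  qed
 qed (use s in auto)
 thus ?thesis
  unfolding has_field_derivative_def
  by (rule has_derivative_eq_rhs) (auto simp: mult.assoc[symmetric])
qed

text \<open>The mass of \<open>rk s/s^3\<close>, common to all scales. Its value is never computed;
  positivity suffices for normalising.\<close>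

definition Zc :: real where
 "Zc = (TI z. rk (1/16) z)/(1/16)^3"

text \<open>The scale derivative of the mass is an integral of partial derivatives of periodic
  functions, hence zero.\<close>

lemma integral_rk:
 assumes s: "0 < s" "s <= 1/16"
 shows "(TI z. rk s z)/s^3 = Zc"
proof -
 have refl_rk: "(TI z. 1*(rk t (0 - z)/t^3)) = (TI z. rk t z)/t^3" for t
  using integral_torus_minus[of "\<lambda>z. rk t z/t^3" 0]
  by (simp add: rk_def bs_def per_pr[of "\<lambda>y. (max 0 (t - (norm y)^2))^2/t^3"])
 have "\<exists>c. \<forall>t\<in>{s..1/16}. (TI z. 1*(rk t (0 - z)/t^3)) = c"
 proof (rule has_derivative_zero_constant)
  fix t assume t: "t \<in> {s..1/16}"
  have m: "tint (\<lambda>z. dkG i t (0 - z) $ j)" for i j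
   by (rule integrable_torus_bounded[where C="5*t^2"])
    (use kernel_bounds(5)[of t] t s order_trans[OF component_le_norm_cart] in \<open>auto intro!: order_trans[OF component_le_norm_cart kernel_bounds(5)]\<close>)
  have z: "(TI z. dkG i t (0 - z) $ j) = 0" for i j
   using integral_gradient_zero[OF C1per_shift[OF C1per_dk[of t i], of 0], of j] t by simp
  have "(TI z. 1*(- (dkG 1 t (0 - z) $ 1 + dkG 2 t (0 - z) $ 2)/(2*t^4))) = 0"
   using m z by (simp del: minus_add_distrib add_uminus_conv_diff)
  thus "((\<lambda>t. TI z. 1*(rk t (0 - z)/t^3)) has_derivative (\<lambda>h. 0)) (at t within {s..1/16})"
   using integral_rk_deriv[of "\<lambda>z. 1" s t 0] s t unfolding has_field_derivative_def
   by (simp only: lambda_zero integrable_const) simp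
 qed simp
 thus ?thesis using s unfolding refl_rk Zc_def by auto
qed

lemma Zc_pos: "Zc > 0"
proof -
 \<comment> \<open>On this square \<open>norm z <= 1/8\<close>, so the kernel base is at least 1/16
   - 1/64, which exceeds 1/32.\<close>
 define A where "A = cbox (0::real^2) (\<chi> i. 1/16)"
 have A: "z \<in> cell" if "z \<in> A" for z
 proof -
  have "0 <= z $ i \<and> z $ i <= 1/16" for i using that by (auto simp: A_def mem_box_cart)
  hence "0 <= z $ i \<and> z $ i <= 1" for i by (smt (verit) divide_le_eq_1)
  thus ?thesis by (simp add: cell_def mem_box_cart)
 qed
 have [measurable]: "A \<in> sets borel" by (simp add: A_def)
 have rkA: "(1/32)^2*indicator A z <= rk (1/16) z" for z
 proof (cases "z \<in> A")
  case True
  have "norm z <= \<bar>z$1\<bar> + \<bar>z$2\<bar>" using norm_le_l1_cart[of z] by (simp add: UNIV_2_eq)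
  also have "\<dots> <= 1/8" using True by (auto simp: A_def mem_box_cart forall_2_iff)
  finally have n: "norm z <= 1/8" .
  have "rnd z = 0" by (rule rnd_unique) (use n in \<open>simp add: ivec_def\<close>)
  hence "pr z = z" by (simp add: pr_def ivec_def)
  moreover have "(norm z)^2 <= (1/8)^2" using n by (intro power_mono) auto
  ultimately have "bs (1/16) z >= 1/32" by (simp add: bs_def power2_eq_square)
  thus ?thesis using True power_mono[of "1/32" "bs (1/16) z" 2] by (simp add: rk_def)
 next
  case False thus ?thesis by (simp add: rk_def)
 qed
 have m: "emeasure torus A = ennreal (1/256)"
 proof -
  have "emeasure torus A = emeasure lborel A" using A by (simp add: emeasure_torus Int_absorb1 subsetI)
  also have "\<dots> = (\<Prod>b\<in>Basis. ((\<chi> i. 1/16) - (0::real^2)) \<bullet> b)"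
   unfolding A_def by (rule emeasure_lborel_cbox) (auto simp: Basis_real2 inner_axis)
  also have "(\<Prod>b\<in>Basis. ((\<chi> i. 1/16) - (0::real^2)) \<bullet> b) = 1/256"
   by (simp add: Basis_real2 inner_axis axis_eq_axis)
  finally show ?thesis .
 qed
 have "0 < (1/32)^2*measure torus A" using m by (simp add: measure_def)
 also have "\<dots> = (TI z. (1/32)^2*indicator A z)" by simp
 also have "\<dots> <= (TI z. rk (1/16) z)"
 proof (rule integral_mono)
  show "tint (rk (1/16))"
   using kernel_bounds(1,2)[of "1/16"] by (intro integrable_torus_bounded[where C="(1/16)^2"]) auto
  show "tint (\<lambda>z. (1/32)^2*indicat_real A z)"
   by (intro integrable_mult_right integrable_torus_bounded[where C=1]) (auto simp: indicator_def)
 qed (rule rkA)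
 finally show ?thesis by (simp add: Zc_def)
qed

section \<open>Mollification\<close>

definition rho :: "real => real^2 => real" where
 "rho s z = 1/(s^3*Zc)*rk s z"

definition rhoG :: "real => real^2 => real^2" where
 "rhoG s z = (1/(s^3*Zc)) *\<^sub>R rkG s z"

lemma rho_measurable [measurable]: "rho s \<in> bmeas"
 unfolding rho_def[abs_def] by measurable

lemma rhoG_measurable [measurable]: "rhoG s \<in> bmeas"
 unfolding rhoG_def[abs_def] by measurable

lemma C1per_rho: "s <= 1/16 ==> C1per (rho s) (rhoG s)"
 unfolding rho_def[abs_def] rhoG_def[abs_def] by (intro C1per_cmult C1per_rk)

lemma rho_facts:
 assumes s: "0 < s" "s <= 1/16"
 shows "0 <= rho s z" "rho s z <= 1/(Zc * s)" "(TI z. rho s z) = 1" "tint (rho s)"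
  and "rho s z \<noteq> 0 ==> norm (pr z) < sqrt s"
  and "norm (rhoG s z) <= 4/(Zc*(s * sqrt s))*indicator (supp s) z"
  and "(TI z. rho s (x - z)) = 1"
proof -
 have Z: "s^3*Zc > 0" using Zc_pos s by simp
 show p: "0 <= rho s z" for z using kernel_bounds(1)[OF s(1), of z] Z by (simp add: rho_def)
 have "rho s z <= 1/(s^3*Zc) * s^2" for z
  unfolding rho_def using kernel_bounds(2)[OF s(1), of z] Z by (intro mult_left_mono) auto
 also have "1/(s^3*Zc) * s^2 = 1/(Zc * s)" using s by (simp add: field_simps power2_eq_square power3_eq_cube)
 finally show le: "rho s z <= 1/(Zc * s)" for z .
 show "tint (rho s)"
  by (rule integrable_torus_bounded[where C="1/(Zc * s)"]) (use p le in auto)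
 show i1: "(TI z. rho s z) = 1"
  using integral_rk[OF s] Zc_pos s by (simp add: rho_def field_simps)
 show "norm (pr z) < sqrt s" if "rho s z \<noteq> 0"
  using that kernel_zero(1)[of s z] s by (cases "norm (pr z) >= sqrt s") (auto simp: rho_def)
 have "norm (rhoG s z) = 1/(s^3*Zc)*norm (rkG s z)" using Z by (simp add: rhoG_def)
 also have "\<dots> <= 1/(s^3*Zc)*(4*(s * sqrt s)*indicator (supp s) z)"
  using kernel_le_supp(2)[OF s(1), of z] Z by (intro mult_left_mono) auto
 also have "\<dots> = 4/(Zc*(s * sqrt s))*indicator (supp s) z"
 proof -
  have "s^3 = s * sqrt s*(s * sqrt s)" using s by (simp add: power3_eq_cube)
  thus ?thesis using s Zc_pos by (simp add: field_simps)
 qed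
 finally show "norm (rhoG s z) <= 4/(Zc*(s * sqrt s))*indicator (supp s) z" .
 show "(TI z. rho s (x - z)) = 1"
  using integral_torus_minus[OF rho_measurable C1per_per[OF C1per_rho[OF s(2)]], of x] i1 by simp
qed

definition moll :: "real => (real^2 => real) => real^2 => real" where
 "moll s f x = (TI z. f z*rho s (x - z))"

lemma moll_eq:
 assumes [measurable]: "f \<in> bmeas" and f: "per f" and s: "s <= 1/16"
 shows "moll s f x = (TI z. rho s z*f (x - z))"
proof -
 have p: "per (\<lambda>z. f z*rho s (x - z))"
  using f per_shift(3)[OF C1per_per[OF C1per_rho[OF s]], of x] by (simp add: per_def)
 have "moll s f x = (TI z. (\<lambda>z. f z*rho s (x - z)) (x - z))"
  unfolding moll_def by (rule integral_torus_minus[OF _ p, symmetric]) simp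
 thus ?thesis by (simp add: mult.commute)
qed

lemma per_moll: "s <= 1/16 ==> per (moll s f)"
proof -
 assume s: "s <= 1/16"
 have "rho s (x + axis 1 1 - z) = rho s (x - z)" "rho s (x + axis 2 1 - z) = rho s (x - z)" for x z
  using C1per_per[OF C1per_rho[OF s]] unfolding per_def by (metis add_diff_eq add.commute)+
 thus ?thesis by (simp add: per_def moll_def)
qed

lemma moll_measurable [measurable]: assumes [measurable]: "f \<in> bmeas" shows "moll s f \<in> bmeas"
proof -
 have "(\<lambda>x. TI z. f z*rho s (x - z)) \<in> borel_measurable torus"
  by (rule torus.borel_measurable_lebesgue_integral) measurable
 thus ?thesis unfolding moll_def[abs_def] measurable_cong_sets[OF sets_torus refl] .
qed

text \<open>Splitting \<open>rho\<close> into two square roots, Cauchy--Schwarz gives Jensen's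
  inequality for the probability density \<open>rho s\<close>. Tonelli then bounds the error by the
  \<open>L^2\<close> modulus of continuity at the radius \<open>sqrt s\<close> of the
  support.\<close>

lemma moll_L2:
 assumes f: "L2f f" and s: "0 < s" "s <= 1/16"
  and e: "\<And>y. norm y < sqrt s ==> nsq (\<lambda>x. f (y + x) - f x) <= e"
 shows "L2f (\<lambda>x. moll s f x - f x)" "nsq (\<lambda>x. moll s f x - f x) <= e"
proof -
 note [measurable] = L2f_meas[OF f]
 note r = rho_facts[OF s]
 have e0: "0 <= e" using e[of 0] s by (simp add: order_trans[OF nsq_nonneg])
 define D where "D x z = f (x - z) - f x" for x z
 have [measurable]: "(\<lambda>(x, z). D x z) \<in> borel_measurable (borel \<Otimes>\<^sub>M borel)" unfolding D_def by measurable
 have DL: "L2f (D x)" for x unfolding D_def[abs_def] by (intro L2f_diff L2f_shift(3)[OF f] L2f_const)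
 have ir: "tint (\<lambda>z. rho s z*g z)" if "tint g" for g
  by (rule Bochner_Integration.integrable_bound[OF integrable_mult_right[OF that, of "1/(Zc * s)"]])
   (use r(1) that order_trans[OF r(2) abs_ge_self] in \<open>auto simp: abs_mult simp del: abs_divide times_divide_eq_left intro!: AE_I2 mult_right_mono\<close>)
 have sq: "(moll s f x - f x)^2 <= (TI z. rho s z*(D x z)^2)" for x
 proof -
  have "moll s f x - f x = (TI z. rho s z*f (x - z)) - (TI z. rho s z*f x)"
   using r(3) by (simp add: moll_eq[OF _ L2f_per[OF f] s(2)])
  also have "\<dots> = (TI z. rho s z*D x z)"
   using ir[OF L2f_integrable[OF L2f_shift(3)[OF f, of x]]] r(4) by (simp add: D_def right_diff_distrib)
  also have "\<dots> = (TI z. sqrt (rho s z)*(sqrt (rho s z)*D x z))"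
   using r(1) by (intro tcong) (auto simp: mult.assoc[symmetric])
  finally have eq: "moll s f x - f x = (TI z. sqrt (rho s z)*(sqrt (rho s z)*D x z))" .
  have [measurable]: "D x \<in> bmeas" by (rule L2f_meas[OF DL])
  have "\<bar>moll s f x - f x\<bar> <= sqrt (TI z. (sqrt (rho s z))^2) * sqrt (TI z. (sqrt (rho s z)*D x z)^2)"
   unfolding eq by (rule Cauchy_Schwarz_integral)
    (use r(1,4) ir[OF L2f_sq[OF DL[of x]]] in \<open>auto simp: power_mult_distrib\<close>)
  also have "\<dots> = sqrt (TI z. rho s z*(D x z)^2)" using r(1,3) by (simp add: power_mult_distrib)
  finally have "\<bar>moll s f x - f x\<bar>^2 <= (sqrt (TI z. rho s z*(D x z)^2))^2" by (rule power_mono) simp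
  thus ?thesis using r(1) by simp
 qed
 have zb: "rho s z*nsq (\<lambda>x. D x z) <= rho s z*e" for z
 proof (cases "rho s z = 0")
  case False
  hence "norm (- pr z) < sqrt s" using r(5) by simp
  moreover have "D x z = f (- pr z + x) - f x" for x
   using per_ivec[OF L2f_per[OF f], of "x - z" "rnd z"] by (simp add: D_def pr_def algebra_simps)
  ultimately show ?thesis using e[of "- pr z"] r(1) by (auto intro!: mult_left_mono)
 qed simp
 have Lz: "L2f (\<lambda>x. D x z)" for z unfolding D_def by (intro L2f_diff L2f_shift(5)[OF f] f)
 have "(\<integral>\<^sup>+x. ennreal ((moll s f x - f x)^2) \<partial>torus) <= (\<integral>\<^sup>+x. \<integral>\<^sup>+z. ennreal (rho s z*(D x z)^2) \<partial>torus \<partial>torus)"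
 proof (rule nn_integral_mono)
  fix x
  have "(\<integral>\<^sup>+z. ennreal (rho s z*(D x z)^2) \<partial>torus) = ennreal (TI z. rho s z*(D x z)^2)"
   by (rule nn_integral_eq_integral) (use ir[OF L2f_sq[OF DL[of x]]] r(1) in auto)
  thus "ennreal ((moll s f x - f x)^2) <= (\<integral>\<^sup>+z. ennreal (rho s z*(D x z)^2) \<partial>torus)"
   using sq[of x] by (simp add: ennreal_leI)
 qed
 also have "\<dots> = (\<integral>\<^sup>+z. \<integral>\<^sup>+x. ennreal (rho s z*(D x z)^2) \<partial>torus \<partial>torus)"
  by (rule torus_pair.Fubini') (simp add: case_prod_beta')
 also have "\<dots> <= (\<integral>\<^sup>+z. ennreal (rho s z*e) \<partial>torus)"
 proof (rule nn_integral_mono)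
  fix z
  have "(\<integral>\<^sup>+x. ennreal (rho s z*(D x z)^2) \<partial>torus) = ennreal (rho s z*nsq (\<lambda>x. D x z))"
   unfolding nsq_def integral_mult_right_zero[symmetric]
   by (rule nn_integral_eq_integral) (use L2f_sq[OF Lz] r(1) in auto)
  thus "(\<integral>\<^sup>+x. ennreal (rho s z*(D x z)^2) \<partial>torus) <= ennreal (rho s z*e)"
   using zb[of z] by (simp add: ennreal_leI)
 qed
 also have "\<dots> = ennreal (TI z. rho s z*e)"
  by (rule nn_integral_eq_integral) (use r(1,4) e0 in auto)
 also have "\<dots> = ennreal e" using r(3) by simp
 finally have fin: "(\<integral>\<^sup>+x. ennreal ((moll s f x - f x)^2) \<partial>torus) <= ennreal e" .
 note R = nn_integral_finite_le[OF _ _ fin e0]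
 have "per (\<lambda>x. moll s f x - f x)" using per_moll[OF s(2), of f] L2f_per[OF f] by (simp add: per_def)
 thus "L2f (\<lambda>x. moll s f x - f x)" using R(1) by (auto simp: L2f_def)
 show "nsq (\<lambda>x. moll s f x - f x) <= e" using R(2) by (simp add: nsq_def)
qed

section \<open>The Biot--Savart law\<close>

text \<open>Carries the constant explicitly, unlike \<open>Linf\<close>, since the argument depends
  on its uniformity in time and along the sequence.\<close>

definition bdd :: "real => (real^2 => real) => bool" where
 "bdd C f \<longleftrightarrow> per f \<and> f \<in> bmeas \<and> (AE x in torus. \<bar>f x\<bar> <= C)"

lemma bddD: assumes "bdd C f" shows bdd_per: "per f" and bdd_meas: "f \<in> bmeas"
 and bdd_AE: "AE x in torus. \<bar>f x\<bar> <= C"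
 using assms by (auto simp: bdd_def)

lemma bdd_L2f: "bdd C f ==> L2f f" and bdd_nsq: "bdd C f ==> nsq f <= C^2"
 using L2f_bounded[of f C] unfolding bdd_def by blast+

lemma bdd_nonneg: assumes "bdd C f" shows "0 <= C"
proof -
 have "AE x in torus. 0 <= C" using bdd_AE[OF assms] by eventually_elim auto
 thus ?thesis by simp
qed

lemma bdd_diff: "bdd C f ==> bdd D g ==> bdd (C + D) (\<lambda>x. f x - g x)"
proof -
 assume f: "bdd C f" and g: "bdd D g"
 note [measurable] = bdd_meas[OF f] bdd_meas[OF g]
 have "AE x in torus. \<bar>f x - g x\<bar> <= C + D"
  using bdd_AE[OF f] bdd_AE[OF g] by eventually_elim linarith
 thus ?thesis using bdd_per[OF f] bdd_per[OF g] by (simp add: bdd_def per_def)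
qed

lemma bdd_mono: "bdd C f ==> C <= D ==> bdd D f"
proof -
 assume f: "bdd C f" and CD: "C <= D"
 have "AE x in torus. \<bar>f x\<bar> <= D" using bdd_AE[OF f] by eventually_elim (use CD in linarith)
 thus ?thesis using f by (simp add: bdd_def)
qed

lemma bdd_mean: assumes "bdd C f" shows "\<bar>TI x. f x\<bar> <= C"
proof -
 note [measurable] = bdd_meas[OF assms]
 have "\<bar>TI x. f x\<bar> <= (TI x. \<bar>f x\<bar>)" by (rule integral_abs_bound)
 also have "\<dots> <= (TI x. C)"
  by (rule integral_mono_AE) (use bdd_AE[OF assms] L2f_integrable[OF bdd_L2f[OF assms]] in auto)
 also have "\<dots> = C" using torus.prob_space by simp
 finally show ?thesis .
qed

lemma Linf_bdd: assumes "Linf f" "AE x in lborel. \<bar>f x\<bar> <= C" shows "bdd C f"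
 using assms AE_torusI[OF assms(2)] by (simp add: bdd_def Linf_def)

lemma sq_k_ge_1: assumes "k \<noteq> 0" shows "(of_int (fst k))^2 + (of_int (snd k))^2 >= (1::real)"
proof -
 have "0 < (fst k)^2 + (snd k)^2" using assms by (cases k) (auto simp: sum_power2_gt_zero_iff zero_prod_def)
 hence "1 <= (fst k)^2 + (snd k)^2" by simp
 hence "(1::real) <= of_int ((fst k)^2 + (snd k)^2)" by (metis of_int_1_le_iff)
 thus ?thesis by simp
qed

definition mean :: "(real^2 => real) => real" where "mean w = (TI x. w x)"

lemma L2field_component: assumes "L2field v" shows "L2f (v $$ j)"
proof -
 have [measurable]: "v \<in> bmeas" using assms by (simp add: L2field_def)
 have i: "tint (\<lambda>x. (norm (v x))^2)"
  using assms by (subst set_integrable_cell_iff[symmetric]) (auto simp: L2field_def)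
 have "tint (\<lambda>x. (v x $ j)^2)"
 proof (rule Bochner_Integration.integrable_bound[OF i])
  have "(v x $ j)^2 <= (norm (v x))^2" for x
   using power_mono[OF component_le_norm_cart[of "v x" j], of 2] by simp
  thus "AE x in torus. norm ((v x $ j)^2) <= norm ((norm (v x))^2)" by simp
 qed simp
 thus ?thesis using assms by (auto simp: L2f_def L2field_def per_def)
qed

section \<open>The velocity of a square-integrable vorticity\<close>

context
 fixes w :: "real^2 => real" and u :: "real^2 => real^2"
 assumes BS: "biot_savart w u" and w: "L2f w"
begin

lemma u_meas: "u \<in> bmeas"
 using BS by (simp add: biot_savart_def L2field_def)

lemma bs_L2f: "L2f (u $$ j)"
 using BS by (auto simp: biot_savart_def intro: L2field_component)

lemma bs_mean_zero: "(TI x. u x $ j) = 0"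
proof -
 note [measurable] = u_meas
 have iu: "tint u"
 proof (rule Bochner_Integration.integrable_bound[of _ "\<lambda>x. \<bar>u x $ 1\<bar> + \<bar>u x $ 2\<bar>"])
  show "AE x in torus. norm (u x) <= norm (\<bar>u x $ 1\<bar> + \<bar>u x $ 2\<bar>)"
   using norm_le_l1_cart[of "u _"] by (auto simp: UNIV_2_eq)
 qed (use bs_L2f L2f_integrable in auto)
 have "(TI x. u x) = 0" using BS by (simp add: biot_savart_def LINT_cell_eq)
 moreover have "(TI x. u x \<bullet> axis j 1) = (TI x. u x) \<bullet> axis j 1"
  using iu by simp
 ultimately show ?thesis by (simp add: inner_axis)
qed

lemma bs_int: "C1per g G ==> tint (\<lambda>x. u x $ i*G x $ j)"
 by (rule L2f_mult[OF bs_L2f C1per_L2f(2)])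

lemma bs_div: assumes g: "C1per g G" shows "(TI x. u x $ 1*G x $ 1) + (TI x. u x $ 2*G x $ 2) = 0"
proof -
 note [measurable] = u_meas C1per_measG[OF g]
 have "(LINT x:cell|lborel. u x \<bullet> G x) = 0" using BS g unfolding biot_savart_def by blast
 hence "(TI x. u x $ 1*G x $ 1 + u x $ 2*G x $ 2) = 0" by (subst (asm) LINT_cell_eq) (auto simp: inner_real2)
 thus ?thesis by (simp add: bs_int[OF g])
qed

lemma bs_curl: assumes g: "C1per g G"
 shows "(TI x. u x $ 1*G x $ 2) - (TI x. u x $ 2*G x $ 1) = (TI x. (w x - mean w)*g x)"
proof -
 note [measurable] = u_meas C1per_measG[OF g] C1per_meas[OF g] L2f_meas[OF w]
 have "(LINT x:cell|lborel. u x $ 1*G x $ 2 - u x $ 2*G x $ 1) = (LINT x:cell|lborel. (w x - (LINT y:cell|lborel. w y))*g x)"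
  using BS g unfolding biot_savart_def by blast
 hence "(TI x. u x $ 1*G x $ 2 - u x $ 2*G x $ 1) = (TI x. (w x - mean w)*g x)"
  by (simp add: LINT_cell_eq mean_def)
 thus ?thesis by (simp add: bs_int[OF g])
qed

lemma bs_fourier_0: "fourier (u $$ j) 0 = 0"
 by (simp add: complex_eq_iff fourier_parts[OF bs_L2f] bs_mean_zero)

lemma mean_mult: "C1per g G ==> (TI x. (w x - mean w)*g x) = (TI x. w x*g x) - mean w*(TI x. g x)"
proof -
 assume g: "C1per g G"
 show ?thesis unfolding left_diff_distrib
  using L2f_mult[OF w C1per_L2f(1)[OF g]] L2f_integrable[OF C1per_L2f(1)[OF g]] by simp
qed

lemma integral_trig_zero: assumes "k \<noteq> 0" shows "(TI x. cos (ph k x)) = 0" "(TI x. sin (ph k x)) = 0"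
proof -
 have i: "tint (\<lambda>x. cis (ph k x))" by (rule integrable_torus_bounded[where C=1]) auto
 show "(TI x. cos (ph k x)) = 0" "(TI x. sin (ph k x)) = 0"
  using integral_Re[OF i] integral_Im[OF i] integral_cis_ph[of k] assms by auto
qed

text \<open>Testing divergence and curl with \<open>cos (ph k x)\<close> and
  \<open>sin (ph k x)\<close> gives four real equations for the four real coefficients of the mode.
  Each is solved by eliminating one unknown through the divergence relation, which produces
  \<open>K\<close>, the squared length of \<open>k\<close>.\<close>

lemma bs_fourier:
 assumes k: "k \<noteq> 0" and K_eq: "K = (of_int (fst k))^2 + (of_int (snd k))^2"
 shows "fourier (u $$ 1) k = \<i> * of_real (of_int (snd k)/(2*pi*K))*fourier w k"
  and "fourier (u $$ 2) k = - \<i> * of_real (of_int (fst k)/(2*pi*K))*fourier w k"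
proof -
 define k1 k2 :: real where "k1 = of_int (fst k)" and "k2 = of_int (snd k)"
 have K: "K > 0" using sq_k_ge_1[OF k] unfolding K_eq by linarith
 have KE: "K = k1^2 + k2^2" by (simp add: K_eq k1_def k2_def)
 let ?a1 = "Re (fourier (u $$ 1) k)" and ?b1 = "Im (fourier (u $$ 1) k)"
 let ?a2 = "Re (fourier (u $$ 2) k)" and ?b2 = "Im (fourier (u $$ 2) k)"
 have cs: "(TI x. u x $ i*((- sin (ph k x)) *\<^sub>R ((2*pi) *\<^sub>R ivec k)) $ j) = - (2*pi*ivec k $ j)*(TI x. u x $ i * sin (ph k x))" for i j
  unfolding integral_mult_right_zero[symmetric] by (rule tcong) (simp_all add: algebra_simps)
 have sn: "(TI x. u x $ i*(cos (ph k x) *\<^sub>R ((2*pi) *\<^sub>R ivec k)) $ j) = (2*pi*ivec k $ j)*(TI x. u x $ i*cos (ph k x))" for i j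
  unfolding integral_mult_right_zero[symmetric] by (rule tcong) (simp_all add: algebra_simps)
 note kk = ivec_nth k1_def[symmetric] k2_def[symmetric]
 define A where "A i = (TI x. u x $ i*cos (ph k x))" for i
 define B where "B i = (TI x. u x $ i * sin (ph k x))" for i
 define Wc where "Wc = (TI x. w x*cos (ph k x))"
 define Ws where "Ws = (TI x. w x * sin (ph k x))"
 have P: "?a1 = A 1" "?b1 = - B 1" "?a2 = A 2" "?b2 = - B 2" "Re (fourier w k) = Wc" "Im (fourier w k) = - Ws"
  by (simp_all only: fourier_parts[OF bs_L2f] fourier_parts[OF w] A_def B_def Wc_def Ws_def)
 note cs' = cs[folded B_def] and sn' = sn[folded A_def]
 have e1: "2*pi*(k1*?b1 + k2*?b2) = 0"
  using bs_div[OF C1per_cos_ph[of k]] unfolding cs' kk P by (simp add: algebra_simps)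
 have e2: "2*pi*(k1*?a1 + k2*?a2) = 0"
  using bs_div[OF C1per_sin_ph[of k]] unfolding sn' kk P by (simp add: algebra_simps)
 have e3: "2*pi*(k2*?b1 - k1*?b2) = Re (fourier w k)"
  using bs_curl[OF C1per_cos_ph[of k]]
  unfolding cs' kk P mean_mult[OF C1per_cos_ph[of k]] integral_trig_zero[OF k] Wc_def[symmetric] by (simp add: algebra_simps)
 have e4: "2*pi*(k2*?a1 - k1*?a2) = - Im (fourier w k)"
  using bs_curl[OF C1per_sin_ph[of k]]
  unfolding sn' kk P mean_mult[OF C1per_sin_ph[of k]] integral_trig_zero[OF k] Ws_def[symmetric] by (simp add: algebra_simps)
 have e1': "k1*?b1 + k2*?b2 = 0" and e2': "k1*?a1 + k2*?a2 = 0" using e1 e2 by auto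
 have i1: "2*pi*K*?b1 = k2 * Re (fourier w k)"
 proof -
  have "k2 * Re (fourier w k) = 2*pi*(k2*(k2*?b1) - k1*(k2*?b2))"
   using arg_cong[OF e3, of "\<lambda>t. k2*t"] by (simp add: algebra_simps)
  also have "k2*?b2 = - (k1*?b1)" using e1' by linarith
  finally show ?thesis unfolding KE by (simp add: power2_eq_square algebra_simps)
 qed
 have i2: "2*pi*K*?a1 = - k2*Im (fourier w k)"
 proof -
  have "- k2*Im (fourier w k) = 2*pi*(k2*(k2*?a1) - k1*(k2*?a2))"
   using arg_cong[OF e4, of "\<lambda>t. k2*t"] by (simp add: algebra_simps)
  also have "k2*?a2 = - (k1*?a1)" using e2' by linarith
  finally show ?thesis unfolding KE by (simp add: power2_eq_square algebra_simps)
 qed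
 have i3: "2*pi*K*?b2 = - k1 * Re (fourier w k)"
 proof -
  have "- k1 * Re (fourier w k) = 2*pi*(k1*(k1*?b2) - k2*(k1*?b1))"
   using arg_cong[OF e3, of "\<lambda>t. k1*t"] by (simp add: algebra_simps)
  also have "k1*?b1 = - (k2*?b2)" using e1' by linarith
  finally show ?thesis unfolding KE by (simp add: power2_eq_square algebra_simps)
 qed
 have i4: "2*pi*K*?a2 = k1*Im (fourier w k)"
 proof -
  have "k1*Im (fourier w k) = 2*pi*(k1*(k1*?a2) - k2*(k1*?a1))"
   using arg_cong[OF e4, of "\<lambda>t. k1*t"] by (simp add: algebra_simps)
  also have "k1*?a1 = - (k2*?a2)" using e2' by linarith
  finally show ?thesis unfolding KE by (simp add: power2_eq_square algebra_simps)
 qed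
 have p: "2*pi*K > 0" using K by simp
 have p': "2*pi*K \<noteq> 0" using p by linarith
 have div: "a = b/(2*pi*K)" if "2*pi*K*a = b" for a b
  unfolding that[symmetric] by (rule nonzero_mult_div_cancel_left[OF p', symmetric])
 show "fourier (u $$ 1) k = \<i> * of_real (of_int (snd k)/(2*pi*K))*fourier w k"
  using div[OF i1] div[OF i2] by (simp add: complex_eq_iff k2_def)
 show "fourier (u $$ 2) k = - \<i> * of_real (of_int (fst k)/(2*pi*K))*fourier w k"
  using div[OF i3] div[OF i4] by (simp add: complex_eq_iff k1_def)
qed

text \<open>The gain of one derivative from vorticity to velocity, in a division-free form that
  includes the zero mode: only \<open>w - mean w\<close> generates velocity.\<close>

lemma bs_fourier_norm:
 "4*pi^2*((of_int (fst k))^2 + (of_int (snd k))^2)*((fr2 u k))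
  = (if k = 0 then 0 else (norm (fourier w k))^2)"
proof (cases "k = 0")
 case True thus ?thesis by simp
next
 case False
 define K :: real where "K = (of_int (fst k))^2 + (of_int (snd k))^2"
 have K: "K > 0" using sq_k_ge_1[OF False] by (simp add: K_def)
 have n: "(fr2 u k) = K/(2*pi*K)^2*(norm (fourier w k))^2"
 proof -
  have "(fr2 u k)
   = ((of_int (snd k))^2/(2*pi*K)^2)*(norm (fourier w k))^2 + ((of_int (fst k))^2/(2*pi*K)^2)*(norm (fourier w k))^2"
   unfolding bs_fourier[OF False K_def] norm_mult power_mult_distrib[of "norm _"] norm_of_real power2_abs
   by (simp add: power_divide power_mult_distrib)
  thus ?thesis by (simp add: K_def add_divide_distrib distrib_right)
 qed
 show ?thesis unfolding n K_def[symmetric] using K False by (simp add: power2_eq_square)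
qed

lemma bs_fourier_le: "(fr2 u k) <= (norm (fourier w k))^2"
proof (cases "k = 0")
 case True thus ?thesis by (simp add: bs_fourier_0)
next
 case False
 let ?N = "(fr2 u k)"
 have "1*1 <= (4*pi^2)*((of_int (fst k))^2 + (of_int (snd k))^2)"
  using sq_k_ge_1[OF False] power_mono[OF less_imp_le[OF pi_gt3], of 2] by (intro mult_mono) auto
 hence "1*?N <= 4*pi^2*((of_int (fst k))^2 + (of_int (snd k))^2)*?N" by (intro mult_right_mono) auto
 thus ?thesis using bs_fourier_norm[of k] False by simp
qed

lemma bs_nsq_lim: "(\<lambda>n. \<Sum>k\<in>Bx n. (fr2 u k))
  \<longlonglongrightarrow> (nsq2 u)"
 unfolding sum.distrib by (intro tendsto_add parseval bs_L2f)

lemma bs_nsq: "(nsq2 u) <= nsq w"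
 by (rule LIMSEQ_le[OF bs_nsq_lim parseval[OF w]], rule exI[of _ 0], intro allI impI sum_mono bs_fourier_le)

lemma bs_nsq_le: "nsq (u $$ j) <= nsq w"
proof -
 have "j = 1 \<or> j = 2" by (rule exhaust_2)
 thus ?thesis using bs_nsq nsq_nonneg[of "\<lambda>x. u x $ 1"] nsq_nonneg[of "\<lambda>x. u x $ 2"] by (elim disjE) (simp_all del: nsq_nonneg)
qed

text \<open>The velocity is in \<open>H^1\<close>: the bound \<open>|cis a - 1| <= |a|\<close> costs
  one factor of the frequency, which is exactly what \<open>bs_fourier_norm\<close> gains.\<close>

lemma bs_translation:
 "nsq (\<lambda>x. u (y + x) $ j - u x $ j) <= (norm y)^2*nsq w"
proof -
 have c: "fourier (\<lambda>x. u (y + x) $ j - u x $ j) k = (cis (ph k y) - 1)*fourier (u $$ j) k" for k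
  using fourier_diff[OF L2f_shift(1)[OF bs_L2f[of j], of y] bs_L2f[of j], of k] fourier_shift[OF bs_L2f[of j], of y k] by (simp add: left_diff_distrib)
 have L: "L2f (\<lambda>x. u (y + x) $ j - u x $ j)" by (intro L2f_diff bs_L2f L2f_shift(1)[OF bs_L2f[of j]])
 have b: "(norm (fourier (\<lambda>x. u (y + x) $ j - u x $ j) k))^2 <= (norm y)^2*(norm (fourier w k))^2" for k
 proof (cases "k = 0")
  case True thus ?thesis by (simp add: c)
 next
  case False
  let ?N = "(fr2 u k)"
  let ?K = "(of_int (fst k))^2 + (of_int (snd k))^2 :: real"
  have "(norm (cis (ph k y) - 1))^2 <= \<bar>ph k y\<bar>^2" by (intro power_mono cis_minus_1_le) auto
  also have "\<dots> <= (norm ((2*pi) *\<^sub>R ivec k)*norm y)^2"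
   unfolding ph_inner by (intro power_mono Cauchy_Schwarz_ineq2) auto
  also have "\<dots> = 4*pi^2*?K*(norm y)^2"
  proof -
   have "(norm (ivec k))^2 = ?K" unfolding power2_norm_eq_inner inner_real2 by (simp add: power2_eq_square)
   thus ?thesis by (simp add: power_mult_distrib)
  qed
  finally have 1: "(norm (cis (ph k y) - 1))^2 <= 4*pi^2*?K*(norm y)^2" .
  have "(norm (fourier (u $$ j) k))^2 <= ?N" using exhaust_2[of j] by auto
  hence "(norm (fourier (\<lambda>x. u (y + x) $ j - u x $ j) k))^2 <= 4*pi^2*?K*(norm y)^2*?N"
   unfolding c norm_mult power_mult_distrib using 1 by (intro mult_mono) auto
  also have "\<dots> = (norm y)^2*(4*pi^2*?K*?N)" by (simp only: mult_ac)
  finally show ?thesis using bs_fourier_norm[of k] False by simp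
 qed
 show ?thesis
 proof (rule LIMSEQ_le[OF parseval[OF L] tendsto_mult_left[OF parseval[OF w]]])
  show "\<exists>N. \<forall>n\<ge>N. (\<Sum>k\<in>Bx n. (norm (fourier (\<lambda>x. u (y + x) $ j - u x $ j) k))^2) <= (norm y)^2*(\<Sum>k\<in>Bx n. (norm (fourier w k))^2)"
   unfolding sum_distrib_left by (auto intro!: sum_mono b)
 qed
qed

lemma bs_moll_L2:
 assumes s: "0 < s" "s <= 1/16"
 shows "nsq (\<lambda>x. moll s (u $$ j) x - u x $ j) <= s*nsq w" "L2f (\<lambda>x. moll s (u $$ j) x - u x $ j)"
proof -
 have t: "nsq (\<lambda>x. u (y + x) $ j - u x $ j) <= s*nsq w" if "norm y < sqrt s" for y
 proof -
  have "(norm y)^2 <= (sqrt s)^2" using that by (intro power_mono) auto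
  hence "(norm y)^2*nsq w <= s*nsq w" using s by (intro mult_right_mono) auto
  thus ?thesis using bs_translation[of y j] by linarith
 qed
 show "nsq (\<lambda>x. moll s (u $$ j) x - u x $ j) <= s*nsq w" "L2f (\<lambda>x. moll s (u $$ j) x - u x $ j)"
  using moll_L2[OF bs_L2f[of j] s t] by auto
qed

end

lemma biot_savart_diff:
 assumes "biot_savart w1 u1" "L2f w1" "biot_savart w2 u2" "L2f w2"
 shows "biot_savart (\<lambda>x. w1 x - w2 x) (\<lambda>x. u1 x - u2 x)"
proof -
 note [measurable] = u_meas[OF assms(1,2)] u_meas[OF assms(3,4)] L2f_meas[OF assms(2)] L2f_meas[OF assms(4)]
 note L = bs_L2f[OF assms(1,2)] bs_L2f[OF assms(3,4)]
 have i: "tint (\<lambda>x. (norm (u1 x - u2 x))^2)"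
  unfolding power2_norm_eq_inner inner_real2 power2_eq_square[symmetric]
  by (intro Bochner_Integration.integrable_add) (auto intro!: L2f_sq[OF L2f_diff[OF L]])
 have "L2field (\<lambda>x. u1 x - u2 x)"
  using assms(1,3) i unfolding L2field_def biot_savart_def
  by (auto simp: set_integrable_cell_iff per_def)
 moreover have "(LINT x:cell|lborel. u1 x - u2 x) = 0"
 proof (subst LINT_cell_eq)
  have iu: "tint u" if "biot_savart w u" "L2f w" for w u
  proof (rule Bochner_Integration.integrable_bound[of _ "\<lambda>x. \<bar>u x $ 1\<bar> + \<bar>u x $ 2\<bar>"])
   show "AE x in torus. norm (u x) <= norm (\<bar>u x $ 1\<bar> + \<bar>u x $ 2\<bar>)"
    using norm_le_l1_cart[of "u _"] by (auto simp: UNIV_2_eq)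
   show "u \<in> borel_measurable torus" using u_meas[OF that] by simp
  qed (use bs_L2f[OF that] L2f_integrable in auto)
  have "(TI x. u1 x) = 0" "(TI x. u2 x) = 0"
   using assms(1,3) by (auto simp: biot_savart_def LINT_cell_eq)
  thus "(TI x. u1 x - u2 x) = 0" using iu[OF assms(1,2)] iu[OF assms(3,4)] by simp
 qed simp
 moreover have "(LINT x:cell|lborel. (u1 x - u2 x) \<bullet> G x) = 0 \<and>
   (LINT x:cell|lborel. (u1 x - u2 x) $ 1*G x $ 2 - (u1 x - u2 x) $ 2*G x $ 1) =
   (LINT x:cell|lborel. (w1 x - w2 x - (LINT y:cell|lborel. w1 y - w2 y))*g x)" if g: "C1per g G" for g G
 proof -
  note [measurable] = C1per_meas[OF g] C1per_measG[OF g]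
  note ints = bs_int[OF assms(1,2) g] bs_int[OF assms(3,4) g]
  have 1: "(TI x. (u1 x - u2 x) $ 1*G x $ 1 + (u1 x - u2 x) $ 2*G x $ 2) = 0"
   using bs_div[OF assms(1,2) g] bs_div[OF assms(3,4) g] ints by (simp add: left_diff_distrib)
  have iw: "tint (\<lambda>x. (w x - mean w)*g x)" if "L2f w" for w
   by (rule L2f_mult[OF L2f_diff[OF that L2f_const] C1per_L2f(1)[OF g]])
  have m: "mean (\<lambda>x. w1 x - w2 x) = mean w1 - mean w2"
   unfolding mean_def using assms by (simp add: L2f_integrable)
  have "(TI x. (w1 x - w2 x - mean (\<lambda>x. w1 x - w2 x))*g x) = (TI x. (w1 x - mean w1)*g x - (w2 x - mean w2)*g x)"
   unfolding m by (rule tcong) (auto simp: algebra_simps)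
  also have "\<dots> = (TI x. (u1 x - u2 x) $ 1*G x $ 2 - (u1 x - u2 x) $ 2*G x $ 1)"
   using bs_curl[OF assms(1,2) g] bs_curl[OF assms(3,4) g] ints iw assms by (simp add: left_diff_distrib)
  finally have 2: "(TI x. (u1 x - u2 x) $ 1*G x $ 2 - (u1 x - u2 x) $ 2*G x $ 1) = (TI x. (w1 x - w2 x - mean (\<lambda>x. w1 x - w2 x))*g x)" by simp
  show ?thesis using 1 2 by (simp add: LINT_cell_eq inner_real2 mean_def)
 qed
 ultimately show ?thesis unfolding biot_savart_def by blast
qed

text \<open>The modes outside \<open>Bx n\<close> gain a factor \<open>1/n^2\<close>.\<close>
lemma biot_savart_compact:
 assumes BS: "\<And>n. biot_savart (f n) (v n)" and f: "\<And>n. bdd C (f n)"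
  and lim: "\<And>k. k \<noteq> 0 ==> (\<lambda>n. fourier (f n) k) \<longlonglongrightarrow> 0"
 shows "(\<lambda>n. (nsq2 (v n))) \<longlonglongrightarrow> 0"
proof -
 note L = bdd_L2f[OF f]
 define N where "N n k = (fr2 (v n) k)" for n k
 have Nle: "N n k <= (if k = 0 then 0 else (norm (fourier (f n) k))^2)" for n k
  using bs_fourier_le[OF BS[of n] L[of n], of k] bs_fourier_0[OF BS[of n] L[of n]] by (auto simp: N_def)
 have Nhigh: "N n k <= (norm (fourier (f n) k))^2/(real m)^2" if "k \<notin> Bx m" "m > 0" for n k m
 proof -
  have k0: "k \<noteq> 0" using that by (auto simp: Bx_def zero_prod_def)
  have "int m <= \<bar>fst k\<bar> \<or> int m <= \<bar>snd k\<bar>" using that by (cases k) (auto simp: Bx_def)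
  hence "real m <= \<bar>of_int (fst k)\<bar> \<or> real m <= \<bar>of_int (snd k)\<bar>" by linarith
  hence "(real m)^2 <= (of_int (fst k))^2 + (of_int (snd k))^2"
   using power_mono[of "real m" "\<bar>of_int (fst k)\<bar>" 2] power_mono[of "real m" "\<bar>of_int (snd k)\<bar>" 2]
   by (auto intro: add_increasing add_increasing2)
  hence "1*(real m)^2 <= 4*pi^2*((of_int (fst k))^2 + (of_int (snd k))^2)"
   using power_mono[OF less_imp_le[OF pi_gt3], of 2] by (intro mult_mono) auto
  hence "(real m)^2*N n k <= 4*pi^2*((of_int (fst k))^2 + (of_int (snd k))^2)*N n k"
   by (intro mult_right_mono) (auto simp: N_def)
  hence "(real m)^2*N n k <= (norm (fourier (f n) k))^2"
   using bs_fourier_norm[OF BS[of n] L[of n], of k] k0 by (simp add: N_def)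
  thus ?thesis using that by (simp add: field_simps)
 qed
 have bound: "(nsq2 (v n)) <= (\<Sum>k\<in>Bx m. if k = 0 then 0 else (norm (fourier (f n) k))^2) + C^2/(real m)^2"
  if m: "m > 0" for m n
 proof (rule LIMSEQ_le_const2[OF bs_nsq_lim[OF BS L]])
  show "\<exists>M. \<forall>p\<ge>M. (\<Sum>k\<in>Bx p. (fr2 (v n) k))
    <= (\<Sum>k\<in>Bx m. if k = 0 then 0 else (norm (fourier (f n) k))^2) + C^2/(real m)^2"
  proof (intro exI[of _ m] allI impI)
   fix p assume p: "m <= p"
   have "(\<Sum>k\<in>Bx p. N n k) = (\<Sum>k\<in>Bx p - Bx m. N n k) + (\<Sum>k\<in>Bx m. N n k)"
    by (rule sum.subset_diff[OF Bx_mono[OF p] finite_Bx])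
   also have "(\<Sum>k\<in>Bx m. N n k) <= (\<Sum>k\<in>Bx m. if k = 0 then 0 else (norm (fourier (f n) k))^2)"
    by (intro sum_mono Nle)
   also have "(\<Sum>k\<in>Bx p - Bx m. N n k) <= (\<Sum>k\<in>Bx p - Bx m. (norm (fourier (f n) k))^2/(real m)^2)"
    by (intro sum_mono Nhigh m) auto
   also have "\<dots> <= C^2/(real m)^2"
    unfolding sum_divide_distrib[symmetric]
    by (intro divide_right_mono order_trans[OF bessel[OF L] bdd_nsq[OF f]]) auto
   finally show "(\<Sum>k\<in>Bx p. (fr2 (v n) k))
    <= (\<Sum>k\<in>Bx m. if k = 0 then 0 else (norm (fourier (f n) k))^2) + C^2/(real m)^2"
    by (simp add: N_def)
  qed
 qed
 show ?thesis
 proof (rule LIMSEQ_I)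
  fix e :: real assume e: "e > 0"
  \<comment> \<open>Since \<open>m <= m^2\<close>, this makes the contribution of all modes outside
    \<open>Bx m\<close> smaller than \<open>e/2\<close>, uniformly in \<open>n\<close>.\<close>
  obtain m :: nat where m: "2 * C^2/e + 1 < real m" using reals_Archimedean2 by blast
  have m1: "1 < real m" using m e by (smt (verit) divide_nonneg_pos zero_le_power2)
  hence m0: "m > 0" by simp
  have "real m <= (real m)^2" using m1 by (intro self_le_power) auto
  hence "2 * C^2/e < (real m)^2" using m by linarith
  hence c2: "C^2/(real m)^2 < e/2" using e m0 by (simp add: field_simps)
  have "(\<lambda>n. \<Sum>k\<in>Bx m. if k = 0 then 0 else (norm (fourier (f n) k))^2) \<longlonglongrightarrow> (\<Sum>k\<in>Bx m. 0)"
  proof (rule tendsto_sum)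
   fix k
   show "(\<lambda>n. if k = 0 then 0 else (norm (fourier (f n) k))^2) \<longlonglongrightarrow> 0"
    using tendsto_power[OF tendsto_norm_zero[OF lim[of k]], of 2] by (cases "k = 0") auto
  qed
  hence "eventually (\<lambda>n. (\<Sum>k\<in>Bx m. if k = 0 then 0 else (norm (fourier (f n) k))^2) < e/2) sequentially"
   by (intro order_tendstoD(2)) (use e in auto)
  then obtain N where N: "\<And>n. n >= N ==> (\<Sum>k\<in>Bx m. if k = 0 then 0 else (norm (fourier (f n) k))^2) < e/2"
   by (auto simp: eventually_sequentially)
  show "\<exists>N. \<forall>n\<ge>N. norm ((nsq2 (v n)) - 0) < e"
  proof (intro exI[of _ N] allI impI)
   fix n assume "N <= n"
   from N[OF this] bound[OF m0, of n] c2 have "(nsq2 (v n)) < e" by linarith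
   thus "norm ((nsq2 (v n)) - 0) < e" by simp
  qed
 qed
qed

subsection \<open>Log-Lipschitz regularity of the velocity\<close>

text \<open>The mollifiers satisfy \<open>d/ds rho = div D\<close> with \<open>D\<close> proportional to \<open>dk/s\<^sup>4\<close>, and the
 Biot--Savart relations turn \<open>u*div D\<close> into \<open>(w - mean w)*D\<close>.\<close>

lemma deriv_compare:
 fixes f g :: "real => real"
 assumes ab: "a <= b" and f: "\<And>s. s \<in> {a..b} ==> (f has_real_derivative f' s) (at s within {a..b})"
  and g: "\<And>s. s \<in> {a..b} ==> (g has_real_derivative g' s) (at s within {a..b})"
  and le: "\<And>s. s \<in> {a..b} ==> f' s <= g' s"
 shows "f b - f a <= g b - g a"
proof -
 have "g a - f a <= g b - f b"
 proof (rule DERIV_nonneg_imp_increasing_open[OF ab])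
  fix s assume s: "a < s" "s < b"
  hence "((\<lambda>s. g s - f s) has_real_derivative g' s - f' s) (at s within {a..b})"
   by (intro DERIV_diff f g) auto
  hence "((\<lambda>s. g s - f s) has_real_derivative g' s - f' s) (at s)"
   using s by (simp add: at_within_Icc_at)
  thus "\<exists>y. ((\<lambda>s. g s - f s) has_real_derivative y) (at s) \<and> 0 <= y" using le[of s] s by auto
 next
  show "continuous_on {a..b} (\<lambda>s. g s - f s)"
   by (intro continuous_intros DERIV_continuous_on[OF f] DERIV_continuous_on[OF g])
 qed
 thus ?thesis by linarith
qed

lemma deriv_compare_abs:
 fixes f g :: "real => real"
 assumes ab: "a <= b" and f: "\<And>s. s \<in> {a..b} ==> (f has_real_derivative f' s) (at s within {a..b})"
  and g: "\<And>s. s \<in> {a..b} ==> (g has_real_derivative g' s) (at s within {a..b})"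
  and le: "\<And>s. s \<in> {a..b} ==> \<bar>f' s\<bar> <= g' s"
 shows "\<bar>f b - f a\<bar> <= g b - g a"
proof -
 have "f b - f a <= g b - g a" by (rule deriv_compare[OF ab f g]) (use le abs_le_D1 in auto)
 moreover have "(- f b) - (- f a) <= g b - g a"
  by (rule deriv_compare[OF ab DERIV_minus[OF f] g]) (use le abs_le_D2 in auto)
 ultimately show ?thesis by linarith
qed

lemma integral_le_sqrt_nsq: assumes "L2f f" shows "(TI x. \<bar>f x\<bar>) <= sqrt (nsq f)"
proof -
 have L: "L2f (\<lambda>x. \<bar>f x\<bar>)" using assms by (auto simp: L2f_def per_def)
 have "nsq (\<lambda>x. 1) = 1" using torus.prob_space by (simp add: nsq_def)
 thus ?thesis using L2f_CS[OF L L2f_const[of 1]] by (simp add: nsq_def)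
qed

lemma integral_mult_bound:
 fixes g k :: "real^2 => real"
 assumes g: "AE x in torus. \<bar>g x\<bar> <= C" and [measurable]: "g \<in> bmeas" and k: "tint k"
 shows "\<bar>TI x. g x*k x\<bar> <= C*(TI x. \<bar>k x\<bar>)" "tint (\<lambda>x. g x*k x)"
proof -
 have [measurable]: "k \<in> borel_measurable torus" using k by auto
 have b: "AE x in torus. \<bar>g x*k x\<bar> <= C*\<bar>k x\<bar>"
  using g by eventually_elim (simp add: abs_mult mult_right_mono)
 show i: "tint (\<lambda>x. g x*k x)"
  by (rule Bochner_Integration.integrable_bound[of _ "\<lambda>x. C*\<bar>k x\<bar>"]) (use k b in \<open>auto elim!: eventually_mono\<close>)
 have "\<bar>TI x. g x*k x\<bar> <= (TI x. C*\<bar>k x\<bar>)"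
  by (rule order_trans[OF integral_abs_bound], rule integral_mono_AE) (use k i b in auto)
 thus "\<bar>TI x. g x*k x\<bar> <= C*(TI x. \<bar>k x\<bar>)" by simp
qed

lemma supp_shift_bound:
 assumes s: "0 < s" "s <= 1/16"
 shows "(TI z. indicator (supp s) (x - z)) <= 4 * s" "tint (\<lambda>z. indicat_real (supp s) (x - z))"
proof -
 have p: "per (indicat_real (supp s))"
  using per_pr[of "\<lambda>y. of_bool (norm y < sqrt s)"] by (simp add: supp_def indicator_def[abs_def])
 have "(TI z. indicat_real (supp s) (x - z)) = (TI z. indicat_real (supp s) z)"
  by (rule integral_torus_minus[OF _ p]) simp
 thus "(TI z. indicator (supp s) (x - z)) <= 4 * s" using measure_supp[OF s] by simp
 show "tint (\<lambda>z. indicat_real (supp s) (x - z))"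
  by (rule integrable_torus_bounded[where C=1]) (auto simp: indicator_def)
qed

section \<open>Integrating the mollified velocity over the scale\<close>

context
 fixes w u C
 assumes BS: "biot_savart w u" and w: "bdd C w"
begin

text \<open>With \<open>op\<close>, these encode the rotation by a right angle: component
  \<open>j\<close> of the velocity is paired with the flux of the other index, with a sign.\<close>

private definition "sg j = (if j = (1::2) then 1 else (-1::real))"
private definition "op j = (if j = (1::2) then (2::2) else 1)"

text \<open>The flux is a radial function times \<open>z\<close>, so its Jacobian is symmetric. This
  symmetry lets the divergence relation for one kernel component and the curl relation for the other
  combine into the integral of \<open>u\<close> against the full divergence.\<close>

lemma bs_divergence_kernel:
 assumes s: "s <= 1/16"
 shows "(TI z. u z $ j*(dkG 1 s (x - z) $ 1 + dkG 2 s (x - z) $ 2))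
  = - sg j*(TI z. (w z - mean w)*dk (op j) s (x - z))"
proof -
 note L = bdd_L2f[OF w]
 note c = C1per_shift[OF C1per_dk[OF s], where x=x]
 have sym: "dkG 1 s y $ 2 = dkG 2 s y $ 1" for y by (simp add: dkG_def axis_def)
 define T where "T i k l = (TI z. u z $ i*dkG k s (x - z) $ l)" for i k l
 have int: "tint (\<lambda>z. u z $ i*dkG k s (x - z) $ l)" for i k l
  using bs_int[OF BS L c[of k], of i l] by simp
 have d: "T 1 k 1 + T 2 k 2 = 0" for k
  using bs_div[OF BS L c[of k]] by (simp add: T_def)
 have cu: "- T 1 k 2 + T 2 k 1 = (TI z. (w z - mean w)*dk k s (x - z))" for k
  using bs_curl[OF BS L c[of k]] by (simp add: T_def)
 have s12: "T i 1 2 = T i 2 1" for i by (simp add: T_def sym)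
 have lhs: "(TI z. u z $ j*(dkG 1 s (x - z) $ 1 + dkG 2 s (x - z) $ 2)) = T j 1 1 + T j 2 2"
  using int by (simp add: T_def distrib_left)
 show ?thesis
  using exhaust_2[of j] d[of 1] d[of 2] cu[of 1] cu[of 2] s12[of 1] s12[of 2] unfolding lhs
  by (auto simp: sg_def op_def)
qed

lemma moll_eq_rk: "moll s f x = (TI z. f z*(rk s (x - z)/s^3))/Zc"
proof -
 have "moll s f x = (TI z. (f z*(rk s (x - z)/s^3))/Zc)"
  unfolding moll_def rho_def by (rule tcong) auto
 thus ?thesis by simp
qed

text \<open>The scale derivative of the mollified velocity. Its size is of order
  \<open>s powr (-1/2)\<close>, integrable down to zero, while its Lipschitz constant is of order
  \<open>1/s\<close>; the latter is the source of the logarithm.\<close>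

private definition "V j s x = sg j/(2 * s^4*Zc)*(TI z. (w z - mean w)*dk (op j) s (x - z))"

lemma bs_moll_deriv:
 assumes a: "0 < a" and s: "s \<in> {a..1/16}"
 shows "((\<lambda>s. moll s (u $$ j) x) has_real_derivative V j s x) (at s within {a..1/16})"
proof -
 have i: "tint (u $$ j)" by (rule L2f_integrable[OF bs_L2f[OF BS bdd_L2f[OF w]]])
 have "((\<lambda>s. moll s (u $$ j) x) has_real_derivative
   (TI z. u z $ j*(- (dkG 1 s (x - z) $ 1 + dkG 2 s (x - z) $ 2)/(2 * s^4)))/Zc) (at s within {a..1/16})"
  unfolding moll_eq_rk by (rule DERIV_cdivide[OF integral_rk_deriv[OF i a s]])
 moreover have "(TI z. u z $ j*(- (dkG 1 s (x - z) $ 1 + dkG 2 s (x - z) $ 2)/(2 * s^4)))/Zc = V j s x"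
 proof -
  have "(TI z. u z $ j*(- (dkG 1 s (x - z) $ 1 + dkG 2 s (x - z) $ 2)/(2 * s^4)))
   = (TI z. (- 1/(2 * s^4))*(u z $ j*(dkG 1 s (x - z) $ 1 + dkG 2 s (x - z) $ 2)))"
   by (rule tcong[OF refl])
    (simp only: minus_divide_left[symmetric] times_divide_eq_right mult_minus_left mult_minus_right mult_1 times_divide_eq_left)
  also have "\<dots>/Zc = V j s x"
   using s by (simp only: integral_mult_right_zero bs_divergence_kernel atLeastAtMost_iff V_def) simp
  finally show ?thesis .
 qed
 ultimately show ?thesis by (simp only:)
qed

lemma w_mean_bound: "AE x in torus. \<bar>w x - mean w\<bar> <= 2 * C"
proof -
 have m: "\<bar>mean w\<bar> <= C" using bdd_mean[OF w] by (simp add: mean_def)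
 show ?thesis using bdd_AE[OF w]
 proof eventually_elim
  fix x assume "\<bar>w x\<bar> <= C"
  with m show "\<bar>w x - mean w\<bar> <= 2 * C" by linarith
 qed
qed

lemma V_bound:
 assumes s: "0 < s" "s <= 1/16"
 shows "\<bar>V j s x\<bar> <= 4 * C/Zc*(1/sqrt s)"
proof -
 note [measurable] = bdd_meas[OF w]
 have C0: "0 <= C" by (rule bdd_nonneg[OF w])
 have i: "tint (\<lambda>z. dk i s (x - z))" for i
  by (rule integrable_torus_bounded[where C="s^2 * sqrt s"]) (use kernel_bounds(4)[OF s(1)] in auto)
 have "(TI z. \<bar>dk i s (x - z)\<bar>) <= (TI z. (s^2 * sqrt s)*indicator (supp s) (x - z))" for i
  by (rule integral_mono) (use i supp_shift_bound[OF s] kernel_le_supp(3)[OF s(1)] in auto)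
 also have "\<dots> <= (s^2 * sqrt s)*(4 * s)"
  using supp_shift_bound(1)[OF s, of x] s by (simp add: mult_left_mono)
 finally have "(TI z. \<bar>dk i s (x - z)\<bar>) <= (s^2 * sqrt s)*(4 * s)" for i .
 hence "2 * C*(TI z. \<bar>dk (op j) s (x - z)\<bar>) <= 2 * C*((s^2 * sqrt s)*(4 * s))"
  using C0 by (intro mult_left_mono) auto
 hence le: "\<bar>TI z. (w z - mean w)*dk (op j) s (x - z)\<bar> <= 2 * C*((s^2 * sqrt s)*(4 * s))"
  by (rule order_trans[OF integral_mult_bound(1)[OF w_mean_bound _ i[of "op j"]], rotated]) simp
 have "\<bar>V j s x\<bar> = 1/(2 * s^4*Zc)*\<bar>TI z. (w z - mean w)*dk (op j) s (x - z)\<bar>"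
  using s Zc_pos by (simp add: V_def abs_mult sg_def)
 also have "\<dots> <= 1/(2 * s^4*Zc)*(2 * C*((s^2 * sqrt s)*(4 * s)))"
  using le s Zc_pos by (intro mult_left_mono) auto
 also have "\<dots> = 4 * C/Zc*(sqrt s/s)"
  using s Zc_pos by (simp add: field_simps power2_eq_square power4_eq_xxxx)
 also have "sqrt s/s = 1/sqrt s" using s by (simp add: field_simps)
 finally show ?thesis .
qed

text \<open>The two kernels differ by at most \<open>5 * s^2 * norm (x - y)\<close>, and only on two
  sets of measure at most \<open>4*s\<close>. Together with \<open>2 * C\<close> for the centred
  vorticity and the prefactor \<open>1/(2 * s^4)\<close> this gives the constant 40.\<close>

lemma V_lipschitz:
 assumes s: "0 < s" "s <= 1/16"
 shows "\<bar>V j s x - V j s y\<bar> <= 40 * C/Zc*norm (x - y)*(1/s)"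
proof -
 note [measurable] = bdd_meas[OF w]
 have C0: "0 <= C" by (rule bdd_nonneg[OF w])
 let ?k = "dk (op j) s"
 have i: "tint (\<lambda>z. ?k (x - z))" for x
  by (rule integrable_torus_bounded[where C="s^2 * sqrt s"]) (use kernel_bounds(4)[OF s(1)] in auto)
 define B where "B = 5 * s^2*norm (x - y)"
 have B0: "0 <= B" by (simp add: B_def)
 have pt: "\<bar>?k (x - z) - ?k (y - z)\<bar> <= B*indicator (supp s) (x - z) + B*indicator (supp s) (y - z)" for z
 proof (cases "x - z \<in> supp s \<or> y - z \<in> supp s")
  case True
  have "\<bar>?k (x - z) - ?k (y - z)\<bar> <= 5 * s^2*norm ((x - z) - (y - z))"
   by (rule C1per_lipschitz[OF C1per_dk[OF s(2)] kernel_bounds(5)[OF s(1)]])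
  hence "\<bar>?k (x - z) - ?k (y - z)\<bar> <= B" by (simp add: B_def)
  thus ?thesis using True B0 by (auto simp: indicator_def)
 next
  case False
  hence "?k (x - z) = 0" "?k (y - z) = 0" using s by (auto simp: supp_def intro!: kernel_zero)
  thus ?thesis using B0 by simp
 qed
 have "(TI z. \<bar>?k (x - z) - ?k (y - z)\<bar>) <= (TI z. B*indicator (supp s) (x - z) + B*indicator (supp s) (y - z))"
  by (rule integral_mono) (use i[of x] i[of y] supp_shift_bound(2)[OF s] pt in auto)
 also have "\<dots> = B*(TI z. indicator (supp s) (x - z)) + B*(TI z. indicator (supp s) (y - z))"
  using supp_shift_bound(2)[OF s] by simp
 also have "\<dots> <= B*(4 * s) + B*(4 * s)"
  using supp_shift_bound(1)[OF s] B0 by (intro add_mono mult_left_mono) auto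
 finally have le1: "(TI z. \<bar>?k (x - z) - ?k (y - z)\<bar>) <= 8 * s*B" by (simp add: mult_ac)
 have iw: "tint (\<lambda>z. (w z - mean w)*?k (x - z))" for x
  by (rule integral_mult_bound(2)[OF w_mean_bound _ i]) simp
 have "(TI z. (w z - mean w)*?k (x - z)) - (TI z. (w z - mean w)*?k (y - z))
   = (TI z. (w z - mean w)*(?k (x - z) - ?k (y - z)))"
  using iw[of x] iw[of y] by (simp add: right_diff_distrib)
 also have "\<bar>\<dots>\<bar> <= 2 * C*(TI z. \<bar>?k (x - z) - ?k (y - z)\<bar>)"
  by (rule integral_mult_bound(1)[OF w_mean_bound]) (use i[of x] i[of y] in auto)
 also have "\<dots> <= 2 * C*(8 * s*B)" using le1 C0 by (intro mult_left_mono) auto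
 finally have le: "\<bar>(TI z. (w z - mean w)*?k (x - z)) - (TI z. (w z - mean w)*?k (y - z))\<bar> <= 2 * C*(8 * s*B)" .
 have "\<bar>V j s x - V j s y\<bar> = 1/(2 * s^4*Zc)*\<bar>(TI z. (w z - mean w)*?k (x - z)) - (TI z. (w z - mean w)*?k (y - z))\<bar>"
  using s Zc_pos unfolding V_def right_diff_distrib[symmetric] abs_mult by (simp add: sg_def)
 also have "\<dots> <= 1/(2 * s^4*Zc)*(2 * C*(8 * s*B))"
  using le s Zc_pos by (intro mult_left_mono) auto
 also have "\<dots> = 40 * C/Zc*norm (x - y)*(1/s)"
  using s Zc_pos by (simp add: B_def field_simps power2_eq_square power4_eq_xxxx)
 finally show ?thesis .
qed

text \<open>The integral of \<open>4 * C/Zc * t powr (-1/2)\<close> over the scales from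
  \<open>s'\<close> to \<open>s\<close>.\<close>

lemma bs_moll_diff:
 assumes s: "0 < s'" "s' <= s" "s <= 1/16"
 shows "\<bar>moll s (u $$ j) x - moll s' (u $$ j) x\<bar> <= 8 * C/Zc * sqrt s"
proof -
 have "\<bar>moll s (u $$ j) x - moll s' (u $$ j) x\<bar> <= 8 * C/Zc * sqrt s - 8 * C/Zc * sqrt s'"
 proof (rule deriv_compare_abs[OF s(2)])
  fix t assume t: "t \<in> {s'..s}"
  show "((\<lambda>t. moll t (u $$ j) x) has_real_derivative V j t x) (at t within {s'..s})"
   by (rule DERIV_subset[OF bs_moll_deriv[OF s(1)]]) (use t s in auto)
  show "((\<lambda>t. 8 * C/Zc * sqrt t) has_real_derivative 8 * C/Zc*(inverse (sqrt t)/2)) (at t within {s'..s})"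
   by (rule DERIV_cmult[OF has_field_derivative_at_within[OF DERIV_real_sqrt]]) (use t s in auto)
  show "\<bar>V j t x\<bar> <= 8 * C/Zc*(inverse (sqrt t)/2)"
   using V_bound[of t j x] t s by (simp add: field_simps)
 qed
 moreover have "0 <= 8 * C/Zc * sqrt s'" using s bdd_nonneg[OF w] Zc_pos by simp
 ultimately show ?thesis by linarith
qed

lemma u_L1: "(TI x. \<bar>u x $ j\<bar>) <= C"
proof -
 have "(TI x. \<bar>u x $ j\<bar>) <= sqrt (nsq (u $$ j))" by (rule integral_le_sqrt_nsq[OF bs_L2f[OF BS bdd_L2f[OF w]]])
 also have "\<dots> <= sqrt (C^2)"
  using bs_nsq_le[OF BS bdd_L2f[OF w], of j] bdd_nsq[OF w] by (intro real_sqrt_le_mono) linarith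
 finally show ?thesis using bdd_nonneg[OF w] by simp
qed

text \<open>The starting values at scale 1/16 for the integration over \<open>s\<close>: there
  \<open>rho\<close> is at most \<open>16/Zc\<close> and its gradient at most \<open>256/Zc\<close>,
  and the \<open>L^1\<close> norm of the velocity is at most \<open>C\<close>.\<close>

lemma bs_moll_base:
 shows "\<bar>moll (1/16) (u $$ j) x\<bar> <= 16 * C/Zc"
  and "\<bar>moll (1/16) (u $$ j) x - moll (1/16) (u $$ j) y\<bar> <= 256 * C/Zc*norm (x - y)"
proof -
 note L = bs_L2f[OF BS bdd_L2f[OF w], of j]
 note iu = L2f_integrable[OF L]
 note [measurable] = L2f_meas[OF L]
 note r = rho_facts[of "1/16"]
 have rb: "\<bar>rho (1/16) z\<bar> <= 16/Zc" for z using r(1,2)[of z] by simp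
 have gb: "norm (rhoG (1/16) z) <= 256/Zc" for z
 proof -
  have "norm (rhoG (1/16) z) <= 4/(Zc*(1/16 * sqrt (1/16)))*indicator (supp (1/16)) z" by (rule r(6)) auto
  also have "sqrt (1/16) = 1/4" by (rule real_sqrt_unique) (auto simp: power2_eq_square)
  also have "4/(Zc*(1/16*(1/4)))*indicator (supp (1/16)) z <= 256/Zc" using Zc_pos by (auto simp: indicator_def)
  finally show ?thesis .
 qed
 have swap: "(TI z. u z $ j*k z) = (TI z. k z*u z $ j)" for k by (simp add: mult.commute)
 have "\<bar>moll (1/16) (u $$ j) x\<bar> <= 16/Zc*(TI x. \<bar>u x $ j\<bar>)"
  unfolding moll_def swap by (rule integral_mult_bound(1)[OF _ _ iu]) (use rb in auto)
 also have "\<dots> <= 16/Zc * C" using u_L1 Zc_pos by (intro mult_left_mono) auto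
 finally show "\<bar>moll (1/16) (u $$ j) x\<bar> <= 16 * C/Zc" by simp
 have im: "tint (\<lambda>z. rho (1/16) (x - z)*u z $ j)" for x
  by (rule integral_mult_bound(2)[OF _ _ iu, where C="16/Zc"]) (use rb in auto)
 have "moll (1/16) (u $$ j) x - moll (1/16) (u $$ j) y = (TI z. (rho (1/16) (x - z) - rho (1/16) (y - z))*u z $ j)"
  unfolding moll_def swap using im[of x] im[of y] by (simp add: left_diff_distrib)
 also have "\<bar>\<dots>\<bar> <= (256/Zc*norm (x - y))*(TI x. \<bar>u x $ j\<bar>)"
 proof (rule integral_mult_bound(1)[OF _ _ iu])
  show "AE z in torus. \<bar>rho (1/16) (x - z) - rho (1/16) (y - z)\<bar> <= 256/Zc*norm (x - y)"
  proof (rule AE_I2)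
   fix z show "\<bar>rho (1/16) (x - z) - rho (1/16) (y - z)\<bar> <= 256/Zc*norm (x - y)"
    using C1per_lipschitz[OF C1per_rho gb, of "x - z" "y - z"] by simp
  qed
 qed simp
 also have "\<dots> <= (256/Zc*norm (x - y)) * C" using u_L1 Zc_pos by (intro mult_left_mono) auto
 finally show "\<bar>moll (1/16) (u $$ j) x - moll (1/16) (u $$ j) y\<bar> <= 256 * C/Zc*norm (x - y)"
  by (simp add: mult_ac)
qed

text \<open>Integrating \<open>1/t\<close> from \<open>s\<close> to 1/16 produces at most
  \<open>ln (1/s)\<close>. The factor 40 of \<open>V_lipschitz\<close> is enlarged to 256 so that it
  merges with the base value.\<close>

lemma bs_moll_lipschitz:
 assumes s: "0 < s" "s <= 1/16"
 shows "\<bar>moll s (u $$ j) x - moll s (u $$ j) y\<bar> <= 256 * C/Zc*(1 + ln (1/s))*norm (x - y)"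
proof -
 let ?f = "\<lambda>s. moll s (u $$ j) x - moll s (u $$ j) y"
 let ?c = "40 * C/Zc*norm (x - y)"
 have c0: "0 <= ?c" using bdd_nonneg[OF w] Zc_pos by simp
 have "\<bar>?f (1/16) - ?f s\<bar> <= ?c*ln (1/16) - ?c*ln s"
 proof (rule deriv_compare_abs[OF s(2)])
  fix t assume t: "t \<in> {s..1/16}"
  show "(?f has_real_derivative V j t x - V j t y) (at t within {s..1/16})"
   by (intro DERIV_diff bs_moll_deriv[OF s(1) t])
  show "((\<lambda>t. ?c*ln t) has_real_derivative ?c*(1/t)) (at t within {s..1/16})"
   by (rule DERIV_cmult[OF has_field_derivative_at_within[OF DERIV_ln_divide]]) (use t s in auto)
  show "\<bar>V j t x - V j t y\<bar> <= ?c*(1/t)" using V_lipschitz[of t j x y] t s by auto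
 qed
 also have "\<dots> <= ?c*ln (1/s)"
 proof -
  have "ln (1/16::real) <= 0" by simp
  hence "?c*ln (1/16) <= 0" using c0 by (intro mult_nonneg_nonpos) auto
  thus ?thesis using s by (simp add: ln_div)
 qed
 finally have 1: "\<bar>?f (1/16) - ?f s\<bar> <= ?c*ln (1/s)" .
 have 2: "\<bar>?f (1/16)\<bar> <= 256 * C/Zc*norm (x - y)" by (rule bs_moll_base)
 have l0: "0 <= ln (1/s)" using s by simp
 have "?c*ln (1/s) <= 256 * C/Zc*norm (x - y)*ln (1/s)"
  using l0 bdd_nonneg[OF w] Zc_pos by (intro mult_right_mono divide_right_mono) auto
 with 1 2 have "\<bar>?f s\<bar> <= 256 * C/Zc*norm (x - y) + 256 * C/Zc*norm (x - y)*ln (1/s)" by linarith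
 thus ?thesis by (simp add: algebra_simps add_divide_distrib)
qed

text \<open>Mollifications are known to converge to \<open>u\<close> in \<open>L^2\<close> only. The
  amount \<open>h\<close> by which the bound fails is dominated by \<open>|moll t u - u|\<close> for
  every \<open>t <= s\<close>, so its norm is arbitrarily small.\<close>

lemma bs_moll_AE:
 assumes s: "0 < s" "s <= 1/16"
 shows "AE x in torus. \<bar>u x $ j - moll s (u $$ j) x\<bar> <= 8 * C/Zc * sqrt s"
proof -
 note L = bs_L2f[OF BS bdd_L2f[OF w], of j]
 note [measurable] = L2f_meas[OF L]
 let ?b = "8 * C/Zc * sqrt s"
 define h where "h x = max 0 (\<bar>u x $ j - moll s (u $$ j) x\<bar> - ?b)" for x
 have [measurable]: "h \<in> bmeas" unfolding h_def[abs_def] by measurable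
 have hb: "h x <= \<bar>moll t (u $$ j) x - u x $ j\<bar>" if "0 < t" "t <= s" for t x
  using bs_moll_diff[OF that s(2), of j x] by (auto simp: h_def)
 have sqle: "(h x)^2 <= (moll t (u $$ j) x - u x $ j)^2" if "0 < t" "t <= s" for t x
  using power_mono[OF hb[OF that, of x], of 2] by (simp add: h_def)
 have ih: "tint (\<lambda>x. (h x)^2)"
  by (rule Bochner_Integration.integrable_bound[OF L2f_sq[OF bs_moll_L2(2)[OF BS bdd_L2f[OF w] s, of j]]]) (use sqle[OF s(1)] in auto)
 have nle: "nsq h <= t*nsq w" if t: "0 < t" "t <= s" for t
 proof -
  have t16: "t <= 1/16" using t s by linarith
  have "nsq h <= nsq (\<lambda>x. moll t (u $$ j) x - u x $ j)"
   unfolding nsq_def by (rule integral_mono[OF ih L2f_sq[OF bs_moll_L2(2)[OF BS bdd_L2f[OF w] t(1) t16]]]) (rule sqle[OF t])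
  also have "\<dots> <= t*nsq w" by (rule bs_moll_L2(1)[OF BS bdd_L2f[OF w] t(1) t16])
  finally show ?thesis .
 qed
 have "nsq h <= 0"
 proof (rule field_le_epsilon)
  fix e :: real assume e: "e > 0"
  define t where "t = min s (e/(nsq w + 1))"
  have p: "0 < nsq w + 1" using nsq_nonneg[of w] by linarith
  have t: "0 < t" "t <= s" using e s p by (auto simp: t_def)
  have "t*nsq w <= e/(nsq w + 1)*(nsq w + 1)" unfolding t_def using e p by (intro mult_mono) auto
  thus "nsq h <= 0 + e" using nle[OF t] p by simp
 qed
 hence "(TI x. (h x)^2) = 0" using nsq_nonneg[of h] unfolding nsq_def by linarith
 hence "AE x in torus. (h x)^2 = 0"
  using ih by (subst (asm) integral_nonneg_eq_0_iff_AE) auto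
 thus ?thesis by eventually_elim (auto simp: h_def max_def split: if_splits)
qed

lemma bs_AE_bound: "AE x in torus. \<bar>u x $ j\<bar> <= 24 * C/Zc"
proof -
 have "sqrt (1/16) <= (1::real)" by (rule real_le_lsqrt) auto
 hence "8 * C/Zc * sqrt (1/16) <= 8 * C/Zc" using bdd_nonneg[OF w] Zc_pos by (intro mult_left_le) auto
 moreover have "AE x in torus. \<bar>u x $ j - moll (1/16) (u $$ j) x\<bar> <= 8 * C/Zc * sqrt (1/16)"
  by (rule bs_moll_AE) auto
 ultimately have "AE x in torus. \<bar>u x $ j\<bar> <= 8 * C/Zc + 16 * C/Zc"
 proof (elim eventually_mono)
  fix x assume "8 * C/Zc * sqrt (1/16) <= 8 * C/Zc" "\<bar>u x $ j - moll (1/16) (u $$ j) x\<bar> <= 8 * C/Zc * sqrt (1/16)"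
  thus "\<bar>u x $ j\<bar> <= 8 * C/Zc + 16 * C/Zc" using bs_moll_base(1)[of j x] by linarith
 qed
 thus ?thesis by (simp add: add_divide_distrib[symmetric])
qed

end

section \<open>Weak solutions with a given forcing functional\<close>

definition ip :: "(real^2 => real) => (real^2 => real) => real" where
 "ip f g = (TI x. f x*g x)"

definition fl :: "(real^2 => real^2) => (real^2 => real) => (real^2 => real^2) => real" where
 "fl u f G = (TI x. (u x \<bullet> G x)*f x)"

text \<open>The functional \<open>N t G\<close> stands for the increment of the noise tested against a function with gradient \<open>G\<close>.\<close>
definition sol :: "real => real => (real^2 => real) => (real => (real^2 => real^2) => real)
  => (real => real^2 => real) => (real => real^2 => real^2) => bool" where
 "sol \<gamma> t0 X0 N \<xi> u \<longleftrightarrow>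
  (\<forall>t\<ge>t0. biot_savart (\<xi> t) (u t)) \<and>
  (\<forall>T. \<exists>C. \<forall>t\<in>{t0..T}. bdd C (\<xi> t)) \<and>
  (\<forall>g. g \<in> bmeas \<longrightarrow> tint g \<longrightarrow> continuous_on {t0..} (\<lambda>t. ip (\<xi> t) g)) \<and>
  (\<forall>g G t. C1per g G \<longrightarrow> t0 <= t \<longrightarrow>
    ip (\<xi> t) g + \<gamma>*(LINT s:{t0..t}|lborel. ip (\<xi> s) g) - (LINT s:{t0..t}|lborel. fl (u s) (\<xi> s) G)
    = ip X0 g + N t G)"

text \<open>From here on the noise enters only through a functional \<open>N\<close>, the same for
  all solutions of one realisation.\<close>

lemma weak_solution_sol:
 assumes ws: "weak_solution \<gamma> c \<beta> e t0 \<omega> X0 \<xi> u" and X0: "Linf X0"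
 shows "sol \<gamma> t0 X0 (\<lambda>t G. wcurl_pair c \<beta> e \<omega> t G - wcurl_pair c \<beta> e \<omega> t0 G) \<xi> u"
proof -
 have L: "Linf (\<xi> t)" "biot_savart (\<xi> t) (u t)" if "t0 <= t" for t
  using ws that unfolding weak_solution_def by blast+
 have m: "\<xi> t \<in> bmeas" if "t0 <= t" for t using L[OF that] by (simp add: Linf_def)
 have um: "u t \<in> bmeas" if "t0 <= t" for t
  using L(2)[OF that] by (simp add: biot_savart_def L2field_def)
 have X0m: "X0 \<in> bmeas" using X0 by (simp add: Linf_def)
 have dp: "dpair f g = ip f g" if "f \<in> bmeas" "g \<in> bmeas" for f g
  unfolding dpair_def ip_def by (rule LINT_cell_eq) (use that in measurable)
 have dpf: "dpair (\<lambda>x. u t x \<bullet> G x) (\<xi> t) = fl (u t) (\<xi> t) G" if "t0 <= t" "G \<in> bmeas" for t G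
  unfolding dpair_def fl_def by (rule LINT_cell_eq) (use that m um in measurable)
 have li: "(LINT s:{t0..t}|lborel. f s) = (LINT s:{t0..t}|lborel. g s)" if "\<And>s. t0 <= s ==> f s = g s" for f g :: "real => real" and t
  by (rule set_lebesgue_integral_cong) (use that in auto)
 show ?thesis unfolding sol_def
 proof (intro conjI allI impI)
  fix t assume "t0 <= t" thus "biot_savart (\<xi> t) (u t)" by (rule L)
 next
  fix T
  obtain C where C: "\<forall>t\<in>{t0..T}. AE x in lborel. \<bar>\<xi> t x\<bar> <= C"
   using ws unfolding weak_solution_def by blast
  hence "\<forall>t\<in>{t0..T}. bdd C (\<xi> t)" using L by (auto intro!: Linf_bdd)
  thus "\<exists>C. \<forall>t\<in>{t0..T}. bdd C (\<xi> t)" ..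
 next
  fix g :: "real^2 => real" assume [measurable]: "g \<in> bmeas" and gi: "tint g"
  hence "continuous_on {t0..} (\<lambda>t. dpair (\<xi> t) g)"
   using ws unfolding weak_solution_def by (simp add: set_integrable_cell_iff)
  thus "continuous_on {t0..} (\<lambda>t. ip (\<xi> t) g)"
   by (rule continuous_on_eq) (auto simp: dp m)
 next
  fix g G t assume g: "C1per g G" and t: "t0 <= t"
  have "dpair (\<xi> t) g + \<gamma>*(LINT s:{t0..t}|lborel. dpair (\<xi> s) g) - (LINT s:{t0..t}|lborel. dpair (\<lambda>x. u s x \<bullet> G x) (\<xi> s))
    = dpair X0 g + (wcurl_pair c \<beta> e \<omega> t G - wcurl_pair c \<beta> e \<omega> t0 G)"
   using ws g t unfolding weak_solution_def by blast
  moreover have "(LINT s:{t0..t}|lborel. dpair (\<xi> s) g) = (LINT s:{t0..t}|lborel. ip (\<xi> s) g)"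
   by (rule li) (simp add: dp m C1per_meas[OF g])
  moreover have "(LINT s:{t0..t}|lborel. dpair (\<lambda>x. u s x \<bullet> G x) (\<xi> s)) = (LINT s:{t0..t}|lborel. fl (u s) (\<xi> s) G)"
   by (rule li) (simp add: dpf C1per_measG[OF g])
  ultimately show "ip (\<xi> t) g + \<gamma>*(LINT s:{t0..t}|lborel. ip (\<xi> s) g) - (LINT s:{t0..t}|lborel. fl (u s) (\<xi> s) G)
    = ip X0 g + (wcurl_pair c \<beta> e \<omega> t G - wcurl_pair c \<beta> e \<omega> t0 G)"
   by (simp add: dp m t X0m C1per_meas[OF g])
 qed
qed

lemma ip_diff_left:
 assumes "L2f f" "L2f f'" "L2f g" shows "ip (\<lambda>x. f x - f' x) g = ip f g - ip f' g"
 using L2f_mult[OF assms(1,3)] L2f_mult[OF assms(2,3)] by (simp add: ip_def left_diff_distrib)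

lemma ip_bdd_le:
 assumes "bdd C f" "tint g"
 shows "tint (\<lambda>x. f x*g x)" "\<bar>ip f g\<bar> <= C*(TI x. \<bar>g x\<bar>)"
 using integral_mult_bound[OF bdd_AE[OF assms(1)] bdd_meas[OF assms(1)] assms(2)] by (auto simp: ip_def)

lemma bs_inner_L2:
 assumes "biot_savart w u" "L2f w" "C1per g G"
 shows "L2f (\<lambda>x. u x \<bullet> G x)"
proof -
 obtain B where B: "\<And>x. norm (G x) <= B" using C1per_bounded[OF assms(3)] by metis
 have "L2f (\<lambda>x. G x $ j*u x $ j)" for j
 proof (rule L2f_bounded_mult(1)[OF bs_L2f[OF assms(1,2)]])
  show "(G $$ j) \<in> bmeas" "per (G $$ j)"
   using C1per_L2f(2)[OF assms(3), of j] by (auto simp: L2f_def)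
  show "AE x in torus. \<bar>G x $ j\<bar> <= B" by (intro AE_I2 order_trans[OF component_le_norm_cart B])
 qed
 from L2f_add[OF this[of 1] this[of 2]] show ?thesis by (simp add: inner_real2 mult.commute)
qed

lemma nsq_inner_le:
 assumes "biot_savart w u" "L2f w" "C1per g G" and B: "\<And>x. norm (G x) <= B"
 shows "nsq (\<lambda>x. u x \<bullet> G x) <= B^2*((nsq2 u))"
proof -
 note L = bs_L2f[OF assms(1,2)]
 have "nsq (\<lambda>x. u x \<bullet> G x) <= (TI x. B^2*((u x $ 1)^2 + (u x $ 2)^2))"
  unfolding nsq_def
 proof (rule integral_mono)
  show "tint (\<lambda>x. (u x \<bullet> G x)^2)" by (rule L2f_sq[OF bs_inner_L2[OF assms(1-3)]])
  show "tint (\<lambda>x. B^2*((u x $ 1)^2 + (u x $ 2)^2))" using L2f_sq[OF L] by simp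
  fix x
  have "\<bar>u x \<bullet> G x\<bar> <= norm (u x)*norm (G x)" by (rule Cauchy_Schwarz_ineq2)
  also have "\<dots> <= norm (u x)*B" by (intro mult_left_mono B) simp
  finally have "\<bar>u x \<bullet> G x\<bar>^2 <= (norm (u x)*B)^2" by (rule power_mono) simp
  hence "(u x \<bullet> G x)^2 <= (norm (u x))^2*B^2" by (simp add: power_mult_distrib)
  also have "(norm (u x))^2 = (u x $ 1)^2 + (u x $ 2)^2"
   unfolding power2_norm_eq_inner inner_real2 by (simp add: power2_eq_square)
  finally show "(u x \<bullet> G x)^2 <= B^2*((u x $ 1)^2 + (u x $ 2)^2)" by (simp add: mult.commute)
 qed
 also have "\<dots> = B^2*((nsq2 u))"
  using L2f_sq[OF L] by (simp add: nsq_def)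
 finally show ?thesis .
qed

lemma fourier_ip:
 assumes "L2f f" shows "fourier f k = Complex (ip f (\<lambda>x. cos (ph k x))) (- ip f (\<lambda>x. sin (ph k x)))"
 by (simp add: complex_eq_iff fourier_parts[OF assms] ip_def)

text \<open>The Biot--Savart map is compact: weak convergence of bounded vorticities, seen on the
  Fourier modes, becomes strong convergence of velocities.\<close>

lemma bs_velocity_tendsto:
 assumes f: "\<And>n. bdd C (f n)" "bdd C f0" and BS: "\<And>n. biot_savart (f n) (v n)" "biot_savart f0 v0"
  and lim: "\<And>g G. C1per g G ==> (\<lambda>n. ip (f n) g) \<longlonglongrightarrow> ip f0 g"
 shows "(\<lambda>n. nsq (\<lambda>x. (v n x - v0 x) $ 1) + nsq (\<lambda>x. (v n x - v0 x) $ 2)) \<longlonglongrightarrow> 0"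
proof (rule biot_savart_compact[where f="\<lambda>n x. f n x - f0 x" and C="C + C"])
 note L = bdd_L2f[OF f(1)] bdd_L2f[OF f(2)]
 show "biot_savart (\<lambda>x. f n x - f0 x) (\<lambda>x. v n x - v0 x)" for n
  by (rule biot_savart_diff[OF BS(1) L(1) BS(2) L(2)])
 show "bdd (C + C) (\<lambda>x. f n x - f0 x)" for n by (rule bdd_diff[OF f])
 fix k :: "int \<times> int"
 have "(\<lambda>n. Complex (ip (f n) (\<lambda>x. cos (ph k x))) (- ip (f n) (\<lambda>x. sin (ph k x)))) \<longlonglongrightarrow>
   Complex (ip f0 (\<lambda>x. cos (ph k x))) (- ip f0 (\<lambda>x. sin (ph k x)))"
  by (rule tendsto_Complex[OF lim[OF C1per_cos_ph] tendsto_minus[OF lim[OF C1per_sin_ph]]])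
 hence "(\<lambda>n. fourier (f n) k) \<longlonglongrightarrow> fourier f0 k" by (simp add: fourier_ip L)
 hence "(\<lambda>n. fourier (f n) k - fourier f0 k) \<longlonglongrightarrow> 0" by (simp add: LIM_zero)
 thus "(\<lambda>n. fourier (\<lambda>x. f n x - f0 x) k) \<longlonglongrightarrow> 0" by (simp add: fourier_diff L)
qed

text \<open>Strong convergence of the velocity times weak convergence of the vorticity: the part
  with \<open>v n - v0\<close> vanishes by Cauchy--Schwarz, and in the rest
  \<open>v0 x \<bullet> G x\<close> is a fixed test function.\<close>

lemma fl_tendsto:
 assumes f: "\<And>n. bdd C (f n)" "bdd C f0" and BS: "\<And>n. biot_savart (f n) (v n)" "biot_savart f0 v0"
  and lim: "\<And>g. g \<in> bmeas ==> tint g ==> (\<lambda>n. ip (f n) g) \<longlonglongrightarrow> ip f0 g"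
  and g: "C1per g G"
 shows "(\<lambda>n. fl (v n) (f n) G) \<longlonglongrightarrow> fl v0 f0 G"
proof -
 note L = bdd_L2f[OF f(1)] bdd_L2f[OF f(2)]
 have C0: "0 <= C" by (rule bdd_nonneg[OF f(2)])
 obtain B where B: "\<And>x. norm (G x) <= B" "B > 0" using C1per_bounded[OF g] by metis
 have lim': "(\<lambda>n. ip (f n) g) \<longlonglongrightarrow> ip f0 g" if "C1per g G" for g G
  by (rule lim) (use C1per_meas[OF that] L2f_integrable[OF C1per_L2f(1)[OF that]] in auto)
 define Y where "Y n = nsq (\<lambda>x. (v n x - v0 x) $ 1) + nsq (\<lambda>x. (v n x - v0 x) $ 2)" for n
 have Y: "Y \<longlonglongrightarrow> 0" unfolding Y_def by (rule bs_velocity_tendsto[OF f BS lim'])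
 have BSd: "biot_savart (\<lambda>x. f n x - f0 x) (\<lambda>x. v n x - v0 x)" for n
  by (rule biot_savart_diff[OF BS(1) L(1) BS(2) L(2)])
 note Ld = L2f_diff[OF L(1) L(2)]
 note G0 = bs_inner_L2[OF BS(2) L(2) g]
 have split: "fl (v n) (f n) G = ip (\<lambda>x. (v n x - v0 x) \<bullet> G x) (f n) + ip (f n) (\<lambda>x. v0 x \<bullet> G x)" for n
  unfolding fl_def ip_def
  using L2f_mult[OF bs_inner_L2[OF BSd Ld g] L(1)] L2f_mult[OF L(1) G0]
  by (subst Bochner_Integration.integral_add[symmetric]) (auto simp: inner_diff_left algebra_simps intro!: tcong)
 have "(\<lambda>n. ip (\<lambda>x. (v n x - v0 x) \<bullet> G x) (f n)) \<longlonglongrightarrow> 0"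
 proof (rule Lim_null_comparison)
  show "\<forall>\<^sub>F n in sequentially. norm (ip (\<lambda>x. (v n x - v0 x) \<bullet> G x) (f n)) <= sqrt (B^2*Y n) * C"
  proof (intro always_eventually allI)
   fix n
   have "\<bar>ip (\<lambda>x. (v n x - v0 x) \<bullet> G x) (f n)\<bar> <= sqrt (nsq (\<lambda>x. (v n x - v0 x) \<bullet> G x)) * sqrt (nsq (f n))"
    unfolding ip_def by (rule L2f_CS[OF bs_inner_L2[OF BSd Ld g] L(1)])
   also have "\<dots> <= sqrt (B^2*Y n) * sqrt (C^2)"
    unfolding Y_def by (intro mult_mono real_sqrt_le_mono nsq_inner_le[OF BSd Ld g B(1)] bdd_nsq[OF f(1)]) auto
   finally show "norm (ip (\<lambda>x. (v n x - v0 x) \<bullet> G x) (f n)) <= sqrt (B^2*Y n) * C" using C0 by simp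
  qed
  have "(\<lambda>n. sqrt (B^2*Y n) * C) \<longlonglongrightarrow> sqrt (B^2*0) * C" by (intro tendsto_intros Y)
  thus "(\<lambda>n. sqrt (B^2*Y n) * C) \<longlonglongrightarrow> 0" by simp
 qed
 moreover have "(\<lambda>n. ip (f n) (\<lambda>x. v0 x \<bullet> G x)) \<longlonglongrightarrow> ip f0 (\<lambda>x. v0 x \<bullet> G x)"
  by (rule lim) (use L2f_meas[OF G0] L2f_integrable[OF G0] in auto)
 ultimately have "(\<lambda>n. fl (v n) (f n) G) \<longlonglongrightarrow> 0 + ip f0 (\<lambda>x. v0 x \<bullet> G x)"
  unfolding split by (rule tendsto_add)
 thus ?thesis by (simp add: fl_def ip_def mult.commute)
qed

section \<open>The weak formulation as a differential equation in time\<close>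

context
 fixes \<gamma> t0 X0 N \<xi> u
 assumes S: "sol \<gamma> t0 X0 N \<xi> u"
begin

lemma sol_BS: "t0 <= t ==> biot_savart (\<xi> t) (u t)"
 using S by (simp add: sol_def)

lemma sol_bdd: obtains C where "\<And>t. t \<in> {t0..T} ==> bdd C (\<xi> t)" "C >= 0"
proof -
 obtain C where C: "\<forall>t\<in>{t0..T}. bdd C (\<xi> t)" using S unfolding sol_def by blast
 hence "bdd (max C 0) (\<xi> t)" if "t \<in> {t0..T}" for t using that bdd_mono[of C] by auto
 thus ?thesis using that[of "max C 0"] by auto
qed

lemma sol_L2f: "t0 <= t ==> L2f (\<xi> t)"
 using sol_bdd[of t] bdd_L2f by (metis atLeastAtMost_iff order_refl)

lemma sol_cont_ip: "g \<in> bmeas ==> tint g ==> continuous_on {t0..} (\<lambda>t. ip (\<xi> t) g)"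
 using S by (simp add: sol_def)

lemma sol_seq_bdd:
 assumes "\<And>n. X n \<in> {t0..}" "X \<longlonglongrightarrow> a" "a \<in> {t0..}"
 obtains C where "\<And>n. bdd C (\<xi> (X n))" "bdd C (\<xi> a)"
proof -
 have "Bseq X" using assms(2) by (rule convergent_imp_Bseq[OF convergentI])
 then obtain K where K: "\<And>n. norm (X n) <= K" by (auto simp: Bseq_def)
 obtain C where C: "\<And>t. t \<in> {t0..max K a} ==> bdd C (\<xi> t)" using sol_bdd[of "max K a"] by metis
 have "bdd C (\<xi> (X n))" for n using assms(1)[of n] K[of n] by (intro C) (auto simp: max_def abs_le_iff intro: order_trans)
 moreover have "bdd C (\<xi> a)" using assms(3) by (intro C) auto
 ultimately show ?thesis using that by blast
qed

text \<open>Weak continuity of the vorticity makes the nonlinear term continuous in time. Its time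
  integral is then continuously differentiable, and the Lebesgue integral agrees with the gauge
  integral.\<close>

lemma sol_cont_fl: assumes g: "C1per g G" shows "continuous_on {t0..} (\<lambda>t. fl (u t) (\<xi> t) G)"
 unfolding continuous_on_sequentially comp_def
proof (intro allI ballI impI)
 fix X a assume X: "(\<forall>n. X n \<in> {t0..}) \<and> X \<longlonglongrightarrow> a" and a: "a \<in> {t0..}"
 obtain C where C: "\<And>n. bdd C (\<xi> (X n))" "bdd C (\<xi> a)" using sol_seq_bdd[of X a] X a by metis
 show "(\<lambda>n. fl (u (X n)) (\<xi> (X n)) G) \<longlonglongrightarrow> fl (u a) (\<xi> a) G"
 proof (rule fl_tendsto[OF C _ _ _ g])
  show "biot_savart (\<xi> (X n)) (u (X n))" for n using X by (intro sol_BS) auto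
  show "biot_savart (\<xi> a) (u a)" using a by (intro sol_BS) auto
  fix h :: "real^2 => real" assume "h \<in> bmeas" "tint h"
  from sol_cont_ip[OF this] show "(\<lambda>n. ip (\<xi> (X n)) h) \<longlonglongrightarrow> ip (\<xi> a) h"
   using X a unfolding continuous_on_sequentially comp_def by blast
 qed
qed

lemma sol_cont_test: assumes g: "C1per g G" shows "continuous_on {t0..} (\<lambda>t. ip (\<xi> t) g)"
 by (rule sol_cont_ip) (use C1per_meas[OF g] L2f_integrable[OF C1per_L2f(1)[OF g]] in auto)

lemma sol_eq:
 assumes g: "C1per g G" and t: "t0 <= t"
 shows "ip (\<xi> t) g - N t G = ip X0 g + integral {t0..t} (\<lambda>s. - \<gamma>*ip (\<xi> s) g + fl (u s) (\<xi> s) G)"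
proof -
 have c: "continuous_on {t0..t} (\<lambda>s. ip (\<xi> s) g)" "continuous_on {t0..t} (\<lambda>s. fl (u s) (\<xi> s) G)"
  by (rule continuous_on_subset[OF sol_cont_test[OF g]] continuous_on_subset[OF sol_cont_fl[OF g]]; auto)+
 have li: "(LINT s:{t0..t}|lborel. f s) = integral {t0..t} f" if "continuous_on {t0..t} f" for f :: "real => real"
  using set_borel_integral_eq_integral(2)[OF borel_integrable_atLeastAtMost'[OF that]] .
 have "ip (\<xi> t) g + \<gamma>*(LINT s:{t0..t}|lborel. ip (\<xi> s) g) - (LINT s:{t0..t}|lborel. fl (u s) (\<xi> s) G) = ip X0 g + N t G"
  using S g t unfolding sol_def by blast
 moreover have "integral {t0..t} (\<lambda>s. - \<gamma>*ip (\<xi> s) g + fl (u s) (\<xi> s) G)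
   = - \<gamma>*integral {t0..t} (\<lambda>s. ip (\<xi> s) g) + integral {t0..t} (\<lambda>s. fl (u s) (\<xi> s) G)"
  using c by (subst Henstock_Kurzweil_Integration.integral_add)
   (auto intro!: integrable_continuous_interval continuous_intros)
 ultimately show ?thesis using li[OF c(1)] li[OF c(2)] by simp
qed

text \<open>Only after subtracting \<open>N t G\<close>, for which no differentiability is
  available, does the tested solution have a derivative.\<close>

lemma sol_deriv:
 assumes g: "C1per g G" and t: "t \<in> {t0..T}"
 shows "((\<lambda>t. ip (\<xi> t) g - N t G) has_real_derivative (- \<gamma>*ip (\<xi> t) g + fl (u t) (\<xi> t) G)) (at t within {t0..T})"
proof -
 have c: "continuous_on {t0..T} (\<lambda>s. - \<gamma>*ip (\<xi> s) g + fl (u s) (\<xi> s) G)"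
  by (intro continuous_intros; rule continuous_on_subset[OF sol_cont_test[OF g]] continuous_on_subset[OF sol_cont_fl[OF g]]; auto)
 have "((\<lambda>t. integral {t0..t} (\<lambda>s. - \<gamma>*ip (\<xi> s) g + fl (u s) (\<xi> s) G)) has_real_derivative
   (- \<gamma>*ip (\<xi> t) g + fl (u t) (\<xi> t) G)) (at t within {t0..T})"
  by (rule integral_has_real_derivative[OF c t])
 from DERIV_add[OF DERIV_const[of "ip X0 g"] this]
 have "((\<lambda>t. ip X0 g + integral {t0..t} (\<lambda>s. - \<gamma>*ip (\<xi> s) g + fl (u s) (\<xi> s) G)) has_real_derivative
   (- \<gamma>*ip (\<xi> t) g + fl (u t) (\<xi> t) G)) (at t within {t0..T})" by simp
 thus ?thesis
  by (rule has_field_derivative_transform_within[OF _ zero_less_one t]) (use sol_eq[OF g] in auto)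
qed

lemma sol_init: assumes g: "C1per g G" shows "ip (\<xi> t0) g - N t0 G = ip X0 g"
 using sol_eq[OF g order_refl] by simp

end

section \<open>The maximum principle\<close>

lemma integrable_bdd_mult: "bdd C f ==> tint k ==> tint (\<lambda>x. f x*k x)"
 by (rule ip_bdd_le(1))

lemma C1per_moll:
 assumes f: "bdd C f" and s: "0 < s" "s <= 1/16"
 shows "C1per (moll s f) (\<lambda>x. \<chi> i. TI z. f z*rhoG s (x - z) $ i)"
proof -
 note [measurable] = bdd_meas[OF f]
 have fi: "tint f" by (rule L2f_integrable[OF bdd_L2f[OF f]])
 obtain B where B: "\<And>x. \<bar>rho s x\<bar> <= B" "\<And>x. norm (rhoG s x) <= B" "B > 0" using C1per_bounded[OF C1per_rho[OF s(2)]] by metis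
 have ii: "tint (\<lambda>z. f z*rhoG s (x - z) $ i)" for x i
  by (rule integrable_bdd_mult[OF f integrable_torus_bounded[where C=B]])
   (auto intro: order_trans[OF component_le_norm_cart B(2)])
 have d: "(moll s f has_derivative (\<lambda>h. TI z. f z*(rhoG s (x - z) \<bullet> h))) (at x)" for x
  unfolding moll_def[abs_def]
 proof (rule has_derivative_integral_dominated[OF fi, where K=B and B=B])
  show "((\<lambda>x. rho s (x - z)) has_derivative (\<lambda>h. rhoG s (x - z) \<bullet> h)) (at x)" for z
   by (rule has_derivative_compose[of "\<lambda>x. x - z" "\<lambda>h. h" x UNIV "rho s" "\<lambda>h. rhoG s (x - z) \<bullet> h"])
    (auto intro!: derivative_eq_intros C1per_deriv[OF C1per_rho[OF s(2)]])
  show "\<bar>rho s (y - z) - rho s (x - z)\<bar> <= B*norm (y - x)" for z y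
   using C1per_lipschitz[OF C1per_rho[OF s(2)] B(2), of "y - z" "x - z"] by simp
  show "\<bar>rhoG s (x - z) \<bullet> h\<bar> <= B*norm h" for z h
   by (rule order_trans[OF Cauchy_Schwarz_ineq2 mult_right_mono[OF B(2)]]) simp
 qed (use B in auto)
 show ?thesis unfolding C1per_def
 proof (intro conjI allI)
  show "per (moll s f)" by (rule per_moll[OF s(2)])
  fix x
  show "(moll s f has_derivative (\<lambda>h. (\<chi> i. TI z. f z*rhoG s (x - z) $ i) \<bullet> h)) (at x)"
  proof (rule has_derivative_eq_rhs[OF d], rule ext)
   fix h :: "real^2"
   have "(TI z. f z*(rhoG s (x - z) \<bullet> h)) = (TI z. (f z*rhoG s (x - z) $ 1)*h $ 1 + (f z*rhoG s (x - z) $ 2)*h $ 2)"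
    by (rule tcong) (auto simp: inner_real2 algebra_simps)
   also have "\<dots> = (\<chi> i. TI z. f z*rhoG s (x - z) $ i) \<bullet> h"
    using ii by (simp add: inner_real2)
   finally show "(TI z. f z*(rhoG s (x - z) \<bullet> h)) = (\<chi> i. TI z. f z*rhoG s (x - z) $ i) \<bullet> h" .
  qed
 next
  have "continuous_on UNIV (\<lambda>x. TI z. f z*rhoG s (x - z) $ i)" for i
   unfolding continuous_on_sequentially comp_def
  proof (intro allI ballI impI)
   fix X a assume X: "(\<forall>n. X n \<in> UNIV) \<and> X \<longlonglongrightarrow> (a::real^2)"
   show "(\<lambda>n. TI z. f z*rhoG s (X n - z) $ i) \<longlonglongrightarrow> (TI z. f z*rhoG s (a - z) $ i)"
   proof (rule integral_dominated_convergence[where w="\<lambda>z. \<bar>f z\<bar>*B"])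
    show "AE z in torus. (\<lambda>n. f z*rhoG s (X n - z) $ i) \<longlonglongrightarrow> f z*rhoG s (a - z) $ i"
    proof (intro AE_I2 tendsto_intros)
     fix z
     have "isCont (rhoG s) (a - z)"
      using C1per_contG[OF C1per_rho[OF s(2)]] by (simp add: continuous_on_eq_continuous_at)
     thus "(\<lambda>n. rhoG s (X n - z)) \<longlonglongrightarrow> rhoG s (a - z)"
      by (rule isCont_tendsto_compose) (use X in \<open>auto intro!: tendsto_intros\<close>)
    qed
    show "AE z in torus. norm (f z*rhoG s (X n - z) $ i) <= \<bar>f z\<bar>*B" for n
    proof (rule AE_I2)
     fix z
     have "\<bar>rhoG s (X n - z) $ i\<bar> <= B" by (rule order_trans[OF component_le_norm_cart B(2)])
     thus "norm (f z*rhoG s (X n - z) $ i) <= \<bar>f z\<bar>*B" by (simp add: abs_mult mult_left_mono)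
    qed
   qed (use fi in auto)
  qed
  thus "continuous_on UNIV (\<lambda>x. \<chi> i. TI z. f z*rhoG s (x - z) $ i)"
   by (intro continuous_on_vec_lambda)
 qed
qed

lemma has_real_derivative_max0_sq_shift:
 "((\<lambda>t::real. (max 0 (t - M))^2) has_real_derivative 2*max 0 (t - M)) (at t)"
proof -
 have "((\<lambda>t. t - M) has_real_derivative 1) (at t)" by (auto intro!: derivative_eq_intros)
 from DERIV_chain'[OF this has_real_derivative_max0_sq] show ?thesis by simp
qed

lemma moll_le:
 assumes f: "bdd C f" and s: "0 < s" "s <= 1/16"
 shows "\<bar>moll s f x\<bar> <= C"
proof -
 note r = rho_facts[OF s]
 have i: "tint (\<lambda>z. rho s (x - z))"
  using integrable_torus_minus[OF rho_measurable C1per_per[OF C1per_rho[OF s(2)]], of x] r(4) by simp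
 have "\<bar>ip f (\<lambda>z. rho s (x - z))\<bar> <= C*(TI z. \<bar>rho s (x - z)\<bar>)" by (rule ip_bdd_le(2)[OF f i])
 thus ?thesis using r(1,7) by (simp add: moll_def ip_def)
qed

section \<open>The commutator of mollification and transport\<close>

context
 fixes w u C th C' and s :: real
 assumes BS: "biot_savart w u" and w: "bdd C w" and th: "bdd C' th" and s: "0 < s" "s <= 1/16"
begin

private lemma um: "u \<in> bmeas" "th \<in> bmeas"
 using u_meas[OF BS bdd_L2f[OF w]] bdd_meas[OF th] by auto

private lemma GB: obtains B where "\<And>x. norm (rhoG s x) <= B" "B > 0"
 using C1per_bounded[OF C1per_rho[OF s(2)]] by metis

text \<open>The commutator \<open>u . grad (moll s th) - moll s (u . grad th)\<close> as a product
  of two differences, so that each factor contributes its own modulus of translation.\<close>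

private definition "r x = (TI y. ((u x - u (x - y)) \<bullet> rhoG s y)*(th (x - y) - th x))"

private lemma per_u: "per u" using BS by (simp add: biot_savart_def L2field_def)

private lemma perG: "per (rhoG s)" by (rule C1per_perG[OF C1per_rho[OF s(2)]])

private lemma int1: "tint (\<lambda>z. (u z \<bullet> rhoG s (x - z))*th z)" (is ?A)
 and int2: "tint (\<lambda>z. (a \<bullet> rhoG s (x - z))*th z)" (is ?B)
 and int3: "tint (\<lambda>z. u z \<bullet> rhoG s (x - z))" (is ?C)
 and int4: "tint (\<lambda>z. a \<bullet> rhoG s (x - z))" (is ?D)
proof -
 note c = C1per_shift[OF C1per_rho[OF s(2)], of x]
 have "L2f (\<lambda>z. u z \<bullet> - rhoG s (x - z))" by (rule bs_inner_L2[OF BS bdd_L2f[OF w] c])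
 hence L: "L2f (\<lambda>z. u z \<bullet> rhoG s (x - z))" using L2f_uminus by fastforce
 show ?A by (rule L2f_mult[OF L bdd_L2f[OF th]])
 show ?C by (rule L2f_integrable[OF L])
 have Gi: "L2f (\<lambda>z. rhoG s (x - z) $ i)" for i
  using L2f_uminus[OF C1per_L2f(2)[OF c, of i]] by simp
 have L2: "L2f (\<lambda>z. a \<bullet> rhoG s (x - z))"
  unfolding inner_real2 by (intro L2f_add L2f_cmult Gi)
 show ?B by (rule L2f_mult[OF L2 bdd_L2f[OF th]])
 show ?D by (rule L2f_integrable[OF L2])
qed

private lemma zero1: "(TI z. u z \<bullet> rhoG s (x - z)) = 0"
proof -
 note c = C1per_shift[OF C1per_rho[OF s(2)], of x]
 have i: "tint (\<lambda>z. u z $ i*rhoG s (x - z) $ j)" for i j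
  using bs_int[OF BS bdd_L2f[OF w] c, of i j] by simp
 have "(TI z. u z $ 1*rhoG s (x - z) $ 1) + (TI z. u z $ 2*rhoG s (x - z) $ 2) = 0"
  using bs_div[OF BS bdd_L2f[OF w] c] by simp
 thus ?thesis using i by (simp add: inner_real2)
qed

private lemma zero2: "(TI z. a \<bullet> rhoG s (x - z)) = 0"
proof -
 note c = C1per_shift[OF C1per_rho[OF s(2)], of x]
 have "(TI z. rhoG s (x - z) $ i) = 0" for i using integral_gradient_zero[OF c, of i] by simp
 moreover have "tint (\<lambda>z. rhoG s (x - z) $ i)" for i
  using L2f_integrable[OF C1per_L2f(2)[OF c, of i]] by simp
 ultimately show ?thesis by (simp add: inner_real2)
qed

text \<open>Since \<open>u\<close> is divergence free, \<open>th (x - y)\<close> may be replaced by \<open>th (x - y) - th x\<close>.\<close>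
private lemma r_eq: "fl u th (\<lambda>z. - rhoG s (x - z)) = r x - u x \<bullet> (\<chi> i. TI z. th z*rhoG s (x - z) $ i)"
proof -
 note um[measurable]
 have Gi: "tint (\<lambda>z. th z*rhoG s (x - z) $ i)" for i
  using L2f_mult[OF bdd_L2f[OF th] C1per_L2f(2)[OF C1per_shift[OF C1per_rho[OF s(2)], of x], of i]] by simp
 have D: "u x \<bullet> (\<chi> i. TI z. th z*rhoG s (x - z) $ i) = (TI z. (u x \<bullet> rhoG s (x - z))*th z)"
 proof -
  have "(TI z. (u x \<bullet> rhoG s (x - z))*th z) = (TI z. u x $ 1*(th z*rhoG s (x - z) $ 1) + u x $ 2*(th z*rhoG s (x - z) $ 2))"
   by (rule tcong) (auto simp: inner_real2 algebra_simps)
  thus ?thesis using Gi by (simp add: inner_real2)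
 qed
 have "r x = (TI y. (\<lambda>z. ((u x - u z) \<bullet> rhoG s (x - z))*(th z - th x)) (x - y))"
  by (simp add: r_def)
 also have "\<dots> = (TI z. ((u x - u z) \<bullet> rhoG s (x - z))*(th z - th x))"
 proof (rule integral_torus_minus)
  have "per (\<lambda>z. rhoG s (x - z))" by (rule per_shift(3)[OF perG])
  thus "per (\<lambda>z. ((u x - u z) \<bullet> rhoG s (x - z))*(th z - th x))"
   using per_u bdd_per[OF th] by (simp add: per_def)
 qed simp
 also have "\<dots> = (TI z. (u x \<bullet> rhoG s (x - z))*th z - (u z \<bullet> rhoG s (x - z))*th z
   - (u x \<bullet> rhoG s (x - z))*th x + (u z \<bullet> rhoG s (x - z))*th x)"
  by (rule tcong) (auto simp: inner_diff_left algebra_simps)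
 also have "\<dots> = (TI z. (u x \<bullet> rhoG s (x - z))*th z) - (TI z. (u z \<bullet> rhoG s (x - z))*th z)"
  using int1[of x] int2[of "u x" x] int3[of x] int4[of "u x" x] zero1[of x] zero2[of "u x" x] by simp
 finally have "r x = u x \<bullet> (\<chi> i. TI z. th z*rhoG s (x - z) $ i) - (TI z. (u z \<bullet> rhoG s (x - z))*th z)"
  by (simp only: D)
 thus ?thesis by (simp add: fl_def)
qed

private lemma r_meas: "r \<in> bmeas"
proof -
 note um[measurable]
 have "(\<lambda>x. TI y. ((u x - u (x - y)) \<bullet> rhoG s y)*(th (x - y) - th x)) \<in> borel_measurable torus"
  by (rule torus.borel_measurable_lebesgue_integral) measurable
 thus ?thesis unfolding r_def[abs_def] measurable_cong_sets[OF sets_torus refl] .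
qed

text \<open>The gradient of the mollifier has size \<open>s powr (-3/2)\<close> on a set of measure
  at most \<open>4*s\<close>, hence total mass of order \<open>s powr (-1/2)\<close>. The
  translation of the \<open>H^1\<close> velocity supplies the compensating \<open>sqrt s\<close>;
  what remains is the \<open>L^2\<close> modulus of \<open>th\<close>, which tends to zero with
  \<open>s\<close>.\<close>

private lemma r_int:
 assumes om: "\<And>y. norm y < sqrt s ==> nsq (\<lambda>x. th (y + x) - th x) <= om"
 shows "tint (\<lambda>x. \<bar>r x\<bar>)" "(TI x. \<bar>r x\<bar>) <= 32 * C/Zc * sqrt om"
proof -
 note um[measurable] r_meas[measurable]
 note L = bs_L2f[OF BS bdd_L2f[OF w]]
 have om0: "0 <= om" using om[of 0] s by (simp add: order_trans[OF nsq_nonneg])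
 have C0: "0 <= C" by (rule bdd_nonneg[OF w])
 define A where "A = 4/(Zc*(s * sqrt s))"
 have A0: "0 <= A" using Zc_pos s by (simp add: A_def)
 define D where "D j x y = \<bar>u x $ j - u (x - y) $ j\<bar>*\<bar>th (x - y) - th x\<bar>" for j x y
 have [measurable]: "(\<lambda>(x, y). D j x y) \<in> borel_measurable (borel \<Otimes>\<^sub>M borel)" for j unfolding D_def by measurable
 have pt: "\<bar>((u x - u (x - y)) \<bullet> rhoG s y)*(th (x - y) - th x)\<bar> <= A*indicator (supp s) y*(D 1 x y + D 2 x y)" for x y
 proof -
  have "\<bar>(u x - u (x - y)) \<bullet> rhoG s y\<bar> <= norm (u x - u (x - y))*norm (rhoG s y)" by (rule Cauchy_Schwarz_ineq2)
  also have "\<dots> <= (\<bar>u x $ 1 - u (x - y) $ 1\<bar> + \<bar>u x $ 2 - u (x - y) $ 2\<bar>)*(A*indicator (supp s) y)"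
   using norm_le_l1_cart[of "u x - u (x - y)"] rho_facts(6)[OF s, of y] by (intro mult_mono) (auto simp: UNIV_2_eq A_def)
  finally have "\<bar>(u x - u (x - y)) \<bullet> rhoG s y\<bar>*\<bar>th (x - y) - th x\<bar> <=
    (\<bar>u x $ 1 - u (x - y) $ 1\<bar> + \<bar>u x $ 2 - u (x - y) $ 2\<bar>)*(A*indicator (supp s) y)*\<bar>th (x - y) - th x\<bar>"
   by (rule mult_right_mono) simp
  thus ?thesis unfolding D_def abs_mult
   by (rule order_trans) (simp only: distrib_left distrib_right mult_ac order_refl)
 qed
 have shift: "f (x - y) = f (- pr y + x)" if "per f" for f :: "real^2 => 'z" and x y
  using per_ivec[OF that, of "x - y" "rnd y"] by (simp add: pr_def algebra_simps)
 have Dx: "(\<integral>\<^sup>+x. ennreal (D j x y) \<partial>torus) <= ennreal (sqrt s * C * sqrt om)" if y: "y \<in> supp s" for j y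
 proof -
  have ny: "norm (- pr y) < sqrt s" using y by (simp add: supp_def)
  have Lu: "L2f (\<lambda>x. u (- pr y + x) $ j - u x $ j)" by (intro L2f_diff L L2f_shift(1)[OF L])
  have Lt: "L2f (\<lambda>x. th (- pr y + x) - th x)" by (intro L2f_diff bdd_L2f[OF th] L2f_shift(1)[OF bdd_L2f[OF th]])
  have La: "L2f (\<lambda>x. \<bar>u (- pr y + x) $ j - u x $ j\<bar>)" "L2f (\<lambda>x. \<bar>th (- pr y + x) - th x\<bar>)"
   using Lu Lt by (auto simp: L2f_def per_def)
  have De: "D j x y = \<bar>u (- pr y + x) $ j - u x $ j\<bar>*\<bar>th (- pr y + x) - th x\<bar>" for x
   using shift[OF per_u, of x y] shift[OF bdd_per[OF th], of x y] by (simp add: D_def abs_minus_commute)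
  have "(TI x. D j x y) <= sqrt (nsq (\<lambda>x. \<bar>u (- pr y + x) $ j - u x $ j\<bar>)) * sqrt (nsq (\<lambda>x. \<bar>th (- pr y + x) - th x\<bar>))"
   unfolding De using L2f_CS[OF La] by linarith
  also have "\<dots> = sqrt (nsq (\<lambda>x. u (- pr y + x) $ j - u x $ j)) * sqrt (nsq (\<lambda>x. th (- pr y + x) - th x))"
   by (simp add: nsq_def)
  also have "\<dots> <= sqrt (s * C^2) * sqrt om"
  proof (intro mult_mono real_sqrt_le_mono om ny)
   have "nsq (\<lambda>x. u (- pr y + x) $ j - u x $ j) <= (norm (- pr y))^2*nsq w"
    by (rule bs_translation[OF BS bdd_L2f[OF w]])
   also have "\<dots> <= (sqrt s)^2 * C^2" using ny bdd_nsq[OF w] by (intro mult_mono power_mono) auto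
   finally show "nsq (\<lambda>x. u (- pr y + x) $ j - u x $ j) <= s * C^2" using s by simp
  qed (use om0 s in auto)
  also have "\<dots> = sqrt s * C * sqrt om" using C0 by (simp add: real_sqrt_mult)
  finally have le: "(TI x. D j x y) <= sqrt s * C * sqrt om" .
  have "tint (\<lambda>x. D j x y)" unfolding De by (rule L2f_mult[OF La])
  hence "(\<integral>\<^sup>+x. ennreal (D j x y) \<partial>torus) = ennreal (TI x. D j x y)"
   by (rule nn_integral_eq_integral) (simp add: D_def)
  thus ?thesis using le by (simp add: ennreal_leI)
 qed
 have "(\<integral>\<^sup>+x. ennreal \<bar>r x\<bar> \<partial>torus) <= (\<integral>\<^sup>+x. \<integral>\<^sup>+y. ennreal (A*indicator (supp s) y*(D 1 x y + D 2 x y)) \<partial>torus \<partial>torus)"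
 proof (rule nn_integral_mono)
  fix x
  have "ennreal \<bar>r x\<bar> <= (\<integral>\<^sup>+y. ennreal (norm (((u x - u (x - y)) \<bullet> rhoG s y)*(th (x - y) - th x))) \<partial>torus)"
  proof (cases "tint (\<lambda>y. ((u x - u (x - y)) \<bullet> rhoG s y)*(th (x - y) - th x))")
   case True thus ?thesis using integral_norm_bound_ennreal[OF True] by (simp add: r_def)
  next
   \<comment> \<open>A non-integrable inner integral has the value 0 by convention, so the bound on
     \<open>\<bar>r x\<bar>\<close> holds at every \<open>x\<close>.\<close>
   case False thus ?thesis by (simp add: r_def not_integrable_integral_eq)
  qed
  also have "\<dots> <= (\<integral>\<^sup>+y. ennreal (A*indicator (supp s) y*(D 1 x y + D 2 x y)) \<partial>torus)"
   by (intro nn_integral_mono ennreal_leI) (use pt in simp)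
  finally show "ennreal \<bar>r x\<bar> <= (\<integral>\<^sup>+y. ennreal (A*indicator (supp s) y*(D 1 x y + D 2 x y)) \<partial>torus)" .
 qed
 also have "\<dots> = (\<integral>\<^sup>+y. \<integral>\<^sup>+x. ennreal (A*indicator (supp s) y*(D 1 x y + D 2 x y)) \<partial>torus \<partial>torus)"
  by (rule torus_pair.Fubini') (simp add: case_prod_beta')
 also have "\<dots> <= (\<integral>\<^sup>+y. ennreal (A*(2*(sqrt s * C * sqrt om))*indicator (supp s) y) \<partial>torus)"
 proof (rule nn_integral_mono)
  fix y
  show "(\<integral>\<^sup>+x. ennreal (A*indicator (supp s) y*(D 1 x y + D 2 x y)) \<partial>torus) <= ennreal (A*(2*(sqrt s * C * sqrt om))*indicator (supp s) y)"
  proof (cases "y \<in> supp s")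
   case True
   have "(\<integral>\<^sup>+x. ennreal (A*indicator (supp s) y*(D 1 x y + D 2 x y)) \<partial>torus) = ennreal A*((\<integral>\<^sup>+x. ennreal (D 1 x y) \<partial>torus) + (\<integral>\<^sup>+x. ennreal (D 2 x y) \<partial>torus))"
   proof -
    have Dn: "0 <= D j x y" for j x by (simp add: D_def)
    have "(\<integral>\<^sup>+x. ennreal (A*indicator (supp s) y*(D 1 x y + D 2 x y)) \<partial>torus) = (\<integral>\<^sup>+x. ennreal A*(ennreal (D 1 x y) + ennreal (D 2 x y)) \<partial>torus)"
     using True A0 Dn by (intro nn_integral_cong) (simp add: ennreal_mult' flip: ennreal_plus)
    also have "\<dots> = ennreal A*(\<integral>\<^sup>+x. ennreal (D 1 x y) + ennreal (D 2 x y) \<partial>torus)" by (rule nn_integral_cmult) simp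
    also have "(\<integral>\<^sup>+x. ennreal (D 1 x y) + ennreal (D 2 x y) \<partial>torus) = (\<integral>\<^sup>+x. ennreal (D 1 x y) \<partial>torus) + (\<integral>\<^sup>+x. ennreal (D 2 x y) \<partial>torus)"
     by (rule nn_integral_add) simp_all
    finally show ?thesis .
   qed
   also have "\<dots> <= ennreal A*(ennreal (sqrt s * C * sqrt om) + ennreal (sqrt s * C * sqrt om))"
    by (intro mult_left_mono add_mono Dx True) auto
   also have "\<dots> = ennreal (A*(2*(sqrt s * C * sqrt om)))"
    using A0 C0 om0 s by (simp add: ennreal_plus[symmetric] ennreal_mult'[symmetric] del: ennreal_plus)
   finally show ?thesis using True by simp
  qed simp
 qed
 also have "\<dots> = ennreal (A*(2*(sqrt s * C * sqrt om))*measure torus (supp s))"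
 proof -
  have "(\<integral>\<^sup>+y. ennreal (A*(2*(sqrt s * C * sqrt om))*indicator (supp s) y) \<partial>torus)
    = (\<integral>\<^sup>+y. ennreal (A*(2*(sqrt s * C * sqrt om)))*indicator (supp s) y \<partial>torus)"
   by (intro nn_integral_cong) (auto simp: indicator_def)
  also have "\<dots> = ennreal (A*(2*(sqrt s * C * sqrt om)))*emeasure torus (supp s)"
   by (rule nn_integral_cmult_indicator) simp
  finally show ?thesis using A0 C0 om0 s by (simp add: torus.emeasure_eq_measure ennreal_mult[symmetric])
 qed
 also have "\<dots> <= ennreal (32 * C/Zc * sqrt om)"
 proof (rule ennreal_leI)
  have "A*(2*(sqrt s * C * sqrt om))*measure torus (supp s) <= A*(2*(sqrt s * C * sqrt om))*(4 * s)"
   using measure_supp[OF s] A0 C0 om0 s by (intro mult_left_mono) auto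
  also have "\<dots> = 32 * C/Zc * sqrt om" using s Zc_pos by (simp add: A_def field_simps)
  finally show "A*(2*(sqrt s * C * sqrt om))*measure torus (supp s) <= 32 * C/Zc * sqrt om" .
 qed
 finally have fin: "(\<integral>\<^sup>+x. ennreal \<bar>r x\<bar> \<partial>torus) <= ennreal (32 * C/Zc * sqrt om)" .
 have "0 <= 32 * C/Zc * sqrt om" using C0 om0 Zc_pos by simp
 note R = nn_integral_finite_le[OF _ _ fin this]
 show "tint (\<lambda>x. \<bar>r x\<bar>)" "(TI x. \<bar>r x\<bar>) <= 32 * C/Zc * sqrt om" using R by auto
qed

text \<open>\<open>P\<close> times the gradient of \<open>moll s th\<close> is the gradient of the
  squared positive part, and this is orthogonal to the divergence-free \<open>u\<close>. Hence only
  \<open>P x*r x\<close> survives, and \<open>0 <= M\<close> keeps \<open>P\<close> below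
  \<open>2 * C'\<close>.\<close>

lemma commutator:
 assumes om: "\<And>y. norm y < sqrt s ==> nsq (\<lambda>x. th (y + x) - th x) <= om" and M: "0 <= M"
 defines "P \<equiv> \<lambda>x. 2*max 0 (moll s th x - M)"
 shows "tint (\<lambda>x. P x*fl u th (\<lambda>z. - rhoG s (x - z)))"
  "(TI x. P x*fl u th (\<lambda>z. - rhoG s (x - z))) <= 2 * C'*(32 * C/Zc * sqrt om)"
proof -
 note um[measurable] r_meas[measurable]
 have C'0: "0 <= C'" by (rule bdd_nonneg[OF th])
 let ?D = "\<lambda>x. \<chi> i. TI z. th z*rhoG s (x - z) $ i"
 note cm = C1per_moll[OF th s]
 have Pm[measurable]: "P \<in> bmeas" unfolding P_def by measurable
 have Pb: "\<bar>P x\<bar> <= 2 * C'" for x using moll_le[OF th s, of x] M C'0 by (auto simp: P_def max_def abs_le_iff)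
 have cP: "C1per (\<lambda>x. (max 0 (moll s th x - M))^2) (\<lambda>x. P x *\<^sub>R ?D x)"
  unfolding P_def
  by (rule C1per_compose[OF cm has_real_derivative_max0_sq_shift]) (intro continuous_intros)
 have zero: "(TI x. P x*(u x \<bullet> ?D x)) = 0"
 proof -
  have "(TI x. u x $ 1*(P x *\<^sub>R ?D x) $ 1) + (TI x. u x $ 2*(P x *\<^sub>R ?D x) $ 2) = 0"
   by (rule bs_div[OF BS bdd_L2f[OF w] cP])
  moreover have "(TI x. P x*(u x \<bullet> ?D x)) = (TI x. u x $ 1*(P x *\<^sub>R ?D x) $ 1 + u x $ 2*(P x *\<^sub>R ?D x) $ 2)"
   by (rule tcong) (auto simp: inner_real2 algebra_simps)
  ultimately show ?thesis using bs_int[OF BS bdd_L2f[OF w] cP] by simp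
 qed
 have i0: "tint (\<lambda>x. P x*(u x \<bullet> ?D x))"
  using L2f_integrable[OF bs_inner_L2[OF BS bdd_L2f[OF w] cP]] by simp
 have ri: "tint r" using r_int(1)[OF om] by (simp add: integrable_abs_iff)
 note PR = integral_mult_bound[OF AE_I2[OF Pb] Pm ri]
 have eq: "P x*fl u th (\<lambda>z. - rhoG s (x - z)) = P x*r x - P x*(u x \<bullet> ?D x)" for x
  by (simp add: r_eq right_diff_distrib)
 show "tint (\<lambda>x. P x*fl u th (\<lambda>z. - rhoG s (x - z)))"
  unfolding eq using PR(2) i0 by (rule Bochner_Integration.integrable_diff)
 have "(TI x. P x*fl u th (\<lambda>z. - rhoG s (x - z))) = (TI x. P x*r x)"
  unfolding eq using PR(2) i0 zero by simp
 also have "\<dots> <= 2 * C'*(TI x. \<bar>r x\<bar>)" using PR(1) by linarith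
 also have "\<dots> <= 2 * C'*(32 * C/Zc * sqrt om)" using r_int(2)[OF om] C'0 by (intro mult_left_mono) auto
 finally show "(TI x. P x*fl u th (\<lambda>z. - rhoG s (x - z))) <= 2 * C'*(32 * C/Zc * sqrt om)" .
qed

end

section \<open>Comparison of the noise-free part with a barrier \<open>M\<close> whose derivative is
  \<open>F\<close>\<close>

context
 fixes \<gamma> t0 X0 N \<xi> u T w K A and sg :: real and F M :: "real => real"
 assumes S: "sol \<gamma> t0 X0 N \<xi> u" and gam: "0 <= \<gamma>" and sg: "sg = 1 \<or> sg = -1"
  and w: "\<And>t. t \<in> {t0..T} ==> bdd K (w t)"
  and Nw: "\<And>t g G. t \<in> {t0..T} ==> C1per g G ==> N t G = ip (w t) g"
  and l: "\<And>t g G. t \<in> {t0..T} ==> C1per g G ==> (\<And>x. 0 <= g x) ==>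
    \<bar>- \<gamma>*ip (w t) g + fl (u t) (w t) G\<bar> <= F t*(TI x. g x)"
  and M: "\<And>t. t \<in> {t0..T} ==> (M has_real_derivative F t) (at t within {t0..T})"
  and F: "continuous_on {t0..T} F" and M0: "\<And>t. t \<in> {t0..T} ==> 0 <= M t"
  and X0: "bdd A X0" "A <= M t0" and tT: "t0 <= T"
begin

text \<open>The functional \<open>N\<close> being represented by \<open>w\<close>, this difference
  satisfies an equation without noise. The two values of \<open>sg\<close> give the upper and the
  lower bound from one argument.\<close>

definition "mpth t x = sg*(\<xi> t x - w t x)"

context
 fixes C assumes C: "\<And>t. t \<in> {t0..T} ==> bdd C (\<xi> t)"
begin

private lemma sgsq: "sg * sg = 1" "\<bar>sg\<bar> = 1" using sg by auto

private lemma BS: "t \<in> {t0..T} ==> biot_savart (\<xi> t) (u t)" using sol_BS[OF S] by simp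

private lemma th_bdd: assumes t: "t \<in> {t0..T}" shows "bdd (C + K) (mpth t)"
proof -
 have "bdd (C + K) (\<lambda>x. \<xi> t x - w t x)" by (rule bdd_diff[OF C[OF t] w[OF t]])
 thus ?thesis unfolding bdd_def mpth_def[abs_def] by (auto simp: per_def abs_mult sgsq)
qed

private lemma ip_th: assumes t: "t \<in> {t0..T}" and g: "C1per g G" shows "ip (mpth t) g = sg*(ip (\<xi> t) g - N t G)"
 using ip_diff_left[OF bdd_L2f[OF C[OF t]] bdd_L2f[OF w[OF t]] C1per_L2f(1)[OF g]]
 by (simp add: Nw[OF t g] ip_def mpth_def mult.assoc)

private lemma fl_th: assumes t: "t \<in> {t0..T}" and g: "C1per g G"
 shows "sg*fl (u t) (\<xi> t) G = fl (u t) (mpth t) G + sg*fl (u t) (w t) G"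
proof -
 note LG = bs_inner_L2[OF BS[OF t] bdd_L2f[OF C[OF t]] g]
 have i: "tint (\<lambda>x. (u t x \<bullet> G x)*mpth t x)" "tint (\<lambda>x. sg*((u t x \<bullet> G x)*w t x))"
  using L2f_mult[OF LG bdd_L2f[OF th_bdd[OF t]]] L2f_mult[OF LG bdd_L2f[OF w[OF t]]] by auto
 have "sg*fl (u t) (\<xi> t) G = (TI x. sg*((u t x \<bullet> G x)*\<xi> t x))" by (simp add: fl_def)
 also have "\<dots> = (TI x. (u t x \<bullet> G x)*mpth t x + sg*((u t x \<bullet> G x)*w t x))"
  by (rule tcong) (auto simp: mpth_def algebra_simps)
 also have "\<dots> = fl (u t) (mpth t) G + sg*fl (u t) (w t) G" using i by (simp add: fl_def)
 finally show ?thesis .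
qed

private lemma Cpos: "0 <= C" "0 <= C + K"
 using bdd_nonneg[OF C[of t0]] bdd_nonneg[OF th_bdd[of t0]] tT by auto

context
 fixes s :: real assumes s: "0 < s" "s <= 1/16"
begin

private abbreviation "g x \<equiv> \<lambda>z. rho s (x - z)"
private abbreviation "G x \<equiv> \<lambda>z. - rhoG s (x - z)"
definition "mpq t x = moll s (mpth t) x"
definition "mpJ t x = sg*(- \<gamma>*ip (\<xi> t) (g x) + fl (u t) (\<xi> t) (G x))"
definition "mpP t x = 2*max 0 (mpq t x - M t)"
text \<open>The squared \<open>L^2\<close> excess over the barrier. Mollification makes it
  differentiable in time: \<open>mpq t x\<close> is the equation tested with
  \<open>rho s (x - z)\<close>, and \<open>mpJ t x\<close> is its derivative.\<close>

definition "mpH t = (TI x. (max 0 (mpq t x - M t))^2)"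
definition "mph t = (TI x. mpP t x*(mpJ t x - F t))"

private lemma cg: "C1per (g x) (G x)" by (rule C1per_shift[OF C1per_rho[OF s(2)]])

private lemma q_eq: assumes t: "t \<in> {t0..T}" shows "mpq t x = sg*(ip (\<xi> t) (g x) - N t (G x))"
 using ip_th[OF t cg[of x]] by (simp add: mpq_def moll_def ip_def)

private lemma dq: assumes t: "t \<in> {t0..T}" shows "((\<lambda>t. mpq t x) has_real_derivative mpJ t x) (at t within {t0..T})"
proof -
 have "((\<lambda>t. sg*(ip (\<xi> t) (g x) - N t (G x))) has_real_derivative mpJ t x) (at t within {t0..T})"
  unfolding mpJ_def by (rule DERIV_cmult[OF sol_deriv[OF S cg t]])
 thus ?thesis
  by (rule has_field_derivative_transform_within[OF _ zero_less_one t]) (simp add: q_eq)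
qed

text \<open>The test function is a probability density, so the forcing hypothesis contributes
  precisely \<open>F t\<close>.\<close>

private lemma J_le: assumes t: "t \<in> {t0..T}" shows "mpJ t x <= - \<gamma>*mpq t x + fl (u t) (mpth t) (G x) + F t"
proof -
 have 1: "sg*ip (\<xi> t) (g x) = mpq t x + sg*ip (w t) (g x)"
  by (simp add: q_eq[OF t] Nw[OF t cg] algebra_simps)
 have "mpJ t x = - \<gamma>*(sg*ip (\<xi> t) (g x)) + sg*fl (u t) (\<xi> t) (G x)" by (simp add: mpJ_def algebra_simps)
 also have "\<dots> = - \<gamma>*mpq t x + fl (u t) (mpth t) (G x) + sg*(- \<gamma>*ip (w t) (g x) + fl (u t) (w t) (G x))"
  unfolding 1 fl_th[OF t cg] by (simp add: algebra_simps)
 also have "sg*(- \<gamma>*ip (w t) (g x) + fl (u t) (w t) (G x)) <= \<bar>sg*(- \<gamma>*ip (w t) (g x) + fl (u t) (w t) (G x))\<bar>" by simp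
 also have "\<dots> <= F t*(TI z. g x z)"
  unfolding abs_mult sgsq mult_1 by (rule l[OF t cg]) (rule rho_facts(1)[OF s])
 finally show ?thesis using rho_facts(7)[OF s] by simp
qed

private lemma q_le: "t \<in> {t0..T} ==> \<bar>mpq t x\<bar> <= C + K"
 unfolding mpq_def by (rule moll_le[OF th_bdd s])

private lemma MB: obtains B where "\<And>t. t \<in> {t0..T} ==> \<bar>M t\<bar> <= B" "B >= 0"
proof -
 have "compact (M ` {t0..T})" by (intro compact_continuous_image DERIV_continuous_on[OF M]) auto
 hence "bounded (M ` {t0..T})" by (rule compact_imp_bounded)
 then obtain B where B: "\<And>y. y \<in> M ` {t0..T} ==> norm y <= B" "B > 0" unfolding bounded_pos by blast
 show ?thesis by (rule that[of B]) (use B in auto)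
qed

private lemma FB: obtains B where "\<And>t. t \<in> {t0..T} ==> \<bar>F t\<bar> <= B" "B >= 0"
proof -
 have "compact (F ` {t0..T})" by (intro compact_continuous_image F) auto
 hence "bounded (F ` {t0..T})" by (rule compact_imp_bounded)
 then obtain B where B: "\<And>y. y \<in> F ` {t0..T} ==> norm y <= B" "B > 0" unfolding bounded_pos by blast
 show ?thesis by (rule that[of B]) (use B in auto)
qed

private lemma JB: obtains B where "\<And>t x. t \<in> {t0..T} ==> \<bar>mpJ t x\<bar> <= B" "B >= 0"
proof -
 obtain GB where GB: "\<And>x. norm (rhoG s x) <= GB" "GB > 0" using C1per_bounded[OF C1per_rho[OF s(2)]] by metis
 have "\<bar>mpJ t x\<bar> <= \<gamma> * C + sqrt (GB^2*(C^2)) * sqrt (C^2)" if t: "t \<in> {t0..T}" for t x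
 proof -
  note L = bdd_L2f[OF C[OF t]]
  have "\<bar>ip (\<xi> t) (g x)\<bar> <= C" using moll_le[OF C[OF t] s, of x] by (simp add: moll_def ip_def)
  hence "\<bar>\<gamma>*ip (\<xi> t) (g x)\<bar> <= \<gamma> * C" using gam by (simp add: abs_mult mult_left_mono)
  moreover have "\<bar>fl (u t) (\<xi> t) (G x)\<bar> <= sqrt (nsq (\<lambda>z. u t z \<bullet> G x z)) * sqrt (nsq (\<xi> t))"
   unfolding fl_def by (rule L2f_CS[OF bs_inner_L2[OF BS[OF t] L cg] L])
  moreover have "\<dots> <= sqrt (GB^2*(C^2)) * sqrt (C^2)"
  proof (intro mult_mono real_sqrt_le_mono)
   have "nsq (\<lambda>z. u t z \<bullet> G x z) <= GB^2*(nsq (\<lambda>z. u t z $ 1) + nsq (\<lambda>z. u t z $ 2))"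
    by (rule nsq_inner_le[OF BS[OF t] L cg]) (use GB in simp)
   also have "\<dots> <= GB^2 * C^2"
    using bs_nsq[OF BS[OF t] L] bdd_nsq[OF C[OF t]] by (intro mult_left_mono) auto
   finally show "nsq (\<lambda>z. u t z \<bullet> G x z) <= GB^2 * C^2" .
  qed (use bdd_nsq[OF C[OF t]] in auto)
  ultimately show ?thesis unfolding mpJ_def abs_mult[of sg] sgsq mult_1 by linarith
 qed
 thus ?thesis using gam Cpos by (intro that[of "\<gamma> * C + sqrt (GB^2*(C^2)) * sqrt (C^2)"]) auto
qed

private lemma J_meas: assumes t: "t \<in> {t0..T}" shows "mpJ t \<in> bmeas"
proof -
 note [measurable] = bdd_meas[OF C[OF t]] u_meas[OF BS[OF t] bdd_L2f[OF C[OF t]]]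
 have "(\<lambda>x. TI z. (u t z \<bullet> G x z)*\<xi> t z) \<in> borel_measurable torus"
  by (rule torus.borel_measurable_lebesgue_integral) measurable
 hence 1: "(\<lambda>x. fl (u t) (\<xi> t) (G x)) \<in> bmeas"
  unfolding fl_def measurable_cong_sets[OF sets_torus refl] .
 have 2: "(\<lambda>x. ip (\<xi> t) (g x)) \<in> bmeas"
  using moll_measurable[OF bdd_meas[OF C[OF t]], of s] by (simp add: moll_def[abs_def] ip_def)
 show ?thesis unfolding mpJ_def[abs_def] using 1 2 by measurable
qed

private lemma q_meas: "t \<in> {t0..T} ==> mpq t \<in> bmeas"
 unfolding mpq_def[abs_def] using moll_measurable[OF bdd_meas[OF th_bdd]] by simp

private lemma PJ_bound: obtains B where "\<And>t x. t \<in> {t0..T} ==> \<bar>mpP t x*(mpJ t x - F t)\<bar> <= B" "B >= 0"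
proof -
 obtain b1 where 1: "\<And>t. t \<in> {t0..T} ==> \<bar>M t\<bar> <= b1" "b1 >= 0" using MB by metis
 obtain b2 where 2: "\<And>t. t \<in> {t0..T} ==> \<bar>F t\<bar> <= b2" "b2 >= 0" using FB by metis
 obtain b3 where 3: "\<And>t x. t \<in> {t0..T} ==> \<bar>mpJ t x\<bar> <= b3" "b3 >= 0" using JB by metis
 have "\<bar>mpP t x*(mpJ t x - F t)\<bar> <= (2*(C + K + b1))*(b3 + b2)" if t: "t \<in> {t0..T}" for t x
  unfolding abs_mult
 proof (intro mult_mono)
  show "\<bar>mpP t x\<bar> <= 2*(C + K + b1)" using q_le[OF t, of x] 1(1)[OF t] Cpos 1(2) by (auto simp: mpP_def max_def)
  show "\<bar>mpJ t x - F t\<bar> <= b3 + b2" using 3(1)[OF t, of x] 2(1)[OF t] by linarith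
 qed (use 1 2 3 Cpos in auto)
 thus ?thesis using Cpos 1 2 3 by (intro that[of "(2*(C + K + b1))*(b3 + b2)"]) auto
qed

private lemma dH: assumes t: "t \<in> {t0..T}" shows "(mpH has_real_derivative mph t) (at t within {t0..T})"
proof -
 obtain B where B: "\<And>t x. t \<in> {t0..T} ==> \<bar>mpP t x*(mpJ t x - F t)\<bar> <= B" "B >= 0" using PJ_bound by metis
 have d: "((\<lambda>t. (max 0 (mpq t x - M t))^2) has_real_derivative mpP t x*(mpJ t x - F t)) (at t within {t0..T})" if t: "t \<in> {t0..T}" for t x
  unfolding mpP_def using DERIV_chain2[OF has_real_derivative_max0_sq DERIV_diff[OF dq[OF t] M[OF t]]] .
 have "((\<lambda>t. TI x. 1*(max 0 (mpq t x - M t))^2) has_derivative (\<lambda>mph. TI x. 1*(mpP t x*(mpJ t x - F t)*mph))) (at t within {t0..T})"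
 proof (rule has_derivative_integral_dominated[where B=B and K="(C + K + \<bar>M t\<bar>)^2"])
  show "((\<lambda>t. (max 0 (mpq t x - M t))^2) has_derivative (*) (mpP t x*(mpJ t x - F t))) (at t within {t0..T})" for x
   using d[OF t] by (simp add: has_field_derivative_def)
  show "\<bar>(max 0 (mpq t x - M t))^2\<bar> <= (C + K + \<bar>M t\<bar>)^2" for x
   unfolding abs_power2 using q_le[OF t, of x] Cpos by (intro power_mono) (auto simp: max_def)
  show "\<bar>(max 0 (mpq y x - M y))^2 - (max 0 (mpq t x - M t))^2\<bar> <= B*norm (y - t)" if "y \<in> {t0..T}" for x y
  proof -
   have "norm ((max 0 (mpq y x - M y))^2 - (max 0 (mpq t x - M t))^2) <= B*norm (y - t)"
   proof (rule differentiable_bound[where S="{t0..T}" and f'="\<lambda>r k. mpP r x*(mpJ r x - F r)*k"])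
    show "((\<lambda>t. (max 0 (mpq t x - M t))^2) has_derivative (*) (mpP r x*(mpJ r x - F r))) (at r within {t0..T})" if "r \<in> {t0..T}" for r
     using d[OF that] by (simp add: has_field_derivative_def)
    show "onorm ((*) (mpP r x*(mpJ r x - F r))) <= B" if "r \<in> {t0..T}" for r
     by (rule onorm_le, unfold real_norm_def abs_mult[of "mpP r x*(mpJ r x - F r)"], rule mult_right_mono[OF B(1)[OF that]]) simp
   qed (use that t in auto)
   thus ?thesis by simp
  qed
  show "\<bar>mpP t x*(mpJ t x - F t)*k\<bar> <= B*norm k" for x k
   unfolding abs_mult[of "mpP t x*(mpJ t x - F t)"] real_norm_def by (rule mult_right_mono[OF B(1)[OF t]]) simp
  show "(\<lambda>x. (max 0 (mpq y x - M y))^2) \<in> borel_measurable torus" if "y \<in> {t0..T}" for y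
   using q_meas[OF that] by measurable
  show "(\<lambda>x. mpP t x*(mpJ t x - F t)*k) \<in> borel_measurable torus" for k
   using q_meas[OF t] J_meas[OF t] unfolding mpP_def by measurable
 qed (use t in auto)
 thus ?thesis unfolding has_field_derivative_def mpH_def[abs_def] mph_def
  by (simp only: mult_1 integral_mult_left_zero)
qed

private lemma h_cont: "continuous_on {t0..T} mph"
 unfolding continuous_on_sequentially comp_def
proof (intro allI ballI impI)
 fix X a assume X: "(\<forall>n. X n \<in> {t0..T}) \<and> X \<longlonglongrightarrow> a" and a: "a \<in> {t0..T}"
 obtain B where B: "\<And>t x. t \<in> {t0..T} ==> \<bar>mpP t x*(mpJ t x - F t)\<bar> <= B" "B >= 0" using PJ_bound by metis
 have c: "(\<lambda>n. f (X n)) \<longlonglongrightarrow> f a" if "continuous_on {t0..T} f" for f :: "real => real"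
  using that X a unfolding continuous_on_sequentially comp_def by blast
 show "(\<lambda>n. mph (X n)) \<longlonglongrightarrow> mph a" unfolding mph_def
 proof (rule integral_dominated_convergence[where w="\<lambda>x. B"])
  have "(\<lambda>x. mpP t x*(mpJ t x - F t)) \<in> borel_measurable torus" if "t \<in> {t0..T}" for t
   using q_meas[OF that] J_meas[OF that] unfolding mpP_def by measurable
  thus "(\<lambda>x. mpP (X n) x*(mpJ (X n) x - F (X n))) \<in> borel_measurable torus"
   "(\<lambda>x. mpP a x*(mpJ a x - F a)) \<in> borel_measurable torus" for n using X a by auto
  show "AE x in torus. (\<lambda>n. mpP (X n) x*(mpJ (X n) x - F (X n))) \<longlonglongrightarrow> mpP a x*(mpJ a x - F a)"
  proof (rule AE_I2)
   fix x
   have "continuous_on {t0..T} (\<lambda>t. mpq t x)" by (rule DERIV_continuous_on[OF dq])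
   moreover have "continuous_on {t0..T} M" by (rule DERIV_continuous_on[OF M])
   moreover have "continuous_on {t0..T} (\<lambda>t. mpJ t x)"
    unfolding mpJ_def by (intro continuous_intros; rule continuous_on_subset[OF sol_cont_test[OF S cg]] continuous_on_subset[OF sol_cont_fl[OF S cg]]; auto)
   ultimately show "(\<lambda>n. mpP (X n) x*(mpJ (X n) x - F (X n))) \<longlonglongrightarrow> mpP a x*(mpJ a x - F a)"
    unfolding mpP_def by (intro tendsto_intros tendsto_max c F) auto
  qed
  show "AE x in torus. norm (mpP (X n) x*(mpJ (X n) x - F (X n))) <= B" for n using B(1)[of "X n"] X by auto
 qed auto
qed

text \<open>Where \<open>mpq\<close> exceeds \<open>M >= 0\<close>, the damping has a favourable
  sign and the forcing is cancelled by the derivative \<open>F\<close> of the barrier. Elsewhere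
  \<open>mpP\<close> vanishes, so only the commutator is left.\<close>

private lemma h_le:
 assumes t: "t \<in> {t0..T}" and om: "\<And>y. norm y < sqrt s ==> nsq (\<lambda>x. mpth t (y + x) - mpth t x) <= om"
 shows "mph t <= 2*(C + K)*(32 * C/Zc * sqrt om)"
proof -
 obtain B where B: "\<And>t x. t \<in> {t0..T} ==> \<bar>mpP t x*(mpJ t x - F t)\<bar> <= B" "B >= 0" using PJ_bound by metis
 note cm = commutator[OF BS[OF t] C[OF t] th_bdd[OF t] s om M0[OF t]]
 have "mph t <= (TI x. mpP t x*fl (u t) (mpth t) (G x))" unfolding mph_def
 proof (rule integral_mono)
  show "tint (\<lambda>x. mpP t x*(mpJ t x - F t))"
   by (rule integrable_torus_bounded[where C=B]) (use B(1)[OF t] q_meas[OF t] J_meas[OF t] in \<open>auto simp: mpP_def\<close>)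
  show "tint (\<lambda>x. mpP t x*fl (u t) (mpth t) (G x))" using cm(1) by (simp add: mpP_def mpq_def)
  fix x
  show "mpP t x*(mpJ t x - F t) <= mpP t x*fl (u t) (mpth t) (G x)"
  proof (cases "mpq t x > M t")
   case True
   hence "0 <= \<gamma>*mpq t x" using gam M0[OF t] by simp
   hence "mpJ t x - F t <= fl (u t) (mpth t) (G x)" using J_le[OF t, of x] by linarith
   thus ?thesis by (intro mult_left_mono) (auto simp: mpP_def)
  qed (simp add: mpP_def)
 qed
 also have "\<dots> <= 2*(C + K)*(32 * C/Zc * sqrt om)" using cm(2) by (simp add: mpP_def mpq_def)
 finally show ?thesis .
qed

private lemma H_init: "mpH t0 = 0"
proof -
 have t0: "t0 \<in> {t0..T}" using tT by simp
 have "mpq t0 x <= M t0" for x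
 proof -
  have "mpq t0 x = sg*ip X0 (g x)" by (simp add: q_eq[OF t0] sol_init[OF S cg])
  also have "\<dots> <= \<bar>sg*ip X0 (g x)\<bar>" by simp
  also have "\<dots> <= A" using moll_le[OF X0(1) s, of x] by (simp add: abs_mult sgsq moll_def ip_def)
  finally show ?thesis using X0(2) by linarith
 qed
 hence "(max 0 (mpq t0 x - M t0))^2 = 0" for x by simp
 thus ?thesis by (simp add: mpH_def)
qed

private lemma H_eq: assumes t: "t \<in> {t0..T}" shows "mpH t <= integral {t0..t} (\<lambda>r. max 0 (mph r))"
proof -
 have sub: "{t0..t} \<subseteq> {t0..T}" using t by auto
 have "(mph has_integral (mpH t - mpH t0)) {t0..t}"
  by (rule fundamental_theorem_of_calculus)
   (use t dH DERIV_subset[OF dH sub] in \<open>auto simp: has_real_derivative_iff_has_vector_derivative[symmetric]\<close>)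
 hence "mpH t = integral {t0..t} mph" using H_init by (simp add: integral_unique)
 also have "\<dots> <= integral {t0..t} (\<lambda>r. max 0 (mph r))"
  by (rule integral_le) (auto intro!: integrable_continuous_interval continuous_intros continuous_on_subset[OF h_cont sub])
 finally show ?thesis .
qed

text \<open>Cutting off at \<open>M\<close> is 1-Lipschitz, so returning from the mollified function
  to \<open>mpth\<close> costs no more than the mollification error.\<close>

private lemma H_lower: assumes t: "t \<in> {t0..T}" and om: "\<And>y. norm y < sqrt s ==> nsq (\<lambda>x. mpth t (y + x) - mpth t x) <= om"
 shows "nsq (\<lambda>x. max 0 (mpth t x - M t)) <= 2*mpH t + 2 * om" "L2f (\<lambda>x. max 0 (mpth t x - M t))"
proof -
 note bt = th_bdd[OF t]
 note [measurable] = bdd_meas[OF bt] q_meas[OF t]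
 note mo = moll_L2[OF bdd_L2f[OF bt] s om]
 have L1: "L2f (\<lambda>x. max 0 (mpq t x - M t))"
 proof (rule L2f_bounded[where C="C + K + \<bar>M t\<bar>"])
  show "AE x in torus. \<bar>max 0 (mpq t x - M t)\<bar> <= C + K + \<bar>M t\<bar>"
  proof (rule AE_I2)
   fix x show "\<bar>max 0 (mpq t x - M t)\<bar> <= C + K + \<bar>M t\<bar>" using q_le[OF t, of x] by linarith
  qed
  show "per (\<lambda>x. max 0 (mpq t x - M t))" using per_moll[OF s(2), of "mpth t"] by (simp add: per_def mpq_def)
 qed simp
 have Lt: "L2f (\<lambda>x. max 0 (mpth t x - M t))"
 proof (rule L2f_bounded[where C="C + K + \<bar>M t\<bar>"])
  show "AE x in torus. \<bar>max 0 (mpth t x - M t)\<bar> <= C + K + \<bar>M t\<bar>"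
   using bdd_AE[OF bt] by eventually_elim linarith
  show "per (\<lambda>x. max 0 (mpth t x - M t))" using bdd_per[OF bt] by (simp add: per_def)
 qed simp
 thus "L2f (\<lambda>x. max 0 (mpth t x - M t))" .
 have Ld: "L2f (\<lambda>x. max 0 (mpth t x - M t) - max 0 (mpq t x - M t))" by (rule L2f_diff[OF Lt L1])
 have "nsq (\<lambda>x. max 0 (mpth t x - M t)) = nsq (\<lambda>x. max 0 (mpq t x - M t) + (max 0 (mpth t x - M t) - max 0 (mpq t x - M t)))" by simp
 also have "\<dots> <= 2*nsq (\<lambda>x. max 0 (mpq t x - M t)) + 2*nsq (\<lambda>x. max 0 (mpth t x - M t) - max 0 (mpq t x - M t))"
  by (rule nsq_add_le[OF L1 Ld])
 also have "nsq (\<lambda>x. max 0 (mpq t x - M t)) = mpH t" by (simp add: nsq_def mpH_def)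
 also have "nsq (\<lambda>x. max 0 (mpth t x - M t) - max 0 (mpq t x - M t)) <= nsq (\<lambda>x. moll s (mpth t) x - mpth t x)"
  unfolding nsq_def
 proof (rule integral_mono[OF L2f_sq[OF Ld] L2f_sq[OF mo(1)]])
  fix x
  have "\<bar>max 0 (mpth t x - M t) - max 0 (mpq t x - M t)\<bar> <= \<bar>mpq t x - mpth t x\<bar>" by linarith
  thus "(max 0 (mpth t x - M t) - max 0 (mpq t x - M t))^2 <= (moll s (mpth t) x - mpth t x)^2"
   using power_mono[of "\<bar>max 0 (mpth t x - M t) - max 0 (mpq t x - M t)\<bar>" "\<bar>mpq t x - mpth t x\<bar>" 2] by (simp add: mpq_def)
 qed
 also have "\<dots> <= om" by (rule mo(2))
 finally show "nsq (\<lambda>x. max 0 (mpth t x - M t)) <= 2*mpH t + 2 * om" by simp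
qed

lemmas mp_facts = h_cont h_le H_eq H_lower

end

private lemma om_all: assumes t: "t \<in> {t0..T}" shows "nsq (\<lambda>x. mpth t (y + x) - mpth t x) <= 4*(C + K)^2"
proof -
 note L = bdd_L2f[OF th_bdd[OF t]]
 have "nsq (\<lambda>x. mpth t (y + x) + (- mpth t x)) <= 2*nsq (\<lambda>x. mpth t (y + x)) + 2*nsq (\<lambda>x. - mpth t x)"
  by (rule nsq_add_le[OF L2f_shift(1)[OF L] L2f_uminus[OF L]])
 also have "nsq (\<lambda>x. - mpth t x) = nsq (mpth t)" by (simp add: nsq_def)
 finally show ?thesis using L2f_shift(2)[OF L, of y] bdd_nsq[OF th_bdd[OF t]] by simp
qed

private lemma om_small: assumes t: "t \<in> {t0..T}" and e: "e > 0"
 obtains n0 where "\<And>n y. n >= n0 ==> norm y < sqrt (1/(16*real (Suc n))) ==> nsq (\<lambda>x. mpth t (y + x) - mpth t x) <= e"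
proof -
 obtain d where d: "d > 0" "\<And>y. norm y < d ==> nsq (\<lambda>x. mpth t (y + x) - mpth t x) < e"
  using translation_continuous[OF bdd_L2f[OF th_bdd[OF t]] e] by metis
 obtain n0 :: nat where n0: "1/d^2 < real n0" using reals_Archimedean2 by blast
 have "nsq (\<lambda>x. mpth t (y + x) - mpth t x) <= e" if "n >= n0" "norm y < sqrt (1/(16*real (Suc n)))" for n y
 proof -
  have "1/d^2 <= 16*real (Suc n)" using n0 that(1) of_nat_mono[OF that(1), where 'a=real] by simp
  hence "1/(16*real (Suc n)) <= d^2" using d(1) by (simp add: field_simps)
  hence "sqrt (1/(16*real (Suc n))) <= d" using d(1) real_sqrt_le_mono by fastforce
  thus ?thesis using d(2)[of y] that(2) by linarith
 qed
 thus ?thesis using that by blast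
qed

text \<open>For each time the commutator vanishes as the scale tends to zero, but at a rate
  depending on that time. The crude bound of \<open>om_all\<close>, uniform in time and scale,
  allows dominated convergence of the time integrals.\<close>

lemma max_principle': assumes t: "t \<in> {t0..T}" shows "AE x in torus. mpth t x <= M t"
proof -
 define s where "s n = 1/(16*real (Suc n))" for n
 have s: "0 < s n" "s n <= 1/16" for n by (auto simp: s_def field_simps)
 \<comment> \<open>The positive part is taken because the available bound, uniform in the scale, is
   one from above.\<close>
 define h' where "h' n r = max 0 (mph (s n) r)" for n r
 have h'c: "continuous_on {t0..t} (h' n)" for n
  unfolding h'_def[abs_def] using t by (intro continuous_intros continuous_on_subset[OF mp_facts(1)[OF s]]) auto
 have "(\<lambda>n. integral {t0..t} (h' n)) \<longlonglongrightarrow> integral {t0..t} (\<lambda>r. 0)"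
 proof (rule dominated_convergence(2)[where h="\<lambda>r. 2*(C + K)*(32 * C/Zc * sqrt (4*(C + K)^2))"])
  show "h' n integrable_on {t0..t}" for n by (rule integrable_continuous_interval[OF h'c])
  show "(\<lambda>r. 2*(C + K)*(32 * C/Zc * sqrt (4*(C + K)^2))) integrable_on {t0..t}" by (rule integrable_const_ivl)
  have b0: "0 <= 2*(C + K)*(32 * C/Zc * sqrt e)" if "0 <= e" for e
   using Cpos Zc_pos that by simp
  show "norm (h' n r) <= 2*(C + K)*(32 * C/Zc * sqrt (4*(C + K)^2))" if "r \<in> {t0..t}" for n r
  proof -
   have r: "r \<in> {t0..T}" using that t by auto
   have "mph (s n) r <= 2*(C + K)*(32 * C/Zc * sqrt (4*(C + K)^2))" by (rule mp_facts(2)[OF s r om_all[OF r]])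
   thus ?thesis using b0[of "4*(C + K)^2"] by (simp add: h'_def)
  qed
  show "(\<lambda>n. h' n r) \<longlonglongrightarrow> 0" if "r \<in> {t0..t}" for r
  proof (rule LIMSEQ_I)
   fix e :: real assume e: "e > 0"
   have r: "r \<in> {t0..T}" using that t by auto
   define b where "b = 2*(C + K)*(32 * C/Zc)"
   have b: "0 <= b" using Cpos Zc_pos by (simp add: b_def)
   define d where "d = (e/(2*(b + 1)))^2"
   have d: "d > 0" using e b by (simp add: d_def)
   obtain n0 where n0: "\<And>n y. n >= n0 ==> norm y < sqrt (1/(16*real (Suc n))) ==> nsq (\<lambda>x. mpth r (y + x) - mpth r x) <= d"
    using om_small[OF r d] by metis
   have "norm (h' n r - 0) < e" if "n >= n0" for n
   proof -
    have "mph (s n) r <= 2*(C + K)*(32 * C/Zc * sqrt d)"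
     by (rule mp_facts(2)[OF s r]) (use n0[OF that] in \<open>simp add: s_def\<close>)
    also have "\<dots> = b * sqrt d" by (simp add: b_def)
    also have "sqrt d = e/(2*(b + 1))" using e b by (simp add: d_def)
    also have "b*(e/(2*(b + 1))) < e"
    proof -
     have "0 <= b*e" using b e by simp
     hence "b*e < 2*(b + 1)*e" using e by (simp add: algebra_simps)
     thus ?thesis using b by (simp add: field_simps)
    qed
    finally show ?thesis using e by (simp add: h'_def)
   qed
   thus "\<exists>no. \<forall>n\<ge>no. norm (h' n r - 0) < e" by blast
  qed
 qed
 hence lim: "(\<lambda>n. integral {t0..t} (h' n)) \<longlonglongrightarrow> 0" by simp
 define f where "f x = max 0 (mpth t x - M t)" for x
 have Lf: "L2f f" unfolding f_def[abs_def] by (rule mp_facts(5)[OF s t om_all[OF t]])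
 have "nsq f <= 0"
 proof (rule field_le_epsilon)
  fix e :: real assume e: "e > 0"
  obtain n0 where n0: "\<And>n y. n >= n0 ==> norm y < sqrt (1/(16*real (Suc n))) ==> nsq (\<lambda>x. mpth t (y + x) - mpth t x) <= e/4"
   using om_small[OF t, of "e/4"] e by auto
  have "eventually (\<lambda>n. integral {t0..t} (h' n) < e/4) sequentially" by (rule order_tendstoD(2)[OF lim]) (use e in simp)
  then obtain n1 where n1: "\<And>n. n >= n1 ==> integral {t0..t} (h' n) < e/4" by (auto simp: eventually_sequentially)
  define n where "n = max n0 n1"
  have "nsq f <= 2*mpH (s n) t + 2*(e/4)"
   unfolding f_def by (rule mp_facts(4)[OF s t]) (use n0[of n] in \<open>simp add: s_def n_def\<close>)
  moreover have "mpH (s n) t <= integral {t0..t} (h' n)" unfolding h'_def by (rule mp_facts(3)[OF s t])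
  ultimately show "nsq f <= 0 + e" using n1[of n] by (simp add: n_def)
 qed
 hence "(TI x. (f x)^2) = 0" using nsq_nonneg[of f] unfolding nsq_def by linarith
 hence "AE x in torus. (f x)^2 = 0"
  using L2f_sq[OF Lf] by (subst (asm) integral_nonneg_eq_0_iff_AE) auto
 thus ?thesis by eventually_elim (auto simp: f_def max_def split: if_splits)
qed

end

lemma max_principle: assumes t: "t \<in> {t0..T}" shows "AE x in torus. sg*(\<xi> t x - w t x) <= M t"
proof -
 obtain C where C: "\<And>t. t \<in> {t0..T} ==> bdd C (\<xi> t)" using sol_bdd[OF S, of T] by metis
 show ?thesis using max_principle'[OF C t] by (simp add: mpth_def)
qed

end

section \<open>Uniform bounds\<close>

text \<open>Stands for a function bounded by \<open>K\<close> with Lipschitz constant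
  \<open>K\<close>. It is encoded through \<open>C^1\<close> approximations because the divergence
  condition of the velocity can be tested only with \<open>C^1\<close> functions.\<close>

definition nice :: "real => (real^2 => real) => bool" where
 "nice K w \<longleftrightarrow> (\<exists>wR WR. (\<forall>R::nat. C1per (wR R) (WR R)) \<and> (\<forall>R x. \<bar>wR R x\<bar> <= K \<and> norm (WR R x) <= K) \<and>
  (\<forall>x. (\<lambda>R. wR R x) \<longlonglongrightarrow> w x))"

lemma nice_bdd: assumes "nice K w" shows "bdd K w"
proof -
 obtain wR WR where c: "\<And>R::nat. C1per (wR R) (WR R)" and b: "\<And>R x. \<bar>wR R x\<bar> <= K" and l: "\<And>x. (\<lambda>R. wR R x) \<longlonglongrightarrow> w x"
  using assms unfolding nice_def by blast
 have m: "w \<in> bmeas" by (rule borel_measurable_LIMSEQ_real[OF l]) (rule C1per_meas[OF c])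
 have p: "w (x + a) = w x" if "\<And>R x. wR R (x + a) = wR R x" for x a
  by (rule LIMSEQ_unique[OF l[of "x + a"]]) (use l[of x] that in simp)
 have "per w" using C1per_per[OF c] unfolding per_def by (intro allI conjI p) auto
 moreover have "\<bar>w x\<bar> <= K" for x
  by (rule LIMSEQ_le_const2[OF tendsto_rabs[OF l]]) (use b in auto)
 ultimately show ?thesis using m by (simp add: bdd_def)
qed

text \<open>As \<open>u\<close> is divergence free, the gradient passes from \<open>g\<close> to the
  approximants of \<open>w\<close>. Their gradients are bounded by \<open>K\<close> and the two
  velocity components by \<open>24 * C/Zc\<close> each, which gives 48.\<close>

lemma nice_forcing:
 assumes BS: "biot_savart f u" and f: "bdd C f" and w: "nice K w" and g: "C1per g G" "\<And>x. 0 <= g x" and gam: "0 <= \<gamma>"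
 shows "\<bar>- \<gamma>*ip w g + fl u w G\<bar> <= (\<gamma>*K + 48*K/Zc * C)*(TI x. g x)"
proof -
 obtain wR WR where c: "\<And>R::nat. C1per (wR R) (WR R)" and b: "\<And>R x. \<bar>wR R x\<bar> <= K" "\<And>R x. norm (WR R x) <= K" and l: "\<And>x. (\<lambda>R. wR R x) \<longlonglongrightarrow> w x"
  using w unfolding nice_def by blast
 note bw = nice_bdd[OF w]
 have K0: "0 <= K" by (rule bdd_nonneg[OF bw])
 have C0: "0 <= C" by (rule bdd_nonneg[OF f])
 have gi: "tint g" by (rule L2f_integrable[OF C1per_L2f(1)[OF g(1)]])
 note L = bdd_L2f[OF f]
 have uGL: "L2f (\<lambda>x. u x \<bullet> G x)" by (rule bs_inner_L2[OF BS L g(1)])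
 have lim: "(\<lambda>R. fl u (wR R) G) \<longlonglongrightarrow> fl u w G"
  unfolding fl_def
 proof (rule integral_dominated_convergence[where w="\<lambda>x. \<bar>u x \<bullet> G x\<bar>*K"])
  note [measurable] = bdd_meas[OF bw] C1per_meas[OF c] L2f_meas[OF uGL]
  show "(\<lambda>x. (u x \<bullet> G x)*w x) \<in> borel_measurable torus" "\<And>i. (\<lambda>x. (u x \<bullet> G x)*wR i x) \<in> borel_measurable torus" by measurable
  show "tint (\<lambda>x. \<bar>u x \<bullet> G x\<bar>*K)" using L2f_integrable[OF uGL] by simp
  show "AE x in torus. (\<lambda>R. (u x \<bullet> G x)*wR R x) \<longlonglongrightarrow> (u x \<bullet> G x)*w x" by (intro AE_I2 tendsto_intros l)
  show "AE x in torus. norm ((u x \<bullet> G x)*wR R x) <= \<bar>u x \<bullet> G x\<bar>*K" for R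
   using b by (intro AE_I2) (simp add: abs_mult mult_left_mono)
 qed
 have R: "\<bar>fl u (wR R) G\<bar> <= 48*K/Zc * C*(TI x. g x)" for R
 proof -
  have L1: "L2f (\<lambda>x. u x \<bullet> WR R x)" by (rule bs_inner_L2[OF BS L c])
  have i1: "tint (\<lambda>x. (u x \<bullet> G x)*wR R x)" by (rule L2f_mult[OF uGL C1per_L2f(1)[OF c]])
  have i2: "tint (\<lambda>x. (u x \<bullet> WR R x)*g x)" by (rule L2f_mult[OF L1 C1per_L2f(1)[OF g(1)]])
  have cm: "C1per (\<lambda>z. wR R z*g z) (\<lambda>z. wR R z *\<^sub>R G z + g z *\<^sub>R WR R z)" by (rule C1per_mult[OF c g(1)])
  have "(TI x. u x \<bullet> (wR R x *\<^sub>R G x + g x *\<^sub>R WR R x)) = 0"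
   using bs_div[OF BS L cm] bs_int[OF BS L cm] by (simp add: inner_real2)
  hence "(TI x. (u x \<bullet> G x)*wR R x + (u x \<bullet> WR R x)*g x) = 0"
   by (simp add: inner_add_right mult.commute)
  hence "fl u (wR R) G = - (TI x. (u x \<bullet> WR R x)*g x)" using i1 i2 by (simp add: fl_def)
  moreover have "\<bar>TI x. (u x \<bullet> WR R x)*g x\<bar> <= 48*K/Zc * C*(TI x. \<bar>g x\<bar>)"
  proof (rule integral_mult_bound(1)[OF _ L2f_meas[OF L1] gi])
   show "AE x in torus. \<bar>u x \<bullet> WR R x\<bar> <= 48*K/Zc * C"
    using bs_AE_bound[OF BS f, of 1] bs_AE_bound[OF BS f, of 2]
   proof eventually_elim
    fix x assume u: "\<bar>u x $ 1\<bar> <= 24 * C/Zc" "\<bar>u x $ 2\<bar> <= 24 * C/Zc"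
    have "\<bar>u x \<bullet> WR R x\<bar> <= norm (u x)*norm (WR R x)" by (rule Cauchy_Schwarz_ineq2)
    also have "\<dots> <= (\<bar>u x $ 1\<bar> + \<bar>u x $ 2\<bar>)*K"
     using norm_le_l1_cart[of "u x"] b(2) by (intro mult_mono) (auto simp: UNIV_2_eq)
    also have "\<dots> <= (24 * C/Zc + 24 * C/Zc)*K" using u K0 by (intro mult_right_mono add_mono) auto
    finally show "\<bar>u x \<bullet> WR R x\<bar> <= 48*K/Zc * C" by (simp add: field_simps)
   qed
  qed
  ultimately show ?thesis using g(2) by simp
 qed
 have 1: "\<bar>fl u w G\<bar> <= 48*K/Zc * C*(TI x. g x)"
  by (rule LIMSEQ_le_const2[OF tendsto_rabs[OF lim]]) (use R in auto)
 have "\<bar>ip w g\<bar> <= K*(TI x. g x)" using ip_bdd_le(2)[OF bw gi] g(2) by simp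
 hence "\<bar>\<gamma>*ip w g\<bar> <= \<gamma>*(K*(TI x. g x))" using gam by (simp add: abs_mult mult_left_mono)
 with 1 have "\<bar>- \<gamma>*ip w g + fl u w G\<bar> <= \<gamma>*(K*(TI x. g x)) + 48*K/Zc * C*(TI x. g x)" by linarith
 thus ?thesis by (simp add: algebra_simps)
qed

text \<open>Twice the factor by which the sup norm of \<open>\<xi> - w\<close> enters the forcing;
  \<open>drift\<close> is the part of the forcing that is present even when
  \<open>\<xi> = w\<close>.\<close>

definition rate :: "real => real" where "rate K = 2*(48*K/Zc + 1)"
definition drift :: "real => real => real" where "drift \<gamma> K = \<gamma>*K + 48*K/Zc*K"
definition Lbound :: "real => real => real => real => real" where
 "Lbound \<gamma> K A d = (2*(A + drift \<gamma> K*d) + 1)*exp (rate K*d) + K"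

text \<open>A Gronwall argument by iteration: an exponential bound with constant \<open>S\<close> improves to
 \<open>A + drift*(T - t0) + S/2\<close>.\<close>
lemma solution_bound:
 assumes S: "sol \<gamma> t0 X0 N \<xi> u" and gam: "0 <= \<gamma>" and w: "\<And>t. t \<in> {t0..T} ==> nice K (w t)"
  and Nw: "\<And>t g G. t \<in> {t0..T} ==> C1per g G ==> N t G = ip (w t) g"
  and X0: "bdd A X0" and t: "t \<in> {t0..T}"
 shows "bdd (Lbound \<gamma> K A (T - t0)) (\<xi> t)"
proof -
 have tT: "t0 <= T" using t by simp
 have K0: "0 <= K" using bdd_nonneg[OF nice_bdd[OF w[of t0]]] tT by simp
 have A0: "0 <= A" by (rule bdd_nonneg[OF X0])
 \<comment> \<open>The summand 1 keeps the rate positive when \<open>K = 0\<close>.\<close>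
 define a where "a = 48*K/Zc + 1"
 define b where "b = drift \<gamma> K"
 have a: "a > 0" using K0 Zc_pos by (simp add: a_def add_nonneg_pos)
 have b: "b >= 0" using K0 Zc_pos gam by (simp add: b_def drift_def)
 \<comment> \<open>The exponent is twice \<open>a\<close>, so the integral of \<open>a*S*E\<close>
   is \<open>S/2*(E t - 1)\<close>: this is what halves the constant in each round.\<close>
 define E where "E t = exp (2*a*(t - t0))" for t
 have E1: "E t >= 1" if "t \<in> {t0..T}" for t using that a by (simp add: E_def)
 define Q where "Q S \<longleftrightarrow> 0 <= S \<and> (\<forall>t\<in>{t0..T}. AE x in torus. \<bar>\<xi> t x - w t x\<bar> <= S*E t)" for S
 define D where "D = A + b*(T - t0)"
 have D0: "0 <= D" using A0 b tT by (simp add: D_def)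
 note L = sol_L2f[OF S]
 have step: "Q (D + S/2)" if Q: "Q S" for S
 proof -
  have S0: "0 <= S" using Q by (simp add: Q_def)
  define F where "F t = b + a*S*E t" for t
  define M where "M t = A + b*(t - t0) + S/2*(E t - 1)" for t
  have \<xi>b: "bdd (S*E t + K) (\<xi> t)" if t: "t \<in> {t0..T}" for t
  proof -
   have "AE x in torus. \<bar>\<xi> t x - w t x\<bar> <= S*E t" using Q t by (simp add: Q_def)
   hence "AE x in torus. \<bar>\<xi> t x\<bar> <= S*E t + K"
    using bdd_AE[OF nice_bdd[OF w[OF t]]] by eventually_elim linarith
   thus ?thesis using L2f_per[OF L] L2f_meas[OF L] t by (simp add: bdd_def)
  qed
  have mp: "AE x in torus. sg*(\<xi> t x - w t x) <= M t" if sg: "sg = 1 \<or> sg = -1" and t: "t \<in> {t0..T}" for sg t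
  proof (rule max_principle[OF S gam sg, where K=K and F=F and A=A and T=T])
   show "bdd K (w t)" if "t \<in> {t0..T}" for t by (rule nice_bdd[OF w[OF that]])
   show "N t G = ip (w t) g" if "t \<in> {t0..T}" "C1per g G" for t g G by (rule Nw[OF that])
   show "\<bar>- \<gamma>*ip (w t) g + fl (u t) (w t) G\<bar> <= F t*(TI x. g x)" if t: "t \<in> {t0..T}" and g: "C1per g G" "\<And>x. 0 <= g x" for t g G
   proof -
    have "\<bar>- \<gamma>*ip (w t) g + fl (u t) (w t) G\<bar> <= (\<gamma>*K + 48*K/Zc*(S*E t + K))*(TI x. g x)"
     by (rule nice_forcing[OF sol_BS[OF S] \<xi>b[OF t] w[OF t] g gam]) (use t in simp)
    also have "\<dots> <= F t*(TI x. g x)"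
    proof (rule mult_right_mono)
     have "0 <= S*E t" using S0 E1[OF t] by simp
     thus "\<gamma>*K + 48*K/Zc*(S*E t + K) <= F t" by (simp add: F_def b_def drift_def a_def algebra_simps add_divide_distrib)
    qed (use g in auto)
    finally show ?thesis .
   qed
   show "(M has_real_derivative F t) (at t within {t0..T})" for t
    unfolding M_def[abs_def] F_def E_def by (auto intro!: derivative_eq_intros)
   show "continuous_on {t0..T} F" unfolding F_def[abs_def] E_def by (intro continuous_intros)
   show "0 <= M t" if t: "t \<in> {t0..T}" for t using A0 b S0 E1[OF t] t by (simp add: M_def)
   show "bdd A X0" by (rule X0)
   show "A <= M t0" by (simp add: M_def E_def)
  qed (use t tT in auto)
  have "AE x in torus. \<bar>\<xi> t x - w t x\<bar> <= (D + S/2)*E t" if t: "t \<in> {t0..T}" for t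
  proof -
   have "b*(t - t0) <= b*(T - t0)" using b t by (intro mult_left_mono) auto
   hence "M t <= D + S/2*E t" using S0 unfolding M_def D_def right_diff_distrib[of "S/2"] by linarith
   moreover have "D*1 <= D*E t" using D0 E1[OF t] by (intro mult_left_mono) auto
   ultimately have le: "M t <= (D + S/2)*E t" by (simp add: algebra_simps)
   have aux: "\<bar>y\<bar> <= B" if "1*y <= m" "- 1*y <= m" "m <= B" for y m B :: real using that by linarith
   show ?thesis using mp[OF disjI1[OF refl] t] mp[OF disjI2[OF refl] t]
    by eventually_elim (rule aux[OF _ _ le])
  qed
  thus ?thesis using D0 S0 by (simp add: Q_def)
 qed
 obtain C where C: "\<And>t. t \<in> {t0..T} ==> bdd C (\<xi> t)" "C >= 0" using sol_bdd[OF S, of T] by metis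
 have Q0: "Q (C + K)"
  unfolding Q_def
 proof (intro conjI ballI)
  fix t assume t: "t \<in> {t0..T}"
  have le: "(C + K)*1 <= (C + K)*E t" using C(2) K0 E1[OF t] by (intro mult_left_mono) auto
  show "AE x in torus. \<bar>\<xi> t x - w t x\<bar> <= (C + K)*E t"
   using bdd_AE[OF bdd_diff[OF C(1)[OF t] nice_bdd[OF w[OF t]]]] by eventually_elim (rule order_trans[OF _ le[unfolded mult_1_right]])
 qed (use C K0 in auto)
 \<comment> \<open>The initial constant \<open>C + K\<close>, which depends on the individual
   solution, is halved \<open>n\<close> times; only the limit \<open>2*D\<close> of the iteration
   and an arbitrarily small rest survive.\<close>
 have Qn: "\<exists>S. Q S \<and> S <= 2*D + (C + K)/2^n" for n
 proof (induction n)
  case 0 thus ?case using Q0 D0 by auto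
 next
  case (Suc n)
  then obtain S where S: "Q S" "S <= 2*D + (C + K)/2^n" by auto
  show ?case by (rule exI[of _ "D + S/2"]) (use step[OF S(1)] S(2) in \<open>auto simp: field_simps\<close>)
 qed
 obtain n where n: "C + K < 2^n" using real_arch_pow[of 2 "C + K"] by auto
 obtain S' where S': "Q S'" "S' <= 2*D + (C + K)/2^n" using Qn[of n] by auto
 have "(C + K)/2^n <= 1" using n by (simp add: field_simps)
 hence S'le: "S' <= 2*D + 1" using S'(2) by linarith
 have Et: "E t <= exp (rate K*(T - t0))" using t a by (simp add: E_def rate_def a_def[symmetric] mult_left_mono)
 have "S'*E t <= (2*D + 1)*exp (rate K*(T - t0))"
  using S'le Et D0 E1[OF t] by (intro mult_mono) auto
 hence le: "S'*E t + K <= Lbound \<gamma> K A (T - t0)" by (simp add: Lbound_def D_def b_def)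
 have "AE x in torus. \<bar>\<xi> t x - w t x\<bar> <= S'*E t" using S'(1) t by (simp add: Q_def)
 hence "AE x in torus. \<bar>\<xi> t x\<bar> <= Lbound \<gamma> K A (T - t0)"
  using bdd_AE[OF nice_bdd[OF w[OF t]]]
 proof eventually_elim
  have aux: "\<bar>y\<bar> <= B" if "\<bar>y - z\<bar> <= m" "\<bar>z\<bar> <= K" "m + K <= B" for y z m B :: real using that by linarith
  fix x assume "\<bar>\<xi> t x - w t x\<bar> <= S'*E t" "\<bar>w t x\<bar> <= K"
  from aux[OF this le] show "\<bar>\<xi> t x\<bar> <= Lbound \<gamma> K A (T - t0)" .
 qed
 thus ?thesis using L2f_per[OF L] L2f_meas[OF L] t by (simp add: bdd_def)
qed

section \<open>Representing the noise by a function\<close>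

lemma filterlim_Bx: "filterlim Bx (finite_subsets_at_top UNIV) sequentially"
 unfolding filterlim_finite_subsets_at_top
proof (intro allI impI)
 fix X :: "(int \<times> int) set" assume "finite X \<and> X \<subseteq> UNIV"
 then obtain n where "X \<subseteq> Bx n" using finite_subset_Bx by blast
 hence "X \<subseteq> Bx m" if "m >= n" for m using that Bx_mono by blast
 thus "\<forall>\<^sub>F y in sequentially. finite (Bx y) \<and> X \<subseteq> Bx y \<and> Bx y \<subseteq> UNIV"
  by (auto simp: eventually_sequentially)
qed

lemma Bx_sum_convergent:
 fixes f :: "int \<times> int => real"
 assumes "\<And>F. finite F ==> (\<Sum>k\<in>F. \<bar>f k\<bar>) <= B"
 obtains l where "(\<lambda>n. \<Sum>k\<in>Bx n. f k) \<longlonglongrightarrow> l"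
proof -
 have "(\<lambda>k. norm (f k)) summable_on UNIV"
  by (rule nonneg_bdd_above_summable_on) (auto intro!: bdd_aboveI2[where M=B] assms)
 hence "f summable_on UNIV" by (rule abs_summable_summable)
 hence "(sum f \<longlongrightarrow> infsum f UNIV) (finite_subsets_at_top UNIV)"
  using has_sum_infsum has_sum_def by blast
 from filterlim_compose[OF this filterlim_Bx] show ?thesis using that by (simp add: comp_def)
qed

definition Pgrad :: "nat => (real^2 => real) => real^2 => real^2" where
 "Pgrad n f x = (\<Sum>k\<in>Bx n. Re (fourier f k) *\<^sub>R ((- sin (ph k x)) *\<^sub>R ((2*pi) *\<^sub>R ivec k))
  + (- Im (fourier f k)) *\<^sub>R (cos (ph k x) *\<^sub>R ((2*pi) *\<^sub>R ivec k)))"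

lemma C1per_Pfour: "C1per (Pfour n f) (Pgrad n f)"
proof -
 have "C1per (\<lambda>x. \<Sum>k\<in>Bx n. Re (fourier f k)*cos (ph k x) + (- Im (fourier f k)) * sin (ph k x)) (Pgrad n f)"
  unfolding Pgrad_def[abs_def] by (intro C1per_sum C1per_add C1per_cmult C1per_cos_ph C1per_sin_ph)
 thus ?thesis by (simp add: Pfour_def[abs_def])
qed

lemma Pgrad_eq: assumes "C1per g G" shows "Pgrad n g x $ j = Pfour n (G $$ j) x"
 unfolding Pgrad_def Pfour_def sum_component
 by (intro sum.cong refl) (simp add: fourier_gradient[OF assms] algebra_simps)

lemma ip_lin: assumes "L2f f" "C1per g G" "C1per g' G'" shows "ip f (\<lambda>x. a*g x + b*g' x) = a*ip f g + b*ip f g'"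
proof -
 have "ip f (\<lambda>x. a*g x + b*g' x) = (TI x. a*(f x*g x) + b*(f x*g' x))"
  unfolding ip_def by (rule tcong) (auto simp: algebra_simps)
 also have "\<dots> = a*ip f g + b*ip f g'"
  using L2f_mult[OF assms(1) C1per_L2f(1)[OF assms(2)]] L2f_mult[OF assms(1) C1per_L2f(1)[OF assms(3)]] by (simp add: ip_def)
 finally show ?thesis .
qed

lemma fl_lin: assumes "biot_savart f v" "L2f f" "C1per g G" "C1per g' G'"
 shows "fl v f (\<lambda>x. a *\<^sub>R G x + b *\<^sub>R G' x) = a*fl v f G + b*fl v f G'"
proof -
 have "fl v f (\<lambda>x. a *\<^sub>R G x + b *\<^sub>R G' x) = (TI x. a*((v x \<bullet> G x)*f x) + b*((v x \<bullet> G' x)*f x))"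
  unfolding fl_def by (rule tcong) (auto simp: inner_add_right algebra_simps)
 also have "\<dots> = a*fl v f G + b*fl v f G'"
  using L2f_mult[OF bs_inner_L2[OF assms(1,2,3)] assms(2)] L2f_mult[OF bs_inner_L2[OF assms(1,2,4)] assms(2)] by (simp add: fl_def)
 finally show ?thesis .
qed

section \<open>Reading properties of the noise off the equation\<close>

context
 fixes \<gamma> t0 X0 N \<xi> u A
 assumes S: "sol \<gamma> t0 X0 N \<xi> u" and X0: "bdd A X0"
begin

lemma sol_N_eq: assumes g: "C1per g G" and t: "t0 <= t"
 shows "N t G = ip (\<xi> t) g - ip X0 g - integral {t0..t} (\<lambda>s. - \<gamma>*ip (\<xi> s) g + fl (u s) (\<xi> s) G)"
 using sol_eq[OF S g t] by linarith

lemma sol_N_integrable: assumes g: "C1per g G"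
 shows "(\<lambda>s. - \<gamma>*ip (\<xi> s) g + fl (u s) (\<xi> s) G) integrable_on {t0..t}"
 by (intro integrable_continuous_interval continuous_intros;
   rule continuous_on_subset[OF sol_cont_test[OF S g]] continuous_on_subset[OF sol_cont_fl[OF S g]]; auto)

lemma sol_N_lin:
 assumes g: "C1per g G" "C1per g' G'" and t: "t0 <= t"
 shows "N t (\<lambda>x. a *\<^sub>R G x + b *\<^sub>R G' x) = a*N t G + b*N t G'"
proof -
 have c: "C1per (\<lambda>x. a*g x + b*g' x) (\<lambda>x. a *\<^sub>R G x + b *\<^sub>R G' x)" by (intro C1per_add C1per_cmult g)
 let ?i = "\<lambda>g G s. - \<gamma>*ip (\<xi> s) g + fl (u s) (\<xi> s) G"
 have "integral {t0..t} (?i (\<lambda>x. a*g x + b*g' x) (\<lambda>x. a *\<^sub>R G x + b *\<^sub>R G' x))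
   = integral {t0..t} (\<lambda>s. a*?i g G s + b*?i g' G' s)"
  by (rule Henstock_Kurzweil_Integration.integral_cong)
   (simp add: ip_lin[OF sol_L2f[OF S] g] fl_lin[OF sol_BS[OF S] sol_L2f[OF S] g] algebra_simps)
 also have "\<dots> = integral {t0..t} (\<lambda>s. a*?i g G s) + integral {t0..t} (\<lambda>s. b*?i g' G' s)"
  by (rule Henstock_Kurzweil_Integration.integral_add) (rule integrable_on_mult_right[OF sol_N_integrable[OF g(1)]] integrable_on_mult_right[OF sol_N_integrable[OF g(2)]])+
 also have "\<dots> = a*integral {t0..t} (?i g G) + b*integral {t0..t} (?i g' G')" by simp
 finally have int: "integral {t0..t} (?i (\<lambda>x. a*g x + b*g' x) (\<lambda>x. a *\<^sub>R G x + b *\<^sub>R G' x)) = a*integral {t0..t} (?i g G) + b*integral {t0..t} (?i g' G')" .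
 show ?thesis unfolding sol_N_eq[OF c t] sol_N_eq[OF g(1) t] sol_N_eq[OF g(2) t] int
  using ip_lin[OF sol_L2f[OF S t] g, of a b] ip_lin[OF bdd_L2f[OF X0] g, of a b] by (simp add: algebra_simps)
qed

lemma sol_N_sum:
 assumes t: "t0 <= t" and F: "finite F" and g: "\<And>k. k \<in> F ==> C1per (g k) (G k)" "\<And>k. k \<in> F ==> C1per (g' k) (G' k)"
 shows "N t (\<lambda>x. \<Sum>k\<in>F. a k *\<^sub>R G k x + b k *\<^sub>R G' k x) = (\<Sum>k\<in>F. a k*N t (G k) + b k*N t (G' k))"
 using F g
proof (induction F)
 case empty
 show ?case using sol_N_lin[OF C1per_const C1per_const t, of 0 0] by simp
next
 case (insert k F)
 have c1: "C1per (\<lambda>x. a k*g k x + b k*g' k x) (\<lambda>x. a k *\<^sub>R G k x + b k *\<^sub>R G' k x)"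
  using insert.prems by (intro C1per_add C1per_cmult) auto
 have c2: "C1per (\<lambda>x. \<Sum>k\<in>F. a k*g k x + b k*g' k x) (\<lambda>x. \<Sum>k\<in>F. a k *\<^sub>R G k x + b k *\<^sub>R G' k x)"
  using insert.prems by (intro C1per_sum C1per_add C1per_cmult) auto
 have "N t (\<lambda>x. \<Sum>k\<in>insert k F. a k *\<^sub>R G k x + b k *\<^sub>R G' k x)
   = N t (\<lambda>x. 1 *\<^sub>R (a k *\<^sub>R G k x + b k *\<^sub>R G' k x) + 1 *\<^sub>R (\<Sum>k\<in>F. a k *\<^sub>R G k x + b k *\<^sub>R G' k x))"
  using insert by simp
 also have "\<dots> = N t (\<lambda>x. a k *\<^sub>R G k x + b k *\<^sub>R G' k x) + N t (\<lambda>x. \<Sum>k\<in>F. a k *\<^sub>R G k x + b k *\<^sub>R G' k x)"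
  using sol_N_lin[OF c1 c2 t, of 1 1] by simp
 also have "N t (\<lambda>x. a k *\<^sub>R G k x + b k *\<^sub>R G' k x) = a k*N t (G k) + b k*N t (G' k)"
  using insert.prems by (intro sol_N_lin t) auto
 finally show ?case using insert by simp
qed

text \<open>Continuity of \<open>N t\<close> in the \<open>H^1\<close> norm of the test function. It
  allows the passage from trigonometric polynomials to all \<open>C^1\<close> functions.\<close>

lemma sol_N_bound:
 assumes g: "C1per g G" and t: "t0 <= t" and C: "\<And>s. s \<in> {t0..t} ==> bdd C (\<xi> s)"
 shows "\<bar>N t G\<bar> <= (C + A + (t - t0)*(\<bar>\<gamma>\<bar> * C + 2 * C * C))*(sqrt (nsq g) + sqrt (nsq (G $$ 1)) + sqrt (nsq (G $$ 2)))"
proof -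
 let ?n = "sqrt (nsq g) + sqrt (nsq (G $$ 1)) + sqrt (nsq (G $$ 2))"
 have C0: "0 <= C" using bdd_nonneg[OF C[of t0]] t by simp
 have A0: "0 <= A" by (rule bdd_nonneg[OF X0])
 have n0: "0 <= ?n" by simp
 have ipb: "\<bar>ip f g\<bar> <= B*?n" if f: "bdd B f" for f B
 proof -
  have B0: "0 <= B" by (rule bdd_nonneg[OF f])
  have "\<bar>ip f g\<bar> <= sqrt (nsq f) * sqrt (nsq g)" unfolding ip_def by (rule L2f_CS[OF bdd_L2f[OF f] C1per_L2f(1)[OF g]])
  also have "\<dots> <= B*?n" using bdd_nsq[OF f] B0 by (intro mult_mono) (auto intro: real_le_lsqrt)
  finally show ?thesis .
 qed
 have flb: "\<bar>fl (u s) (\<xi> s) G\<bar> <= 2 * C * C*?n" if s: "s \<in> {t0..t}" for s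
 proof -
  have BS: "biot_savart (\<xi> s) (u s)" using sol_BS[OF S] s by simp
  note L = bdd_L2f[OF C[OF s]]
  have j: "L2f (\<lambda>x. \<xi> s x*u s x $ j) \<and> \<bar>TI x. (\<xi> s x*u s x $ j)*G x $ j\<bar> <= C * C*?n" for j
  proof -
   note M = L2f_bounded_mult[OF bs_L2f[OF BS L, of j] bdd_meas[OF C[OF s]] bdd_per[OF C[OF s]] bdd_AE[OF C[OF s]]]
   have "\<bar>TI x. (\<xi> s x*u s x $ j)*G x $ j\<bar> <= sqrt (nsq (\<lambda>x. \<xi> s x*u s x $ j)) * sqrt (nsq (G $$ j))"
    by (rule L2f_CS[OF M(1) C1per_L2f(2)[OF g]])
   also have "\<dots> <= C * C*?n"
   proof (intro mult_mono)
    have "nsq (\<lambda>x. \<xi> s x*u s x $ j) <= C^2*nsq (u s $$ j)" by (rule M(2))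
    also have "\<dots> <= C^2 * C^2" using bs_nsq_le[OF BS L, of j] bdd_nsq[OF C[OF s]] by (intro mult_left_mono) auto
    finally show "sqrt (nsq (\<lambda>x. \<xi> s x*u s x $ j)) <= C * C" using C0 by (intro real_le_lsqrt) (auto simp: power2_eq_square mult_ac)
    show "sqrt (nsq (G $$ j)) <= ?n" using exhaust_2[of j] by auto
   qed (use C0 in auto)
   finally show ?thesis using M(1) by simp
  qed
  have i: "tint (\<lambda>x. (\<xi> s x*u s x $ j)*G x $ j)" for j
   using j[of j] L2f_mult[OF _ C1per_L2f(2)[OF g]] by blast
  have "fl (u s) (\<xi> s) G = (TI x. (\<xi> s x*u s x $ 1)*G x $ 1 + (\<xi> s x*u s x $ 2)*G x $ 2)"
   unfolding fl_def by (rule tcong) (auto simp: inner_real2 algebra_simps)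
  also have "\<dots> = (TI x. (\<xi> s x*u s x $ 1)*G x $ 1) + (TI x. (\<xi> s x*u s x $ 2)*G x $ 2)" using i by simp
  finally show ?thesis using j[of 1] j[of 2] by linarith
 qed
 have "norm (integral {t0..t} (\<lambda>s. - \<gamma>*ip (\<xi> s) g + fl (u s) (\<xi> s) G)) <= integral {t0..t} (\<lambda>s. (\<bar>\<gamma>\<bar> * C + 2 * C * C)*?n)"
 proof (rule integral_norm_bound_integral[OF sol_N_integrable[OF g] integrable_const_ivl])
  fix s assume s: "s \<in> {t0..t}"
  have "\<bar>- \<gamma>*ip (\<xi> s) g\<bar> <= \<bar>\<gamma>\<bar>*(C*?n)" using ipb[OF C[OF s]] by (simp add: abs_mult mult_left_mono)
  thus "norm (- \<gamma>*ip (\<xi> s) g + fl (u s) (\<xi> s) G) <= (\<bar>\<gamma>\<bar> * C + 2 * C * C)*?n"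
   using flb[OF s] unfolding real_norm_def distrib_right mult.assoc by linarith
 qed
 also have "\<dots> = (t - t0)*((\<bar>\<gamma>\<bar> * C + 2 * C * C)*?n)" using t by simp
 finally have 1: "\<bar>integral {t0..t} (\<lambda>s. - \<gamma>*ip (\<xi> s) g + fl (u s) (\<xi> s) G)\<bar> <= (t - t0)*((\<bar>\<gamma>\<bar> * C + 2 * C * C)*?n)" by simp
 have "\<bar>N t G\<bar> <= C*?n + A*?n + (t - t0)*((\<bar>\<gamma>\<bar> * C + 2 * C * C)*?n)"
 proof -
  have aux: "\<bar>x - y - z\<bar> <= p + q + r" if "\<bar>x\<bar> <= p" "\<bar>y\<bar> <= q" "\<bar>z\<bar> <= r" for x y z p q r :: real using that by linarith
  have "t \<in> {t0..t}" using t by simp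
  from aux[OF ipb[OF C[OF this]] ipb[OF X0] 1] show ?thesis unfolding sol_N_eq[OF g t] .
 qed
 thus ?thesis by (simp only: distrib_right mult.assoc)
qed

lemma sol_N_cont: assumes g: "C1per g G" shows "continuous_on {t0..T} (\<lambda>t. N t G)"
proof -
 have "continuous_on {t0..T} (\<lambda>t. ip (\<xi> t) g - ip X0 g - integral {t0..t} (\<lambda>s. - \<gamma>*ip (\<xi> s) g + fl (u s) (\<xi> s) G))"
  by (intro continuous_intros continuous_on_subset[OF sol_cont_test[OF S g]] indefinite_integral_continuous_1 sol_N_integrable[OF g]) auto
 thus ?thesis by (rule continuous_on_eq) (simp add: sol_N_eq[OF g])
qed

text \<open>The partial Fourier sums of the representing function are the \<open>wR\<close> of \<open>nice\<close>.\<close>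
lemma noise_function:
 assumes t: "t0 <= t"
  and b: "\<And>k. \<bar>N t (gc k)\<bar> <= b k"
   "\<And>k. \<bar>N t (gs k)\<bar> <= b k"
  and K: "\<And>F. finite F ==> (\<Sum>k\<in>F. 2*b k*(1 + 2*pi*norm (ivec k))) <= K"
 shows "\<exists>w. nice K w \<and> (\<forall>g G. C1per g G \<longrightarrow> N t G = ip w g)"
proof -
 define Nc where "Nc k = N t (gc k)" for k
 define Ns where "Ns k = N t (gs k)" for k
 have bc: "\<bar>Nc k\<bar> <= b k" "\<bar>Ns k\<bar> <= b k" for k using b by (auto simp: Nc_def Ns_def)
 have b0: "0 <= b k" for k using bc(1)[of k] by linarith
 define wR where "wR R x = (\<Sum>k\<in>Bx R. Nc k*cos (ph k x) + Ns k * sin (ph k x))" for R x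
 define WR where "WR R x = (\<Sum>k\<in>Bx R. Nc k *\<^sub>R ((- sin (ph k x)) *\<^sub>R ((2*pi) *\<^sub>R ivec k)) + Ns k *\<^sub>R (cos (ph k x) *\<^sub>R ((2*pi) *\<^sub>R ivec k)))" for R x
 have cR: "C1per (wR R) (WR R)" for R
  unfolding wR_def[abs_def] WR_def[abs_def] by (intro C1per_sum C1per_add C1per_cmult C1per_cos_ph C1per_sin_ph)
 have tm: "\<bar>Nc k*cos (ph k x) + Ns k * sin (ph k x)\<bar> <= 2*b k" for k x
 proof -
  have "\<bar>Nc k*cos (ph k x)\<bar> <= b k*1" "\<bar>Ns k * sin (ph k x)\<bar> <= b k*1"
   unfolding abs_mult using bc by (intro mult_mono b0; simp)+
  thus ?thesis by linarith
 qed
 have le1: "2*b k <= 2*b k*(1 + 2*pi*norm (ivec k))" for k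
  using b0[of k] mult_left_mono[of 1 "1 + 2*pi*norm (ivec k)" "2*b k"] by simp
 have absF: "(\<Sum>k\<in>F. \<bar>Nc k*cos (ph k x) + Ns k * sin (ph k x)\<bar>) <= K" if "finite F" for F x
  by (rule order_trans[OF sum_mono K[OF that]]) (rule order_trans[OF tm le1])
 have wb: "\<bar>wR R x\<bar> <= K" for R x
  unfolding wR_def by (rule order_trans[OF sum_abs absF]) simp
 have Wb: "norm (WR R x) <= K" for R x
 proof -
  have "norm (WR R x) <= (\<Sum>k\<in>Bx R. 2*b k*(1 + 2*pi*norm (ivec k)))"
   unfolding WR_def
  proof (rule order_trans[OF norm_sum], rule sum_mono)
   fix k
   have "norm (Nc k *\<^sub>R ((- sin (ph k x)) *\<^sub>R ((2*pi) *\<^sub>R ivec k))) <= b k*(1*(2*pi*norm (ivec k)))"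
    unfolding norm_scaleR using bc b0 by (intro mult_mono) auto
   moreover have "norm (Ns k *\<^sub>R (cos (ph k x) *\<^sub>R ((2*pi) *\<^sub>R ivec k))) <= b k*(1*(2*pi*norm (ivec k)))"
    unfolding norm_scaleR using bc b0 by (intro mult_mono) auto
   ultimately have "norm (Nc k *\<^sub>R ((- sin (ph k x)) *\<^sub>R ((2*pi) *\<^sub>R ivec k)) + Ns k *\<^sub>R (cos (ph k x) *\<^sub>R ((2*pi) *\<^sub>R ivec k)))
     <= 2*(b k*(2*pi*norm (ivec k)))"
    by (intro order_trans[OF norm_triangle_ineq]) linarith
   also have "\<dots> <= 2*b k*(1 + 2*pi*norm (ivec k))" using b0[of k] by (simp add: algebra_simps)
   finally show "norm (Nc k *\<^sub>R ((- sin (ph k x)) *\<^sub>R ((2*pi) *\<^sub>R ivec k)) + Ns k *\<^sub>R (cos (ph k x) *\<^sub>R ((2*pi) *\<^sub>R ivec k)))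
     <= 2*b k*(1 + 2*pi*norm (ivec k))" .
  qed
  also have "\<dots> <= K" by (rule K) simp
  finally show ?thesis .
 qed
 have "\<exists>l. (\<lambda>R. wR R x) \<longlonglongrightarrow> l" for x
  using Bx_sum_convergent[OF absF[of _ x]] unfolding wR_def by metis
 then obtain w where w: "\<And>x. (\<lambda>R. wR R x) \<longlonglongrightarrow> w x" by metis
 have nice: "nice K w" unfolding nice_def using cR wb Wb w by blast
 moreover have "N t G = ip w g" if g: "C1per g G" for g G
 proof -
  note Lg = C1per_L2f[OF g]
  obtain C where C: "\<And>s. s \<in> {t0..t} ==> bdd C (\<xi> s)" using sol_bdd[OF S, of t] by metis
  define c where "c = C + A + (t - t0)*(\<bar>\<gamma>\<bar> * C + 2 * C * C)"
  \<comment> \<open>The gradient of a partial sum is the partial sum of the gradient, so the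
    remainder of \<open>g\<close> is small in \<open>H^1\<close> and \<open>sol_N_bound\<close>
    applies to it.\<close>
  have dG: "C1per (\<lambda>x. 1*g x + (- 1)*Pfour R g x) (\<lambda>x. 1 *\<^sub>R G x + (- 1) *\<^sub>R Pgrad R g x)" for R
   by (intro C1per_add C1per_cmult g C1per_Pfour)
  have "N t (\<lambda>x. 1 *\<^sub>R G x + (- 1) *\<^sub>R Pgrad R g x) = N t G - N t (Pgrad R g)" for R
   using sol_N_lin[OF g C1per_Pfour t, of 1 "-1"] by simp
  hence le: "\<bar>N t G - N t (Pgrad R g)\<bar> <= c*(sqrt (nsq (\<lambda>x. g x - Pfour R g x)) + sqrt (nsq (\<lambda>x. G x $ 1 - Pfour R (G $$ 1) x)) + sqrt (nsq (\<lambda>x. G x $ 2 - Pfour R (G $$ 2) x)))" for R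
   using sol_N_bound[OF dG t C, of R] by (simp add: c_def Pgrad_eq[OF g])
  define d where "d R = c*(sqrt (nsq (\<lambda>x. g x - Pfour R g x)) + sqrt (nsq (\<lambda>x. G x $ 1 - Pfour R (G $$ 1) x)) + sqrt (nsq (\<lambda>x. G x $ 2 - Pfour R (G $$ 2) x)))" for R
  have "d \<longlonglongrightarrow> c*(sqrt 0 + sqrt 0 + sqrt 0)"
   unfolding d_def by (intro tendsto_intros Pfour_tendsto Lg)
  hence d0: "d \<longlonglongrightarrow> 0" by simp
  have "(\<lambda>R. N t G - N t (Pgrad R g)) \<longlonglongrightarrow> 0"
  proof (rule Lim_null_comparison[OF _ d0])
   show "\<forall>\<^sub>F R in sequentially. norm (N t G - N t (Pgrad R g)) <= d R"
    unfolding d_def real_norm_def by (intro always_eventually allI le)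
  qed
  from tendsto_diff[OF tendsto_const[of "N t G"] this] have l1: "(\<lambda>R. N t (Pgrad R g)) \<longlonglongrightarrow> N t G" by simp
  have eq: "N t (Pgrad R g) = ip (wR R) g" for R
  proof -
   have "N t (Pgrad R g) = (\<Sum>k\<in>Bx R. Re (fourier g k)*Nc k + (- Im (fourier g k))*Ns k)"
    unfolding Pgrad_def[abs_def] Nc_def Ns_def
    by (rule sol_N_sum[OF t finite_Bx C1per_cos_ph C1per_sin_ph])
   also have "\<dots> = (\<Sum>k\<in>Bx R. Nc k*(TI x. g x*cos (ph k x)) + Ns k*(TI x. g x * sin (ph k x)))"
    by (intro sum.cong refl) (simp add: fourier_parts[OF Lg(1)])
   also have "\<dots> = (\<Sum>k\<in>Bx R. (TI x. Nc k*(g x*cos (ph k x)) + Ns k*(g x * sin (ph k x))))"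
    using L2f_mult[OF Lg(1) L2f_cos_ph] L2f_mult[OF Lg(1) L2f_sin_ph] by (intro sum.cong refl) simp
   also have "\<dots> = (TI x. (\<Sum>k\<in>Bx R. Nc k*(g x*cos (ph k x)) + Ns k*(g x * sin (ph k x))))"
    using L2f_mult[OF Lg(1) L2f_cos_ph] L2f_mult[OF Lg(1) L2f_sin_ph] by (intro Bochner_Integration.integral_sum[symmetric]) simp
   also have "\<dots> = ip (wR R) g"
    unfolding ip_def wR_def sum_distrib_right
    by (rule tcong[OF refl], rule sum.cong[OF refl]) (simp add: algebra_simps)
   finally show ?thesis .
  qed
  have "(\<lambda>R. ip (wR R) g) \<longlonglongrightarrow> ip w g" unfolding ip_def
  proof (rule integral_dominated_convergence[where w="\<lambda>x. K*\<bar>g x\<bar>"])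
   note [measurable] = C1per_meas[OF g] C1per_meas[OF cR] bdd_meas[OF nice_bdd[OF nice]]
   show "(\<lambda>x. w x*g x) \<in> borel_measurable torus" "\<And>R. (\<lambda>x. wR R x*g x) \<in> borel_measurable torus" by measurable
   show "tint (\<lambda>x. K*\<bar>g x\<bar>)" using L2f_integrable[OF Lg(1)] by simp
   show "AE x in torus. (\<lambda>R. wR R x*g x) \<longlonglongrightarrow> w x*g x" by (intro AE_I2 tendsto_intros w)
   show "AE x in torus. norm (wR R x*g x) <= K*\<bar>g x\<bar>" for R
    using wb by (intro AE_I2) (simp add: abs_mult mult_right_mono)
  qed
  thus ?thesis using l1 unfolding eq by (rule LIMSEQ_unique[rotated])
 qed
 ultimately show ?thesis by blast
qed

end

section \<open>Energy stability\<close>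

lemma L2_prod_tendsto:
 assumes f: "\<And>n. L2f (f n)" "L2f f0" and h: "\<And>n. L2f (h n)" "L2f h0"
  and lf: "(\<lambda>n. nsq (\<lambda>x. f0 x - f n x)) \<longlonglongrightarrow> 0" and lh: "(\<lambda>n. nsq (\<lambda>x. h0 x - h n x)) \<longlonglongrightarrow> 0"
 shows "(\<lambda>n. ip (f n) (h n)) \<longlonglongrightarrow> ip f0 h0"
proof -
 define df where "df n x = f0 x - f n x" for n x
 define dh where "dh n x = h0 x - h n x" for n x
 have Ldf: "L2f (df n)" and Ldh: "L2f (dh n)" for n unfolding df_def[abs_def] dh_def[abs_def] by (intro L2f_diff f h)+
 have sf: "(\<lambda>n. sqrt (nsq (df n))) \<longlonglongrightarrow> sqrt 0" "(\<lambda>n. sqrt (nsq (dh n))) \<longlonglongrightarrow> sqrt 0"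
  unfolding df_def dh_def by (rule tendsto_real_sqrt[OF lf], rule tendsto_real_sqrt[OF lh])
 have eq: "ip f0 h0 - ip (f n) (h n) = ip (df n) h0 + ip f0 (dh n) - ip (df n) (dh n)" for n
 proof -
  have "ip (df n) h0 + ip f0 (dh n) - ip (df n) (dh n) = (TI x. df n x*h0 x + f0 x*dh n x - df n x*dh n x)"
   using L2f_mult[OF Ldf h(2)] L2f_mult[OF f(2) Ldh] L2f_mult[OF Ldf Ldh] by (simp add: ip_def)
  also have "\<dots> = (TI x. f0 x*h0 x - f n x*h n x)"
   by (rule tcong) (auto simp: df_def dh_def algebra_simps)
  also have "\<dots> = ip f0 h0 - ip (f n) (h n)" using L2f_mult[OF f(2) h(2)] L2f_mult[OF f(1) h(1)] by (simp add: ip_def)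
  finally show ?thesis by simp
 qed
 have "(\<lambda>n. ip f0 h0 - ip (f n) (h n)) \<longlonglongrightarrow> 0"
 proof (rule Lim_null_comparison)
  show "\<forall>\<^sub>F n in sequentially. norm (ip f0 h0 - ip (f n) (h n)) <= sqrt (nsq (df n)) * sqrt (nsq h0) + sqrt (nsq f0) * sqrt (nsq (dh n)) + sqrt (nsq (df n)) * sqrt (nsq (dh n))"
  proof (intro always_eventually allI)
   fix n
   have aux: "\<bar>x + y - z\<bar> <= p + q + r" if "\<bar>x\<bar> <= p" "\<bar>y\<bar> <= q" "\<bar>z\<bar> <= r" for x y z p q r :: real using that by linarith
   show "norm (ip f0 h0 - ip (f n) (h n)) <= sqrt (nsq (df n)) * sqrt (nsq h0) + sqrt (nsq f0) * sqrt (nsq (dh n)) + sqrt (nsq (df n)) * sqrt (nsq (dh n))"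
    unfolding eq real_norm_def unfolding ip_def by (intro aux L2f_CS Ldf Ldh f h)
  qed
  have "(\<lambda>n. sqrt (nsq (df n)) * sqrt (nsq h0) + sqrt (nsq f0) * sqrt (nsq (dh n)) + sqrt (nsq (df n)) * sqrt (nsq (dh n)))
    \<longlonglongrightarrow> sqrt 0 * sqrt (nsq h0) + sqrt (nsq f0) * sqrt 0 + sqrt 0 * sqrt 0"
   by (intro tendsto_intros sf)
  thus "(\<lambda>n. sqrt (nsq (df n)) * sqrt (nsq h0) + sqrt (nsq f0) * sqrt (nsq (dh n)) + sqrt (nsq (df n)) * sqrt (nsq (dh n))) \<longlonglongrightarrow> 0" by simp
 qed
 from tendsto_diff[OF tendsto_const[of "ip f0 h0"] this] show ?thesis by simp
qed

lemma nsq_tendsto: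
 assumes f: "\<And>n. L2f (f n)" "L2f f0" and lf: "(\<lambda>n. nsq (\<lambda>x. f0 x - f n x)) \<longlonglongrightarrow> 0"
 shows "(\<lambda>n. nsq (f n)) \<longlonglongrightarrow> nsq f0"
 using L2_prod_tendsto[OF f f lf lf] by (simp add: ip_def nsq_def power2_eq_square)

section \<open>The trilinear term\<close>

context
 fixes \<eta> v D \<xi> u C
 assumes BSv: "biot_savart \<eta> v" and \<eta>: "bdd D \<eta>" and BSu: "biot_savart \<xi> u" and \<xi>: "bdd C \<xi>"
begin

private lemma Lv: "L2f (v $$ j)" by (rule bs_L2f[OF BSv bdd_L2f[OF \<eta>]])
private lemma Lu: "L2f (u $$ j)" by (rule bs_L2f[OF BSu bdd_L2f[OF \<xi>]])

private definition "Vn j n = Pfour n (v $$ j)"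
private definition "VG j n = Pgrad n (v $$ j)"
private definition "W n = Pfour n (\<lambda>x. \<eta> x - mean \<eta>)"

private lemma Lm: "L2f (\<lambda>x. \<eta> x - mean \<eta>)" by (intro L2f_diff bdd_L2f[OF \<eta>] L2f_const)

private lemma cV: "C1per (Vn j n) (VG j n)" unfolding Vn_def VG_def by (rule C1per_Pfour)

private lemma four_m: "fourier (\<lambda>x. \<eta> x - mean \<eta>) k = (if k = 0 then 0 else fourier \<eta> k)"
proof -
 have c: "fourier (\<lambda>x. mean \<eta>) k = (if k = 0 then of_real (mean \<eta>) else 0)"
 proof -
  have "fourier (\<lambda>x. mean \<eta>) k = of_real (mean \<eta>)*(TI x. cis (ph (-k) x))"
   by (subst fourier_eq) (simp_all add: ph_minus)
  thus ?thesis by (simp add: integral_cis_ph)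
 qed
 have "fourier \<eta> 0 = of_real (mean \<eta>)"
  by (simp add: complex_eq_iff fourier_parts[OF bdd_L2f[OF \<eta>]] mean_def)
 thus ?thesis using fourier_diff[OF bdd_L2f[OF \<eta>] L2f_const, of "mean \<eta>" k] c by auto
qed

text \<open>Fourier truncation commutes with the Biot--Savart multiplier. The truncated velocity is
  therefore exactly divergence free and its curl is exactly the truncated centred vorticity, so the
  identity behind the trilinear bound holds pointwise.\<close>

private lemma V_div_curl: "VG 1 n x $ 1 + VG 2 n x $ 2 = 0" "VG 2 n x $ 1 - VG 1 n x $ 2 = W n x"
proof -
 have k: "Re (fourier (v $$ 1) k) = - of_int (snd k)*(Im (fourier \<eta> k)/(2*pi*((of_int (fst k))^2 + (of_int (snd k))^2)))"
  "Im (fourier (v $$ 1) k) = of_int (snd k)*(Re (fourier \<eta> k)/(2*pi*((of_int (fst k))^2 + (of_int (snd k))^2)))"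
  "Re (fourier (v $$ 2) k) = of_int (fst k)*(Im (fourier \<eta> k)/(2*pi*((of_int (fst k))^2 + (of_int (snd k))^2)))"
  "Im (fourier (v $$ 2) k) = - of_int (fst k)*(Re (fourier \<eta> k)/(2*pi*((of_int (fst k))^2 + (of_int (snd k))^2)))" if "k \<noteq> 0" for k
  using bs_fourier[OF BSv bdd_L2f[OF \<eta>] that refl] by simp_all
 have z: "fourier (v $$ j) 0 = 0" for j by (rule bs_fourier_0[OF BSv bdd_L2f[OF \<eta>]])
 show "VG 1 n x $ 1 + VG 2 n x $ 2 = 0"
  unfolding VG_def Pgrad_def sum_component sum.distrib[symmetric]
 proof (rule sum.neutral, rule ballI)
  fix k
  show "(Re (fourier (v $$ 1) k) *\<^sub>R (- sin (ph k x) *\<^sub>R (2*pi) *\<^sub>R ivec k) + - Im (fourier (v $$ 1) k) *\<^sub>R (cos (ph k x) *\<^sub>R (2*pi) *\<^sub>R ivec k)) $ 1 +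
   (Re (fourier (v $$ 2) k) *\<^sub>R (- sin (ph k x) *\<^sub>R (2*pi) *\<^sub>R ivec k) + - Im (fourier (v $$ 2) k) *\<^sub>R (cos (ph k x) *\<^sub>R (2*pi) *\<^sub>R ivec k)) $ 2 = 0"
  proof (cases "k = 0")
   case True thus ?thesis by (simp add: z)
  next
   case False
   define p q where "p = Im (fourier \<eta> k)/(2*pi*((of_int (fst k))^2 + (of_int (snd k))^2))"
    and "q = Re (fourier \<eta> k)/(2*pi*((of_int (fst k))^2 + (of_int (snd k))^2))"
   show ?thesis unfolding k[OF False] p_def[symmetric] q_def[symmetric] by (simp add: algebra_simps)
  qed
 qed
 show "VG 2 n x $ 1 - VG 1 n x $ 2 = W n x"
  unfolding VG_def Pgrad_def W_def Pfour_def sum_component sum_subtractf[symmetric]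
 proof (rule sum.cong[OF refl])
  fix k
  show "(Re (fourier (v $$ 2) k) *\<^sub>R (- sin (ph k x) *\<^sub>R (2*pi) *\<^sub>R ivec k) + - Im (fourier (v $$ 2) k) *\<^sub>R (cos (ph k x) *\<^sub>R (2*pi) *\<^sub>R ivec k)) $ 1 -
   (Re (fourier (v $$ 1) k) *\<^sub>R (- sin (ph k x) *\<^sub>R (2*pi) *\<^sub>R ivec k) + - Im (fourier (v $$ 1) k) *\<^sub>R (cos (ph k x) *\<^sub>R (2*pi) *\<^sub>R ivec k)) $ 2
   = Re (fourier (\<lambda>x. \<eta> x - mean \<eta>) k)*cos (ph k x) - Im (fourier (\<lambda>x. \<eta> x - mean \<eta>) k) * sin (ph k x)"
  proof (cases "k = 0")
   case True thus ?thesis by (simp add: z four_m)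
  next
   case False
   define K :: real where "K = (of_int (fst k))^2 + (of_int (snd k))^2"
   have "K > 0" using sq_k_ge_1[OF False] unfolding K_def by linarith
   hence K: "2*pi*K \<noteq> 0" by simp
   define p q where "p = Im (fourier \<eta> k)/(2*pi*K)" and "q = Re (fourier \<eta> k)/(2*pi*K)"
   have pq: "Im (fourier \<eta> k) = 2*pi*K*p" "Re (fourier \<eta> k) = 2*pi*K*q" using K by (simp_all add: p_def q_def)
   have four: "fourier (\<lambda>x. \<eta> x - mean \<eta>) k = fourier \<eta> k" using False by (simp add: four_m)
   show ?thesis unfolding four k[OF False] K_def[symmetric] p_def[symmetric] q_def[symmetric] unfolding pq
    by (simp add: K_def power2_eq_square algebra_simps)
  qed
 qed
qed

context
 fixes \<sigma> :: real assumes s: "0 < \<sigma>" "\<sigma> <= 1/16"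
begin

private definition "U j = moll \<sigma> (u $$ j)"
private abbreviation "Lip \<equiv> 256 * C/Zc*(1 + ln (1/\<sigma>))"

private lemma U_lip: "\<bar>U j x - U j y\<bar> <= Lip*norm (x - y)"
 unfolding U_def by (rule bs_moll_lipschitz[OF BSu \<xi> s])

private lemma U_per: "per (U j)" unfolding U_def by (rule per_moll[OF s(2)])

private lemma U_meas: "U j \<in> bmeas" unfolding U_def by (rule moll_measurable[OF L2f_meas[OF Lu]])

private lemma Lip0: "0 <= Lip" using bdd_nonneg[OF \<xi>] Zc_pos s by simp

private lemma U_bdd: obtains B where "\<And>x. \<bar>U j x\<bar> <= B" "B > 0"
proof -
 have "continuous_on UNIV (U j)"
  using U_lip Lip0 by (intro lipschitz_on_continuous_on[of Lip] lipschitz_onI) (auto simp: dist_norm)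
 from continuous_bounded_Q0[OF U_per this] show ?thesis using that by (metis real_norm_def)
qed

text \<open>For a divergence free field \<open>V\<close>, \<open>curl V*V\<^sup>\<bottom>\<close> is the divergence of \<open>V \<otimes> V\<close> up to a gradient.\<close>
private lemma trig_trilinear:
 "\<bar>ip (W n) (\<lambda>x. - U 1 x*Vn 2 n x + U 2 x*Vn 1 n x)\<bar> <= 2*Lip*(nsq (Vn 1 n) + nsq (Vn 2 n))"
proof -
 let ?V1 = "Vn 1 n" and ?V2 = "Vn 2 n" and ?G1 = "VG 1 n" and ?G2 = "VG 2 n"
 note c1 = cV[of 1 n] and c2 = cV[of 2 n]
 have L: "L2f ?V1" "L2f ?V2" by (rule C1per_L2f(1)[OF c1] C1per_L2f(1)[OF c2])+
 \<comment> \<open>Half the difference of the squares of the components and, below, their product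
   \<open>g\<close>: the independent entries of the trace-free part of the tensor square of the
   truncated velocity.\<close>
 define f where "f x = (1/2)*(?V1 x*?V1 x) + (-1/2)*(?V2 x*?V2 x)" for x
 define F where "F x = (1/2) *\<^sub>R (?V1 x *\<^sub>R ?G1 x + ?V1 x *\<^sub>R ?G1 x) + (-1/2) *\<^sub>R (?V2 x *\<^sub>R ?G2 x + ?V2 x *\<^sub>R ?G2 x)" for x
 have cf: "C1per f F" unfolding f_def[abs_def] F_def[abs_def] by (intro C1per_add C1per_cmult C1per_mult c1 c2)
 define g where "g x = ?V1 x*?V2 x" for x
 define G where "G x = ?V1 x *\<^sub>R ?G2 x + ?V2 x *\<^sub>R ?G1 x" for x
 have cg: "C1per g G" unfolding g_def[abs_def] G_def[abs_def] by (intro C1per_mult c1 c2)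
 have iU: "tint (\<lambda>x. U i x*H x $ j)" if "C1per h H" for i h H j
 proof -
  obtain B where B: "\<And>x. \<bar>U i x\<bar> <= B" using U_bdd by metis
  show ?thesis by (rule integral_mult_bound(2)[OF AE_I2[OF B] U_meas L2f_integrable[OF C1per_L2f(2)[OF that]]])
 qed
 have pt: "W n x*(- U 1 x*?V2 x + U 2 x*?V1 x) = U 1 x*F x $ 1 + U 1 x*G x $ 2 + U 2 x*G x $ 1 - U 2 x*F x $ 2" for x
 proof -
  have d: "?G2 x $ 2 = - ?G1 x $ 1" using V_div_curl(1)[of n x] by linarith
  show ?thesis unfolding V_div_curl(2)[symmetric] F_def G_def by (simp add: d algebra_simps)
 qed
 have "ip (W n) (\<lambda>x. - U 1 x*?V2 x + U 2 x*?V1 x) = (TI x. U 1 x*F x $ 1 + U 1 x*G x $ 2 + U 2 x*G x $ 1 - U 2 x*F x $ 2)"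
  unfolding ip_def pt ..
 also have "\<dots> = (TI x. U 1 x*F x $ 1) + (TI x. U 1 x*G x $ 2) + (TI x. U 2 x*G x $ 1) - (TI x. U 2 x*F x $ 2)"
  using iU[OF cf] iU[OF cg] by simp
 finally have eq: "ip (W n) (\<lambda>x. - U 1 x*?V2 x + U 2 x*?V1 x) = (TI x. U 1 x*F x $ 1) + (TI x. U 1 x*G x $ 2) + (TI x. U 2 x*G x $ 1) - (TI x. U 2 x*F x $ 2)" .
 have bF: "\<bar>TI x. U i x*F x $ j\<bar> <= Lip*(TI x. \<bar>f x\<bar>)" for i j
  by (rule integral_lipschitz_gradient[OF cf U_per U_lip])
 have bG: "\<bar>TI x. U i x*G x $ j\<bar> <= Lip*(TI x. \<bar>g x\<bar>)" for i j
  by (rule integral_lipschitz_gradient[OF cg U_per U_lip])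
 have half: "(TI x. \<bar>k x\<bar>) <= (nsq ?V1 + nsq ?V2)/2" if "tint k" and k: "\<And>x. \<bar>k x\<bar> <= ((?V1 x)^2 + (?V2 x)^2)/2" for k
 proof -
  have "(TI x. \<bar>k x\<bar>) <= (TI x. ((?V1 x)^2 + (?V2 x)^2)/2)"
   by (rule integral_mono) (use that L2f_sq[OF L(1)] L2f_sq[OF L(2)] in auto)
  also have "\<dots> = (nsq ?V1 + nsq ?V2)/2" using L2f_sq[OF L(1)] L2f_sq[OF L(2)] by (simp add: nsq_def)
  finally show ?thesis .
 qed
 have hf: "(TI x. \<bar>f x\<bar>) <= (nsq ?V1 + nsq ?V2)/2"
 proof (rule half[OF L2f_integrable[OF C1per_L2f(1)[OF cf]]])
  fix x
  have aux: "\<bar>1/2*a + - 1/2*b\<bar> <= (a + b)/2" if "0 <= a" "0 <= b" for a b :: real using that by (simp add: abs_if)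
  show "\<bar>f x\<bar> <= ((?V1 x)^2 + (?V2 x)^2)/2" unfolding f_def power2_eq_square[symmetric] by (intro aux zero_le_power2)
 qed
 have hg: "(TI x. \<bar>g x\<bar>) <= (nsq ?V1 + nsq ?V2)/2"
 proof (rule half[OF L2f_integrable[OF C1per_L2f(1)[OF cg]]])
  fix x
  show "\<bar>g x\<bar> <= ((?V1 x)^2 + (?V2 x)^2)/2"
   using sum_squares_bound[of "\<bar>?V1 x\<bar>" "\<bar>?V2 x\<bar>"] by (simp add: g_def abs_mult)
 qed
 have "Lip*(TI x. \<bar>f x\<bar>) <= Lip*((nsq ?V1 + nsq ?V2)/2)" "Lip*(TI x. \<bar>g x\<bar>) <= Lip*((nsq ?V1 + nsq ?V2)/2)"
  using hf hg Lip0 by (intro mult_left_mono; simp)+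
 hence "\<bar>ip (W n) (\<lambda>x. - U 1 x*?V2 x + U 2 x*?V1 x)\<bar> <= 4*(Lip*((nsq ?V1 + nsq ?V2)/2))"
  unfolding eq using bF[of 1 1] bG[of 1 2] bG[of 2 1] bF[of 2 2] by linarith
 thus ?thesis by simp
qed

private lemma LU: "L2f h ==> L2f (\<lambda>x. U i x*h x)"
proof -
 assume h: "L2f h"
 obtain B where B: "\<And>x. \<bar>U i x\<bar> <= B" using U_bdd by metis
 show ?thesis by (rule L2f_bounded_mult(1)[OF h U_meas U_per AE_I2[OF B]])
qed

private lemma limit_trilinear:
 "\<bar>ip (\<lambda>x. \<eta> x - mean \<eta>) (\<lambda>x. - U 1 x * v x $ 2 + U 2 x * v x $ 1)\<bar> <= 2*Lip*((nsq2 v))"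
proof -
 have LV: "L2f (Vn j n)" for j n unfolding Vn_def by (rule L2f_Pfour)
 have Vl: "(\<lambda>n. nsq (\<lambda>x. v x $ j - Vn j n x)) \<longlonglongrightarrow> 0" for j unfolding Vn_def by (rule Pfour_tendsto[OF Lv])
 have LW: "L2f (W n)" for n unfolding W_def by (rule L2f_Pfour)
 have Wl: "(\<lambda>n. nsq (\<lambda>x. (\<eta> x - mean \<eta>) - W n x)) \<longlonglongrightarrow> 0" unfolding W_def by (rule Pfour_tendsto[OF Lm])
 obtain B1 where B1: "\<And>x. \<bar>U 1 x\<bar> <= B1" using U_bdd by metis
 obtain B2 where B2: "\<And>x. \<bar>U 2 x\<bar> <= B2" using U_bdd by metis
 have LH: "L2f (\<lambda>x. - U 1 x*h x + U 2 x*k x)" if "L2f h" "L2f k" for h k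
  using L2f_add[OF L2f_uminus[OF LU[OF that(1), of 1]] LU[OF that(2), of 2]] by simp
 have Hl: "(\<lambda>n. nsq (\<lambda>x. (- U 1 x * v x $ 2 + U 2 x * v x $ 1) - (- U 1 x*Vn 2 n x + U 2 x*Vn 1 n x))) \<longlonglongrightarrow> 0"
 proof (rule tendsto_sandwich[OF _ _ tendsto_const])
  show "\<forall>\<^sub>F n in sequentially. nsq (\<lambda>x. (- U 1 x * v x $ 2 + U 2 x * v x $ 1) - (- U 1 x*Vn 2 n x + U 2 x*Vn 1 n x))
    <= 2*(B1^2*nsq (\<lambda>x. v x $ 2 - Vn 2 n x)) + 2*(B2^2*nsq (\<lambda>x. v x $ 1 - Vn 1 n x))"
  proof (intro always_eventually allI)
   fix n
   have Ld: "L2f (\<lambda>x. v x $ j - Vn j n x)" for j by (intro L2f_diff Lv LV)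
   have "nsq (\<lambda>x. (- U 1 x * v x $ 2 + U 2 x * v x $ 1) - (- U 1 x*Vn 2 n x + U 2 x*Vn 1 n x))
     = nsq (\<lambda>x. - (U 1 x*(v x $ 2 - Vn 2 n x)) + U 2 x*(v x $ 1 - Vn 1 n x))"
    by (simp add: algebra_simps)
   also have "\<dots> <= 2*nsq (\<lambda>x. - (U 1 x*(v x $ 2 - Vn 2 n x))) + 2*nsq (\<lambda>x. U 2 x*(v x $ 1 - Vn 1 n x))"
    by (rule nsq_add_le[OF L2f_uminus[OF LU[OF Ld]] LU[OF Ld]])
   also have "nsq (\<lambda>x. - (U 1 x*(v x $ 2 - Vn 2 n x))) = nsq (\<lambda>x. U 1 x*(v x $ 2 - Vn 2 n x))" by (simp add: nsq_def)
   also have "\<dots> <= B1^2*nsq (\<lambda>x. v x $ 2 - Vn 2 n x)" by (rule L2f_bounded_mult(2)[OF Ld U_meas U_per AE_I2[OF B1]])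
   also have "nsq (\<lambda>x. U 2 x*(v x $ 1 - Vn 1 n x)) <= B2^2*nsq (\<lambda>x. v x $ 1 - Vn 1 n x)" by (rule L2f_bounded_mult(2)[OF Ld U_meas U_per AE_I2[OF B2]])
   finally show "nsq (\<lambda>x. (- U 1 x * v x $ 2 + U 2 x * v x $ 1) - (- U 1 x*Vn 2 n x + U 2 x*Vn 1 n x))
    <= 2*(B1^2*nsq (\<lambda>x. v x $ 2 - Vn 2 n x)) + 2*(B2^2*nsq (\<lambda>x. v x $ 1 - Vn 1 n x))" by simp
  qed
  have "(\<lambda>n. 2*(B1^2*nsq (\<lambda>x. v x $ 2 - Vn 2 n x)) + 2*(B2^2*nsq (\<lambda>x. v x $ 1 - Vn 1 n x))) \<longlonglongrightarrow> 2*(B1^2*0) + 2*(B2^2*0)"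
   by (intro tendsto_intros Vl)
  thus "(\<lambda>n. 2*(B1^2*nsq (\<lambda>x. v x $ 2 - Vn 2 n x)) + 2*(B2^2*nsq (\<lambda>x. v x $ 1 - Vn 1 n x))) \<longlonglongrightarrow> 0" by simp
 qed simp
 have l1: "(\<lambda>n. \<bar>ip (W n) (\<lambda>x. - U 1 x*Vn 2 n x + U 2 x*Vn 1 n x)\<bar>) \<longlonglongrightarrow> \<bar>ip (\<lambda>x. \<eta> x - mean \<eta>) (\<lambda>x. - U 1 x * v x $ 2 + U 2 x * v x $ 1)\<bar>"
  by (rule tendsto_rabs[OF L2_prod_tendsto[OF LW Lm LH[OF LV LV] LH[OF Lv Lv] Wl Hl]])
 have l2: "(\<lambda>n. 2*Lip*(nsq (Vn 1 n) + nsq (Vn 2 n))) \<longlonglongrightarrow> 2*Lip*((nsq2 v))"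
  by (intro tendsto_intros nsq_tendsto LV Lv Vl)
 show ?thesis by (rule LIMSEQ_le[OF l1 l2]) (use trig_trilinear in auto)
qed

text \<open>The curl of \<open>v\<close> is only \<open>\<eta> - mean \<eta>\<close>, so the mean is
  split off and costs \<open>2 * C*D\<close> times its modulus. Replacing \<open>u\<close> by its
  mollification costs \<open>sqrt \<sigma>\<close>, and the remainder is controlled by the Lipschitz
  constant times the energy.\<close>

lemma trilinear_bound:
 "\<bar>ip \<eta> (\<lambda>x. - u x $ 1 * v x $ 2 + u x $ 2 * v x $ 1)\<bar>
  <= 2 * C*D*\<bar>mean \<eta>\<bar> + 4*D*D*(8 * C/Zc) * sqrt \<sigma> + 2*Lip*((nsq2 v))"
proof -
 have D0: "0 <= D" by (rule bdd_nonneg[OF \<eta>])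
 have C0: "0 <= C" by (rule bdd_nonneg[OF \<xi>])
 let ?m = "mean \<eta>"
 have Luv: "tint (\<lambda>x. u x $ i * v x $ j)" for i j by (rule L2f_mult[OF Lu Lv])
 have uv: "\<bar>TI x. u x $ i * v x $ j\<bar> <= C*D" for i j
 proof -
  have "\<bar>TI x. u x $ i * v x $ j\<bar> <= sqrt (nsq (u $$ i)) * sqrt (nsq (v $$ j))" by (rule L2f_CS[OF Lu Lv])
  also have "\<dots> <= C*D"
   using bs_nsq_le[OF BSu bdd_L2f[OF \<xi>], of i] bdd_nsq[OF \<xi>] bs_nsq_le[OF BSv bdd_L2f[OF \<eta>], of j] bdd_nsq[OF \<eta>] C0 D0
   by (intro mult_mono real_le_lsqrt) auto
  finally show ?thesis .
 qed
 have vL1: "(TI x. \<bar>v x $ j\<bar>) <= D" for j by (rule u_L1[OF BSv \<eta>])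
 define d where "d j x = u x $ j - U j x" for j x
 have dm: "d j \<in> bmeas" for j unfolding d_def[abs_def] using L2f_meas[OF Lu, of j] U_meas[of j] by measurable
 have dAE: "AE x in torus. \<bar>d j x\<bar> <= 8 * C/Zc * sqrt \<sigma>" for j unfolding d_def U_def by (rule bs_moll_AE[OF BSu \<xi> s])
 have em: "(\<lambda>x. \<eta> x - ?m) \<in> bmeas" using bdd_meas[OF \<eta>] by measurable
 have edb: "AE x in torus. \<bar>(\<eta> x - ?m)*d j x\<bar> <= 2*D*(8 * C/Zc * sqrt \<sigma>)" for j
  using w_mean_bound[OF BSv \<eta>] dAE[of j] unfolding abs_mult
 proof eventually_elim
  case (elim x)
  show ?case by (rule mult_mono[OF elim]) (use D0 in auto)
 qed
 have edm: "(\<lambda>x. (\<eta> x - ?m)*d j x) \<in> bmeas" for j using em dm by measurable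
 note E = integral_mult_bound[OF edb edm L2f_integrable[OF Lv]]
 have e2: "\<bar>TI x. (\<eta> x - ?m)*d i x * v x $ j\<bar> <= 2*D*(8 * C/Zc * sqrt \<sigma>)*D" for i j
 proof -
  have "0 <= 2*D*(8 * C/Zc * sqrt \<sigma>)" using D0 C0 Zc_pos s by simp
  hence "2*D*(8 * C/Zc * sqrt \<sigma>)*(TI x. \<bar>v x $ j\<bar>) <= 2*D*(8 * C/Zc * sqrt \<sigma>)*D" by (intro mult_left_mono vL1)
  thus ?thesis using E(1)[of i j] by linarith
 qed
 let ?T = "ip (\<lambda>x. \<eta> x - ?m) (\<lambda>x. - U 1 x * v x $ 2 + U 2 x * v x $ 1)"
 have iT: "tint (\<lambda>x. (\<eta> x - ?m)*(- U 1 x * v x $ 2 + U 2 x * v x $ 1))"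
  using L2f_mult[OF Lm L2f_add[OF L2f_uminus[OF LU[OF Lv[of 2], of 1]] LU[OF Lv[of 1], of 2]]] by simp
 have "ip \<eta> (\<lambda>x. - u x $ 1 * v x $ 2 + u x $ 2 * v x $ 1)
   = (TI x. - ?m*(u x $ 1 * v x $ 2) + ?m*(u x $ 2 * v x $ 1) - (\<eta> x - ?m)*d 1 x * v x $ 2 + (\<eta> x - ?m)*d 2 x * v x $ 1
    + (\<eta> x - ?m)*(- U 1 x * v x $ 2 + U 2 x * v x $ 1))"
  unfolding ip_def by (rule tcong) (auto simp: d_def algebra_simps)
 also have "\<dots> = - ?m*(TI x. u x $ 1 * v x $ 2) + ?m*(TI x. u x $ 2 * v x $ 1)
   - (TI x. (\<eta> x - ?m)*d 1 x * v x $ 2) + (TI x. (\<eta> x - ?m)*d 2 x * v x $ 1) + ?T"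
  using Luv[of 1 2] Luv[of 2 1] E(2)[of 1 2] E(2)[of 2 1] iT by (simp add: ip_def)
 finally have eq: "ip \<eta> (\<lambda>x. - u x $ 1 * v x $ 2 + u x $ 2 * v x $ 1) = - ?m*(TI x. u x $ 1 * v x $ 2) + ?m*(TI x. u x $ 2 * v x $ 1)
   - (TI x. (\<eta> x - ?m)*d 1 x * v x $ 2) + (TI x. (\<eta> x - ?m)*d 2 x * v x $ 1) + ?T" .
 have mu: "\<bar>?m*(TI x. u x $ i * v x $ j)\<bar> <= \<bar>?m\<bar>*(C*D)" for i j unfolding abs_mult using uv by (intro mult_left_mono) auto
 have aux: "\<bar>- a*b + c - d + e + f\<bar> <= 2*p + 2*q + r" if "\<bar>a*b\<bar> <= p" "\<bar>c\<bar> <= p" "\<bar>d\<bar> <= q" "\<bar>e\<bar> <= q" "\<bar>f\<bar> <= r" for a b c d e f p q r :: real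
  using that by (simp add: abs_le_iff)
 have "\<bar>ip \<eta> (\<lambda>x. - u x $ 1 * v x $ 2 + u x $ 2 * v x $ 1)\<bar> <= 2*(\<bar>?m\<bar>*(C*D)) + 2*(2*D*(8 * C/Zc * sqrt \<sigma>)*D)
   + 2*Lip*((nsq2 v))"
  unfolding eq by (rule aux[OF mu mu e2 e2 limit_trilinear])
 thus ?thesis by (simp add: mult_ac)
qed

end

end

text \<open>\<open>y\<close> is merely integrable, so the integral \<open>G\<close> above it need
  not be differentiable. Substituting once more gives \<open>H\<close> with a continuous integrand
  and \<open>y <= G <= H\<close>; differentiating \<open>H\<close> with the exponential weight
  closes the argument.\<close>

lemma gronwall_integral:
 fixes y :: "real => real"
 assumes ab: "a <= b" and int: "y integrable_on {a..b}" and k: "0 <= \<kappa>" "0 <= \<beta>"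
  and le: "\<And>t. t \<in> {a..b} ==> y t <= y0 + integral {a..t} (\<lambda>s. \<kappa>*y s + \<beta>)"
 shows "y b <= exp (\<kappa>*(b - a))*(y0 + \<beta>*(b - a))"
proof -
 define G where "G t = y0 + integral {a..t} (\<lambda>s. \<kappa>*y s + \<beta>)" for t
 define H where "H t = y0 + integral {a..t} (\<lambda>s. \<kappa>*G s + \<beta>)" for t
 have intk: "(\<lambda>s. \<kappa>*y s + \<beta>) integrable_on {a..b}" using integrable_add[OF integrable_cmul[OF int, of \<kappa>] integrable_const_ivl[of \<beta>]] by simp
 have Gc: "continuous_on {a..b} G" unfolding G_def[abs_def]
  by (intro continuous_on_add continuous_on_const indefinite_integral_continuous_1[OF intk])
 have yG: "y t <= G t" if "t \<in> {a..b}" for t using le[OF that] by (simp add: G_def)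
 have Gc': "continuous_on {a..b} (\<lambda>s. \<kappa>*G s + \<beta>)" by (intro continuous_intros Gc)
 have GH: "G t <= H t" if t: "t \<in> {a..b}" for t
 proof -
  have "integral {a..t} (\<lambda>s. \<kappa>*y s + \<beta>) <= integral {a..t} (\<lambda>s. \<kappa>*G s + \<beta>)"
  proof (rule integral_le)
   show "(\<lambda>s. \<kappa>*y s + \<beta>) integrable_on {a..t}" by (rule integrable_on_subinterval[OF intk]) (use t in auto)
   show "(\<lambda>s. \<kappa>*G s + \<beta>) integrable_on {a..t}"
    by (rule integrable_continuous_interval[OF continuous_on_subset[OF Gc']]) (use t in auto)
   fix s assume "s \<in> {a..t}"
   thus "\<kappa>*y s + \<beta> <= \<kappa>*G s + \<beta>" using yG[of s] k t by (simp add: mult_left_mono)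
  qed
  thus ?thesis by (simp add: G_def H_def)
 qed
 have Hd: "(H has_real_derivative (\<kappa>*G t + \<beta>)) (at t within {a..b})" if "t \<in> {a..b}" for t
  using DERIV_add[OF DERIV_const[of y0] integral_has_real_derivative[OF Gc' that]] by (simp add: H_def[abs_def])
 have "exp (- \<kappa>*(b - a))*H b - exp (- \<kappa>*(a - a))*H a <= \<beta>*b - \<beta>*a"
 proof (rule deriv_compare[OF ab])
  fix s assume s: "s \<in> {a..b}"
  show "((\<lambda>s. exp (- \<kappa>*(s - a))*H s) has_real_derivative
    (exp (- \<kappa>*(s - a))*(- \<kappa>))*H s + (\<kappa>*G s + \<beta>)*exp (- \<kappa>*(s - a))) (at s within {a..b})"
   by (intro DERIV_mult Hd s) (auto intro!: derivative_eq_intros)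
  show "((\<lambda>s. \<beta> * s) has_real_derivative \<beta>) (at s within {a..b})" by (auto intro!: derivative_eq_intros)
  have e: "0 <= exp (- \<kappa>*(s - a))" "exp (- \<kappa>*(s - a)) <= 1" using k s by auto
  have "(exp (- \<kappa>*(s - a))*(- \<kappa>))*H s + (\<kappa>*G s + \<beta>)*exp (- \<kappa>*(s - a))
    = exp (- \<kappa>*(s - a))*(\<kappa>*(G s - H s)) + \<beta>*exp (- \<kappa>*(s - a))" by (simp add: algebra_simps)
  also have "\<dots> <= 0 + \<beta>*1"
   using GH[OF s] e k by (intro add_mono mult_left_mono mult_nonneg_nonpos) auto
  finally show "(exp (- \<kappa>*(s - a))*(- \<kappa>))*H s + (\<kappa>*G s + \<beta>)*exp (- \<kappa>*(s - a)) <= \<beta>" by simp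
 qed
 hence "exp (- \<kappa>*(b - a))*H b <= y0 + \<beta>*(b - a)" by (simp add: H_def right_diff_distrib)
 hence "exp (\<kappa>*(b - a))*(exp (- \<kappa>*(b - a))*H b) <= exp (\<kappa>*(b - a))*(y0 + \<beta>*(b - a))" by (intro mult_left_mono) auto
 moreover have "exp (\<kappa>*(b - a))*(exp (- \<kappa>*(b - a))*H b) = H b"
  unfolding mult.assoc[symmetric] exp_add[symmetric] by simp
 moreover have "y b <= H b" using yG[of b] GH[of b] ab by auto
 ultimately show ?thesis by linarith
qed

lemma fl_sum:
 assumes "biot_savart f v" "L2f f" "\<And>k. k \<in> F ==> C1per (g k) (G k)"
 shows "fl v f (\<lambda>x. \<Sum>k\<in>F. G k x) = (\<Sum>k\<in>F. fl v f (G k))"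
proof -
 have "fl v f (\<lambda>x. \<Sum>k\<in>F. G k x) = (TI x. (\<Sum>k\<in>F. (v x \<bullet> G k x)*f x))"
  unfolding fl_def by (simp add: inner_sum_right sum_distrib_right)
 also have "\<dots> = (\<Sum>k\<in>F. fl v f (G k))" unfolding fl_def
  by (rule Bochner_Integration.integral_sum) (rule L2f_mult[OF bs_inner_L2[OF assms(1,2) assms(3)] assms(2)])
 finally show ?thesis .
qed

lemma fl_components:
 assumes BS: "biot_savart f v" and f: "bdd C f" and L: "L2f p" "L2f q" and G: "\<And>x. G x $ 1 = - p x" "\<And>x. G x $ 2 = q x"
 shows "fl v f G = ip (\<lambda>x. f x * v x $ 2) q - ip (\<lambda>x. f x * v x $ 1) p"
proof -
 have L': "L2f (\<lambda>x. f x * v x $ j)" for j by (rule L2f_bounded_mult(1)[OF bs_L2f[OF BS bdd_L2f[OF f]] bdd_meas[OF f] bdd_per[OF f] bdd_AE[OF f]])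
 have "fl v f G = (TI x. f x * v x $ 2*q x - f x * v x $ 1*p x)"
  unfolding fl_def by (rule tcong) (auto simp: inner_real2 G algebra_simps)
 also have "\<dots> = ip (\<lambda>x. f x * v x $ 2) q - ip (\<lambda>x. f x * v x $ 1) p"
  using L2f_mult[OF L'[of 2] L(2)] L2f_mult[OF L'[of 1] L(1)] by (simp add: ip_def)
 finally show ?thesis .
qed

lemma ip_vel_Pfour_bound:
 assumes BS: "biot_savart f v" and f: "bdd C f" and g: "L2f g" "nsq g <= D^2" "0 <= D"
 shows "\<bar>ip (\<lambda>x. f x * v x $ j) (Pfour n g)\<bar> <= C * C*(2*D)"
proof -
 note L = bs_L2f[OF BS bdd_L2f[OF f]]
 note L' = L2f_bounded_mult[OF L bdd_meas[OF f] bdd_per[OF f] bdd_AE[OF f]]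
 have C0: "0 <= C" by (rule bdd_nonneg[OF f])
 have n1: "sqrt (nsq (\<lambda>x. f x * v x $ j)) <= C * C"
 proof (rule real_le_lsqrt)
  have "nsq (\<lambda>x. f x * v x $ j) <= C^2*nsq (v $$ j)" by (rule L'(2))
  also have "\<dots> <= C^2 * C^2" using bs_nsq_le[OF BS bdd_L2f[OF f], of j] bdd_nsq[OF f] by (intro mult_left_mono) auto
  finally show "nsq (\<lambda>x. f x * v x $ j) <= (C * C)^2" by (simp add: power_mult_distrib)
 qed (use C0 in auto)
 have "nsq (\<lambda>x. - (g x - Pfour n g x)) = nsq (\<lambda>x. g x - Pfour n g x)" by (simp add: nsq_def power2_commute)
 also have "\<dots> <= nsq g"
  using Pfour_approx[OF g(1), of n] sum_nonneg[of "Bx n" "\<lambda>k. (norm (fourier g k))^2"] by simp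
 finally have n2: "sqrt (nsq (\<lambda>x. - (g x - Pfour n g x))) <= D" using g by (intro real_le_lsqrt) auto
 have "sqrt (nsq (Pfour n g)) <= sqrt (nsq g) + sqrt (nsq (\<lambda>x. - (g x - Pfour n g x)))"
  using nsq_sqrt_triangle[OF g(1) L2f_uminus[OF L2f_diff[OF g(1) L2f_Pfour[of n g]]]] by simp
 moreover have "sqrt (nsq g) <= D" using g by (intro real_le_lsqrt) auto
 ultimately have n3: "sqrt (nsq (Pfour n g)) <= 2*D" using n2 by linarith
 have "\<bar>ip (\<lambda>x. f x * v x $ j) (Pfour n g)\<bar> <= sqrt (nsq (\<lambda>x. f x * v x $ j)) * sqrt (nsq (Pfour n g))"
  unfolding ip_def by (rule L2f_CS[OF L'(1) L2f_Pfour])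
 also have "\<dots> <= C * C*(2*D)" using n1 n3 C0 by (intro mult_mono) auto
 finally show ?thesis .
qed

section \<open>The energy of the difference of two solutions\<close>

context
 fixes \<gamma> t0 X1 X2 N \<xi>1 u1 \<xi>2 u2 C T
 assumes S1: "sol \<gamma> t0 X1 N \<xi>1 u1" and S2: "sol \<gamma> t0 X2 N \<xi>2 u2" and gam: "0 <= \<gamma>"
  and b1: "\<And>t. t \<in> {t0..T} ==> bdd C (\<xi>1 t)" and b2: "\<And>t. t \<in> {t0..T} ==> bdd C (\<xi>2 t)"
begin

private definition "\<eta> t x = \<xi>1 t x - \<xi>2 t x"
private definition "v t x = u1 t x - u2 t x"
private definition "\<Phi> t G = fl (u1 t) (\<xi>1 t) G - fl (u2 t) (\<xi>2 t) G"
private definition "y t = (nsq2 (v t))"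
text \<open>The multiplier of the inverse of minus the Laplacian, with the default 0 at the zero
  mode, which carries no velocity.\<close>

private definition "wk k = (if k = 0 then 0 else 1/(4*pi^2*((real_of_int (fst k))^2 + (real_of_int (snd k))^2)))"
private definition "ac k t = ip (\<eta> t) (\<lambda>x. cos (ph k x))"
private definition "as k t = ip (\<eta> t) (\<lambda>x. sin (ph k x))"
private definition "en R t = (\<Sum>k\<in>Bx R. wk k*((ac k t)^2 + (as k t)^2))"
text \<open>The gradient of the truncated stream function of \<open>\<eta> t\<close>. Its
  coefficients depend on time, so the equation is applied to each mode and the results are
  summed.\<close>

private definition "\<Psi> R t x = (\<Sum>k\<in>Bx R. (wk k*ac k t) *\<^sub>R gc k x + (wk k*as k t) *\<^sub>R gs k x)"
text \<open>The flux difference \<open>\<xi>1 u1 - \<xi>2 u2\<close> equals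
  \<open>\<eta> u2 + \<xi>1 v\<close>. The second term is pointwise orthogonal to the rotated
  \<open>v\<close>, so only the first remains.\<close>

private definition "B s = ip (\<eta> s) (\<lambda>x. - u2 s x $ 1 * v s x $ 2 + u2 s x $ 2 * v s x $ 1)"

private lemma BS1: "t \<in> {t0..T} ==> biot_savart (\<xi>1 t) (u1 t)" and BS2: "t \<in> {t0..T} ==> biot_savart (\<xi>2 t) (u2 t)"
 using sol_BS[OF S1] sol_BS[OF S2] by auto

private lemma BSv: "t \<in> {t0..T} ==> biot_savart (\<eta> t) (v t)"
 unfolding \<eta>_def[abs_def] v_def[abs_def] by (intro biot_savart_diff BS1 BS2 bdd_L2f[OF b1] bdd_L2f[OF b2])

private lemma be: "t \<in> {t0..T} ==> bdd (2 * C) (\<eta> t)"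
 unfolding \<eta>_def[abs_def] using bdd_diff[OF b1 b2] by simp

text \<open>Both solutions are driven by the same \<open>N\<close>, which cancels, so the tested
  difference is differentiable without correction.\<close>

private lemma \<eta>_deriv:
 assumes g: "C1per g G" and t: "t \<in> {t0..T}"
 shows "((\<lambda>t. ip (\<eta> t) g) has_real_derivative (- \<gamma>*ip (\<eta> t) g + \<Phi> t G)) (at t within {t0..T})"
proof -
 have e: "ip (\<eta> s) g = ip (\<xi>1 s) g - ip (\<xi>2 s) g" if "s \<in> {t0..T}" for s
  unfolding \<eta>_def[abs_def] by (rule ip_diff_left[OF bdd_L2f[OF b1[OF that]] bdd_L2f[OF b2[OF that]] C1per_L2f(1)[OF g]])
 have "((\<lambda>t. ip (\<eta> t) g) has_real_derivative (- \<gamma>*ip (\<xi>1 t) g + fl (u1 t) (\<xi>1 t) G) - (- \<gamma>*ip (\<xi>2 t) g + fl (u2 t) (\<xi>2 t) G)) (at t within {t0..T})"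
  by (rule has_field_derivative_transform_within[OF DERIV_diff[OF sol_deriv[OF S1 g t] sol_deriv[OF S2 g t]] zero_less_one t]) (use e in auto)
 thus ?thesis unfolding e[OF t] \<Phi>_def by (simp add: algebra_simps)
qed

private lemma \<eta>_cont: "C1per g G ==> continuous_on {t0..T} (\<lambda>t. ip (\<eta> t) g)"
 by (rule DERIV_continuous_on[OF \<eta>_deriv])

private lemma \<Phi>_cont: "C1per g G ==> continuous_on {t0..T} (\<lambda>t. \<Phi> t G)"
 unfolding \<Phi>_def by (intro continuous_on_diff; rule continuous_on_subset[OF sol_cont_fl[OF S1]] continuous_on_subset[OF sol_cont_fl[OF S2]]; auto)

private lemma en_eq:
 assumes t: "t \<in> {t0..T}"
 shows "en R t = (\<Sum>k\<in>Bx R. (fr2 (v t) k))"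
 unfolding en_def
proof (rule sum.cong[OF refl])
 fix k
 note L = bdd_L2f[OF be[OF t]]
 show "wk k*((ac k t)^2 + (as k t)^2) = (fr2 (v t) k)"
 proof (cases "k = 0")
  case True thus ?thesis by (simp add: wk_def bs_fourier_0[OF BSv[OF t] L])
 next
  case False
  define K :: real where "K = (of_int (fst k))^2 + (of_int (snd k))^2"
  have p: "K > 0" using sq_k_ge_1[OF False] unfolding K_def by linarith
  have "(ac k t)^2 + (as k t)^2 = (norm (fourier (\<eta> t) k))^2" by (simp add: fourier_ip[OF L] cmod_power2 ac_def as_def)
  also have "\<dots> = 4*pi^2*K*((fr2 (v t) k))"
   using bs_fourier_norm[OF BSv[OF t] L, of k] False unfolding K_def by simp
  finally show ?thesis using False p unfolding wk_def K_def[symmetric] by simp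
 qed
qed

private lemma \<Phi>_\<Psi>: assumes t: "t \<in> {t0..T}"
 shows "\<Phi> t (\<Psi> R t) = (\<Sum>k\<in>Bx R. wk k*ac k t*\<Phi> t (gc k) + wk k*as k t*\<Phi> t (gs k))"
proof -
 have f: "fl w f (\<Psi> R t) = (\<Sum>k\<in>Bx R. wk k*ac k t*fl w f (gc k) + wk k*as k t*fl w f (gs k))" if "biot_savart f w" "L2f f" for w f
 proof -
  have "fl w f (\<Psi> R t) = (\<Sum>k\<in>Bx R. fl w f (\<lambda>x. (wk k*ac k t) *\<^sub>R gc k x + (wk k*as k t) *\<^sub>R gs k x))"
   unfolding \<Psi>_def[abs_def] by (rule fl_sum[OF that, where g="\<lambda>k x. wk k*ac k t*cos (ph k x) + wk k*as k t * sin (ph k x)"]) (intro C1per_add C1per_cmult C1per_cos_ph C1per_sin_ph)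
  also have "\<dots> = (\<Sum>k\<in>Bx R. wk k*ac k t*fl w f (gc k) + wk k*as k t*fl w f (gs k))"
   by (intro sum.cong refl fl_lin[OF that C1per_cos_ph C1per_sin_ph])
  finally show ?thesis .
 qed
 show ?thesis unfolding \<Phi>_def f[OF BS1[OF t] bdd_L2f[OF b1[OF t]]] f[OF BS2[OF t] bdd_L2f[OF b2[OF t]]] sum_subtractf[symmetric]
  by (intro sum.cong refl) (simp add: algebra_simps)
qed

private lemma \<Phi>_\<Psi>_cont: "continuous_on {t0..T} (\<lambda>t. \<Phi> t (\<Psi> R t))"
proof -
 have "continuous_on {t0..T} (\<lambda>t. \<Sum>k\<in>Bx R. wk k*ac k t*\<Phi> t (gc k) + wk k*as k t*\<Phi> t (gs k))"
  unfolding ac_def as_def by (intro continuous_intros \<eta>_cont[OF C1per_cos_ph] \<eta>_cont[OF C1per_sin_ph] \<Phi>_cont[OF C1per_cos_ph] \<Phi>_cont[OF C1per_sin_ph])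
 thus ?thesis by (rule continuous_on_eq) (rule \<Phi>_\<Psi>[symmetric])
qed

private lemma en_deriv: assumes t: "t \<in> {t0..T}"
 shows "(en R has_real_derivative (- 2*\<gamma>*en R t + 2*\<Phi> t (\<Psi> R t))) (at t within {t0..T})"
proof -
 have "(en R has_real_derivative (\<Sum>k\<in>Bx R. wk k*(2*ac k t*(- \<gamma>*ac k t + \<Phi> t (gc k)) + 2*as k t*(- \<gamma>*as k t + \<Phi> t (gs k))))) (at t within {t0..T})"
  unfolding en_def[abs_def]
 proof (rule DERIV_sum)
  fix k
  have "(ac k has_real_derivative (- \<gamma>*ac k t + \<Phi> t (gc k))) (at t within {t0..T})" "(as k has_real_derivative (- \<gamma>*as k t + \<Phi> t (gs k))) (at t within {t0..T})"
   unfolding ac_def[abs_def] as_def[abs_def] by (rule \<eta>_deriv[OF C1per_cos_ph t] \<eta>_deriv[OF C1per_sin_ph t])+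
  from DERIV_cmult[OF DERIV_add[OF DERIV_power[OF this(1), of 2] DERIV_power[OF this(2), of 2]], of "wk k"]
  show "((\<lambda>t. wk k*((ac k t)^2 + (as k t)^2)) has_real_derivative wk k*(2*ac k t*(- \<gamma>*ac k t + \<Phi> t (gc k)) + 2*as k t*(- \<gamma>*as k t + \<Phi> t (gs k)))) (at t within {t0..T})"
   by (rule DERIV_cong) (simp add: algebra_simps)
 qed
 thus ?thesis
  by (rule DERIV_cong) (unfold \<Phi>_\<Psi>[OF t] en_def sum_distrib_left sum.distrib[symmetric], intro sum.cong refl, simp add: algebra_simps power2_eq_square)
qed

text \<open>The gradient of the stream function is the velocity rotated by a right angle. This
  identifies the abstract test gradient with partial Fourier sums of \<open>v\<close>, which
  converge in \<open>L^2\<close>.\<close>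

private lemma \<Psi>_components: assumes t: "t \<in> {t0..T}"
 shows "\<Psi> R t x $ 1 = - Pfour R (v t $$ 2) x" "\<Psi> R t x $ 2 = Pfour R (v t $$ 1) x"
proof -
 note L = bdd_L2f[OF be[OF t]]
 have iv: "ivec k $ 1 = of_int (fst k)" "ivec k $ 2 = of_int (snd k)" for k by (simp_all add: ivec_def axis_def)
 have f: "Re (fourier (v t $$ 1) k) = of_int (snd k)*(2*pi)*(wk k*as k t)" "Im (fourier (v t $$ 1) k) = of_int (snd k)*(2*pi)*(wk k*ac k t)"
  "Re (fourier (v t $$ 2) k) = - of_int (fst k)*(2*pi)*(wk k*as k t)" "Im (fourier (v t $$ 2) k) = - of_int (fst k)*(2*pi)*(wk k*ac k t)" for k
 proof -
  have "Re (fourier (v t $$ 1) k) = of_int (snd k)*(2*pi)*(wk k*as k t) \<and> Im (fourier (v t $$ 1) k) = of_int (snd k)*(2*pi)*(wk k*ac k t) \<and>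
  Re (fourier (v t $$ 2) k) = - of_int (fst k)*(2*pi)*(wk k*as k t) \<and> Im (fourier (v t $$ 2) k) = - of_int (fst k)*(2*pi)*(wk k*ac k t)"
  proof (cases "k = 0")
   case True thus ?thesis by (simp add: wk_def bs_fourier_0[OF BSv[OF t] L])
  next
   case False
   define K :: real where "K = (of_int (fst k))^2 + (of_int (snd k))^2"
   have "K > 0" using sq_k_ge_1[OF False] unfolding K_def by linarith
   hence w: "1/(2*pi*K) = 2*pi*wk k" using False unfolding wk_def K_def[symmetric] by (simp add: power2_eq_square)
   have w': "x/(2*pi*K) = x*(2*pi*wk k)" for x unfolding w[symmetric] by simp
   show ?thesis unfolding bs_fourier[OF BSv[OF t] L False K_def] w' by (simp add: fourier_ip[OF L] ac_def as_def)
  qed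
  thus "Re (fourier (v t $$ 1) k) = of_int (snd k)*(2*pi)*(wk k*as k t)" "Im (fourier (v t $$ 1) k) = of_int (snd k)*(2*pi)*(wk k*ac k t)"
  "Re (fourier (v t $$ 2) k) = - of_int (fst k)*(2*pi)*(wk k*as k t)" "Im (fourier (v t $$ 2) k) = - of_int (fst k)*(2*pi)*(wk k*ac k t)" by auto
 qed
 show "\<Psi> R t x $ 1 = - Pfour R (v t $$ 2) x" "\<Psi> R t x $ 2 = Pfour R (v t $$ 1) x"
  unfolding \<Psi>_def Pfour_def f sum_component sum_negf[symmetric]
  by (intro sum.cong refl, simp add: iv algebra_simps)+
qed

private lemma \<Phi>_\<Psi>_lim: assumes t: "t \<in> {t0..T}" shows "(\<lambda>R. \<Phi> t (\<Psi> R t)) \<longlonglongrightarrow> B t"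
proof -
 note L = bs_L2f[OF BSv[OF t] bdd_L2f[OF be[OF t]]]
 have m: "L2f (\<lambda>x. f x*w x $ j)" if "biot_savart f w" "bdd C f" for f w j
  by (rule L2f_bounded_mult(1)[OF bs_L2f[OF that(1) bdd_L2f[OF that(2)]] bdd_meas[OF that(2)] bdd_per[OF that(2)] bdd_AE[OF that(2)]])
 have lim: "(\<lambda>R. ip (\<lambda>x. f x*w x $ i) (Pfour R (v t $$ j))) \<longlonglongrightarrow> ip (\<lambda>x. f x*w x $ i) (v t $$ j)" if "biot_savart f w" "bdd C f" for f w i j
 proof (rule L2_prod_tendsto)
  show "(\<lambda>n. nsq (\<lambda>x. v t x $ j - Pfour n (v t $$ j) x)) \<longlonglongrightarrow> 0" by (rule Pfour_tendsto[OF L])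
  show "(\<lambda>n. nsq (\<lambda>x. f x*w x $ i - f x*w x $ i)) \<longlonglongrightarrow> 0" by (simp add: nsq_def)
 qed (intro m that L L2f_Pfour)+
 have fe: "fl w f (\<Psi> R t) = ip (\<lambda>x. f x*w x $ 2) (Pfour R (v t $$ 1)) - ip (\<lambda>x. f x*w x $ 1) (Pfour R (v t $$ 2))" if "biot_savart f w" "bdd C f" for f w R
  by (rule fl_components[OF that L2f_Pfour L2f_Pfour \<Psi>_components[OF t]])
 note h = lim[OF BS1[OF t] b1[OF t]] lim[OF BS2[OF t] b2[OF t]]
 let ?m1 = "\<lambda>i j. ip (\<lambda>x. \<xi>1 t x*u1 t x $ i) (v t $$ j)" and ?m2 = "\<lambda>i j. ip (\<lambda>x. \<xi>2 t x*u2 t x $ i) (v t $$ j)"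
 have "(\<lambda>R. \<Phi> t (\<Psi> R t)) \<longlonglongrightarrow> (?m1 2 1 - ?m1 1 2) - (?m2 2 1 - ?m2 1 2)"
  unfolding \<Phi>_def fe[OF BS1[OF t] b1[OF t]] fe[OF BS2[OF t] b2[OF t]] by (intro tendsto_diff h)
 moreover have "(?m1 2 1 - ?m1 1 2) - (?m2 2 1 - ?m2 1 2) = B t"
 proof -
  have i: "tint (\<lambda>x. \<xi>1 t x*u1 t x $ i * v t x $ j)" "tint (\<lambda>x. \<xi>2 t x*u2 t x $ i * v t x $ j)" for i j
   by (intro L2f_mult m L BS1 BS2 b1 b2 t)+
  have "(?m1 2 1 - ?m1 1 2) - (?m2 2 1 - ?m2 1 2)
   = (TI x. (\<xi>1 t x*u1 t x $ 2 * v t x $ 1 - \<xi>1 t x*u1 t x $ 1 * v t x $ 2) - (\<xi>2 t x*u2 t x $ 2 * v t x $ 1 - \<xi>2 t x*u2 t x $ 1 * v t x $ 2))"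
   using i by (simp add: ip_def)
  also have "\<dots> = B t" unfolding B_def ip_def
   by (rule tcong) (auto simp: \<eta>_def v_def algebra_simps)
  finally show ?thesis .
 qed
 ultimately show ?thesis by simp
qed

private lemma C0: "t \<in> {t0..T} ==> 0 <= C" using bdd_nonneg[OF b1] by auto

text \<open>The bound involves neither \<open>R\<close> nor \<open>t\<close>, as required of a
  dominating constant in \<open>energy_integral\<close>.\<close>

private lemma \<Phi>_\<Psi>_bound: assumes t: "t \<in> {t0..T}" shows "\<bar>\<Phi> t (\<Psi> R t)\<bar> <= 4*(C * C*(2*(2 * C)))"
proof -
 note L = bs_L2f[OF BSv[OF t] bdd_L2f[OF be[OF t]]]
 have n: "nsq (v t $$ j) <= (2 * C)^2" for j using bs_nsq_le[OF BSv[OF t] bdd_L2f[OF be[OF t]], of j] bdd_nsq[OF be[OF t]] by linarith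
 have fe: "\<bar>fl w f (\<Psi> R t)\<bar> <= 2*(C * C*(2*(2 * C)))" if "biot_savart f w" "bdd C f" for f w
 proof -
  have "\<bar>ip (\<lambda>x. f x*w x $ i) (Pfour R (v t $$ j))\<bar> <= C * C*(2*(2 * C))" for i j
   by (rule ip_vel_Pfour_bound[OF that L n]) (use C0[OF t] in auto)
  from this[of 1 2] this[of 2 1] show ?thesis unfolding fl_components[OF that L2f_Pfour L2f_Pfour \<Psi>_components[OF t]] by linarith
 qed
 show ?thesis unfolding \<Phi>_def using fe[OF BS1[OF t] b1[OF t]] fe[OF BS2[OF t] b2[OF t]] by linarith
qed

private lemma en_bound: assumes t: "t \<in> {t0..T}" shows "0 <= en R t" "en R t <= (2 * C)^2"
proof -
 note L = bs_L2f[OF BSv[OF t] bdd_L2f[OF be[OF t]]]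
 show "0 <= en R t" unfolding en_eq[OF t] by (intro sum_nonneg) auto
 have "en R t <= (nsq2 (v t))"
  unfolding en_eq[OF t] sum.distrib by (intro add_mono bessel L finite_Bx)
 thus "en R t <= (2 * C)^2" using bs_nsq[OF BSv[OF t] bdd_L2f[OF be[OF t]]] bdd_nsq[OF be[OF t]] by linarith
qed

private lemma en_lim: assumes t: "t \<in> {t0..T}" shows "(\<lambda>R. en R t) \<longlonglongrightarrow> y t"
 unfolding en_eq[OF t] y_def by (rule bs_nsq_lim[OF BSv[OF t] bdd_L2f[OF be[OF t]]])

text \<open>\<open>y\<close> and \<open>B\<close> are limits of continuous functions of time under
  uniform bounds. Dominated convergence makes them integrable and carries the truncated energy
  balance to the limit in integrated form; the damping is dropped because of its sign.\<close>

private lemma energy_integral: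
 assumes a: "t0 <= a" "a <= t" "t <= T"
 shows "y integrable_on {a..t}" "B integrable_on {a..t}" "y t <= y a + integral {a..t} (\<lambda>s. 2*B s)"
proof -
 have sub: "s \<in> {t0..T}" if "s \<in> {a..t}" for s using that a by auto
 have c1: "continuous_on {a..t} (\<lambda>s. 2*\<Phi> s (\<Psi> R s))" for R
  by (intro continuous_intros continuous_on_subset[OF \<Phi>_\<Psi>_cont]) (use a in auto)
 have c2: "continuous_on {a..t} (en R)" for R
  by (rule continuous_on_subset[OF DERIV_continuous_on[OF en_deriv]]) (use a in auto)
 note d1 = dominated_convergence[where f="\<lambda>R s. 2*\<Phi> s (\<Psi> R s)" and S="{a..t}" and g="\<lambda>s. 2*B s" and h="\<lambda>s. 2*(4*(C * C*(2*(2 * C))))"]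
 have d1: "(\<lambda>s. 2*B s) integrable_on {a..t}" "(\<lambda>R. integral {a..t} (\<lambda>s. 2*\<Phi> s (\<Psi> R s))) \<longlonglongrightarrow> integral {a..t} (\<lambda>s. 2*B s)"
  by (rule d1; use \<Phi>_\<Psi>_bound sub integrable_continuous_interval[OF c1] \<Phi>_\<Psi>_lim in \<open>auto simp: abs_mult intro!: tendsto_intros\<close>)+
 note d2 = dominated_convergence(1)[where f="\<lambda>R s. en R s" and S="{a..t}" and g=y and h="\<lambda>s. (2 * C)^2"]
 show "y integrable_on {a..t}"
  by (rule d2) (use en_bound sub integrable_continuous_interval[OF c2] en_lim in \<open>auto simp: abs_of_nonneg\<close>)
 show "B integrable_on {a..t}" using integrable_on_cmult_left[OF d1(1), of "1/2"] by simp
 have "en R t <= en R a + integral {a..t} (\<lambda>s. 2*\<Phi> s (\<Psi> R s))" for R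
 proof -
  have "en R t - en R a <= integral {a..t} (\<lambda>s. 2*\<Phi> s (\<Psi> R s)) - integral {a..a} (\<lambda>s. 2*\<Phi> s (\<Psi> R s))"
  proof (rule deriv_compare[OF a(2)])
   fix s assume s: "s \<in> {a..t}"
   show "(en R has_real_derivative (- 2*\<gamma>*en R s + 2*\<Phi> s (\<Psi> R s))) (at s within {a..t})"
    by (rule DERIV_subset[OF en_deriv[OF sub[OF s]]]) (use a in auto)
   show "((\<lambda>t. integral {a..t} (\<lambda>s. 2*\<Phi> s (\<Psi> R s))) has_real_derivative 2*\<Phi> s (\<Psi> R s)) (at s within {a..t})"
    by (rule integral_has_real_derivative[OF c1 s])
   show "- 2*\<gamma>*en R s + 2*\<Phi> s (\<Psi> R s) <= 2*\<Phi> s (\<Psi> R s)"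
    using en_bound(1)[OF sub[OF s], of R] gam by simp
  qed
  thus ?thesis by simp
 qed
 thus "y t <= y a + integral {a..t} (\<lambda>s. 2*B s)"
  using a by (intro LIMSEQ_le[OF en_lim tendsto_add[OF en_lim d1(2)]]) auto
qed

text \<open>The constant test function has zero gradient, so the transport term disappears and the
  squared mean has derivative \<open>- 2*\<gamma>\<close> times itself.\<close>

private lemma mean_dec: assumes t: "t \<in> {t0..T}" shows "\<bar>mean (\<eta> t)\<bar> <= \<bar>mean (\<eta> t0)\<bar>"
proof -
 let ?m = "\<lambda>t. ip (\<eta> t) (\<lambda>_. 1)"
 have m: "?m t = mean (\<eta> t)" for t by (simp add: ip_def mean_def)
 have z: "\<Phi> s (\<lambda>_. 0) = 0" for s by (simp add: \<Phi>_def fl_def)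
 have "(?m t)^2 - (?m t0)^2 <= 0 - 0"
 proof (rule deriv_compare[where f="\<lambda>s. (?m s)^2" and g="\<lambda>_. 0" and f'="\<lambda>s. - 2*\<gamma>*(?m s)^2" and g'="\<lambda>_. 0"])
  show "t0 <= t" using t by auto
  fix s assume s: "s \<in> {t0..t}"
  hence s': "s \<in> {t0..T}" using t by auto
  have d: "(?m has_real_derivative (- \<gamma>*?m s)) (at s within {t0..t})"
   using DERIV_subset[OF \<eta>_deriv[OF C1per_const s'], of "{t0..t}"] t by (simp add: z)
  show "((\<lambda>s. (?m s)^2) has_real_derivative - 2*\<gamma>*(?m s)^2) (at s within {t0..t})"
   by (rule DERIV_cong[OF DERIV_power[OF d, of 2]]) (simp add: power2_eq_square)
  show "((\<lambda>s. 0) has_real_derivative 0) (at s within {t0..t})" by simp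
  show "- 2*\<gamma>*(?m s)^2 <= 0" using gam by simp
 qed
 thus ?thesis unfolding m by (simp add: abs_le_square_iff)
qed

lemma mean_decay: "t \<in> {t0..T} ==> \<bar>mean (\<lambda>x. \<xi>1 t x - \<xi>2 t x)\<bar> <= \<bar>mean (\<lambda>x. \<xi>1 t0 x - \<xi>2 t0 x)\<bar>"
 using mean_dec unfolding \<eta>_def[abs_def] .

lemma energy_estimate:
 assumes a: "t0 <= a" "a <= t" "t <= T" and s: "0 < \<sigma>" "\<sigma> <= 1/16"
 shows "nsq (\<lambda>x. (u1 t x - u2 t x) $ 1) + nsq (\<lambda>x. (u1 t x - u2 t x) $ 2)
  <= exp (4*(256 * C/Zc*(1 + ln (1/\<sigma>)))*(t - a))*(nsq (\<lambda>x. (u1 a x - u2 a x) $ 1) + nsq (\<lambda>x. (u1 a x - u2 a x) $ 2)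
   + 2*(2 * C*(2 * C)*\<bar>mean (\<lambda>x. \<xi>1 t0 x - \<xi>2 t0 x)\<bar> + 4*(2 * C)*(2 * C)*(8 * C/Zc) * sqrt \<sigma>)*(t - a))"
proof -
 let ?L = "256 * C/Zc*(1 + ln (1/\<sigma>))" and ?b = "2 * C*(2 * C)*\<bar>mean (\<eta> t0)\<bar> + 4*(2 * C)*(2 * C)*(8 * C/Zc) * sqrt \<sigma>"
 have C: "0 <= C" using C0[of t] a by auto
 have L0: "0 <= ?L" using C Zc_pos s by simp
 have b0: "0 <= ?b" using C Zc_pos s by simp
 have sub: "r \<in> {t0..T}" if "r \<in> {a..t}" for r using that a by auto
 have Bb: "2*B r <= 4*?L*y r + 2*?b" if "r \<in> {a..t}" for r
 proof -
  note r = sub[OF that]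
  have "\<bar>B r\<bar> <= 2 * C*(2 * C)*\<bar>mean (\<eta> r)\<bar> + 4*(2 * C)*(2 * C)*(8 * C/Zc) * sqrt \<sigma> + 2*?L*y r"
   unfolding B_def y_def by (rule trilinear_bound[OF BSv[OF r] be[OF r] BS2[OF r] b2[OF r] s])
  moreover have "2 * C*(2 * C)*\<bar>mean (\<eta> r)\<bar> <= 2 * C*(2 * C)*\<bar>mean (\<eta> t0)\<bar>" using C by (intro mult_left_mono mean_dec r) auto
  ultimately have "\<bar>B r\<bar> <= ?b + 2*?L*y r" by linarith
  moreover have "2*b <= 4*l*q + 2*p" if "\<bar>b\<bar> <= p + 2*l*q" for b p l q :: real using that by (simp add: abs_le_iff)
  ultimately show ?thesis by blast
 qed
 have "y t <= exp (4*?L*(t - a))*(y a + 2*?b*(t - a))"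
 proof (rule gronwall_integral[OF a(2)])
  show "y integrable_on {a..t}" by (rule energy_integral(1)[OF a])
  show "0 <= 4*?L" "0 <= 2*?b" using L0 b0 by auto
  fix r assume r: "r \<in> {a..t}"
  hence ra: "t0 <= a" "a <= r" "r <= T" using a by auto
  have "integral {a..r} (\<lambda>s. 2*B s) <= integral {a..r} (\<lambda>s. 4*?L*y s + 2*?b)"
  proof (rule integral_le)
   show "(\<lambda>s. 2*B s) integrable_on {a..r}" using integrable_cmul[OF energy_integral(2)[OF ra], of 2] by simp
   show "(\<lambda>s. 4*?L*y s + 2*?b) integrable_on {a..r}" using integrable_add[OF integrable_cmul[OF energy_integral(1)[OF ra], of "4*?L"] integrable_const_ivl[of "2*?b"]] by simp
   fix q assume "q \<in> {a..r}"
   thus "2*B q <= 4*?L*y q + 2*?b" using r by (intro Bb) auto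
  qed
  thus "y r <= y a + integral {a..r} (\<lambda>s. 4*?L*y s + 2*?b)" using energy_integral(3)[OF ra] by linarith
 qed
 thus ?thesis unfolding y_def v_def \<eta>_def[abs_def] .
qed

end

section \<open>From Fourier modes back to weak-star convergence\<close>

lemma trigs_L1_dense:
 assumes [measurable]: "g \<in> bmeas" and g: "tint g" and e: "0 < e"
 obtains F c where "finite F" "(TI x. norm (complex_of_real (g x) - trig F c x)) < e" "tint (\<lambda>x. norm (complex_of_real (g x) - trig F c x))"
proof -
 define h where "h M x = max (- real M) (min (real M) (g x))" for M x
 have [measurable]: "h M \<in> bmeas" for M unfolding h_def[abs_def] by measurable
 have hb: "\<bar>h M x\<bar> <= real M" "\<bar>h M x\<bar> <= \<bar>g x\<bar>" for M x by (auto simp: h_def)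
 have ih: "tint (h M)" for M by (rule Bochner_Integration.integrable_bound[OF g]) (use hb in auto)
 have "(\<lambda>M. TI x. \<bar>g x - h M x\<bar>) \<longlonglongrightarrow> (TI x. 0)"
 proof (rule integral_dominated_convergence[where w="\<lambda>x. 2*\<bar>g x\<bar>"])
  show "AE x in torus. (\<lambda>M. \<bar>g x - h M x\<bar>) \<longlonglongrightarrow> 0"
  proof (rule AE_I2)
   fix x
   obtain M0 where M0: "\<bar>g x\<bar> <= real M0" using real_arch_simple by blast
   have "eventually (\<lambda>M. \<bar>g x - h M x\<bar> = 0) sequentially"
    using eventually_ge_at_top[of M0] by eventually_elim (use M0 in \<open>auto simp: h_def\<close>)
   thus "(\<lambda>M. \<bar>g x - h M x\<bar>) \<longlonglongrightarrow> 0" by (rule tendsto_eventually)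
  qed
  show "AE x in torus. norm \<bar>g x - h M x\<bar> <= 2*\<bar>g x\<bar>" for M
  proof (rule AE_I2)
   fix x show "norm \<bar>g x - h M x\<bar> <= 2*\<bar>g x\<bar>" using hb(2)[of M x] unfolding real_norm_def by linarith
  qed
 qed (use g in auto)
 hence "(\<lambda>M. TI x. \<bar>g x - h M x\<bar>) \<longlonglongrightarrow> 0" by simp
 from order_tendstoD(2)[OF this, of "e/2"] obtain M where M: "(TI x. \<bar>g x - h M x\<bar>) < e/2"
  using e by (auto dest: eventually_happens'[rotated])
 have "tint (\<lambda>x. (h M x)^2)"
  by (rule integrable_torus_bounded[where C="(real M)^2"]) (use hb(1) in \<open>auto simp: abs_le_square_iff[symmetric]\<close>)
 from tdense_L2[OF _ this] obtain T where T: "T \<in> trigs" "(TI x. (norm (complex_of_real (h M x) - T x))^2) < (e/2)^2"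
  using e unfolding tdense_def by (auto dest!: spec[of _ "(e/2)^2"])
 then obtain F c where F: "finite F" "T = trig F c" by (auto simp: trigs_def)
 note [measurable] = trigs_measurable[OF T(1)]
 obtain Bd where Bd: "\<And>x. norm (T x) <= Bd" using trigs_bounded[OF T(1)] by blast
 have iT: "tint T" by (rule integrable_torus_bounded[where C=Bd]) (use Bd in auto)
 let ?d = "\<lambda>x. norm (complex_of_real (h M x) - T x)"
 have db: "?d x <= real M + Bd" for x using norm_triangle_ineq4[of "complex_of_real (h M x)" "T x"] hb(1)[of M x] Bd[of x] by simp
 have i1: "tint ?d" using ih[of M] iT by auto
 have i2: "tint (\<lambda>x. (?d x)^2)"
  by (rule integrable_torus_bounded[where C="(real M + Bd)^2"]) (use db in \<open>auto intro!: power_mono\<close>)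
 have "\<bar>TI x. ?d x*1\<bar> <= sqrt (TI x. (?d x)^2) * sqrt (TI x. 1^2)"
  by (rule Cauchy_Schwarz_integral) (use i2 in auto)
 also have "\<dots> = sqrt (TI x. (?d x)^2)" by (simp add: torus.prob_space[simplified])
 also have "\<dots> < e/2" using T(2) e by (intro real_less_lsqrt) auto
 finally have d: "(TI x. ?d x) < e/2" by simp
 have i3: "tint (\<lambda>x. norm (complex_of_real (g x) - T x))" using g iT by auto
 have "(TI x. norm (complex_of_real (g x) - T x)) <= (TI x. \<bar>g x - h M x\<bar> + ?d x)"
 proof (rule integral_mono[OF i3])
  show "tint (\<lambda>x. \<bar>g x - h M x\<bar> + ?d x)" using g ih[of M] i1 by auto
  fix x
  show "norm (complex_of_real (g x) - T x) <= \<bar>g x - h M x\<bar> + ?d x"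
   using norm_triangle_ineq[of "complex_of_real (g x - h M x)" "complex_of_real (h M x) - T x"] by (simp del: of_real_diff) (simp add: of_real_diff)
 qed
 also have "\<dots> = (TI x. \<bar>g x - h M x\<bar>) + (TI x. ?d x)" using g ih[of M] i1 by (intro Bochner_Integration.integral_add) auto
 also have "\<dots> < e" using M d by linarith
 finally show ?thesis using that[OF F(1), of c] i3 unfolding F(2) by blast
qed

text \<open>Pairing with a trigonometric polynomial is a finite combination of Fourier coefficients.
  By density in \<open>L^1\<close> the rest of \<open>g\<close> is small in \<open>L^1\<close>, and
  the uniform bound \<open>D\<close> controls its pairing.\<close>

lemma bounded_fourier_weak_null:
 assumes f: "\<And>n. bdd D (f n)" and lim: "\<And>k. (\<lambda>n. fourier (f n) k) \<longlonglongrightarrow> 0"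
  and gm: "g \<in> bmeas" and g: "tint g"
 shows "(\<lambda>n. ip (f n) g) \<longlonglongrightarrow> 0"
proof (rule LIMSEQ_I)
 fix r :: real assume r: "0 < r"
 have D0: "0 <= D" by (rule bdd_nonneg[OF f])
 define e where "e = r/(2*(D + 1))"
 have e: "0 < e" using r D0 by (simp add: e_def)
 obtain F c where F: "finite F" and d: "(TI x. norm (complex_of_real (g x) - trig F c x)) < e"
  and di: "tint (\<lambda>x. norm (complex_of_real (g x) - trig F c x))"
  using trigs_L1_dense[OF gm g e] .
 have T: "trig F c \<in> trigs" using F by (auto simp: trigs_def)
 note [measurable] = trigs_measurable[OF T] bdd_meas[OF f] gm
 have cisi: "tint (\<lambda>x. complex_of_real (f n x)*cis (ph k x))" for n k
  by (rule Bochner_Integration.integrable_bound[OF L2f_integrable[OF bdd_L2f[OF f[of n]]]])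
   (auto simp: norm_mult ph_def intro!: borel_measurable_times)
 have "(TI x. complex_of_real (f n x)*trig F c x) = (\<Sum>k\<in>F. c k*fourier (f n) (- k))" for n
 proof -
  have "(TI x. complex_of_real (f n x)*trig F c x) = (TI x. (\<Sum>k\<in>F. c k*(complex_of_real (f n x)*cis (ph k x))))"
   by (intro tcong refl) (simp add: trig_def sum_distrib_left mult.left_commute)
  also have "\<dots> = (\<Sum>k\<in>F. c k*(TI x. complex_of_real (f n x)*cis (ph k x)))"
   using cisi by (subst Bochner_Integration.integral_sum) auto
  also have "\<dots> = (\<Sum>k\<in>F. c k*fourier (f n) (- k))"
   by (intro sum.cong refl arg_cong2[where f="(*)"]) (subst fourier_eq[OF bdd_meas[OF f]], intro tcong refl, simp add: ph_def algebra_simps)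
  finally show ?thesis .
 qed
 moreover have "(\<lambda>n. \<Sum>k\<in>F. c k*fourier (f n) (- k)) \<longlonglongrightarrow> (\<Sum>k\<in>F. c k*0)" by (intro tendsto_intros lim)
 ultimately have "(\<lambda>n. TI x. complex_of_real (f n x)*trig F c x) \<longlonglongrightarrow> 0" by simp
 from LIMSEQ_D[OF this, of "r/2"] r obtain n0 where n0: "\<And>n. n >= n0 ==> norm (TI x. complex_of_real (f n x)*trig F c x) < r/2" by auto
 show "\<exists>no. \<forall>n\<ge>no. norm (ip (f n) g - 0) < r"
 proof (intro exI allI impI)
  fix n assume n: "n0 <= n"
  have iT: "tint (\<lambda>x. complex_of_real (f n x)*trig F c x)"
  proof -
   obtain B where "\<And>x. norm (trig F c x) <= B" using trigs_bounded[OF T] by blast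
   thus ?thesis
    by (intro Bochner_Integration.integrable_bound[OF integrable_mult_right[OF integrable_norm[OF L2f_integrable[OF bdd_L2f[OF f[of n]]]], of B]])
     (auto simp: norm_mult abs_mult mult.commute[of B] intro!: mult_left_mono AE_I2 order_trans[OF _ abs_ge_self[of B]])
  qed
  have ig: "tint (\<lambda>x. f n x*g x)" by (rule ip_bdd_le(1)[OF f g])
  have "norm (complex_of_real (ip (f n) g) - (TI x. complex_of_real (f n x)*trig F c x))
   = norm (TI x. complex_of_real (f n x)*(complex_of_real (g x) - trig F c x))"
  proof -
   have c: "complex_of_real (ip (f n) g) = (TI x. complex_of_real (f n x)*complex_of_real (g x))"
    unfolding ip_def of_real_mult[symmetric] by (rule integral_complex_of_real[symmetric])
   have ci: "tint (\<lambda>x. complex_of_real (f n x)*complex_of_real (g x))"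
    unfolding of_real_mult[symmetric] using ig by (rule integrable_of_real)
   show ?thesis unfolding c right_diff_distrib Bochner_Integration.integral_diff[OF ci iT] ..
  qed
  also have "\<dots> <= (TI x. norm (complex_of_real (f n x)*(complex_of_real (g x) - trig F c x)))" by (rule integral_norm_bound)
  also have "\<dots> = ip (\<lambda>x. \<bar>f n x\<bar>) (\<lambda>x. norm (complex_of_real (g x) - trig F c x))" by (simp add: ip_def norm_mult)
  also have "\<dots> <= D*(TI x. \<bar>norm (complex_of_real (g x) - trig F c x)\<bar>)"
  proof -
   have "bdd D (\<lambda>x. \<bar>f n x\<bar>)" using f[of n] by (auto simp: bdd_def per_def)
   from ip_bdd_le(2)[OF this di] show ?thesis by linarith
  qed
  also have "\<dots> <= D*e" using d D0 by (intro mult_left_mono) auto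
  finally have a: "norm (complex_of_real (ip (f n) g) - (TI x. complex_of_real (f n x)*trig F c x)) <= D*e" .
  have "D*e <= r/2" using r D0 by (simp add: e_def field_simps)
  hence "norm (complex_of_real (ip (f n) g)) < r"
   using a n0[OF n] norm_triangle_sub[of "complex_of_real (ip (f n) g)" "TI x. complex_of_real (f n x)*trig F c x"] by linarith
  thus "norm (ip (f n) g - 0) < r" by simp
 qed
qed

text \<open>The parameter \<open>s\<close> is the fourth root of the mollification scale.\<close>
lemma tendsto_zero_log_trick:
 fixes y z :: "nat => real"
 assumes y: "\<And>n. 0 <= y n" and z: "z \<longlonglongrightarrow> 0" and F: "0 <= F"
  and le: "\<And>s n. 0 < s ==> s <= 1/2 ==> y n <= 2/s*z n + F * s"
 shows "y \<longlonglongrightarrow> 0"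
proof (rule LIMSEQ_I)
 fix r :: real assume r: "0 < r"
 define s where "s = min (1/2) (r/(2*(F + 1)))"
 have s: "0 < s" "s <= 1/2" "s <= r/(2*(F + 1))" proof -
  have "0 < r/(2*(F + 1))" using r F by simp
  thus "0 < s" unfolding s_def min_less_iff_conj by simp
  show "s <= 1/2" "s <= r/(2*(F + 1))" unfolding s_def by (rule min.cobounded1 min.cobounded2)+
 qed
 have "F * s <= F*(r/(2*(F + 1)))" using s F by (intro mult_left_mono) auto
 also have "\<dots> <= r/2" using r F by (simp add: field_simps)
 finally have Fs: "F * s <= r/2" .
 have "(\<lambda>n. 2/s*z n) \<longlonglongrightarrow> 2/s*0" by (intro tendsto_intros z)
 hence "(\<lambda>n. 2/s*z n) \<longlonglongrightarrow> 0" by simp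
 from LIMSEQ_D[OF this, of "r/2"] r obtain n0 where n0: "\<And>n. n >= n0 ==> norm (2/s*z n - 0) < r/2" by auto
 show "\<exists>no. \<forall>n\<ge>no. norm (y n - 0) < r"
 proof (intro exI allI impI)
  fix n assume "n0 <= n"
  from n0[OF this] have "2/s*z n < r/2" unfolding diff_zero real_norm_def by linarith
  hence "y n < r" using le[OF s(1,2), of n] Fs by linarith
  thus "norm (y n - 0) < r" using y[of n] by simp
 qed
qed

text \<open>With mollification scale \<open>s^4\<close> the logarithm is \<open>4*ln (1/s)\<close>,
  and \<open>q*d <= 1/16\<close> brings the whole exponent below \<open>1/4 + ln (1/s)\<close>. The
  Gronwall factor is therefore a single inverse power of \<open>s\<close>, weaker than the gain
  \<open>sqrt (s^4) = s^2\<close>.\<close>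

lemma exp_log_step:
 fixes s q d :: real
 assumes s: "0 < s" "s <= 1/2" and q: "0 <= q" and d: "0 <= d" "d <= 1/(16*(q + 1))"
 shows "exp (4*(q*(1 + ln (1/s^4)))*d) <= 2/s"
proof -
 have l: "ln (1/s^4) = 4*ln (1/s)" using s by (simp add: ln_div ln_realpow)
 have l0: "0 <= ln (1/s)" using s by simp
 have "q*d <= q*(1/(16*(q + 1)))" using d q by (intro mult_left_mono)
 also have "\<dots> <= 1/16" using q by (simp add: field_simps)
 finally have qd: "q*d <= 1/16" .
 have "4*(q*(1 + ln (1/s^4)))*d = (q*d)*(4*(1 + 4*ln (1/s)))" unfolding l by (simp add: algebra_simps)
 also have "\<dots> <= 1/16*(4*(1 + 4*ln (1/s)))" using qd l0 by (intro mult_right_mono) auto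
 also have "\<dots> = 1/4 + ln (1/s)" by (simp add: field_simps)
 finally have "exp (4*(q*(1 + ln (1/s^4)))*d) <= exp (1/4 + ln (1/s))" by simp
 also have "\<dots> = exp (1/4)*(1/s)" using s by (simp add: exp_add)
 also have "\<dots> <= 2*(1/s)"
 proof (rule mult_right_mono)
  have "exp (1/4 :: real) <= 1 + 1/4 + (1/4)^2" by (rule exp_bound) auto
  thus "exp (1/4 :: real) <= 2" by (simp add: power2_eq_square)
 qed (use s in auto)
 finally show ?thesis by simp
qed

section \<open>Propagation of convergence along a sequence of solutions\<close>

context
 fixes \<gamma> t0 X X0 N \<xi> u \<xi>0 u0 C T
 assumes S: "\<And>n::nat. sol \<gamma> t0 (X n) N (\<xi> n) (u n)" and S0: "sol \<gamma> t0 X0 N \<xi>0 u0" and gam: "0 <= \<gamma>"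
  and b: "\<And>n t. t \<in> {t0..T} ==> bdd C (\<xi> n t)" and b0: "\<And>t. t \<in> {t0..T} ==> bdd C (\<xi>0 t)"
  and lim: "\<And>g G. C1per g G ==> (\<lambda>n. ip (X n) g) \<longlonglongrightarrow> ip X0 g"
begin

private definition "\<zeta> n t x = \<xi> n t x - \<xi>0 t x"
private definition "dv n t x = u n t x - u0 t x"
private definition "dy n t = (nsq2 (dv n t))"

private lemma BSdv: "t \<in> {t0..T} ==> biot_savart (\<zeta> n t) (dv n t)"
 unfolding \<zeta>_def[abs_def] dv_def[abs_def] using sol_BS[OF S] sol_BS[OF S0]
 by (intro biot_savart_diff bdd_L2f[OF b] bdd_L2f[OF b0]) auto

private lemma bdw: "t \<in> {t0..T} ==> bdd (2 * C) (\<zeta> n t)"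
 unfolding \<zeta>_def[abs_def] using bdd_diff[OF b b0] by simp

private lemma init_lim: assumes T: "t0 <= T" and g: "C1per g G" shows "(\<lambda>n. ip (\<zeta> n t0) g) \<longlonglongrightarrow> 0"
proof -
 have t: "t0 \<in> {t0..T}" using T by simp
 have "ip (\<zeta> n t0) g = ip (X n) g - ip X0 g" for n
  unfolding \<zeta>_def[abs_def] ip_diff_left[OF bdd_L2f[OF b[OF t]] bdd_L2f[OF b0[OF t]] C1per_L2f(1)[OF g]]
  using sol_init[OF S g, of n] sol_init[OF S0 g] by linarith
 moreover have "(\<lambda>n. ip (X n) g - ip X0 g) \<longlonglongrightarrow> ip X0 g - ip X0 g" by (intro tendsto_intros lim[OF g])
 ultimately show ?thesis by simp
qed

private lemma y_init: assumes T: "t0 <= T" shows "(\<lambda>n. dy n t0) \<longlonglongrightarrow> 0"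
 unfolding dy_def
proof (rule biot_savart_compact)
 have t: "t0 \<in> {t0..T}" using T by simp
 show "biot_savart (\<zeta> n t0) (dv n t0)" "bdd (2 * C) (\<zeta> n t0)" for n by (rule BSdv[OF t] bdw[OF t])+
 fix k :: "int \<times> int"
 show "(\<lambda>n. fourier (\<zeta> n t0) k) \<longlonglongrightarrow> 0"
  unfolding fourier_ip[OF bdd_L2f[OF bdw[OF t]]]
  using tendsto_Complex[OF init_lim[OF T C1per_cos_ph] tendsto_minus[OF init_lim[OF T C1per_sin_ph]]] by (simp add: zero_complex.code[symmetric])
qed

private lemma mean_init: assumes T: "t0 <= T" shows "(\<lambda>n. mean (\<zeta> n t0)) \<longlonglongrightarrow> 0"
 using init_lim[OF T C1per_const[of 1]] by (simp add: ip_def mean_def)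

text \<open>The admissible step length depends only on the common vorticity bound \<open>C\<close>,
  so finitely many steps reach any time. The factor \<open>2/s\<close> times the mollification error
  \<open>2*E * s^2\<close> leaves \<open>4*E * s\<close>, which vanishes with \<open>s\<close> after
  the limit in \<open>n\<close>.\<close>

private lemma y_step:
 assumes a: "t0 <= a" "a <= t" "t <= T" and d: "t - a <= 1/(16*(256 * C/Zc + 1))" and ya: "(\<lambda>n. dy n a) \<longlonglongrightarrow> 0"
 shows "(\<lambda>n. dy n t) \<longlonglongrightarrow> 0"
proof (rule tendsto_zero_log_trick)
 have C0: "0 <= C" using bdd_nonneg[OF b0, of t] a by auto
 define E where "E = 4*(2 * C)*(2 * C)*(8 * C/Zc)"
 have E0: "0 <= E" using C0 Zc_pos by (simp add: E_def)
 have q0: "0 <= 256 * C/Zc" using C0 Zc_pos by simp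
 have d1: "t - a <= 1" using d q0 order_trans[OF d, of 1] by (simp add: divide_le_eq)
 show "0 <= dy n t" for n by (simp add: dy_def)
 have "(\<lambda>n. dy n a + 2*(2 * C*(2 * C)*\<bar>mean (\<zeta> n t0)\<bar>)) \<longlonglongrightarrow> 0 + 2*(2 * C*(2 * C)*\<bar>0\<bar>)"
  using a by (intro tendsto_intros ya mean_init) auto
 thus "(\<lambda>n. dy n a + 2*(2 * C*(2 * C)*\<bar>mean (\<zeta> n t0)\<bar>)) \<longlonglongrightarrow> 0" by simp
 show "0 <= 4*E" using E0 by simp
 fix s :: real and n assume s: "0 < s" "s <= 1/2"
 have s4: "0 < s^4" "s^4 <= 1/16" using s power_mono[of s "1/2" 4] by (auto simp: power_divide)
 have sq: "sqrt (s^4) = s^2" using s by (intro real_sqrt_unique) (auto simp: power_mult[symmetric])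
 define m where "m = 2 * C*(2 * C)*\<bar>mean (\<zeta> n t0)\<bar>"
 have m0: "0 <= m" using C0 by (simp add: m_def)
 have y0: "0 <= dy n a" by (simp add: dy_def)
 have "dy n t <= exp (4*(256 * C/Zc*(1 + ln (1/s^4)))*(t - a))*(dy n a + 2*(m + E * s^2)*(t - a))"
  using energy_estimate[OF S S0 gam b b0 a s4] unfolding dy_def dv_def \<zeta>_def[abs_def] E_def sq m_def .
 also have "\<dots> <= (2/s)*(dy n a + 2*(m + E * s^2)*1)"
  using exp_log_step[OF s q0 _ d] a d1 y0 m0 E0 s by (intro mult_mono add_left_mono mult_left_mono add_nonneg_nonneg mult_nonneg_nonneg) auto
 also have "\<dots> = 2/s*(dy n a + 2*m) + 4*E * s" using s by (simp add: field_simps power2_eq_square)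
 finally show "dy n t <= 2/s*(dy n a + 2*(2 * C*(2 * C)*\<bar>mean (\<zeta> n t0)\<bar>)) + 4*E * s" unfolding m_def .
qed

private lemma y_lim: assumes t: "t \<in> {t0..T}" shows "(\<lambda>n. dy n t) \<longlonglongrightarrow> 0"
proof -
 have C0: "0 <= C" using bdd_nonneg[OF b0, of t] t by auto
 define \<tau> where "\<tau> = 1/(16*(256 * C/Zc + 1))"
 have "0 <= 256 * C/Zc" using C0 Zc_pos by simp
 hence tau: "0 < \<tau>" by (simp add: \<tau>_def)
 have T: "t0 <= T" using t by auto
 have "\<forall>t\<in>{t0..T}. t <= t0 + real j*\<tau> \<longrightarrow> (\<lambda>n. dy n t) \<longlonglongrightarrow> 0" for j
 proof (induction j)
  case 0
  thus ?case using y_init[OF T] by auto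
 next
  case (Suc j)
  show ?case
  proof (intro ballI impI)
   fix t assume t: "t \<in> {t0..T}" "t <= t0 + real (Suc j)*\<tau>"
   show "(\<lambda>n. dy n t) \<longlonglongrightarrow> 0"
   proof (cases "t <= t0 + real j*\<tau>")
    case True thus ?thesis using Suc t by auto
   next
    case False
    define a where "a = t0 + real j*\<tau>"
    have a: "t0 <= a" "a <= t" "t <= T" using False t tau by (auto simp: a_def)
    have "t - a <= \<tau>" using t by (simp add: a_def algebra_simps)
    thus ?thesis using y_step[OF a, folded \<tau>_def] Suc a by (auto simp: a_def)
   qed
  qed
 qed
 moreover obtain j :: nat where "(t - t0)/\<tau> <= real j" using real_arch_simple by blast
 moreover from this have "t <= t0 + real j*\<tau>" using tau by (simp add: field_simps)
 ultimately show ?thesis using t by blast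
qed

text \<open>A non-zero mode of the vorticity is a fixed multiple of the same mode of the velocity,
  which converges in \<open>L^2\<close>. The zero mode is the mean, invisible to the velocity, and
  is controlled by \<open>mean_decay\<close>.\<close>

lemma sol_weak_continuity:
 assumes t: "t \<in> {t0..T}" and gm: "g \<in> bmeas" and g: "tint g"
 shows "(\<lambda>n. ip (\<xi> n t) g) \<longlonglongrightarrow> ip (\<xi>0 t) g"
proof -
 have T: "t0 <= T" using t by auto
 note L = bdd_L2f[OF bdw[OF t]]
 have f0: "(\<lambda>n. fourier (\<zeta> n t) k) \<longlonglongrightarrow> 0" for k
 proof (cases "k = 0")
  case True
  have "fourier (\<zeta> n t) k = of_real (mean (\<zeta> n t))" for n
   unfolding True fourier_ip[OF L] by (simp add: ph_def ip_def mean_def complex_of_real_def)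
  moreover have "(\<lambda>n. mean (\<zeta> n t)) \<longlonglongrightarrow> 0"
  proof (rule Lim_null_comparison)
   show "\<forall>\<^sub>F n in sequentially. norm (mean (\<zeta> n t)) <= \<bar>mean (\<zeta> n t0)\<bar>"
    using mean_decay[OF S S0 gam b b0 t] unfolding \<zeta>_def[abs_def] by simp
   show "(\<lambda>n. \<bar>mean (\<zeta> n t0)\<bar>) \<longlonglongrightarrow> 0" using tendsto_rabs[OF mean_init[OF T]] by simp
  qed
  ultimately show ?thesis using tendsto_of_real[where 'a=complex] by fastforce
 next
  case False
  define K :: real where "K = (of_int (fst k))^2 + (of_int (snd k))^2"
  have K: "K > 0" using sq_k_ge_1[OF False] unfolding K_def by linarith
  have le: "(norm (fourier (\<zeta> n t) k))^2 <= 4*pi^2*K*dy n t" for n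
  proof -
   note Lv = bs_L2f[OF BSdv[OF t] L]
   have "(norm (fourier (\<zeta> n t) k))^2 = 4*pi^2*K*((fr2 (dv n t) k))"
    using bs_fourier_norm[OF BSdv[OF t] L, of k] False unfolding K_def by simp
   also have "\<dots> <= 4*pi^2*K*dy n t"
    using bessel[OF Lv[of n 1], of "{k}"] bessel[OF Lv[of n 2], of "{k}"] K unfolding dy_def by (intro mult_left_mono add_mono) auto
   finally show ?thesis .
  qed
  have "(\<lambda>n. sqrt (4*pi^2*K*dy n t)) \<longlonglongrightarrow> sqrt (4*pi^2*K*0)" by (intro tendsto_intros y_lim[OF t])
  hence "(\<lambda>n. sqrt (4*pi^2*K*dy n t)) \<longlonglongrightarrow> 0" by simp
  thus ?thesis by (rule Lim_null_comparison[rotated]) (use le in \<open>auto intro!: always_eventually real_le_rsqrt\<close>)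
 qed
 have "(\<lambda>n. ip (\<zeta> n t) g) \<longlonglongrightarrow> 0" by (rule bounded_fourier_weak_null[OF bdw[OF t] f0 gm g])
 moreover have "ip (\<zeta> n t) g = ip (\<xi> n t) g - ip (\<xi>0 t) g" for n
  using ip_bdd_le(1)[OF b[OF t] g] ip_bdd_le(1)[OF b0[OF t] g] unfolding ip_def \<zeta>_def left_diff_distrib by simp
 ultimately show ?thesis by (simp add: LIM_zero_iff)
qed

end

section \<open>Uniform boundedness\<close>

text \<open>A substitute for the essential supremum norm, which is not introduced: the last bound in
  a geometric sequence of ratio 3/4 exceeds the norm by a factor of at most 4/3.\<close>

lemma bdd_almost_sharp:
 assumes f: "bdd C' f" and n: "\<not> bdd D f" and D: "0 < D"
 obtains C where "bdd C f" "\<not> bdd (3/4 * C) f" "D <= C"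
proof -
 define P where "P j \<longleftrightarrow> \<not> bdd (C'*(3/4)^j) f" for j :: nat
 have C0: "0 <= C'" by (rule bdd_nonneg[OF f])
 have "\<exists>j. P j"
 proof -
  obtain j where j: "(3/4 :: real)^j < D/(C' + 1)" using real_arch_pow_inv[of "D/(C' + 1)" "3/4"] D C0 by auto
  have "C'*(3/4)^j <= (C' + 1)*(3/4)^j" by (intro mult_right_mono) auto
  also have "\<dots> <= D" using j C0 by (simp add: pos_less_divide_eq mult.commute)
  finally show ?thesis using n bdd_mono unfolding P_def by blast
 qed
 define j where "j = (LEAST j. P j)"
 have Pj: "P j" unfolding j_def by (rule LeastI_ex) fact
 have "j \<noteq> 0"
 proof
  assume "j = 0" thus False using Pj f by (simp add: P_def)
 qed
 then obtain i where i: "j = Suc i" by (cases j) auto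
 have "\<not> P i" using not_less_Least[of i P] i unfolding j_def[symmetric] by simp
 hence b: "bdd (C'*(3/4)^i) f" by (simp add: P_def)
 moreover have "\<not> bdd (3/4*(C'*(3/4)^i)) f" using Pj by (simp add: P_def i mult_ac)
 moreover have "D <= C'*(3/4)^i" using n bdd_mono[OF b, of D] by linarith
 ultimately show ?thesis using that by blast
qed

text \<open>The normalised sign of \<open>f\<close> on the set where \<open>\<bar>f x\<bar>\<close>
  exceeds \<open>3/4 * C\<close>, which has positive measure because that smaller bound
  fails.\<close>

lemma bdd_norming_function:
 assumes f: "bdd C f" and n: "\<not> bdd (3/4 * C) f"
 obtains h where "h \<in> bmeas" "tint h" "(TI x. \<bar>h x\<bar>) = 1" "3/4 * C <= ip f h"
proof -
 note [measurable] = bdd_meas[OF f]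
 have C0: "0 <= C" by (rule bdd_nonneg[OF f])
 define A where "A = {x. 3/4 * C < \<bar>f x\<bar>}"
 have A[measurable]: "A \<in> sets borel" unfolding A_def by measurable
 define m where "m = measure torus A"
 have "m \<noteq> 0"
 proof
  assume "m = 0"
  hence "emeasure torus A = 0" by (simp add: m_def torus.emeasure_eq_measure)
  hence "AE x in torus. x \<notin> A" by (intro AE_not_in) (auto simp: null_sets_def)
  hence "AE x in torus. \<bar>f x\<bar> <= 3/4 * C" by eventually_elim (auto simp: A_def)
  thus False using n f by (simp add: bdd_def)
 qed
 hence m: "0 < m" by (simp add: m_def zero_less_measure_iff)
 have iA: "tint (\<lambda>x. indicator A x :: real)" "(TI x. indicator A x) = m" by (auto simp: m_def torus.emeasure_eq_measure intro!: integrable_real_indicator)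
 define h where "h x = sgn (f x)*(indicator A x/m)" for x
 have [measurable]: "h \<in> bmeas" unfolding h_def[abs_def] sgn_real_def by measurable
 have ab: "\<bar>h x\<bar> = indicator A x/m" for x using C0 m by (auto simp: h_def A_def abs_mult sgn_real_def split: split_indicator)
 have hi: "tint h"
  by (rule Bochner_Integration.integrable_bound[OF integrable_divide_zero[OF iA(1), of m]]) (use m in \<open>auto simp: ab[simplified]\<close>)
 have i1: "(TI x. \<bar>h x\<bar>) = 1" unfolding ab using m iA by simp
 have "3/4 * C = (TI x. 3/4 * C*(indicator A x/m))" using m iA by simp
 also have "\<dots> <= ip f h" unfolding ip_def
 proof (rule integral_mono)
  show "tint (\<lambda>x. 3/4 * C*(indicator A x/m))" using iA by auto
  show "tint (\<lambda>x. f x*h x)" by (rule ip_bdd_le(1)[OF f hi])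
  fix x
  have "f x*h x = \<bar>f x\<bar>*(indicator A x/m)" by (simp add: h_def sgn_real_def)
  moreover have "3/4 * C*(indicator A x/m) <= \<bar>f x\<bar>*(indicator A x/m)"
  proof (cases "x \<in> A")
   case True thus ?thesis using m by (intro mult_right_mono) (auto simp: A_def)
  qed simp
  ultimately show "3/4 * C*(indicator A x/m) <= f x*h x" by simp
 qed
 finally have "3/4 * C <= ip f h" .
 thus ?thesis using that[of h] hi i1 by auto
qed

text \<open>Tonelli turns absolute summability in \<open>L^1\<close> into absolute convergence
  almost everywhere. Boundedness of \<open>F\<close> then permits termwise pairing.\<close>

lemma ip_gliding_sums:
 assumes F: "bdd C F" and dm: "\<And>i. d i \<in> bmeas" and d: "\<And>i::nat. tint (d i)" and s: "summable (\<lambda>i. TI x. \<bar>d i x\<bar>)"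
 shows "(\<lambda>i. ip F (d i)) sums ip F (\<lambda>x. \<Sum>i. d i x)" "tint (\<lambda>x. \<Sum>i. d i x)"
proof -
 note [measurable] = bdd_meas[OF F] dm
 have "(\<integral>\<^sup>+x. (\<Sum>i. ennreal \<bar>d i x\<bar>) \<partial>torus) = (\<Sum>i. \<integral>\<^sup>+x. ennreal \<bar>d i x\<bar> \<partial>torus)"
  by (rule nn_integral_suminf) auto
 also have "\<dots> = (\<Sum>i. ennreal (TI x. \<bar>d i x\<bar>))" using d by (intro suminf_cong nn_integral_eq_integral) auto
 also have "\<dots> < \<infinity>" using s by (simp add: suminf_ennreal_eq[OF _ summable_sums] less_top[symmetric])
 finally have "(\<integral>\<^sup>+x. (\<Sum>i. ennreal \<bar>d i x\<bar>) \<partial>torus) \<noteq> \<infinity>" by simp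
 hence "AE x in torus. (\<Sum>i. ennreal \<bar>d i x\<bar>) \<noteq> \<infinity>" by (intro nn_integral_noteq_infinite) auto
 hence AEs: "AE x in torus. summable (\<lambda>i. norm (d i x))"
  by eventually_elim (auto intro: summable_suminf_not_top)
 show "tint (\<lambda>x. \<Sum>i. d i x)" by (rule integrable_suminf[OF d AEs]) (use s in simp)
 have "(\<lambda>i. TI x. F x*d i x) sums (TI x. (\<Sum>i. F x*d i x))"
 proof (rule sums_integral)
  show "tint (\<lambda>x. F x*d i x)" for i by (rule ip_bdd_le(1)[OF F d])
  show "AE x in torus. summable (\<lambda>i. norm (F x*d i x))" using AEs by eventually_elim (simp add: abs_mult summable_mult)
  have C0: "0 <= C" by (rule bdd_nonneg[OF F])
  have Fa: "bdd C (\<lambda>x. \<bar>F x\<bar>)" using F by (auto simp: bdd_def per_def)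
  have "(TI x. norm (F x*d i x)) <= C*(TI x. \<bar>d i x\<bar>)" for i
   using ip_bdd_le(2)[OF Fa integrable_abs[OF d[of i]]] by (simp add: ip_def abs_mult)
  thus "summable (\<lambda>i. TI x. norm (F x*d i x))"
   by (intro summable_comparison_test'[OF summable_mult[OF s, of C], of 0]) auto
 qed
 moreover have "(TI x. (\<Sum>i. F x*d i x)) = ip F (\<lambda>x. \<Sum>i. d i x)" unfolding ip_def
 proof (rule integral_cong_AE)
  show "AE x in torus. (\<Sum>i. F x*d i x) = F x*(\<Sum>i. d i x)"
   using AEs by eventually_elim (rule suminf_mult[OF summable_norm_cancel])
 qed auto
 ultimately show "(\<lambda>i. ip F (d i)) sums ip F (\<lambda>x. \<Sum>i. d i x)" by (simp add: ip_def)
qed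

text \<open>A gliding hump argument: the signs in \<open>\<Sum>n. \<plusminus> 3\<^sup>-\<^sup>n h n\<close> are chosen so that no cancellation with the earlier terms occurs.\<close>
lemma weak_star_bounded:
 fixes f :: "nat => real^2 => real"
 assumes f: "\<And>n. \<exists>C. bdd C (f n)"
  and B: "\<And>g. g \<in> bmeas ==> tint g ==> \<exists>B. \<forall>n. \<bar>ip (f n) g\<bar> <= B"
 obtains A where "\<And>n. bdd A (f n)"
proof (rule ccontr)
 assume neg: "\<not> thesis"
 have nb: "\<exists>i. \<not> bdd D (f i)" for D using neg that by blast
 have "\<exists>i C. bdd C (f i) \<and> \<not> bdd (3/4 * C) (f i) \<and> 4^n <= C" for n :: nat
 proof -
  obtain i where "\<not> bdd (4^n) (f i)" using nb by blast
  thus ?thesis using f[of i] bdd_almost_sharp[of _ "f i" "4^n"] by (metis zero_less_power zero_less_numeral)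
 qed
 then obtain \<phi> C where C: "\<And>n. bdd (C n) (f (\<phi> n))" "\<And>n. \<not> bdd (3/4 * C n) (f (\<phi> n))" "\<And>n. 4^n <= C n" by metis
 define F where "F n = f (\<phi> n)" for n
 have "\<exists>h. h \<in> bmeas \<and> tint h \<and> (TI x. \<bar>h x\<bar>) = 1 \<and> 3/4 * C n <= ip (F n) h" for n
  using bdd_norming_function[OF C(1,2)[of n]] unfolding F_def by metis
 then obtain h where h: "\<And>n. h n \<in> bmeas" "\<And>n. tint (h n)" "\<And>n. (TI x. \<bar>h n x\<bar>) = 1" "\<And>n. 3/4 * C n <= ip (F n) (h n)" by metis
 \<comment> \<open>Partial sums built recursively, since the sign of each new term is decided by the
   pairing of \<open>F n\<close> with the sum of the earlier ones.\<close>
 define S where "S = rec_nat (\<lambda>x. 0) (\<lambda>n p x. p x + (if 0 <= ip (F n) p then 1 else -1)*(1/3)^n*h n x)"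
 define s :: "nat => real" where "s n = (if 0 <= ip (F n) (S n) then 1 else -1)*(1/3)^n" for n
 define d where "d n x = s n*h n x" for n x
 have S: "S n x = (\<Sum>m<n. d m x)" for n x by (induction n) (auto simp: S_def d_def s_def)
 have dm: "d n \<in> bmeas" for n unfolding d_def[abs_def] using h(1)[of n] by measurable
 have di: "tint (d n)" for n unfolding d_def[abs_def] using h(2)[of n] by auto
 have dn: "(TI x. \<bar>d n x\<bar>) = (1/3)^n" for n using h(3)[of n] by (simp add: d_def s_def abs_mult)
 have ds: "summable (\<lambda>i. TI x. \<bar>d i x\<bar>)" unfolding dn by (rule summable_geometric) simp
 define g where "g x = (\<Sum>i. d i x)" for x
 have Fb: "bdd (C n) (F n)" for n using C(1) by (simp add: F_def)
 have gs: "(\<lambda>i. ip (F n) (d i)) sums ip (F n) g" for n unfolding g_def[abs_def] by (rule ip_gliding_sums(1)[OF Fb dm di ds])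
 have gi: "tint g" unfolding g_def[abs_def] by (rule ip_gliding_sums(2)[OF Fb dm di ds])
 have gm: "g \<in> bmeas" unfolding g_def[abs_def] using dm by measurable
 obtain B where B: "\<And>n. \<bar>ip (f n) g\<bar> <= B" using B[OF gm gi] by blast
 have fin: "1/4*(4/3)^n <= B" for n
 proof -
  have C0: "0 <= C n" by (rule bdd_nonneg[OF Fb])
  define q where "q i = ip (F n) (d i)" for i
  have qs: "q sums ip (F n) g" using gs by (simp add: q_def[abs_def])
  have qb: "\<bar>q i\<bar> <= C n*(1/3)^i" for i using ip_bdd_le(2)[OF Fb di, of n i] by (simp add: q_def dn)
  have "ip (F n) (S n) = (\<Sum>i<n. q i)"
   unfolding q_def ip_def S[abs_def] sum_distrib_left using ip_bdd_le(1)[OF Fb di] by (intro Bochner_Integration.integral_sum) auto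
  moreover have "q n = s n*ip (F n) (h n)" unfolding q_def ip_def d_def by (simp add: mult.left_commute)
  moreover have "0 <= ip (F n) (h n)" using h(4)[of n] C0 by linarith
  moreover have "\<bar>a + (if 0 <= a then 1 else -1)*p*b\<bar> >= p*b" if "0 <= p*b" for a b p :: real
   using that by (auto simp: abs_if)
  from this[of "(1/3)^n" "ip (F n) (h n)" "ip (F n) (S n)"]
  have "0 <= ip (F n) (h n) ==> (1/3)^n*ip (F n) (h n) <= \<bar>ip (F n) (S n) + s n*ip (F n) (h n)\<bar>" by (simp add: s_def)
  ultimately have "(1/3)^n*ip (F n) (h n) <= \<bar>\<Sum>i<Suc n. q i\<bar>" by simp
  moreover have "(1/3)^n*(3/4 * C n) <= (1/3)^n*ip (F n) (h n)" using h(4)[of n] by (intro mult_left_mono) auto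
  ultimately have lo: "(1/3)^n*(3/4 * C n) <= \<bar>\<Sum>i<Suc n. q i\<bar>" by linarith
  have geo: "(\<lambda>i. C n*(1/3)^(Suc n)*(1/3)^i) sums (C n*(1/3)^(Suc n)*(1/(1 - 1/3)))"
   by (intro sums_mult geometric_sums) simp
  have tl: "\<bar>ip (F n) g - (\<Sum>i<Suc n. q i)\<bar> <= C n*(1/3)^(Suc n)*(1/(1 - 1/3))"
  proof -
   have "(\<lambda>i. q (i + Suc n)) sums (ip (F n) g - (\<Sum>i<Suc n. q i))" by (rule sums_split_initial_segment[OF qs])
   hence e: "ip (F n) g - (\<Sum>i<Suc n. q i) = (\<Sum>i. q (i + Suc n))" by (rule sums_unique)
   have le: "norm (q (i + Suc n)) <= C n*(1/3)^(Suc n)*(1/3)^i" for i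
    using qb[of "i + Suc n"] by (simp add: power_add mult_ac)
   show ?thesis unfolding e real_norm_def[symmetric]
    using norm_suminf_le[OF le sums_summable[OF geo]] unfolding sums_unique[OF geo, symmetric] .
  qed
  \<comment> \<open>The geometric tail with ratio 1/3 amounts to one half of
    \<open>(1/3)^n * C n\<close>, less than the 3/4 guaranteed by the main term. The remaining
    quarter grows like \<open>(4/3)^n\<close> because \<open>4^n <= C n\<close>.\<close>
  have "C n*(1/3)^(Suc n)*(1/(1 - 1/3)) = (1/3)^n*(1/2 * C n)" by simp
  hence "(1/3)^n*(3/4 * C n) - (1/3)^n*(1/2 * C n) <= \<bar>ip (F n) g\<bar>" using lo tl by linarith
  hence "(1/3)^n*(1/4 * C n) <= B" using B[of "\<phi> n"] unfolding F_def by (simp add: algebra_simps)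
  moreover have "(1/3)^n*(1/4*4^n) <= (1/3)^n*(1/4 * C n)" using C(3)[of n] by (intro mult_left_mono) auto
  moreover have "(1/3)^n*(1/4*4^n) = 1/4*(4/3 :: real)^n" by (simp add: power_divide)
  ultimately show ?thesis by linarith
 qed
 obtain n where "4*B < (4/3)^n" using real_arch_pow[of "4/3" "4*B"] by auto
 thus False using fin[of n] by linarith
qed

section \<open>Suprema of Gaussian processes\<close>

text \<open>A point of level \<open>m\<close> differs from the point \<open>j div 2\<close> of the
  previous level by at most one increment. Only level 0 needs up to \<open>L\<close> increments; the
  factor \<open>L\<close> is allowed on every level for uniformity.\<close>

lemma dyadic_chaining:
 fixes x :: "real => real"
 assumes L: "1 <= L" and g: "\<And>l j. j < L*2^l ==> \<bar>x (t0 + real (Suc j)/2^l) - x (t0 + real j/2^l)\<bar> <= g l"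
  and j: "j <= L*2^m"
 shows "\<bar>x (t0 + real j/2^m) - x t0\<bar> <= real L*(\<Sum>l\<le>m. g l)"
 using j
proof (induction m arbitrary: j)
 case 0
 have g0: "0 <= g 0" using g[of 0 0] L by simp
 have "j <= L ==> \<bar>x (t0 + real j) - x t0\<bar> <= real j*g 0" for j
 proof (induction j)
  case (Suc j)
  have "\<bar>x (t0 + real (Suc j)) - x (t0 + real j)\<bar> <= g 0" using g[of j 0] Suc.prems by simp
  moreover have "\<bar>x (t0 + real j) - x t0\<bar> <= real j*g 0" using Suc by simp
  moreover have "real (Suc j)*g 0 = real j*g 0 + g 0" by (simp add: algebra_simps)
  ultimately show ?case by linarith
 qed simp
 from this[of j] 0 have "\<bar>x (t0 + real j) - x t0\<bar> <= real j*g 0" by simp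
 also have "\<dots> <= real L*g 0" using 0 g0 by (intro mult_right_mono) auto
 finally show ?case by simp
next
 case (Suc m)
 have gm: "0 <= g (Suc m)"
 proof -
  have "0 < L*2^Suc m" using L by simp
  from order_trans[OF abs_ge_zero g[OF this]] show ?thesis .
 qed
 have "1*g (Suc m) <= real L*g (Suc m)" using L gm by (intro mult_right_mono) auto
 hence gL: "g (Suc m) <= real L*g (Suc m)" by simp
 define i where "i = j div 2"
 have i: "i <= L*2^m" using Suc.prems by (simp add: i_def)
 note IH = Suc.IH[OF i]
 have e: "real (2*i)/2^Suc m = real i/2^m" by simp
 have sm: "real L*(\<Sum>l\<le>Suc m. g l) = real L*(\<Sum>l\<le>m. g l) + real L*g (Suc m)" by (simp add: algebra_simps)
 show ?case
 proof (cases "even j")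
  case True
  hence "j = 2*i" by (simp add: i_def)
  hence "\<bar>x (t0 + real j/2^Suc m) - x t0\<bar> <= real L*(\<Sum>l\<le>m. g l)" using IH e by metis
  thus ?thesis unfolding sm using gL gm by linarith
 next
  case False
  hence j: "j = Suc (2*i)" by (simp add: i_def)
  have "\<bar>x (t0 + real (Suc (2*i))/2^Suc m) - x (t0 + real (2*i)/2^Suc m)\<bar> <= g (Suc m)"
   by (rule g) (use Suc.prems j in simp)
  thus ?thesis unfolding sm using IH gL unfolding j e by linarith
 qed
qed

section \<open>Moments of sums of independent Wiener processes\<close>

context
 fixes M :: "'a measure" and \<beta> :: "nat => real => 'a => real"
 assumes P: "prob_space M" and W: "indep_wiener_family M \<beta>"
begin

interpretation prob_space M by (rule P)

lemma wiener_measurable: "\<beta> i t \<in> borel_measurable M"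
 using W by (simp add: indep_wiener_family_def two_sided_wiener_def)

lemma wiener_normal: "s < t ==> distributed M lborel (\<lambda>om. \<beta> i t om - \<beta> i s om) (normal_density 0 (sqrt (t - s)))"
 using W by (simp add: indep_wiener_family_def two_sided_wiener_def)

text \<open>The assumption makes the sigma-algebras generated by whole paths independent; an
  increment of the \<open>i\<close>-th process is measurable with respect to the \<open>i\<close>-th
  of them.\<close>

lemma wiener_indep_increments: "indep_vars (\<lambda>_. borel) (\<lambda>i om. \<beta> i t om - \<beta> i s om) I"
 unfolding indep_vars_def2
proof (intro conjI ballI)
 show "random_variable borel (\<lambda>om. \<beta> i t om - \<beta> i s om)" for i using wiener_measurable[of i] by measurable
 define A where "A i = {\<beta> i t -` A \<inter> space M | t A. A \<in> sets borel}" for i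
 have "indep_sets (\<lambda>i. sigma_sets (space M) (A i)) UNIV" using W by (simp add: indep_wiener_family_def A_def)
 hence "indep_sets (\<lambda>i. sigma_sets (space M) (A i)) I" by (rule indep_sets_mono_index[rotated]) auto
 thus "indep_sets (\<lambda>i. {(\<lambda>om. \<beta> i t om - \<beta> i s om) -` B \<inter> space M | B. B \<in> sets borel}) I"
 proof (rule indep_sets_mono_sets)
  fix i
  define N where "N = sigma (space M) (A i)"
  have Ap: "A i \<subseteq> Pow (space M)" by (auto simp: A_def)
  have sN: "space N = space M" "sets N = sigma_sets (space M) (A i)" using Ap by (simp_all add: N_def)
  have "\<beta> i t \<in> borel_measurable N" for t
   by (rule measurableI) (auto simp: sN A_def intro!: sigma_sets.Basic)
  hence m: "(\<lambda>om. \<beta> i t om - \<beta> i s om) \<in> borel_measurable N" by measurable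
  show "{(\<lambda>om. \<beta> i t om - \<beta> i s om) -` B \<inter> space M | B. B \<in> sets borel} \<subseteq> sigma_sets (space M) (A i)"
  proof clarify
   fix B :: "real set" assume "B \<in> sets borel"
   from measurable_sets[OF m this] show "(\<lambda>om. \<beta> i t om - \<beta> i s om) -` B \<inter> space M \<in> sigma_sets (space M) (A i)" unfolding sN .
  qed
 qed
qed

text \<open>A finite combination of independent Gaussian increments is Gaussian, and a centred
  Gaussian has fourth moment three times its squared variance.\<close>

lemma wiener_sum_moment:
 assumes st: "s < t"
 shows "(\<integral>\<^sup>+om. ennreal ((\<Sum>i<n. a i*(\<beta> i t om - \<beta> i s om))^4) \<partial>M) <= ennreal (3*(\<Sum>i<n. (a i)^2)^2*(t - s)^2)"
proof -
 \<comment> \<open>Zero coefficients are dropped because a normal density requires a positive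
   deviation.\<close>
 define I where "I = {i \<in> {..<n}. a i \<noteq> 0}"
 have fI: "finite I" by (simp add: I_def)
 have e1: "(\<Sum>i<n. a i*(\<beta> i t om - \<beta> i s om)) = (\<Sum>i\<in>I. a i*(\<beta> i t om - \<beta> i s om))" for om
  by (rule sum.mono_neutral_right) (auto simp: I_def)
 have e2: "(\<Sum>i<n. (a i)^2) = (\<Sum>i\<in>I. (a i)^2)" by (rule sum.mono_neutral_right) (auto simp: I_def)
 show ?thesis
 proof (cases "I = {}")
  case True thus ?thesis unfolding e1 e2 by simp
 next
  case False
  let ?s = "sqrt (\<Sum>i\<in>I. (\<bar>a i\<bar> * sqrt (t - s))^2)"
  have "distributed M lborel (\<lambda>om. \<Sum>i\<in>I. a i*(\<beta> i t om - \<beta> i s om)) (normal_density (\<Sum>i\<in>I. 0) ?s)"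
  proof (rule sum_indep_normal[OF fI False])
   show "indep_vars (\<lambda>i. borel) (\<lambda>i om. a i*(\<beta> i t om - \<beta> i s om)) I"
    by (rule indep_vars_compose2[OF wiener_indep_increments]) simp
   fix i assume i: "i \<in> I"
   thus "0 < \<bar>a i\<bar> * sqrt (t - s)" using st by (simp add: I_def)
   show "distributed M lborel (\<lambda>om. a i*(\<beta> i t om - \<beta> i s om)) (normal_density 0 (\<bar>a i\<bar> * sqrt (t - s)))"
    using normal_density_affine[OF wiener_normal[OF st], of "a i" 0 i] i st by (simp add: I_def)
  qed
  hence d: "distributed M lborel (\<lambda>om. \<Sum>i\<in>I. a i*(\<beta> i t om - \<beta> i s om)) (normal_density 0 ?s)" by simp
  have s2: "?s^2 = (\<Sum>i<n. (a i)^2)*(t - s)"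
   using st by (simp add: sum_nonneg e2 power_mult_distrib sum_distrib_right)
  obtain i where i: "i \<in> I" using False by auto
  have "0 < (\<Sum>i\<in>I. (\<bar>a i\<bar> * sqrt (t - s))^2)" by (rule sum_pos2[OF fI i]) (use i st in \<open>auto simp: I_def\<close>)
  hence s0: "0 < ?s" by simp
  have "has_bochner_integral lborel (\<lambda>x. normal_density 0 r x*x^4) (3*(r^2)^2)" if "0 < r" for r
   using normal_moment_even[OF that, of 0 2] that by (simp add: fact_numeral power_divide)
  note hb = this[OF s0]
  have "(\<integral>\<^sup>+om. ennreal ((\<Sum>i\<in>I. a i*(\<beta> i t om - \<beta> i s om))^4) \<partial>M) = (\<integral>\<^sup>+x. ennreal (normal_density 0 ?s x)*ennreal (x^4) \<partial>lborel)"
   by (rule distributed_nn_integral[OF d, symmetric]) simp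
  also have "\<dots> = (\<integral>\<^sup>+x. ennreal (normal_density 0 ?s x*x^4) \<partial>lborel)" by (intro nn_integral_cong) (simp add: ennreal_mult')
  also have "\<dots> = ennreal (3*(?s^2)^2)"
   using hb unfolding has_bochner_integral_iff by (subst nn_integral_eq_integral) (auto intro!: mult_nonneg_nonneg)
  finally show ?thesis unfolding e1 s2 by (simp add: power_mult_distrib mult.assoc)
 qed
qed

lemma wiener_abs_bound: obtains K where "\<And>i. (\<integral>\<^sup>+om. ennreal \<bar>\<beta> i t om\<bar> \<partial>M) <= ennreal K"
proof -
 \<comment> \<open>A time before both \<open>t\<close> and 0. As the process vanishes at 0, its
   value at \<open>t\<close> is a difference of two forward increments from \<open>s\<close>,
   whatever the sign of \<open>t\<close>; this makes the bound uniform in \<open>i\<close>.\<close>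
 define s where "s = min t 0 - 1"
 have st: "s < t" "s < 0" by (auto simp: s_def)
 note [measurable] = wiener_measurable
 have one: "(\<integral>\<^sup>+om. ennreal \<bar>\<beta> i r om - \<beta> i s om\<bar> \<partial>M) <= ennreal (1 + 3*(r - s)^2)" if "s < r" for i r
 proof -
  have "(\<integral>\<^sup>+om. ennreal \<bar>\<beta> i r om - \<beta> i s om\<bar> \<partial>M) <= (\<integral>\<^sup>+om. 1 + ennreal ((\<beta> i r om - \<beta> i s om)^4) \<partial>M)"
  proof (rule nn_integral_mono)
   fix om
   have "\<bar>x\<bar> <= 1 + x^4" for x :: real
   proof (cases "\<bar>x\<bar> <= 1")
    case True thus ?thesis by (simp add: add_increasing2)
   next
    case False
    hence "\<bar>x\<bar>^1 <= \<bar>x\<bar>^4" by (intro power_increasing) auto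
    thus ?thesis by (simp add: power_even_abs)
   qed
   hence "ennreal \<bar>\<beta> i r om - \<beta> i s om\<bar> <= ennreal (1 + (\<beta> i r om - \<beta> i s om)^4)" by (rule ennreal_leI)
   thus "ennreal \<bar>\<beta> i r om - \<beta> i s om\<bar> <= 1 + ennreal ((\<beta> i r om - \<beta> i s om)^4)" by (simp add: ennreal_plus)
  qed
  also have "\<dots> = 1 + (\<integral>\<^sup>+om. ennreal ((\<beta> i r om - \<beta> i s om)^4) \<partial>M)"
   by (subst nn_integral_add) (auto simp: emeasure_space_1)
  also have "(\<integral>\<^sup>+om. ennreal ((\<beta> i r om - \<beta> i s om)^4) \<partial>M) <= ennreal (3*(r - s)^2)"
   using wiener_sum_moment[OF that, where n="Suc i" and a="\<lambda>j. if j = i then 1 else 0"]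
   by (simp add: if_distrib[of "\<lambda>z. z * _"] if_distrib[of "\<lambda>z. z^2"] sum.delta cong: if_cong)
  finally show ?thesis by (simp add: ennreal_plus add_left_mono)
 qed
 have "(\<integral>\<^sup>+om. ennreal \<bar>\<beta> i t om\<bar> \<partial>M) <= ennreal ((1 + 3*(t - s)^2) + (1 + 3*(0 - s)^2))" for i
 proof -
  have "AE om in M. \<beta> i 0 om = 0" using W by (simp add: indep_wiener_family_def two_sided_wiener_def)
  hence "(\<integral>\<^sup>+om. ennreal \<bar>\<beta> i t om\<bar> \<partial>M) <= (\<integral>\<^sup>+om. ennreal \<bar>\<beta> i t om - \<beta> i s om\<bar> + ennreal \<bar>\<beta> i 0 om - \<beta> i s om\<bar> \<partial>M)"
   by (intro nn_integral_mono_AE, eventually_elim) (auto simp: ennreal_plus[symmetric] simp del: ennreal_plus intro!: ennreal_leI)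
  also have "\<dots> = (\<integral>\<^sup>+om. ennreal \<bar>\<beta> i t om - \<beta> i s om\<bar> \<partial>M) + (\<integral>\<^sup>+om. ennreal \<bar>\<beta> i 0 om - \<beta> i s om\<bar> \<partial>M)"
   by (rule nn_integral_add) auto
  also have "\<dots> <= ennreal (1 + 3*(t - s)^2) + ennreal (1 + 3*(0 - s)^2)" by (intro add_mono one st)
  finally show ?thesis by (simp add: ennreal_plus[symmetric] del: ennreal_plus)
 qed
 thus ?thesis by (rule that)
qed

context
 fixes a :: "nat => real"
 assumes a: "summable (\<lambda>i. \<bar>a i\<bar>)"
begin

lemma wiener_series_summable: "AE om in M. summable (\<lambda>i. a i*\<beta> i t om)"
proof -
 obtain K where K: "\<And>i. (\<integral>\<^sup>+om. ennreal \<bar>\<beta> i t om\<bar> \<partial>M) <= ennreal K" using wiener_abs_bound[of t] by blast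
 note [measurable] = wiener_measurable
 have "(\<integral>\<^sup>+om. (\<Sum>i. ennreal \<bar>a i*\<beta> i t om\<bar>) \<partial>M) = (\<Sum>i. \<integral>\<^sup>+om. ennreal \<bar>a i*\<beta> i t om\<bar> \<partial>M)" by (rule nn_integral_suminf) auto
 also have "\<dots> <= (\<Sum>i. ennreal \<bar>a i\<bar>*ennreal K)"
  by (intro suminf_le) (auto simp: abs_mult ennreal_mult nn_integral_cmult intro!: mult_left_mono K)
 also have "\<dots> = (\<Sum>i. ennreal \<bar>a i\<bar>)*ennreal K" by simp
 also have "\<dots> < \<infinity>" using a by (simp add: suminf_ennreal_eq[OF _ summable_sums] ennreal_mult_eq_top_iff less_top[symmetric])
 finally have "AE om in M. (\<Sum>i. ennreal \<bar>a i*\<beta> i t om\<bar>) \<noteq> \<infinity>" by (intro nn_integral_noteq_infinite) auto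
 thus ?thesis
  by eventually_elim (rule summable_norm_cancel, auto intro: summable_suminf_not_top)
qed

text \<open>Fatou's lemma along the partial sums, which converge almost surely at both
  times.\<close>

lemma wiener_series_moment:
 assumes Q: "\<And>n. (\<Sum>i<n. (a i)^2) <= Q" and st: "s < t"
 shows "(\<integral>\<^sup>+om. ennreal (((\<Sum>i. a i*\<beta> i t om) - (\<Sum>i. a i*\<beta> i s om))^4) \<partial>M) <= ennreal (3*Q^2*(t - s)^2)"
proof -
 define f where "f n om = ennreal ((\<Sum>i<n. a i*(\<beta> i t om - \<beta> i s om))^4)" for n om
 note [measurable] = wiener_measurable
 have fm: "f n \<in> borel_measurable M" for n unfolding f_def[abs_def] by measurable
 have "AE om in M. ennreal (((\<Sum>i. a i*\<beta> i t om) - (\<Sum>i. a i*\<beta> i s om))^4) <= liminf (\<lambda>n. f n om)"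
  using wiener_series_summable[of t] wiener_series_summable[of s]
 proof eventually_elim
  case (elim om)
  have "(\<lambda>n. \<Sum>i<n. a i*\<beta> i t om - a i*\<beta> i s om) \<longlonglongrightarrow> (\<Sum>i. a i*\<beta> i t om) - (\<Sum>i. a i*\<beta> i s om)"
   using sums_diff[OF summable_sums[OF elim(1)] summable_sums[OF elim(2)]] by (simp add: sums_def)
  hence "(\<lambda>n. f n om) \<longlonglongrightarrow> ennreal (((\<Sum>i. a i*\<beta> i t om) - (\<Sum>i. a i*\<beta> i s om))^4)"
   unfolding f_def right_diff_distrib by (intro tendsto_intros)
  thus ?case by (simp add: lim_imp_Liminf)
 qed
 hence "(\<integral>\<^sup>+om. ennreal (((\<Sum>i. a i*\<beta> i t om) - (\<Sum>i. a i*\<beta> i s om))^4) \<partial>M) <= (\<integral>\<^sup>+om. liminf (\<lambda>n. f n om) \<partial>M)"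
  by (rule nn_integral_mono_AE)
 also have "\<dots> <= liminf (\<lambda>n. \<integral>\<^sup>+om. f n om \<partial>M)" by (rule nn_integral_liminf[OF fm])
 also have "\<dots> <= liminf (\<lambda>n::nat. ennreal (3*Q^2*(t - s)^2))"
 proof (intro Liminf_mono always_eventually allI)
  fix n
  have "(\<integral>\<^sup>+om. f n om \<partial>M) <= ennreal (3*(\<Sum>i<n. (a i)^2)^2*(t - s)^2)" unfolding f_def by (rule wiener_sum_moment[OF st])
  also have "\<dots> <= ennreal (3*Q^2*(t - s)^2)"
   by (intro ennreal_leI mult_right_mono mult_left_mono power_mono Q sum_nonneg) auto
  finally show "(\<integral>\<^sup>+om. f n om \<partial>M) <= ennreal (3*Q^2*(t - s)^2)" .
 qed
 finally show ?thesis by (simp add: Liminf_const)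
qed

text \<open>Chaining with \<open>\<bar>z\<bar> <= A + z\<^sup>4/A\<^sup>3\<close> at level \<open>m\<close>, where \<open>A = q (9/10)\<^sup>m\<close>; the ratio \<open>500/729\<close> is \<open>1/(2 (9/10)\<^sup>3)\<close>.\<close>
lemma wiener_series_sup:
 assumes Q: "\<And>n. (\<Sum>i<n. (a i)^2) <= q^2" and q: "0 < q" and L: "1 <= L"
 obtains S where "S \<in> borel_measurable M" "(\<integral>\<^sup>+om. S om \<partial>M) <= ennreal (q*(real L*(10 + 3*real L*(729/229))))"
  "\<And>om m j. j <= L*2^m ==> ennreal \<bar>(\<Sum>i. a i*\<beta> i (t0 + real j/2^m) om) - (\<Sum>i. a i*\<beta> i t0 om)\<bar> <= S om"
proof -
 note [measurable] = wiener_measurable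
 define X where "X t om = (\<Sum>i. a i*\<beta> i t om)" for t om
 have [measurable]: "X t \<in> borel_measurable M" for t unfolding X_def[abs_def] by measurable
 define A where "A m = q*(9/10)^m" for m :: nat
 have A0: "0 < A m" for m using q by (simp add: A_def)
 define \<Delta> where "\<Delta> m j om = X (t0 + real (Suc j)/2^m) om - X (t0 + real j/2^m) om" for m j om
 have [measurable]: "\<Delta> m j \<in> borel_measurable M" for m j unfolding \<Delta>_def[abs_def] by measurable
 define G where "G m om = A m + (\<Sum>j<L*2^m. (1/A m^3)*(\<Delta> m j om)^4)" for m om
 have [measurable]: "G m \<in> borel_measurable M" for m unfolding G_def[abs_def] by measurable
 have G0: "0 <= G m om" for m om unfolding G_def using A0[of m] by (intro add_nonneg_nonneg sum_nonneg mult_nonneg_nonneg) auto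
 have key: "\<bar>\<Delta> m j om\<bar> <= G m om" if "j < L*2^m" for m j om
 proof -
  have aux: "\<bar>z\<bar> <= A m + 1/A m^3*z^4" for z
  proof (cases "\<bar>z\<bar> <= A m")
   case True
   have "0 <= 1/A m^3*z^4" using A0[of m] by (intro mult_nonneg_nonneg) auto
   thus ?thesis using True by linarith
  next
   case False
   hence "A m^3*\<bar>z\<bar> <= \<bar>z\<bar>^3*\<bar>z\<bar>" using A0[of m] by (intro mult_right_mono power_mono) auto
   also have "\<dots> = z^4" by (simp add: power_even_abs flip: power_Suc2)
   finally have "\<bar>z\<bar> <= 1/A m^3*z^4" using A0[of m] by (simp add: pos_le_divide_eq mult.commute)
   thus ?thesis using A0[of m] by linarith
  qed
  have "1/A m^3*\<Delta> m j om^4 <= (\<Sum>j<L*2^m. (1/A m^3)*(\<Delta> m j om)^4)"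
   by (rule member_le_sum) (use that A0[of m] in \<open>auto intro!: mult_nonneg_nonneg\<close>)
  thus ?thesis using aux[of "\<Delta> m j om"] unfolding G_def by linarith
 qed
 define S where "S om = ennreal (real L)*(\<Sum>m. ennreal (G m om))" for om
 have Sm: "S \<in> borel_measurable M" unfolding S_def[abs_def] by measurable
 have mom: "(\<integral>\<^sup>+om. ennreal (\<Delta> m j om^4) \<partial>M) <= ennreal (3*(q^2)^2*(1/2^m)^2)" for m j
 proof -
  have "t0 + real j/2^m < t0 + real (Suc j)/2^m" by (simp add: divide_strict_right_mono)
  from wiener_series_moment[OF Q this] show ?thesis unfolding \<Delta>_def X_def by (simp add: diff_divide_distrib[symmetric])
 qed
 have Gi: "(\<integral>\<^sup>+om. ennreal (G m om) \<partial>M) <= ennreal (q*((9/10)^m + 3*real L*(500/729)^m))" for m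
 proof -
  have "(\<integral>\<^sup>+om. ennreal (G m om) \<partial>M) = (\<integral>\<^sup>+om. ennreal (A m) + (\<Sum>j<L*2^m. ennreal (1/A m^3)*ennreal (\<Delta> m j om^4)) \<partial>M)"
  proof (rule nn_integral_cong)
   fix om
   have "ennreal (\<Sum>j<L*2^m. (1/A m^3)*(\<Delta> m j om)^4) = (\<Sum>j<L*2^m. ennreal (1/A m^3*\<Delta> m j om^4))"
    using A0[of m] by (subst sum_ennreal) (auto intro!: mult_nonneg_nonneg)
   also have "\<dots> = (\<Sum>j<L*2^m. ennreal (1/A m^3)*ennreal (\<Delta> m j om^4))"
    using A0[of m] by (intro sum.cong refl ennreal_mult) auto
   finally show "ennreal (G m om) = ennreal (A m) + (\<Sum>j<L*2^m. ennreal (1/A m^3)*ennreal (\<Delta> m j om^4))"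
    unfolding G_def using A0[of m] by (subst ennreal_plus) (auto intro!: sum_nonneg mult_nonneg_nonneg)
  qed
  also have "\<dots> = ennreal (A m) + (\<Sum>j<L*2^m. ennreal (1/A m^3)*(\<integral>\<^sup>+om. ennreal (\<Delta> m j om^4) \<partial>M))"
   by (simp add: nn_integral_add nn_integral_sum nn_integral_cmult emeasure_space_1)
  also have "\<dots> <= ennreal (A m) + (\<Sum>j<L*2^m. ennreal (1/A m^3)*ennreal (3*(q^2)^2*(1/2^m)^2))"
   by (intro add_left_mono sum_mono mult_left_mono mom) auto
  also have "\<dots> = ennreal (A m) + (\<Sum>j<L*2^m. ennreal (1/A m^3*(3*(q^2)^2*(1/2^m)^2)))"
   using A0[of m] by (intro arg_cong2[where f="(+)"] sum.cong refl ennreal_mult[symmetric]) auto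
  also have "\<dots> = ennreal (A m + (\<Sum>j<L*2^m. 1/A m^3*(3*(q^2)^2*(1/2^m)^2)))"
   using A0[of m] by (subst sum_ennreal) (auto simp: ennreal_plus[symmetric] simp del: ennreal_plus)
  also have "A m + (\<Sum>j<L*2^m. 1/A m^3*(3*(q^2)^2*(1/2^m)^2)) = q*((9/10)^m + 3*real L*(500/729)^m)"
  proof -
   have "(1/(2*r^3))^m = 1/(2^m*(r^m)^3)" for r :: real
    by (simp add: power_divide power_mult_distrib power_mult[symmetric] mult.commute)
   from this[of "9/10"] have p: "(500/729 :: real)^m = 1/(2^m*((9/10)^m)^3)" by (simp only: power3_eq_cube) (simp del: power_mult_distrib)
   have aux: "real L*c*(1/(q*r)^3*(3*(q^2)^2*(1/c)^2)) = q*(3*real L*(1/(c*r^3)))" if "0 < c" "0 < r" for c r :: real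
    using q that by (simp add: field_simps power2_eq_square power3_eq_cube)
   have "real (L*2^m)*(1/A m^3*(3*(q^2)^2*(1/2^m)^2)) = q*(3*real L*(500/729)^m)"
    unfolding p A_def of_nat_mult of_nat_power of_nat_numeral by (rule aux) auto
   thus ?thesis by (simp add: A_def algebra_simps)
  qed
  finally show ?thesis .
 qed
 have "(\<integral>\<^sup>+om. S om \<partial>M) = ennreal (real L)*(\<Sum>m. \<integral>\<^sup>+om. ennreal (G m om) \<partial>M)"
  unfolding S_def by (subst nn_integral_cmult) (auto simp: nn_integral_suminf)
 also have "\<dots> <= ennreal (real L)*(\<Sum>m. ennreal (q*((9/10)^m + 3*real L*(500/729)^m)))"
  by (intro mult_left_mono suminf_le Gi) auto
 also have "(\<Sum>m. ennreal (q*((9/10)^m + 3*real L*(500/729)^m))) = ennreal (q*(1/(1 - 9/10) + 3*real L*(1/(1 - 500/729))))"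
 proof (rule suminf_ennreal_eq)
  show "0 <= q*((9/10)^m + 3*real L*(500/729)^m)" for m using q by simp
  show "(\<lambda>m. q*((9/10)^m + 3*real L*(500/729)^m)) sums (q*(1/(1 - 9/10) + 3*real L*(1/(1 - 500/729))))"
   by (intro sums_mult sums_add geometric_sums) auto
 qed
 finally have Si: "(\<integral>\<^sup>+om. S om \<partial>M) <= ennreal (q*(real L*(10 + 3*real L*(729/229))))"
  using q by (simp add: ennreal_mult'[symmetric] mult.left_commute)
 have "ennreal \<bar>X (t0 + real j/2^m) om - X t0 om\<bar> <= S om" if j: "j <= L*2^m" for om m j
 proof -
  have "\<bar>X (t0 + real j/2^m) om - X t0 om\<bar> <= real L*(\<Sum>l\<le>m. G l om)"
   by (rule dyadic_chaining[where x="\<lambda>t. X t om", OF L _ j]) (use key in \<open>auto simp: \<Delta>_def\<close>)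
  hence "ennreal \<bar>X (t0 + real j/2^m) om - X t0 om\<bar> <= ennreal (real L)*ennreal (\<Sum>l\<le>m. G l om)"
   using G0 by (subst ennreal_mult[symmetric]) (auto intro!: ennreal_leI sum_nonneg)
  also have "ennreal (\<Sum>l\<le>m. G l om) = (\<Sum>l\<le>m. ennreal (G l om))" using G0 by (subst sum_ennreal) auto
  also have "\<dots> <= (\<Sum>l. ennreal (G l om))" by (rule sum_le_suminf) auto
  finally show ?thesis unfolding S_def by (simp add: mult_left_mono)
 qed
 thus ?thesis using that[OF Sm Si] unfolding X_def by blast
qed

end

end

section \<open>The noise\<close>

lemma vinner_ip:
 assumes "L2field v" "L2field w"
 shows "vinner v w = ip (v $$ 1) (w $$ 1) + ip (v $$ 2) (w $$ 2)"
proof -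
 have [measurable]: "v \<in> bmeas" "w \<in> bmeas" using assms by (simp_all add: L2field_def)
 have "vinner v w = (TI x. v x \<bullet> w x)" unfolding vinner_def by (rule LINT_cell_eq) measurable
 also have "\<dots> = (TI x. v x $ 1*w x $ 1 + v x $ 2*w x $ 2)" by (simp add: inner_real2)
 also have "\<dots> = ip (v $$ 1) (w $$ 1) + ip (v $$ 2) (w $$ 2)"
  unfolding ip_def by (rule Bochner_Integration.integral_add; intro L2f_mult L2field_component assms)
 finally show ?thesis .
qed

lemma nsq_diff_sum:
 assumes w: "L2f w" and f: "\<And>i. L2f (f i)"
 shows "nsq (\<lambda>x. w x - (\<Sum>i\<in>F. a i*f i x)) = nsq w - 2*(\<Sum>i\<in>F. a i*ip (f i) w) + (\<Sum>i\<in>F. \<Sum>j\<in>F. a i*a j*ip (f i) (f j))"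
proof -
 have "nsq (\<lambda>x. w x - (\<Sum>i\<in>F. a i*f i x))
   = (TI x. ((w x)^2 - 2*(\<Sum>i\<in>F. a i*(f i x*w x))) + (\<Sum>i\<in>F. \<Sum>j\<in>F. a i*a j*(f i x*f j x)))"
  unfolding nsq_def
 proof (rule tcong[OF refl])
  fix x
  have "(\<Sum>i\<in>F. \<Sum>j\<in>F. a i*a j*(f i x*f j x)) = (\<Sum>i\<in>F. a i*f i x)^2"
   unfolding power2_eq_square sum_product by (intro sum.cong refl) (simp add: mult_ac)
  moreover have "(\<Sum>i\<in>F. a i*(f i x*w x)) = (\<Sum>i\<in>F. a i*f i x)*w x" by (simp add: sum_distrib_right mult.assoc)
  ultimately show "(w x - (\<Sum>i\<in>F. a i*f i x))^2 = ((w x)^2 - 2*(\<Sum>i\<in>F. a i*(f i x*w x))) + (\<Sum>i\<in>F. \<Sum>j\<in>F. a i*a j*(f i x*f j x))"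
   by (simp add: power2_diff)
 qed
 also have "\<dots> = nsq w - 2*(\<Sum>i\<in>F. a i*ip (f i) w) + (\<Sum>i\<in>F. \<Sum>j\<in>F. a i*a j*ip (f i) (f j))"
  using L2f_sq[OF w] L2f_mult[OF f w] L2f_mult[OF f f] by (simp add: nsq_def ip_def)
 finally show ?thesis .
qed

text \<open>Bessel's inequality in all of \<open>L^2\<close> for pairs of functions, so membership
  of the tested field in \<open>H\<close> does not have to be checked.\<close>

lemma ONS_bessel:
 assumes e: "\<And>i. L2field (e i)" and o: "\<And>i j. vinner (e i) (e j) = (if i = j then 1 else 0)" and w: "L2f w1" "L2f w2"
 shows "(\<Sum>i<(n::nat). (ip (e i $$ 1) w1 + ip (e i $$ 2) w2)^2) <= nsq w1 + nsq w2"
proof -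
 note L = L2field_component[OF e]
 define a where "a i = ip (e i $$ 1) w1 + ip (e i $$ 2) w2" for i
 have "0 <= nsq (\<lambda>x. w1 x - (\<Sum>i<n. a i*e i x $ 1)) + nsq (\<lambda>x. w2 x - (\<Sum>i<n. a i*e i x $ 2))" by simp
 also have "\<dots> = nsq w1 + nsq w2 - 2*(\<Sum>i<n. a i*a i) + (\<Sum>i<n. \<Sum>j<n. a i*a j * vinner (e i) (e j))"
  unfolding nsq_diff_sum[OF w(1) L] nsq_diff_sum[OF w(2) L] vinner_ip[OF e e] a_def[symmetric]
  by (subst (3) a_def) (simp add: distrib_left sum.distrib)
 also have "(\<Sum>i<n. \<Sum>j<n. a i*a j * vinner (e i) (e j)) = (\<Sum>i<n. a i*a i)"
  unfolding o by (intro sum.cong refl) (simp add: if_distrib sum.delta cong: if_cong)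
 finally show ?thesis unfolding a_def[symmetric] by (simp add: power2_eq_square)
qed

lemma sum_le_nn_integral_count:
 "finite F ==> (\<Sum>k\<in>F. f k) <= (\<integral>\<^sup>+k. f k \<partial>count_space UNIV)"
proof -
 assume F: "finite F"
 have "(\<Sum>k\<in>F. f k) = (\<integral>\<^sup>+k. f k*indicator F k \<partial>count_space UNIV)"
  by (cases "F = UNIV") (use F in \<open>simp_all add: nn_integral_count_space_finite[symmetric] nn_integral_count_space_indicator\<close>)
 also have "\<dots> <= (\<integral>\<^sup>+k. f k \<partial>count_space UNIV)" by (intro nn_integral_mono) (auto split: split_indicator)
 finally show ?thesis .
qed

lemma nn_integral_int_powr:
 assumes "1 < a" shows "(\<integral>\<^sup>+m. ennreal ((1 + \<bar>real_of_int m\<bar>) powr - a) \<partial>count_space UNIV) < \<infinity>"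
proof -
 let ?g = "\<lambda>m::int. ennreal ((1 + \<bar>real_of_int m\<bar>) powr - a)"
 have s: "summable (\<lambda>n. real (Suc n) powr - a)" using assms summable_real_powr_iff[of "- a"] by (subst summable_Suc_iff) simp
 have fin: "(\<integral>\<^sup>+m. ?g m \<partial>count_space (h ` UNIV)) < \<infinity>" if h: "inj h" "\<And>n. \<bar>real_of_int (h n)\<bar> = real n" for h :: "nat => int"
 proof -
  have "(\<integral>\<^sup>+m. ?g m \<partial>count_space (h ` UNIV)) = (\<integral>\<^sup>+n. ?g (h n) \<partial>count_space UNIV)"
   by (rule nn_integral_bij_count_space[symmetric]) (use h in \<open>simp add: bij_betw_def\<close>)
  also have "\<dots> = (\<Sum>n. ennreal (real (Suc n) powr - a))" by (simp add: h(2) nn_integral_count_space_nat)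
  also have "\<dots> < \<infinity>" using s by (simp add: suminf_ennreal_eq[OF _ summable_sums] less_top[symmetric])
  finally show ?thesis .
 qed
 have "(\<integral>\<^sup>+m. ?g m \<partial>count_space UNIV) <= (\<integral>\<^sup>+m. ?g m*indicator (range int) m + ?g m*indicator (range (\<lambda>n. - int n)) m \<partial>count_space UNIV)"
 proof (rule nn_integral_mono)
  fix m :: int
  have "m \<in> range int \<or> m \<in> range (\<lambda>n. - int n)"
   by (cases "0 <= m") (auto simp: image_iff intro: exI[of _ "nat m"] exI[of _ "nat (- m)"])
  thus "?g m <= ?g m*indicator (range int) m + ?g m*indicator (range (\<lambda>n. - int n)) m" by (auto split: split_indicator)
 qed
 also have "\<dots> = (\<integral>\<^sup>+m. ?g m*indicator (range int) m \<partial>count_space UNIV) + (\<integral>\<^sup>+m. ?g m*indicator (range (\<lambda>n. - int n)) m \<partial>count_space UNIV)"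
  by (rule nn_integral_add) auto
 also have "\<dots> = (\<integral>\<^sup>+m. ?g m \<partial>count_space (range int)) + (\<integral>\<^sup>+m. ?g m \<partial>count_space (range (\<lambda>n. - int n)))"
  by (simp only: nn_integral_restrict_space[symmetric] restrict_count_space sets_count_space space_count_space Int_UNIV_left Int_UNIV_right Pow_UNIV UNIV_I)
 also have "\<dots> < \<infinity>" using fin[of int] fin[of "\<lambda>n. - int n"] by (simp add: inj_on_def)
 finally show ?thesis .
qed

definition lam :: "int \<times> int => real" where
 "lam k = 1 + (2*pi)^2*(of_int (fst k))^2 + (2*pi)^2*(of_int (snd k))^2"

lemma lam_ge_1: "1 <= lam k" by (simp add: lam_def)

text \<open>The product \<open>(1 + |i|)*(1 + |j|)\<close> is at most \<open>lam (i, j)\<close>, so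
  the double sum is dominated by the product of two convergent one-dimensional sums.\<close>

lemma lam_lattice_sum:
 assumes "1 < a" shows "(\<integral>\<^sup>+k. ennreal (lam k powr - a) \<partial>count_space UNIV) < \<infinity>"
proof -
 let ?g = "\<lambda>m::int. ennreal ((1 + \<bar>real_of_int m\<bar>) powr - a)"
 have le: "lam (i, j) powr - a <= (1 + \<bar>real_of_int i\<bar>) powr - a*(1 + \<bar>real_of_int j\<bar>) powr - a" for i j
 proof -
  define x y where "x = \<bar>real_of_int i\<bar>" and "y = \<bar>real_of_int j\<bar>"
  have "\<bar>real_of_int m\<bar> <= (real_of_int m)^2" for m
  proof -
   have "\<bar>m\<bar> <= m^2" by (cases "m = 0") (use self_le_power[of "\<bar>m\<bar>" 2] in auto)
   thus ?thesis by (metis of_int_abs of_int_le_iff of_int_power)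
  qed
  hence sq: "x <= x^2" "y <= y^2" "0 <= x" "0 <= y" by (auto simp: x_def y_def)
  have "1 <= pi^2" using pi_gt3 by (intro one_le_power) linarith
  hence p: "2 <= (2*pi)^2" unfolding power_mult_distrib by simp
  have "2*x*y <= x^2 + y^2" by (rule sum_squares_bound)
  hence "(1 + x)*(1 + y) <= 1 + 2*x^2 + 2*y^2" using sq by (simp add: algebra_simps)
  also have "\<dots> <= 1 + (2*pi)^2*x^2 + (2*pi)^2*y^2" using p by (intro add_mono mult_right_mono) auto
  also have "\<dots> = lam (i, j)" by (simp add: lam_def x_def y_def)
  finally have "lam (i, j) powr - a <= ((1 + x)*(1 + y)) powr - a"
   using assms sq by (intro powr_mono2') (auto intro!: add_nonneg_pos mult_pos_pos)
  thus ?thesis using sq by (simp add: powr_mult x_def y_def)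
 qed
 have "(\<integral>\<^sup>+k. ennreal (lam k powr - a) \<partial>count_space UNIV) <= (\<integral>\<^sup>+k. ?g (fst k)*?g (snd k) \<partial>count_space UNIV)"
 proof (rule nn_integral_mono)
  fix k :: "int \<times> int"
  show "ennreal (lam k powr - a) <= ?g (fst k)*?g (snd k)"
   using le[of "fst k" "snd k"] by (simp add: ennreal_mult[symmetric] ennreal_leI)
 qed
 also have "\<dots> = (\<integral>\<^sup>+i. \<integral>\<^sup>+j. ?g i*?g j \<partial>count_space UNIV \<partial>count_space UNIV)"
  by (subst nn_integral_fst_count_space[symmetric]) simp
 also have "\<dots> = (\<integral>\<^sup>+m. ?g m \<partial>count_space UNIV)*(\<integral>\<^sup>+m. ?g m \<partial>count_space UNIV)"
  by (simp add: nn_integral_cmult nn_integral_multc)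
 also have "\<dots> < \<infinity>" using nn_integral_int_powr[OF assms] by (simp add: ennreal_mult_less_top)
 finally show ?thesis .
qed

section \<open>Fourier modes of the noise\<close>

definition coef :: "(real^2 => real^2) => (real^2 => real^2) => real" where
 "coef v G = (LINT x:cell|lborel. v x $ 1*G x $ 2 - v x $ 2*G x $ 1)"

definition fsq :: "(real^2 => real^2) => int \<times> int => real" where
 "fsq v k = (fr2 v k)"

lemma fsq_nonneg: "0 <= fsq v k" by (simp add: fsq_def)

lemma coef_ip:
 assumes v: "L2field v" and G: "C1per g G"
 shows "coef v G = ip (v $$ 1) (G $$ 2) + ip (v $$ 2) (\<lambda>x. - G x $ 1)"
proof -
 note L = L2field_component[OF v]
 have i: "tint (\<lambda>x. v x $ i*G x $ j)" for i j by (rule L2f_mult[OF L C1per_L2f(2)[OF G]])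
 have "coef v G = (TI x. v x $ 1*G x $ 2 - v x $ 2*G x $ 1)"
  unfolding coef_def using L2f_meas[OF L] L2f_meas[OF C1per_L2f(2)[OF G]]
  by (intro LINT_cell_eq borel_measurable_diff borel_measurable_times)
 thus ?thesis using i by (simp add: ip_def)
qed

text \<open>The coefficient is, up to sign, \<open>2*pi\<close> times the pairing of the rotated
  frequency with the Fourier data. Lagrange's identity bounds its square by the squared length of
  the frequency, hence by \<open>lam k\<close>.\<close>

lemma coef_trig_bound:
 assumes v: "L2field v"
 shows "(coef v (gc k))^2 <= lam k*fsq v k"
  and "(coef v (gs k))^2 <= lam k*fsq v k"
proof -
 note L = L2field_component[OF v]
 define k1 k2 :: real where "k1 = of_int (fst k)" and "k2 = of_int (snd k)"
 have aux: "(2*pi*(k2*x - k1*y))^2 <= lam k*fsq v k" if "x^2 + y^2 <= fsq v k" for x y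
 proof -
  have "(2*pi*(k2*x - k1*y))^2 = (2*pi)^2*(k2*x - k1*y)^2" by (simp add: power_mult_distrib)
  also have "(k2*x - k1*y)^2 = (k1^2 + k2^2)*(x^2 + y^2) - (k1*x + k2*y)^2" by (simp add: power2_eq_square algebra_simps)
  also have "(2*pi)^2*((k1^2 + k2^2)*(x^2 + y^2) - (k1*x + k2*y)^2) <= (2*pi)^2*((k1^2 + k2^2)*(x^2 + y^2))" by (intro mult_left_mono) auto
  also have "\<dots> = ((2*pi)^2*(k1^2 + k2^2))*(x^2 + y^2)" by simp
  also have "\<dots> <= lam k*fsq v k"
  proof (rule mult_mono[OF _ that])
   show "(2*pi)^2*(k1^2 + k2^2) <= lam k" unfolding lam_def k1_def k2_def distrib_left by linarith
  qed (use lam_ge_1[of k] in auto)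
  finally show ?thesis .
 qed
 have c: "(ip f (\<lambda>x. cos (ph k x)))^2 <= (cmod (fourier f k))^2" "(ip f (\<lambda>x. sin (ph k x)))^2 <= (cmod (fourier f k))^2" if "L2f f" for f
  unfolding fourier_ip[OF that] by (simp_all add: cmod_power2)
 have sc: "ip f (\<lambda>x. r*g x) = r*ip f g" for f g :: "real^2 => real" and r by (simp add: ip_def mult.left_commute)
 have "coef v (gc k)
  = ip (v $$ 1) (\<lambda>x. (- (2*pi*k2)) * sin (ph k x)) + ip (v $$ 2) (\<lambda>x. (2*pi*k1) * sin (ph k x))"
  unfolding coef_ip[OF v C1per_cos_ph] by (simp add: k1_def k2_def mult_ac)
 also have "\<dots> = - (2*pi*(k2*ip (v $$ 1) (\<lambda>x. sin (ph k x)) - k1*ip (v $$ 2) (\<lambda>x. sin (ph k x))))"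
  unfolding sc by (simp add: algebra_simps)
 finally show "(coef v (gc k))^2 <= lam k*fsq v k"
  using aux[of "ip (v $$ 1) (\<lambda>x. sin (ph k x))" "ip (v $$ 2) (\<lambda>x. sin (ph k x))"] c(2)[OF L[of 1]] c(2)[OF L[of 2]]
  unfolding fsq_def by simp
 have "coef v (gs k)
  = ip (v $$ 1) (\<lambda>x. (2*pi*k2)*cos (ph k x)) + ip (v $$ 2) (\<lambda>x. (- (2*pi*k1))*cos (ph k x))"
  unfolding coef_ip[OF v C1per_sin_ph] by (simp add: k1_def k2_def mult_ac)
 also have "\<dots> = 2*pi*(k2*ip (v $$ 1) (\<lambda>x. cos (ph k x)) - k1*ip (v $$ 2) (\<lambda>x. cos (ph k x)))"
  unfolding sc by (simp add: algebra_simps)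
 finally show "(coef v (gs k))^2 <= lam k*fsq v k"
  using aux[of "ip (v $$ 1) (\<lambda>x. cos (ph k x))" "ip (v $$ 2) (\<lambda>x. cos (ph k x))"] c(1)[OF L[of 1]] c(1)[OF L[of 2]]
  unfolding fsq_def by simp
qed

lemma sob_sq_fsq: "sob_sq h v = (\<integral>\<^sup>+k. ennreal (lam k powr h*fsq v k) \<partial>count_space UNIV)"
 by (simp add: sob_sq_def lam_def fsq_def)

text \<open>Parseval, and Sobolev weights of at least 1. Applied to the basis fields it turns the
  hypothesis on the noise into square summability of the coefficients \<open>c i\<close>.\<close>

lemma sob_sq_ge_1:
 assumes v: "L2field v" "vinner v v = 1" and h: "0 <= h" shows "1 <= sob_sq h v"
proof -
 note L = L2field_component[OF v(1)]
 have "(\<lambda>n. ennreal (\<Sum>k\<in>Bx n. fsq v k)) \<longlonglongrightarrow> ennreal ((nsq2 v))"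
  unfolding fsq_def sum.distrib by (intro tendsto_intros parseval L)
 moreover have "(nsq2 v) = 1" using v(2) unfolding vinner_ip[OF v(1) v(1)] by (simp add: ip_def nsq_def power2_eq_square)
 ultimately have l: "(\<lambda>n. ennreal (\<Sum>k\<in>Bx n. fsq v k)) \<longlonglongrightarrow> 1" by simp
 have "ennreal (\<Sum>k\<in>Bx n. fsq v k) <= sob_sq h v" for n
 proof -
  have "ennreal (\<Sum>k\<in>Bx n. fsq v k) = (\<Sum>k\<in>Bx n. ennreal (fsq v k))" using fsq_nonneg by (subst sum_ennreal) auto
  also have "\<dots> <= (\<Sum>k\<in>Bx n. ennreal (lam k powr h*fsq v k))"
  proof (intro sum_mono ennreal_leI)
   fix k
   have "1 <= lam k powr h" using lam_ge_1[of k] h by (rule ge_one_powr_ge_zero)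
   thus "fsq v k <= lam k powr h*fsq v k" using mult_right_mono[OF _ fsq_nonneg[of v k], of 1 "lam k powr h"] by simp
  qed
  also have "\<dots> <= sob_sq h v" unfolding sob_sq_fsq by (rule sum_le_nn_integral_count[OF finite_Bx])
  finally show ?thesis .
 qed
 thus ?thesis by (intro LIMSEQ_le_const2[OF l]) auto
qed

lemma dyadic_dense_bound:
 fixes f :: "real => real"
 assumes c: "continuous_on {t0..t0 + real L} f" and b: "\<And>m j. j <= L*2^m ==> \<bar>f (t0 + real j/2^m)\<bar> <= B"
  and t: "t \<in> {t0..t0 + real L}"
 shows "\<bar>f t\<bar> <= B"
proof -
 define j where "j m = nat \<lfloor>(t - t0)*2^m\<rfloor>" for m :: nat
 define \<tau> where "\<tau> m = t0 + real (j m)/2^m" for m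
 have jr: "real (j m) = of_int \<lfloor>(t - t0)*2^m\<rfloor>" for m using t by (simp add: j_def)
 have j1: "real (j m) <= (t - t0)*2^m" for m unfolding jr by simp
 have j2: "(t - t0)*2^m < real (j m) + 1" for m unfolding jr by linarith
 have up: "\<tau> m <= t" for m using j1[of m] by (simp add: \<tau>_def field_simps)
 have lo: "t - 1/2^m <= \<tau> m" for m
 proof -
  have "t - t0 < (real (j m) + 1)/2^m" using j2[of m] by (simp add: pos_less_divide_eq)
  thus ?thesis unfolding \<tau>_def add_divide_distrib by linarith
 qed
 have jL: "j m <= L*2^m" for m
 proof -
  have "(t - t0)*2^m <= real L*2^m" using t by (intro mult_right_mono) auto
  hence "real (j m) <= real (L*2^m)" using j1[of m] unfolding of_nat_mult of_nat_power of_nat_numeral by linarith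
  thus ?thesis by (simp only: of_nat_le_iff)
 qed
 have "(\<lambda>m. 1/2^m :: real) \<longlonglongrightarrow> 0" using LIMSEQ_realpow_zero[of "1/2 :: real"] by (simp add: power_one_over)
 hence "(\<lambda>m. t - 1/2^m) \<longlonglongrightarrow> t - 0" by (intro tendsto_intros)
 hence l: "(\<lambda>m. t - 1/2^m) \<longlonglongrightarrow> t" by simp
 have "\<tau> \<longlonglongrightarrow> t" by (rule tendsto_sandwich[OF _ _ l tendsto_const[of t]]) (use lo up in auto)
 hence "(\<lambda>m. f (\<tau> m)) \<longlonglongrightarrow> f t"
 proof (rule continuous_on_tendsto_compose[OF c])
  have "\<tau> m \<in> {t0..t0 + real L}" for m using up[of m] t order_trans[OF up[of m]] by (simp add: \<tau>_def)
  thus "\<forall>\<^sub>F m in sequentially. \<tau> m \<in> {t0..t0 + real L}" by simp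
 qed (use t in simp)
 hence "(\<lambda>m. \<bar>f (\<tau> m)\<bar>) \<longlonglongrightarrow> \<bar>f t\<bar>" by (rule tendsto_rabs)
 thus ?thesis by (rule LIMSEQ_le_const2) (use b[OF jL] in \<open>auto simp: \<tau>_def\<close>)
qed

section \<open>Almost sure bounds for all modes at once\<close>

context
 fixes M :: "'a measure" and \<beta> :: "nat => real => 'a => real" and c :: "nat => real" and e :: "nat => real^2 => real^2" and h t0 :: real
 assumes P: "prob_space M" and W: "indep_wiener_family M \<beta>" and E: "complete_ONS_H e" and h: "3 < h"
  and H: "(\<integral>\<^sup>+ i. ennreal ((c i)^2) * sob_sq h (e i) \<partial>count_space UNIV) < \<infinity>"
begin

private lemma eL: "L2field (e i)" using E by (simp add: complete_ONS_H_def inH_def)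

private lemma eo: "vinner (e i) (e j) = (if i = j then 1 else 0)" using E by (simp add: complete_ONS_H_def)

private lemma c_sq: obtains C2 where "\<And>n. (\<Sum>i<n. (c i)^2) <= C2"
proof -
 let ?I = "\<integral>\<^sup>+ i. ennreal ((c i)^2) * sob_sq h (e i) \<partial>count_space UNIV"
 have "(\<Sum>i<n. (c i)^2) <= enn2real ?I" for n
 proof -
  have "ennreal (\<Sum>i<n. (c i)^2) = (\<Sum>i<n. ennreal ((c i)^2)*1)" by (subst sum_ennreal[symmetric]) auto
  also have "\<dots> <= (\<Sum>i<n. ennreal ((c i)^2) * sob_sq h (e i))"
   by (intro sum_mono mult_left_mono sob_sq_ge_1 eL) (use eo h in auto)
  also have "\<dots> <= ?I" by (rule sum_le_nn_integral_count) simp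
  also have "?I = ennreal (enn2real ?I)" using H by simp
  finally show ?thesis by (simp add: ennreal_le_iff)
 qed
 thus ?thesis by (rule that)
qed

text \<open>The variance of the \<open>k\<close>-th Fourier mode of the noise at unit time, kept in
  \<open>ennreal\<close> until \<open>Pk_eq\<close> establishes finiteness.\<close>

private definition "Pk k = (\<integral>\<^sup>+ i. ennreal ((c i)^2*fsq (e i) k) \<partial>count_space UNIV)"
private definition "p k = enn2real (Pk k)"
text \<open>The extra summand makes \<open>q k\<close> strictly positive, as
  \<open>wiener_series_sup\<close> demands. Its exponent is chosen so that division by
  \<open>lam k powr (1 - h)\<close> in \<open>weight_q\<close> yields the power \<open>2 - h\<close>
  again.\<close>

private definition "q k = sqrt (lam k*p k + lam k powr (3 - 2*h))"

private lemma Pk_sum: "(\<integral>\<^sup>+ k. ennreal (lam k powr h)*Pk k \<partial>count_space UNIV) < \<infinity>"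
proof -
 have "(\<integral>\<^sup>+ i. ennreal ((c i)^2) * sob_sq h (e i) \<partial>count_space UNIV)
   = (\<integral>\<^sup>+ i. \<integral>\<^sup>+ k. ennreal (lam k powr h)*ennreal ((c i)^2*fsq (e i) k) \<partial>count_space UNIV \<partial>count_space UNIV)"
  unfolding sob_sq_fsq by (simp add: nn_integral_cmult[symmetric] ennreal_mult[symmetric] fsq_nonneg mult.left_commute)
 also have "\<dots> = (\<integral>\<^sup>+ k. \<integral>\<^sup>+ i. ennreal (lam k powr h)*ennreal ((c i)^2*fsq (e i) k) \<partial>count_space UNIV \<partial>count_space UNIV)"
  by (rule nn_integral_count_space_nn_integral) auto
 also have "\<dots> = (\<integral>\<^sup>+ k. ennreal (lam k powr h)*Pk k \<partial>count_space UNIV)" unfolding Pk_def by (simp add: nn_integral_cmult)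
 finally show ?thesis using H by simp
qed

private lemma lam_powr_ge: "1 <= lam k powr h" using lam_ge_1[of k] h by (intro ge_one_powr_ge_zero) auto

private lemma Pk_eq: "Pk k = ennreal (p k)"
proof -
 have "1*Pk k <= ennreal (lam k powr h)*Pk k" using lam_powr_ge[of k] by (intro mult_right_mono) (auto simp: ennreal_1[symmetric] simp del: ennreal_1)
 also have "\<dots> <= (\<integral>\<^sup>+ k. ennreal (lam k powr h)*Pk k \<partial>count_space UNIV)" by (rule nn_integral_ge_point) simp
 finally have "Pk k < \<infinity>" using Pk_sum by simp
 thus ?thesis by (simp add: p_def)
qed

private lemma p_nonneg: "0 <= p k" by (simp add: p_def)

private lemma p_sum: "(\<Sum>i<n. (c i)^2*fsq (e i) k) <= p k"
proof -
 have "ennreal (\<Sum>i<n. (c i)^2*fsq (e i) k) = (\<Sum>i<n. ennreal ((c i)^2*fsq (e i) k))" using fsq_nonneg by (subst sum_ennreal) auto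
 also have "\<dots> <= ennreal (p k)" unfolding Pk_eq[symmetric] Pk_def by (rule sum_le_nn_integral_count) simp
 finally show ?thesis using p_nonneg by (simp add: ennreal_le_iff)
qed

private lemma q_pos: "0 < q k" and q_sq: "(q k)^2 = lam k*p k + lam k powr (3 - 2*h)"
proof -
 have "0 <= lam k*p k" using lam_ge_1[of k] p_nonneg[of k] by simp
 moreover have "0 < lam k powr (3 - 2*h)" using lam_ge_1[of k] by simp
 ultimately have "0 < lam k*p k + lam k powr (3 - 2*h)" by linarith
 thus "0 < q k" "(q k)^2 = lam k*p k + lam k powr (3 - 2*h)" by (simp_all add: q_def)
qed

text \<open>Weighted arithmetic-geometric mean with weight \<open>lam k powr (1 - h)\<close>. The
  squared gradient weight is at most \<open>2*lam k\<close> and becomes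
  \<open>lam k powr (2 - h)\<close>, summable over the lattice exactly because
  \<open>h - 2 > 1\<close>; the variance part becomes the summand of the noise hypothesis. This is
  where \<open>h > 3\<close> is decisive.\<close>

private lemma weight_q: "(1 + 2*pi*norm (ivec k))*q k <= (3*lam k powr (2 - h) + lam k powr h*p k)/2"
proof -
 define l where "l = lam k"
 define x where "x = 2*pi*norm (ivec k)"
 define s where "s = l powr (1 - h)"
 have l1: "1 <= l" unfolding l_def by (rule lam_ge_1)
 hence s0: "0 < s" by (simp add: s_def)
 have "(norm (ivec k))^2 = (of_int (fst k))^2 + (of_int (snd k))^2" unfolding power2_norm_eq_inner inner_real2 by (simp add: power2_eq_square)
 hence "l = 1 + x^2" unfolding l_def x_def lam_def power_mult_distrib by (simp add: distrib_left)
 moreover have "(1 + x)^2 <= 2*(1 + x^2)" using sum_squares_bound[of 1 x] by (simp add: power2_sum)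
 ultimately have w: "(1 + x)^2 <= 2*l" by simp
 have amgm: "a*b <= (a^2 * s + b^2/s)/2" for a b :: real
 proof -
  have "0 <= (a * s - b)^2" by simp
  hence "2*(a*b) * s <= (a^2 * s + b^2/s) * s" using s0 by (simp add: power2_eq_square algebra_simps)
  thus ?thesis using s0 by (simp add: mult_le_cancel_right)
 qed
 have e1: "l * s = l powr (2 - h)" using l1 powr_add[of l 1 "1 - h"] by (simp add: s_def)
 have e2: "l/s = l powr h" using l1 powr_diff[of l 1 "1 - h"] by (simp add: s_def)
 have e3: "l powr (3 - 2*h)/s = l powr (2 - h)" using powr_diff[of l "3 - 2*h" "1 - h"] by (simp add: s_def)
 have "(1 + x)*q k <= ((1 + x)^2 * s + (q k)^2/s)/2" by (rule amgm)
 also have "\<dots> <= (2*l * s + (q k)^2/s)/2" using w s0 by (simp add: mult_right_mono)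
 also have "(q k)^2/s = (l/s)*p k + l powr (3 - 2*h)/s" unfolding q_sq l_def[symmetric] by (simp add: add_divide_distrib)
 also have "2*l * s = 2*(l * s)" by simp
 finally have "(1 + x)*q k <= (2*l powr (2 - h) + (l powr h*p k + l powr (2 - h)))/2" unfolding e1 e2 e3 .
 thus ?thesis unfolding l_def x_def by (simp add: algebra_simps)
qed

private abbreviation "N om t G \<equiv> wcurl_pair c \<beta> e om t G - wcurl_pair c \<beta> e om t0 G"
private abbreviation "CL L \<equiv> real (Suc L)*(10 + 3*real (Suc L)*(729/229))"

private lemma coef_summable: assumes G: "C1per g G" shows "summable (\<lambda>i. \<bar>c i*coef (e i) G\<bar>)"
proof -
 obtain C2 where C2: "\<And>n. (\<Sum>i<n. (c i)^2) <= C2" using c_sq by blast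
 show ?thesis
 proof (rule summableI_nonneg_bounded)
  fix n
  have "(\<Sum>i<n. \<bar>c i*coef (e i) G\<bar>) <= (\<Sum>i<n. (c i)^2 + (coef (e i) G)^2)"
  proof (rule sum_mono)
   fix i
   have "2*\<bar>c i\<bar>*\<bar>coef (e i) G\<bar> <= (c i)^2 + (coef (e i) G)^2" using sum_squares_bound[of "\<bar>c i\<bar>" "\<bar>coef (e i) G\<bar>"] by simp
   moreover have "0 <= \<bar>c i\<bar>*\<bar>coef (e i) G\<bar>" by simp
   ultimately show "\<bar>c i*coef (e i) G\<bar> <= (c i)^2 + (coef (e i) G)^2" unfolding abs_mult by linarith
  qed
  also have "\<dots> = (\<Sum>i<n. (c i)^2) + (\<Sum>i<n. (coef (e i) G)^2)" by (rule sum.distrib)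
  also have "\<dots> <= C2 + (nsq (G $$ 2) + nsq (\<lambda>x. - G x $ 1))"
   unfolding coef_ip[OF eL G] by (intro add_mono C2 ONS_bessel eL eo L2f_uminus C1per_L2f(2)[OF G])
  finally show "(\<Sum>i<n. \<bar>c i*coef (e i) G\<bar>) <= C2 + (nsq (G $$ 2) + nsq (\<lambda>x. - G x $ 1))" .
 qed simp
qed

private lemma noise_sup:
 assumes G: "C1per g G" and b: "\<And>i. (coef (e i) G)^2 <= lam k*fsq (e i) k"
 shows "\<exists>S. S \<in> borel_measurable M \<and> (\<integral>\<^sup>+om. S om \<partial>M) <= ennreal (q k * CL L) \<and>
  (\<forall>om m j. j <= Suc L*2^m \<longrightarrow> ennreal \<bar>N om (t0 + real j/2^m) G\<bar> <= S om)"
proof -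
 have Q: "(\<Sum>i<n. (c i*coef (e i) G)^2) <= (q k)^2" for n
 proof -
  have "(\<Sum>i<n. (c i*coef (e i) G)^2) <= (\<Sum>i<n. lam k*((c i)^2*fsq (e i) k))"
  proof (rule sum_mono)
   fix i
   have "(c i)^2*(coef (e i) G)^2 <= (c i)^2*(lam k*fsq (e i) k)" by (intro mult_left_mono b) auto
   thus "(c i*coef (e i) G)^2 <= lam k*((c i)^2*fsq (e i) k)" by (simp add: power_mult_distrib mult.left_commute)
  qed
  also have "\<dots> <= lam k*p k" unfolding sum_distrib_left[symmetric] using lam_ge_1[of k] by (intro mult_left_mono p_sum) auto
  also have "\<dots> <= (q k)^2" unfolding q_sq by simp
  finally show ?thesis .
 qed
 have N: "N om t G = (\<Sum>i. c i*coef (e i) G*\<beta> i t om) - (\<Sum>i. c i*coef (e i) G*\<beta> i t0 om)" for om t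
  unfolding wcurl_pair_def coef_def by (simp add: mult_ac)
 obtain S where "S \<in> borel_measurable M" "(\<integral>\<^sup>+om. S om \<partial>M) <= ennreal (q k * CL L)"
  "\<And>om m j. j <= Suc L*2^m ==> ennreal \<bar>(\<Sum>i. c i*coef (e i) G*\<beta> i (t0 + real j/2^m) om) - (\<Sum>i. c i*coef (e i) G*\<beta> i t0 om)\<bar> <= S om"
  using wiener_series_sup[OF P W coef_summable[OF G] Q q_pos, where L="Suc L" and ?t0.0=t0] by auto
 thus ?thesis unfolding N by blast
qed

text \<open>The weighted sum of the suprema over all modes has finite expectation by
  \<open>weight_q\<close>, hence is finite almost surely. Quantifying over the countably many
  lengths \<open>L\<close> inside the event provides one null set for all time horizons.\<close>

lemma noise_dyadic_bound:
 "AE om in M. \<forall>L. \<exists>b K. (\<forall>k m j. j <= Suc L*2^m \<longrightarrow> \<bar>N om (t0 + real j/2^m) (gc k)\<bar> <= b k \<and> \<bar>N om (t0 + real j/2^m) (gs k)\<bar> <= b k) \<and>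
  (\<forall>F. finite F \<longrightarrow> (\<Sum>k\<in>F. 2*b k*(1 + 2*pi*norm (ivec k))) <= K)"
proof -
 define R where "R G k L S \<longleftrightarrow> S \<in> borel_measurable M \<and> (\<integral>\<^sup>+om. S om \<partial>M) <= ennreal (q k * CL L) \<and>
  (\<forall>om m j. j <= Suc L*2^m \<longrightarrow> ennreal \<bar>N om (t0 + real j/2^m) G\<bar> <= S om)" for G k L S
 define Sc where "Sc L k = (SOME S. R (gc k) k L S)" for L k
 define Ss where "Ss L k = (SOME S. R (gs k) k L S)" for L k
 have "\<exists>S. R (gc k) k L S" for L k unfolding R_def by (rule noise_sup[OF C1per_cos_ph coef_trig_bound(1)[OF eL]])
 hence "R (gc k) k L (Sc L k)" for L k unfolding Sc_def by (rule someI_ex)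
 hence Sc: "Sc L k \<in> borel_measurable M" "(\<integral>\<^sup>+om. Sc L k om \<partial>M) <= ennreal (q k * CL L)"
  "j <= Suc L*2^m ==> ennreal \<bar>N om (t0 + real j/2^m) (gc k)\<bar> <= Sc L k om" for L k om m j
  unfolding R_def by blast+
 have "\<exists>S. R (gs k) k L S" for L k unfolding R_def by (rule noise_sup[OF C1per_sin_ph coef_trig_bound(2)[OF eL]])
 hence "R (gs k) k L (Ss L k)" for L k unfolding Ss_def by (rule someI_ex)
 hence Ss: "Ss L k \<in> borel_measurable M" "(\<integral>\<^sup>+om. Ss L k om \<partial>M) <= ennreal (q k * CL L)"
  "j <= Suc L*2^m ==> ennreal \<bar>N om (t0 + real j/2^m) (gs k)\<bar> <= Ss L k om" for L k om m j
  unfolding R_def by blast+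
 define w where "w k = 1 + 2*pi*norm (ivec k)" for k
 have w1: "1 <= w k" for k by (simp add: w_def)
 define Y where "Y L k om = ennreal (2*w k)*(Sc L k om + Ss L k om)" for L k om
 have [measurable]: "Y L k \<in> borel_measurable M" for L k unfolding Y_def[abs_def] using Sc(1)[of L k] Ss(1)[of L k] by measurable
 define Z where "Z L om = (\<integral>\<^sup>+ k. Y L k om \<partial>count_space UNIV)" for L om
 have Zm: "Z L \<in> borel_measurable M" for L
 proof -
  \<comment> \<open>An enumeration of the lattice rewrites the sum over all modes as a series of
    measurable functions.\<close>
  have inf: "infinite (UNIV :: (int \<times> int) set)" by (simp add: finite_prod infinite_UNIV_int)
  have "bij_betw (from_nat_into (UNIV :: (int \<times> int) set)) UNIV UNIV" by (rule bij_betw_from_nat_into[OF _ inf]) simp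
  hence "Z L = (\<lambda>om. \<Sum>n. Y L (from_nat_into UNIV n) om)"
   unfolding Z_def[abs_def] by (simp add: nn_integral_bij_count_space[symmetric] nn_integral_count_space_nat)
  thus ?thesis by simp
 qed
 have Zi: "(\<integral>\<^sup>+ om. Z L om \<partial>M) \<noteq> \<infinity>" for L
 proof -
  have CL0: "0 <= CL L" by simp
  have Yb: "(\<integral>\<^sup>+ om. Y L k om \<partial>M) <= ennreal (2 * CL L)*(3*ennreal (lam k powr - (h - 2)) + ennreal (lam k powr h)*Pk k)" for k
  proof -
   have "(\<integral>\<^sup>+ om. Y L k om \<partial>M) = ennreal (2*w k)*((\<integral>\<^sup>+ om. Sc L k om \<partial>M) + (\<integral>\<^sup>+ om. Ss L k om \<partial>M))"
    unfolding Y_def using Sc(1)[of L k] Ss(1)[of L k] by (simp add: nn_integral_cmult nn_integral_add)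
   also have "\<dots> <= ennreal (2*w k)*(ennreal (q k * CL L) + ennreal (q k * CL L))" by (intro mult_left_mono add_mono Sc Ss) auto
   also have "\<dots> = ennreal (2*w k*(q k * CL L + q k * CL L))"
   proof -
    have aux: "ennreal x*(ennreal y + ennreal y) = ennreal (x*(y + y))" if "0 <= x" "0 <= y" for x y
     using that by (simp only: ennreal_plus[symmetric] ennreal_mult[symmetric] add_nonneg_nonneg)
    show ?thesis by (rule aux) (use w1[of k] q_pos[of k] CL0 in \<open>auto intro!: mult_nonneg_nonneg\<close>)
   qed
   also have "\<dots> <= ennreal (2 * CL L*(3*lam k powr - (h - 2) + lam k powr h*p k))"
   proof (rule ennreal_leI)
    have "w k*q k <= (3*lam k powr (2 - h) + lam k powr h*p k)/2" unfolding w_def by (rule weight_q)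
    hence "4 * CL L*(w k*q k) <= 4 * CL L*((3*lam k powr (2 - h) + lam k powr h*p k)/2)" using CL0 by (intro mult_left_mono) auto
    moreover have "2*w*(q * C + q * C) = 4 * C*(w*q)" for w q C :: real by simp
    moreover have "4 * C*(r/2) = 2 * C*r" for C r :: real by simp
    ultimately show "2*w k*(q k * CL L + q k * CL L) <= 2 * CL L*(3*lam k powr - (h - 2) + lam k powr h*p k)" by (metis minus_diff_eq)
   qed
   also have "\<dots> = ennreal (2 * CL L)*(ennreal (3*lam k powr - (h - 2)) + ennreal (lam k powr h*p k))"
    using CL0 p_nonneg[of k] by (simp only: ennreal_mult[symmetric] ennreal_plus[symmetric] mult_nonneg_nonneg add_nonneg_nonneg powr_ge_zero zero_le_numeral)
   also have "\<dots> = ennreal (2 * CL L)*(3*ennreal (lam k powr - (h - 2)) + ennreal (lam k powr h)*Pk k)"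
    unfolding Pk_eq using p_nonneg[of k] by (simp only: ennreal_mult powr_ge_zero zero_le_numeral ennreal_numeral)
   finally show ?thesis .
  qed
  have "(\<integral>\<^sup>+ om. Z L om \<partial>M) = (\<integral>\<^sup>+ k. \<integral>\<^sup>+ om. Y L k om \<partial>M \<partial>count_space UNIV)"
   unfolding Z_def by (rule nn_integral_count_space_nn_integral) auto
  also have "\<dots> <= (\<integral>\<^sup>+ k. ennreal (2 * CL L)*(3*ennreal (lam k powr - (h - 2)) + ennreal (lam k powr h)*Pk k) \<partial>count_space UNIV)"
   by (intro nn_integral_mono Yb)
  also have "\<dots> = ennreal (2 * CL L)*(3*(\<integral>\<^sup>+ k. ennreal (lam k powr - (h - 2)) \<partial>count_space UNIV) + (\<integral>\<^sup>+ k. ennreal (lam k powr h)*Pk k \<partial>count_space UNIV))"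
   by (subst nn_integral_cmult, simp, subst nn_integral_add, simp, simp, subst nn_integral_cmult, simp, rule refl)
  also have "\<dots> < \<infinity>"
  proof -
   have "(\<integral>\<^sup>+ k. ennreal (lam k powr - (h - 2)) \<partial>count_space UNIV) < \<infinity>" by (rule lam_lattice_sum) (use h in simp)
   thus ?thesis using Pk_sum by (auto simp: ennreal_mult_less_top)
  qed
  finally show ?thesis by simp
 qed
 have "AE om in M. \<forall>L. Z L om \<noteq> \<infinity>" unfolding AE_all_countable using nn_integral_noteq_infinite[OF Zm Zi] by auto
 thus ?thesis
 proof eventually_elim
  case (elim om)
  show ?case
  proof
   fix L
   have Zf: "Z L om \<noteq> \<infinity>" using elim by blast
   define b where "b k = enn2real (Sc L k om + Ss L k om)" for k
   have fin: "Sc L k om + Ss L k om = ennreal (b k)" for k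
   proof -
    have "1*(Sc L k om + Ss L k om) <= Y L k om" unfolding Y_def using w1[of k]
     by (intro mult_right_mono) (auto simp: ennreal_1[symmetric] simp del: ennreal_1 intro!: ennreal_leI)
    also have "\<dots> <= Z L om" unfolding Z_def by (rule nn_integral_ge_point) simp
    finally have "Sc L k om + Ss L k om < \<infinity>" using Zf by (simp add: less_top[symmetric] top_unique) (auto simp: top_unique)
    thus ?thesis unfolding b_def by (simp del: ennreal_add_eq_top)
   qed
   have b0: "0 <= b k" for k by (simp add: b_def)
   have "\<bar>N om (t0 + real j/2^m) (gc k)\<bar> <= b k \<and> \<bar>N om (t0 + real j/2^m) (gs k)\<bar> <= b k" if j: "j <= Suc L*2^m" for k m j
   proof
    have "ennreal \<bar>N om (t0 + real j/2^m) (gc k)\<bar> <= Sc L k om + Ss L k om" by (rule add_increasing2[OF _ Sc(3)[OF j]]) simp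
    thus "\<bar>N om (t0 + real j/2^m) (gc k)\<bar> <= b k" unfolding fin using b0[of k] by (simp only: ennreal_le_iff)
    have "ennreal \<bar>N om (t0 + real j/2^m) (gs k)\<bar> <= Sc L k om + Ss L k om" by (rule add_increasing[OF _ Ss(3)[OF j]]) simp
    thus "\<bar>N om (t0 + real j/2^m) (gs k)\<bar> <= b k" unfolding fin using b0[of k] by (simp only: ennreal_le_iff)
   qed
   moreover have "(\<Sum>k\<in>F. 2*b k*(1 + 2*pi*norm (ivec k))) <= enn2real (Z L om)" if F: "finite F" for F
   proof -
    have "ennreal (\<Sum>k\<in>F. 2*b k*(1 + 2*pi*norm (ivec k))) = (\<Sum>k\<in>F. ennreal (2*b k*w k))"
     unfolding w_def[symmetric] using b0 order_trans[OF zero_le_one w1] by (subst sum_ennreal) auto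
    also have "\<dots> = (\<Sum>k\<in>F. Y L k om)"
    proof (rule sum.cong[OF refl])
     fix k
     have "Y L k om = ennreal (2*w k*b k)" unfolding Y_def fin using w1[of k] b0[of k] by (intro ennreal_mult[symmetric]) auto
     thus "ennreal (2*b k*w k) = Y L k om" by (simp add: mult.commute mult.left_commute)
    qed
    also have "\<dots> <= Z L om" unfolding Z_def by (rule sum_le_nn_integral_count[OF F])
    also have "\<dots> = ennreal (enn2real (Z L om))" using Zf by (simp add: less_top)
    finally show ?thesis by (simp add: ennreal_le_iff)
   qed
   ultimately show "\<exists>b K. (\<forall>k m j. j <= Suc L*2^m \<longrightarrow> \<bar>N om (t0 + real j/2^m) (gc k)\<bar> <= b k \<and> \<bar>N om (t0 + real j/2^m) (gs k)\<bar> <= b k) \<and>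
    (\<forall>F. finite F \<longrightarrow> (\<Sum>k\<in>F. 2*b k*(1 + 2*pi*norm (ivec k))) <= K)" by blast
  qed
 qed
qed

end

text \<open>The test functions of \<open>wstar_conv\<close> are constrained on the cell only;
  extending them by zero makes them Borel measurable on the plane without changing the
  pairing.\<close>

lemma wstar_conv_iff_ip:
 assumes f: "\<And>n. f n \<in> bmeas" "f0 \<in> bmeas"
 shows "wstar_conv f f0 \<longleftrightarrow> (\<forall>g. g \<in> bmeas \<longrightarrow> tint g \<longrightarrow> (\<lambda>n. ip (f n) g) \<longlonglongrightarrow> ip f0 g)"
proof -
 have dp: "dpair k g = ip k g" if [measurable]: "k \<in> bmeas" "g \<in> bmeas" for k g
  unfolding dpair_def ip_def by (rule LINT_cell_eq) measurable
 show ?thesis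
 proof (intro iffI allI impI)
  fix g :: "real^2 => real" assume "wstar_conv f f0" and g: "g \<in> bmeas" "tint g"
  hence "(\<lambda>n. dpair (f n) g) \<longlonglongrightarrow> dpair f0 g" unfolding wstar_conv_def using set_integrable_cell_iff[OF g(1)] by blast
  thus "(\<lambda>n. ip (f n) g) \<longlonglongrightarrow> ip f0 g" using f g by (simp add: dp)
 next
  assume *: "\<forall>g. g \<in> bmeas \<longrightarrow> tint g \<longrightarrow> (\<lambda>n. ip (f n) g) \<longlonglongrightarrow> ip f0 g"
  show "wstar_conv f f0" unfolding wstar_conv_def
  proof (intro allI impI)
   fix g :: "real^2 => real" assume g: "set_integrable lborel cell g"
   define g' where "g' x = indicator cell x *\<^sub>R g x" for x
   have gm: "g' \<in> bmeas" using g unfolding set_integrable_def g'_def[abs_def] by auto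
   have "set_integrable lborel cell g'" using g unfolding set_integrable_def g'_def
    by (rule back_subst[of "integrable lborel"]) (auto split: split_indicator)
   hence "tint g'" using set_integrable_cell_iff[OF gm] by blast
   hence l: "(\<lambda>n. ip (f n) g') \<longlonglongrightarrow> ip f0 g'" using*gm by blast
   have "dpair k g = dpair k g'" for k unfolding dpair_def set_lebesgue_integral_def g'_def
    by (intro tcong refl) (auto split: split_indicator)
   thus "(\<lambda>n. dpair (f n) g) \<longlonglongrightarrow> dpair f0 g" using l f gm by (simp add: dp)
  qed
 qed
qed

text \<open>Continuity of \<open>N t G\<close> in time, known from the equation, extends the dyadic
  bounds on the modes to every time. At each time the modes then sum to a function.\<close>

lemma noise_field:
 assumes S: "sol \<gamma> t0 X0 N \<xi> u" and X0: "bdd A X0"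
  and b: "\<And>k m j. j <= L*2^m ==> \<bar>N (t0 + real j/2^m) (gc k)\<bar> <= b k"
   "\<And>k m j. j <= L*2^m ==> \<bar>N (t0 + real j/2^m) (gs k)\<bar> <= b k"
  and K: "\<And>F. finite F ==> (\<Sum>k\<in>F. 2*b k*(1 + 2*pi*norm (ivec k))) <= K"
 obtains w where "\<And>t. t \<in> {t0..t0 + real L} ==> nice K (w t)"
  "\<And>t g G. t \<in> {t0..t0 + real L} ==> C1per g G ==> N t G = ip (w t) g"
proof -
 have "\<exists>w. nice K w \<and> (\<forall>g G. C1per g G \<longrightarrow> N t G = ip w g)" if t: "t \<in> {t0..t0 + real L}" for t
 proof (rule noise_function[OF S X0])
  show "t0 <= t" using t by simp
  show "\<bar>N t (gc k)\<bar> <= b k" for k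
   by (rule dyadic_dense_bound[OF sol_N_cont[OF S X0 C1per_cos_ph] b(1) t])
  show "\<bar>N t (gs k)\<bar> <= b k" for k
   by (rule dyadic_dense_bound[OF sol_N_cont[OF S X0 C1per_sin_ph] b(2) t])
 qed (rule K)
 hence "\<forall>t\<in>{t0..t0 + real L}. \<exists>w. nice K w \<and> (\<forall>g G. C1per g G \<longrightarrow> N t G = ip w g)" by blast
 from bchoice[OF this] obtain w where "\<forall>t\<in>{t0..t0 + real L}. nice K (w t) \<and> (\<forall>g G. C1per g G \<longrightarrow> N t G = ip (w t) g)" by blast
 thus ?thesis using that[of w] by blast
qed

theorem theorem3p1:
  fixes M :: "'a measure"
    and \<beta> :: "nat \<Rightarrow> real \<Rightarrow> 'a \<Rightarrow> real"
    and c :: "nat \<Rightarrow> real"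
    and e :: "nat \<Rightarrow> real^2 \<Rightarrow> real^2"
    and \<gamma> h t0 :: real
    and X0s :: "nat \<Rightarrow> real^2 \<Rightarrow> real"
    and X0 :: "real^2 \<Rightarrow> real"
  assumes "prob_space M" and "complete_measure M"
    and "indep_wiener_family M \<beta>"
    and "complete_ONS_H e"
    and "\<gamma> \<ge> 0"
    and "h > 3"
    and "(\<integral>\<^sup>+ i. ennreal ((c i)\<^sup>2) * sob_sq h (e i) \<partial>count_space UNIV) < \<infinity>"
    and "\<forall>n. Linf (X0s n)" and "Linf X0"
    and "wstar_conv X0s X0"
  shows "AE \<omega> in M. \<forall>\<xi>s us \<xi> u.
           (\<forall>n. weak_solution \<gamma> c \<beta> e t0 \<omega> (X0s n) (\<xi>s n) (us n)) \<and>
           weak_solution \<gamma> c \<beta> e t0 \<omega> X0 \<xi> u \<longrightarrow>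
           (\<forall>t>t0. wstar_conv (\<lambda>n. \<xi>s n t) (\<xi> t))"
proof -
 have Lb: "\<exists>C. bdd C f" if "Linf f" for f using that Linf_bdd[OF that] unfolding Linf_def by blast
 have m: "X0s n \<in> bmeas" "X0 \<in> bmeas" for n using assms(8,9) by (auto simp: Linf_def)
 have lim: "(\<lambda>n. ip (X0s n) g) \<longlonglongrightarrow> ip X0 g" if "g \<in> bmeas" "tint g" for g
  using assms(10) that unfolding wstar_conv_iff_ip[OF m] by blast
 obtain A0 where A0: "\<And>n. bdd A0 (X0s n)"
 proof (rule weak_star_bounded)
  show "\<exists>C. bdd C (X0s n)" for n using Lb assms(8) by blast
  show "\<exists>B. \<forall>n. \<bar>ip (X0s n) g\<bar> <= B" if "g \<in> bmeas" "tint g" for g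
   using convergent_imp_Bseq[OF convergentI[OF lim[OF that]]] unfolding Bseq_def by auto
 qed blast
 obtain A1 where A1: "bdd A1 X0" using Lb assms(9) by blast
 define A where "A = max A0 A1"
 have A: "bdd A (X0s n)" "bdd A X0" for n using bdd_mono[OF A0] bdd_mono[OF A1] by (auto simp: A_def)
 \<comment> \<open>The event fixed here involves the noise and \<open>t0\<close> only; solutions,
   times and test functions are quantified within it.\<close>
 show ?thesis using noise_dyadic_bound[OF assms(1,3,4,6,7), of t0]
 proof eventually_elim
  case (elim \<omega>)
  let ?N = "\<lambda>t G. wcurl_pair c \<beta> e \<omega> t G - wcurl_pair c \<beta> e \<omega> t0 G"
  show ?case
  proof (intro allI impI, elim conjE)
   fix \<xi>s us \<xi> u t
   assume ws: "\<forall>n. weak_solution \<gamma> c \<beta> e t0 \<omega> (X0s n) (\<xi>s n) (us n)" and w0: "weak_solution \<gamma> c \<beta> e t0 \<omega> X0 \<xi> u" and t: "t0 < t"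
   have S: "sol \<gamma> t0 (X0s n) ?N (\<xi>s n) (us n)" for n using weak_solution_sol[of \<gamma> c \<beta> e t0 \<omega> "X0s n"] ws assms(8) by blast
   have S0: "sol \<gamma> t0 X0 ?N \<xi> u" by (rule weak_solution_sol[OF w0 assms(9)])
   obtain L :: nat where "t - t0 <= real L" using real_arch_simple by blast
   \<comment> \<open>The interval has length \<open>Suc L\<close> because chaining needs at least
     one unit interval.\<close>
   hence tT: "t \<in> {t0..t0 + real (Suc L)}" using t by simp
   obtain b K where b: "\<And>k m j. j <= Suc L*2^m ==> \<bar>?N (t0 + real j/2^m) (gc k)\<bar> <= b k"
    "\<And>k m j. j <= Suc L*2^m ==> \<bar>?N (t0 + real j/2^m) (gs k)\<bar> <= b k"
    and K: "\<And>F. finite F ==> (\<Sum>k\<in>F. 2*b k*(1 + 2*pi*norm (ivec k))) <= K"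
    using spec[OF elim, of L] by blast
   \<comment> \<open>The functional \<open>?N\<close> is shared by all solutions, so representing it
     with the help of the limit solution serves the whole sequence.\<close>
   obtain w where w: "\<And>t. t \<in> {t0..t0 + real (Suc L)} ==> nice K (w t)"
    "\<And>t g G. t \<in> {t0..t0 + real (Suc L)} ==> C1per g G ==> ?N t G = ip (w t) g"
    using noise_field[OF S0 A(2) b K] by blast
   \<comment> \<open>The bound involves only the common bound \<open>A\<close> of the initial data,
     the noise bound \<open>K\<close>, the damping and the time horizon, and is therefore uniform in
     \<open>n\<close>.\<close>
   define C where "C = Lbound \<gamma> K A (t0 + real (Suc L) - t0)"
   have B: "bdd C (\<xi>s n s)" "bdd C (\<xi> s)" if s: "s \<in> {t0..t0 + real (Suc L)}" for n s
    unfolding C_def by (rule solution_bound[OF S assms(5) w A(1) s] solution_bound[OF S0 assms(5) w A(2) s]; assumption)+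
   have lim1: "(\<lambda>n. ip (X0s n) g) \<longlonglongrightarrow> ip X0 g" if "C1per g G" for g G
    by (rule lim[OF L2f_meas[OF C1per_L2f(1)[OF that]] L2f_integrable[OF C1per_L2f(1)[OF that]]])
   show "wstar_conv (\<lambda>n. \<xi>s n t) (\<xi> t)"
    unfolding wstar_conv_iff_ip[OF bdd_meas[OF B(1)[OF tT]] bdd_meas[OF B(2)[OF tT]]]
   proof (intro allI impI)
    fix g :: "real^2 => real" assume g: "g \<in> bmeas" "tint g"
    show "(\<lambda>n. ip (\<xi>s n t) g) \<longlonglongrightarrow> ip (\<xi> t) g"
     by (rule sol_weak_continuity[where C=C, OF S S0 assms(5) _ _ _ tT g]) (assumption | rule B lim1)+
   qed
  qed
 qed
qed

end
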